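(* Let $m\le 4$ and $N\in\mathbb{N}^\ast$. Let $f\in C^\infty(\mathbb{R}^N\times(\mathbb{R}^m\otimes\mathbb{R}^N),\mathbb{R}^N)$ and $g\in C^\infty(\mathbb{R}^N,\mathbb{R}^N)$ be such that for some $C>0$ \[ |f(\xi,\Xi)|\le C\,|\xi|\,|\Xi|\quad\text{and}\quad |g(\xi)|\le C\,|\xi|^3\qquad\text{for all }\xi,\Xi . \] Let $u\in W^{1,2}(B^m,\mathbb{R}^N)$ satisfy \[ \Delta u=f(u,\nabla u)+g(u) \] in the sense of distributions in $B^m$. Then $u$ is $C^\infty$ in $B^m$.
   Context: $B^m$ denotes the unit ball of $\mathbb{R}^m$ and $\Delta=\sum_k\partial^2_{x_k}$. *)

theory Defs
  imports "HOL-Analysis.Analysis"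
begin

definition partial_dir :: "'a::real_normed_vector \<Rightarrow> ('a \<Rightarrow> 'b::real_normed_vector) \<Rightarrow> 'a \<Rightarrow> 'b" where
  "partial_dir v f x = vector_derivative (\<lambda>t. f (x + t *\<^sub>R v)) (at 0)"

definition smooth_on :: "'a::euclidean_space set \<Rightarrow> ('a \<Rightarrow> 'b::real_normed_vector) \<Rightarrow> bool" where
  "smooth_on S f \<longleftrightarrow>
     (\<forall>vs. set vs \<subseteq> Basis \<longrightarrow>
        continuous_on S (foldr partial_dir vs f) \<and>
        (\<forall>v\<in>Basis. \<forall>x\<in>S. (\<lambda>t. foldr partial_dir vs f (x + t *\<^sub>R v)) differentiable (at 0)))"

definition test_function :: "'a::euclidean_space set \<Rightarrow> ('a \<Rightarrow> real) \<Rightarrow> bool" where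
  "test_function U \<phi> \<longleftrightarrow> smooth_on UNIV \<phi> \<and>
     (\<exists>K. compact K \<and> K \<subseteq> U \<and> (\<forall>x. x \<notin> K \<longrightarrow> \<phi> x = 0))"

definition laplacian :: "(real^'m \<Rightarrow> real) \<Rightarrow> real^'m \<Rightarrow> real" where
  "laplacian \<phi> x = (\<Sum>i\<in>UNIV. partial_dir (axis i 1) (partial_dir (axis i 1) \<phi>) x)"

definition L2_on :: "'a::euclidean_space set \<Rightarrow> ('a \<Rightarrow> 'b::euclidean_space) \<Rightarrow> bool" where
  "L2_on U u \<longleftrightarrow> u \<in> borel_measurable (lebesgue_on U) \<and>
     integrable (lebesgue_on U) (\<lambda>x. (norm (u x))\<^sup>2)"

definition weak_gradient_on :: "(real^'m) set \<Rightarrow> (real^'m \<Rightarrow> real^'n) \<Rightarrow> (real^'m \<Rightarrow> real^'n^'m) \<Rightarrow> bool" where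
  "weak_gradient_on U u Du \<longleftrightarrow>
     (\<forall>\<phi> i. test_function U \<phi> \<longrightarrow>
        integral\<^sup>L (lebesgue_on U) (\<lambda>x. partial_dir (axis i 1) \<phi> x *\<^sub>R u x)
        = - integral\<^sup>L (lebesgue_on U) (\<lambda>x. \<phi> x *\<^sub>R (Du x $ i)))"

definition W12_with_gradient :: "(real^'m) set \<Rightarrow> (real^'m \<Rightarrow> real^'n) \<Rightarrow> (real^'m \<Rightarrow> real^'n^'m) \<Rightarrow> bool" where
  "W12_with_gradient U u Du \<longleftrightarrow> L2_on U u \<and> L2_on U Du \<and> weak_gradient_on U u Du"

definition locally_integrable_on :: "'a::euclidean_space set \<Rightarrow> ('a \<Rightarrow> 'b::euclidean_space) \<Rightarrow> bool" where
  "locally_integrable_on U F \<longleftrightarrow> (\<forall>K. compact K \<and> K \<subseteq> U \<longrightarrow> integrable (lebesgue_on K) F)"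

definition distr_laplace_eq :: "(real^'m) set \<Rightarrow> (real^'m \<Rightarrow> real^'n) \<Rightarrow> (real^'m \<Rightarrow> real^'n) \<Rightarrow> bool" where
  "distr_laplace_eq U u F \<longleftrightarrow> locally_integrable_on U F \<and>
     (\<forall>\<phi>. test_function U \<phi> \<longrightarrow>
        integral\<^sup>L (lebesgue_on U) (\<lambda>x. laplacian \<phi> x *\<^sub>R u x)
        = integral\<^sup>L (lebesgue_on U) (\<lambda>x. \<phi> x *\<^sub>R F x))"

end

theory Submission
  imports Defs "HOL-Computational_Algebra.Polynomial"
begin

text \<open>Integration against two dyadic families of smooth kernels linked by
  \<open>\<Delta> \<kappa>\<^sub>j = \<rho>\<^sub>j\<^sub>-\<^sub>1 - \<rho>\<^sub>j\<close>, \<open>\<rho>\<^sub>j\<close> a mollifier at scale \<open>2\<^sup>-\<^sup>j\<close>, turns the distributional equation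
  \<open>\<Delta> u = G\<close> into the local representation \<open>\<rho>\<^sub>j\<^sub>-\<^sub>1 * u - \<rho>\<^sub>j * u = \<kappa>\<^sub>j * G\<close>; no fundamental
  solution and no boundary value problem is needed. Since \<open>|G| \<le> C |u| (|Du| + |u|\<^sup>2)\<close>, the Sobolev
  inequality for exponents 2 and 4 in dimension at most four makes the potential of \<open>G\<close> on a ball
  quadratically small in \<open>\<Psi>(r) = \<integral>|Du|\<^sup>2 + (\<integral>|u|\<^sup>4)\<^sup>1\<^sup>/\<^sup>2\<close> (integrals over the ball of radius \<open>r\<close>), while the
  remaining part of \<open>u\<close> is an average with bounded derivatives. Hence \<open>\<Psi>(r)\<close> decays like a power of
  \<open>r\<close>, which makes \<open>u\<close> bounded and, in a second pass, \<open>Du\<close> Hoelder continuous. Schauder estimates, again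
  read off from the dyadic representation, bootstrap this to smoothness.\<close>

text \<open>In dimension four every term is critical: \<open>u\<close> in L4 and \<open>Du\<close>
  in L2 put the right-hand side only in L^(4/3), and inverting the Laplacian returns exactly the
  regularity one started from. The gain comes from absolute continuity of the integral, which makes
  \<open>psi\<close> small on all small balls at once, so that the quadratic term can be absorbed.
  The recursion is run for \<open>psi\<close>, whose L4 part improves at half the volume rate, and
  then for the energy alone, which inherits twice that exponent from the quadratic source. The
  potential of the cut-off right-hand side has compact support, so integration by parts has no
  boundary terms; its bounds are uniform in the finest dyadic scale, so Fatou's lemma carries them
  to \<open>u\<close>. Dimensions below four are covered by the same argument: the product
  inequality behind the Sobolev inequality always has four factors, and the volume gain is expressed
  through \<open>tau\<close>. As \<open>u\<close> is given up to null sets, the smooth version is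
  the everywhere existing limit of its mollifications.\<close>

abbreviation nn_lborel :: "('a::euclidean_space \<Rightarrow> ennreal) \<Rightarrow> ennreal" (binder "NBINT " 10)
  where "nn_lborel f \<equiv> nn_integral lborel f"

section \<open>Locally Hoelder continuous derivatives\<close>

text \<open>Radius, exponent and constant may depend on the point, so that sums, products and
  composites with smooth functions stay in the class. The clause
  \<open>ball x r \<subseteq> S\<close> also forces \<open>S\<close> to be open.\<close>

definition lhol :: "'a::euclidean_space set \<Rightarrow> ('a \<Rightarrow> real) \<Rightarrow> bool" where
  "lhol S f \<longleftrightarrow> (\<forall>x\<in>S. \<exists>r>0. \<exists>\<alpha>>0. \<exists>C\<ge>0. ball x r \<subseteq> S \<and>
     (\<forall>y\<in>ball x r. \<forall>z\<in>ball x r. \<bar>f y - f z\<bar> \<le> C * dist y z powr \<alpha>))"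

text \<open>Plain continuity at the top order would not be carried through the inversion of the
  Laplacian; with the Hoelder condition two orders are gained there. Holding for every
  \<open>k\<close> it amounts to \<open>smooth_on\<close>.\<close>

primrec HC :: "nat \<Rightarrow> 'a::euclidean_space set \<Rightarrow> ('a \<Rightarrow> real) \<Rightarrow> bool" where
  "HC 0 S f = lhol S f"
| "HC (Suc k) S f = (\<forall>b\<in>Basis. (\<forall>x\<in>S. (\<lambda>t. f (x + t *\<^sub>R b)) differentiable (at 0)) \<and> HC k S (partial_dir b f))"

text \<open>The radius is kept at most 1/2 so that distances inside the ball are at most 1, and then
  the smaller of two exponents serves both estimates. Exponents at most 1/2 keep the dyadic ratio
  \<open>(1/2) powr \<alpha>\<close> above 1/2 in the Schauder estimate.\<close>

lemma lhol_common:
  assumes "finite I" "\<And>i. i \<in> I \<Longrightarrow> lhol S (f i)" "x \<in> S" "open S"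
  shows "\<exists>r>0. \<exists>\<alpha>>0. \<exists>C\<ge>0. r \<le> 1/2 \<and> \<alpha> \<le> 1/2 \<and> ball x r \<subseteq> S \<and>
     (\<forall>i\<in>I. \<forall>y\<in>ball x r. \<forall>z\<in>ball x r. \<bar>f i y - f i z\<bar> \<le> C * dist y z powr \<alpha>)"
  using assms(1,2)
proof (induction I)
  case empty
  obtain e where "e > 0" "ball x e \<subseteq> S" using assms(3,4) open_contains_ball by blast
  then show ?case by (intro exI[of _ "min e (1/2)"] exI[of _ "1/2"] conjI exI[of _ 0]) auto
next
  case (insert i I)
  then obtain r \<alpha> C where 1: "r > 0" "\<alpha> > 0" "C \<ge> 0" "r \<le> 1/2" "\<alpha> \<le> 1/2" "ball x r \<subseteq> S"
     "\<And>j y z. \<lbrakk>j\<in>I; y \<in> ball x r; z \<in> ball x r\<rbrakk> \<Longrightarrow> \<bar>f j y - f j z\<bar> \<le> C * dist y z powr \<alpha>"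
    by (metis insertI2)
  have "lhol S (f i)" using insert by auto
  then obtain r' \<alpha>' C' where 2: "r' > 0" "\<alpha>' > 0" "C' \<ge> 0" "ball x r' \<subseteq> S"
     "\<And>y z. \<lbrakk>y \<in> ball x r'; z \<in> ball x r'\<rbrakk> \<Longrightarrow> \<bar>f i y - f i z\<bar> \<le> C' * dist y z powr \<alpha>'"
    using \<open>x \<in> S\<close> unfolding lhol_def by metis
  define R where "R = min r r'"
  define A where "A = min \<alpha> \<alpha>'"
  have pw: "dist y z powr \<alpha> \<le> dist y z powr A" "dist y z powr \<alpha>' \<le> dist y z powr A"
    if "y \<in> ball x R" "z \<in> ball x R" for y z
  proof -
    have "dist y z \<le> dist x y + dist x z" by (metis dist_commute dist_triangle2)
    then have "dist y z \<le> 1" using that 1(4) by (auto simp: R_def)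
    then show "dist y z powr \<alpha> \<le> dist y z powr A" "dist y z powr \<alpha>' \<le> dist y z powr A"
      using 1(2) 2(2) by (auto intro!: powr_mono' simp: A_def)
  qed
  have "\<bar>f j y - f j z\<bar> \<le> (C + C') * dist y z powr A" if "j \<in> insert i I" "y \<in> ball x R" "z \<in> ball x R" for j y z
  proof -
    have yz: "y \<in> ball x r" "z \<in> ball x r" "y \<in> ball x r'" "z \<in> ball x r'" using that by (auto simp: R_def)
    have "\<bar>f j y - f j z\<bar> \<le> C * dist y z powr \<alpha> \<or> \<bar>f j y - f j z\<bar> \<le> C' * dist y z powr \<alpha>'"
      using that(1) 1(7)[of j y z] 2(5)[of y z] yz by auto
    moreover have "C * dist y z powr \<alpha> \<le> C * dist y z powr A" "C' * dist y z powr \<alpha>' \<le> C' * dist y z powr A"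
      using pw[OF that(2,3)] 1 2 by (auto intro: mult_left_mono)
    moreover have "C * dist y z powr A \<ge> 0" "C' * dist y z powr A \<ge> 0" using 1 2 by auto
    ultimately show ?thesis by (smt (verit) distrib_right)
  qed
  then show ?case using 1 2
    by (intro exI[of _ R] conjI exI[of _ A] exI[of _ "C+C'"]) (auto simp: R_def A_def)
qed

lemma lholD:
  assumes "lhol S f" "x \<in> S"
  shows "\<exists>r>0. \<exists>\<alpha>>0. \<exists>C\<ge>0. r \<le> 1/2 \<and> \<alpha> \<le> 1/2 \<and> ball x r \<subseteq> S \<and>
     (\<forall>y\<in>ball x r. \<forall>z\<in>ball x r. \<bar>f y - f z\<bar> \<le> C * dist y z powr \<alpha>)"
proof -
  have "open S" using assms(1) unfolding lhol_def open_contains_ball by blast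
  then show ?thesis using lhol_common[of "{()}" S "\<lambda>_. f" x] assms by auto
qed

lemma lhol_open: "lhol S f \<Longrightarrow> open S"
  unfolding lhol_def open_contains_ball by blast

lemma lholI:
  assumes "\<And>x. x \<in> S \<Longrightarrow> \<exists>r>0. \<exists>\<alpha>>0. \<exists>C\<ge>0. ball x r \<subseteq> S \<and>
     (\<forall>y\<in>ball x r. \<forall>z\<in>ball x r. \<bar>f y - f z\<bar> \<le> C * dist y z powr \<alpha>)"
  shows "lhol S f" using assms unfolding lhol_def by blast

lemma lhol_continuous:
  assumes "lhol S f" shows "continuous_on S f"
proof -
  have "isCont f x" if xS: "x \<in> S" for x
  proof -
    obtain r \<alpha> C where 1: "r > 0" "\<alpha> > 0" "C \<ge> 0" "ball x r \<subseteq> S"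
     "\<And>y z. \<lbrakk>y \<in> ball x r; z \<in> ball x r\<rbrakk> \<Longrightarrow> \<bar>f y - f z\<bar> \<le> C * dist y z powr \<alpha>"
      using lholD[OF assms xS] by metis
    have "((\<lambda>y. C * dist y x powr \<alpha>) \<longlongrightarrow> C * 0 powr \<alpha>) (at x)"
      using 1(2) by (intro tendsto_intros tendsto_powr') (auto intro!: tendsto_eq_intros)
    then have "((\<lambda>y. C * dist y x powr \<alpha>) \<longlongrightarrow> 0) (at x)" by simp
    moreover have "\<forall>\<^sub>F y in at x. norm (f y - f x) \<le> C * dist y x powr \<alpha>"
      unfolding eventually_at using 1 by (intro exI[of _ r]) (auto simp: dist_commute)
    ultimately have "((\<lambda>y. f y - f x) \<longlongrightarrow> 0) (at x)" by (rule Lim_null_comparison[rotated])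
    then show ?thesis using isCont_def LIM_zero_iff by blast
  qed
  then show ?thesis by (simp add: continuous_at_imp_continuous_on)
qed

lemma lhol_cong: assumes "lhol S f" "\<And>x. x \<in> S \<Longrightarrow> f x = g x" shows "lhol S g"
proof (rule lholI)
  fix x assume "x \<in> S"
  then obtain r \<alpha> C where 1: "r > 0" "\<alpha> > 0" "C \<ge> 0" "ball x r \<subseteq> S"
     "\<And>y z. \<lbrakk>y \<in> ball x r; z \<in> ball x r\<rbrakk> \<Longrightarrow> \<bar>f y - f z\<bar> \<le> C * dist y z powr \<alpha>"
      using lholD[OF assms(1)] by metis
  then have "\<And>y z. \<lbrakk>y \<in> ball x r; z \<in> ball x r\<rbrakk> \<Longrightarrow> \<bar>g y - g z\<bar> \<le> C * dist y z powr \<alpha>"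
    using assms(2) by (metis subsetD)
  then show "\<exists>r>0. \<exists>\<alpha>>0. \<exists>C\<ge>0. ball x r \<subseteq> S \<and> (\<forall>y\<in>ball x r. \<forall>z\<in>ball x r. \<bar>g y - g z\<bar> \<le> C * dist y z powr \<alpha>)"
    using 1 by blast
qed

lemma lhol_const: "open S \<Longrightarrow> lhol S (\<lambda>x. c)"
  unfolding lhol_def open_contains_ball
  by (metis abs_0 diff_self mult_zero_left order_refl zero_less_one)

lemma lhol_add: assumes "lhol S f" "lhol S g" shows "lhol S (\<lambda>x. f x + g x)"
proof (rule lholI)
  fix x assume "x \<in> S"
  have "\<And>b. lhol S (if b then f else g)" using assms by auto
  from lhol_common[of "UNIV::bool set" S "\<lambda>b. if b then f else g", OF _ this \<open>x \<in> S\<close> lhol_open[OF assms(1)]]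
  obtain r \<alpha> C where 1: "r > 0" "\<alpha> > 0" "C \<ge> 0" "ball x r \<subseteq> S"
   and 2: "\<And>b y z. \<lbrakk>y \<in> ball x r; z \<in> ball x r\<rbrakk> \<Longrightarrow> \<bar>(if b then f else g) y - (if b then f else g) z\<bar> \<le> C * dist y z powr \<alpha>"
    by auto
  have "\<bar>f y + g y - (f z + g z)\<bar> \<le> (C + C) * dist y z powr \<alpha>" if "y \<in> ball x r" "z \<in> ball x r" for y z
    using 2[OF that, of True] 2[OF that, of False] by (simp add: distrib_right)
  then show "\<exists>r>0. \<exists>\<alpha>>0. \<exists>C\<ge>0. ball x r \<subseteq> S \<and> (\<forall>y\<in>ball x r. \<forall>z\<in>ball x r. \<bar>f y + g y - (f z + g z)\<bar> \<le> C * dist y z powr \<alpha>)"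
    using 1 by (metis add_nonneg_nonneg)
qed

lemma lhol_mult: assumes "lhol S f" "lhol S g" shows "lhol S (\<lambda>x. f x * g x)"
proof (rule lholI)
  fix x assume "x \<in> S"
  have "\<And>b. lhol S (if b then f else g)" using assms by auto
  from lhol_common[of "UNIV::bool set" S "\<lambda>b. if b then f else g", OF _ this \<open>x \<in> S\<close> lhol_open[OF assms(1)]]
  obtain r \<alpha> C where 1: "r > 0" "\<alpha> > 0" "C \<ge> 0" "ball x r \<subseteq> S" "r \<le> 1/2"
   and 2: "\<And>b y z. \<lbrakk>y \<in> ball x r; z \<in> ball x r\<rbrakk> \<Longrightarrow> \<bar>(if b then f else g) y - (if b then f else g) z\<bar> \<le> C * dist y z powr \<alpha>"
    by auto
  define M where "M = \<bar>f x\<bar> + \<bar>g x\<bar> + C"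
  have bd: "\<bar>f y\<bar> \<le> M \<and> \<bar>g y\<bar> \<le> M" if "y \<in> ball x r" for y
  proof -
    have "dist y x powr \<alpha> \<le> 1 powr \<alpha>" using that 1 by (intro powr_mono2) (auto simp: dist_commute)
    then have "C * dist y x powr \<alpha> \<le> C" using 1 by (simp add: mult_left_le)
    then show ?thesis using 2[OF that, of x True] 2[OF that, of x False] 1 by (auto simp: M_def)
  qed
  have "\<bar>f y * g y - f z * g z\<bar> \<le> (2*M*C) * dist y z powr \<alpha>" if "y \<in> ball x r" "z \<in> ball x r" for y z
  proof -
    have "f y * g y - f z * g z = f y * (g y - g z) + (f y - f z) * g z" by (simp add: algebra_simps)
    also have "\<bar>\<dots>\<bar> \<le> \<bar>f y\<bar> * \<bar>g y - g z\<bar> + \<bar>f y - f z\<bar> * \<bar>g z\<bar>" by (metis abs_mult abs_triangle_ineq)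
    also have "\<dots> \<le> M * (C * dist y z powr \<alpha>) + (C * dist y z powr \<alpha>) * M"
      using 2[OF that, of True] 2[OF that, of False] bd[OF that(1)] bd[OF that(2)]
      by (intro add_mono mult_mono) (auto intro: order_trans[OF abs_ge_zero])
    finally show ?thesis by (simp add: algebra_simps)
  qed
  moreover have "2*M*C \<ge> 0" using 1 by (simp add: M_def)
  ultimately show "\<exists>r>0. \<exists>\<alpha>>0. \<exists>C\<ge>0. ball x r \<subseteq> S \<and> (\<forall>y\<in>ball x r. \<forall>z\<in>ball x r. \<bar>f y * g y - (f z * g z)\<bar> \<le> C * dist y z powr \<alpha>)"
    using 1 by blast
qed

section \<open>Partial derivatives and functions of class C1\<close>

lemma partial_dirI: "((\<lambda>t. f (x + t *\<^sub>R b)) has_vector_derivative D) (at 0) \<Longrightarrow> partial_dir b f x = D"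
  unfolding partial_dir_def by (rule vector_derivative_at)

lemma partial_dirI': "((\<lambda>t. f (x + t *\<^sub>R b)) has_real_derivative D) (at 0) \<Longrightarrow> partial_dir b f x = D"
  by (rule partial_dirI) (simp add: has_real_derivative_iff_has_vector_derivative)

lemma DERIV_partial:
  fixes f :: "'a::real_normed_vector \<Rightarrow> real"
  assumes "(\<lambda>t. f (x + t *\<^sub>R b)) differentiable (at 0)"
  shows "((\<lambda>t. f (x + t *\<^sub>R b)) has_real_derivative partial_dir b f x) (at 0)"
  using assms unfolding partial_dir_def
  by (simp add: has_real_derivative_iff_has_vector_derivative vector_derivative_works[symmetric])

lemma DERIV_partial_at:
  fixes f :: "'a::real_normed_vector \<Rightarrow> real"
  assumes "(\<lambda>t. f ((x + s *\<^sub>R b) + t *\<^sub>R b)) differentiable (at 0)"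
  shows "((\<lambda>t. f (x + t *\<^sub>R b)) has_real_derivative partial_dir b f (x + s *\<^sub>R b)) (at s)"
proof -
  have "((\<lambda>t. f ((x + s *\<^sub>R b) + t *\<^sub>R b)) has_real_derivative partial_dir b f (x + s *\<^sub>R b)) (at 0)"
    by (rule DERIV_partial[OF assms])
  then have "((\<lambda>t. f (x + (t + s) *\<^sub>R b)) has_real_derivative partial_dir b f (x + s *\<^sub>R b)) (at 0)"
    by (simp add: algebra_simps)
  then show ?thesis using DERIV_shift[of "\<lambda>t. f (x + t *\<^sub>R b)" _ 0 s] by simp
qed

lemma differentiable_realI: "(f has_real_derivative D) (at (x::real)) \<Longrightarrow> f differentiable (at x)"
  using real_differentiable_def by blast

lemma partial_cong:
  fixes S :: "'a::euclidean_space set"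
  assumes "open S" "x \<in> S" "\<And>y. y \<in> S \<Longrightarrow> f y = g y"
    and "((\<lambda>t. f (x + t *\<^sub>R b)) has_real_derivative D) (at 0)"
  shows "((\<lambda>t. g (x + t *\<^sub>R b)) has_real_derivative D) (at 0)"
proof -
  have "((\<lambda>t. x + t *\<^sub>R b) \<longlongrightarrow> x) (nhds 0)"
    by (auto intro!: tendsto_eq_intros filterlim_ident)
  then have "\<forall>\<^sub>F t in nhds (0::real). x + t *\<^sub>R b \<in> S"
    using assms(1,2) topological_tendstoD by fastforce
  then have "\<forall>\<^sub>F t in nhds (0::real). f (x + t *\<^sub>R b) = g (x + t *\<^sub>R b)"
    by (rule eventually_mono) (rule assms(3))
  from DERIV_cong_ev[OF refl this refl] assms(4) show ?thesis by simp
qed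

lemma partial_diff_cong:
  fixes S :: "'a::euclidean_space set" and f :: "'a \<Rightarrow> real"
  assumes "open S" "x \<in> S" "\<And>y. y \<in> S \<Longrightarrow> f y = g y"
    and "(\<lambda>t. f (x + t *\<^sub>R b)) differentiable (at 0)"
  shows "(\<lambda>t. g (x + t *\<^sub>R b)) differentiable (at 0)" "partial_dir b f x = partial_dir b g x"
  using partial_cong[OF assms(1-3) DERIV_partial[OF assms(4)]]
  by (auto intro: differentiable_realI simp: partial_dirI')

lemma HC_cong:
  fixes f :: "'a::euclidean_space \<Rightarrow> real"
  assumes "open S" "HC k S f" "\<And>x. x \<in> S \<Longrightarrow> f x = g x" shows "HC k S g"
  using assms(2,3)
proof (induction k arbitrary: f g)
  case 0 then show ?case using lhol_cong by auto
next
  case (Suc k)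
  show ?case unfolding HC.simps
  proof (intro ballI conjI)
    fix b :: 'a assume b: "b \<in> Basis"
    show "(\<lambda>t. g (x + t *\<^sub>R b)) differentiable (at 0)" if "x \<in> S" for x
    proof (rule partial_diff_cong(1)[OF assms(1) that Suc(3)])
      show "(\<lambda>t. f (x + t *\<^sub>R b)) differentiable (at 0)" using Suc(2) b that by auto
    qed
    show "HC k S (partial_dir b g)"
      by (rule Suc.IH[of "partial_dir b f"])
        (use Suc(2) b partial_diff_cong(2)[OF assms(1) _ Suc(3)] in auto)
  qed
qed

text \<open>The increment is built up one coordinate at a time; the mean value theorem turns each
  coordinate step into a partial derivative at a nearby point, where continuity compares it with the
  value at \<open>x\<close>.\<close>

lemma C1_has_derivative:
  fixes f :: "'a::euclidean_space \<Rightarrow> real"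
  assumes S: "open S" "x \<in> S"
    and d: "\<And>b y. \<lbrakk>b \<in> Basis; y \<in> S\<rbrakk> \<Longrightarrow> (\<lambda>t. f (y + t *\<^sub>R b)) differentiable (at 0)"
    and c: "\<And>b. b \<in> Basis \<Longrightarrow> continuous_on S (partial_dir b f)"
  shows "(f has_derivative (\<lambda>h. \<Sum>b\<in>Basis. (h \<bullet> b) * partial_dir b f x)) (at x)"
proof -
  have key: "\<exists>\<delta>>0. \<forall>h. norm h < \<delta> \<longrightarrow> \<bar>f (x + h) - f x - (\<Sum>b\<in>Basis. (h \<bullet> b) * partial_dir b f x)\<bar> \<le> e * norm h"
    if e: "e > 0" for e :: real
  proof -
    define e' where "e' = e / DIM('a)"
    have e': "e' > 0" using e by (simp add: e'_def)
    have "\<exists>\<delta>>0. ball x \<delta> \<subseteq> S \<and> (\<forall>y\<in>ball x \<delta>. \<bar>partial_dir b f y - partial_dir b f x\<bar> < e')" if "b \<in> Basis" for b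
    proof -
      have "isCont (partial_dir b f) x" using c[OF that] S continuous_on_eq_continuous_at by blast
      then obtain \<delta> where "\<delta> > 0" "\<And>y. dist y x < \<delta> \<Longrightarrow> dist (partial_dir b f y) (partial_dir b f x) < e'"
        using e' unfolding continuous_at_eps_delta by blast
      moreover obtain \<delta>' where "\<delta>' > 0" "ball x \<delta>' \<subseteq> S" using S open_contains_ball by blast
      ultimately show ?thesis
        by (intro exI[of _ "min \<delta> \<delta>'"]) (auto simp: dist_real_def dist_commute)
    qed
    then obtain D where D: "\<And>b. b \<in> Basis \<Longrightarrow> D b > 0 \<and> ball x (D b) \<subseteq> S \<and> (\<forall>y\<in>ball x (D b). \<bar>partial_dir b f y - partial_dir b f x\<bar> < e')"
      by metis
    define \<delta> where "\<delta> = Min (D ` Basis)"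
    have \<delta>: "\<delta> > 0" "\<And>b. b \<in> Basis \<Longrightarrow> \<delta> \<le> D b" using D by (auto simp: \<delta>_def)
    have bS: "ball x \<delta> \<subseteq> S" using D \<delta> by (meson SOME_Basis order_trans subset_ball)
    have near: "\<bar>partial_dir b f y - partial_dir b f x\<bar> \<le> e'" if "b \<in> Basis" "y \<in> ball x \<delta>" for b y
      using D[OF that(1)] \<delta>(2)[OF that(1)] that(2) by (smt (verit) mem_ball)
    \<comment> \<open>Induction over the set \<open>B\<close> of coordinates already moved. With
      \<open>e' = e / DIM('a)\<close> the errors of all coordinates add up to
      \<open>e * norm h\<close>; the intermediate points stay in the ball because their components
      are dominated by those of \<open>h\<close>.\<close>
    have ind: "\<bar>f (x + (\<Sum>b\<in>B. (h \<bullet> b) *\<^sub>R b)) - f x - (\<Sum>b\<in>B. (h \<bullet> b) * partial_dir b f x)\<bar> \<le> card B * (e' * norm h)"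
      if h: "norm h < \<delta>" and B: "B \<subseteq> Basis" for h B
      using finite_subset[OF B finite_Basis] B
    proof (induction B)
      case (insert b B)
      then have b: "b \<in> Basis" by auto
      define y where "y = x + (\<Sum>c\<in>B. (h \<bullet> c) *\<^sub>R c)"
      define t where "t = h \<bullet> b"
      have inS: "y + s *\<^sub>R b \<in> ball x \<delta>" if "\<bar>s\<bar> \<le> \<bar>t\<bar>" for s
      proof -
        have "norm ((\<Sum>c\<in>B. (h \<bullet> c) *\<^sub>R c) + s *\<^sub>R b) \<le> norm h"
        proof (rule norm_le_componentwise)
          fix c :: 'a assume c: "c \<in> Basis"
          have "(\<Sum>c\<in>B. (h \<bullet> c) *\<^sub>R c) \<bullet> c = (\<Sum>d\<in>B. if d = c then h \<bullet> c else 0)"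
            unfolding inner_sum_left using insert c by (intro sum.cong) (auto simp: inner_Basis)
          also have "\<dots> = (if c \<in> B then h \<bullet> c else 0)" using insert by simp
          finally show "\<bar>((\<Sum>c\<in>B. (h \<bullet> c) *\<^sub>R c) + s *\<^sub>R b) \<bullet> c\<bar> \<le> \<bar>h \<bullet> c\<bar>"
            using that insert(2) b c by (auto simp: inner_add_left inner_Basis t_def)
        qed
        then have "norm ((x + ((\<Sum>c\<in>B. (h \<bullet> c) *\<^sub>R c) + s *\<^sub>R b)) - x) < \<delta>" using h by simp
        then show ?thesis by (simp only: mem_ball dist_norm norm_minus_commute[of x] y_def add.assoc)
      qed
      have dd: "((\<lambda>t. f (y + t *\<^sub>R b)) has_real_derivative partial_dir b f (y + s *\<^sub>R b)) (at s)" if "\<bar>s\<bar> \<le> \<bar>t\<bar>" for s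
        by (rule DERIV_partial_at[OF d[OF b]]) (use inS[OF that] bS in auto)
      have "\<exists>s. \<bar>s\<bar> \<le> \<bar>t\<bar> \<and> f (y + t *\<^sub>R b) - f y = t * partial_dir b f (y + s *\<^sub>R b)"
      proof -
        consider "t = 0" | "t > 0" | "t < 0" by linarith
        then show ?thesis
        proof cases
          case 2
          then obtain z where "0 < z" "z < t" "f (y + t *\<^sub>R b) - f (y + 0 *\<^sub>R b) = (t - 0) * partial_dir b f (y + z *\<^sub>R b)"
            using MVT2[of 0 t "\<lambda>t. f (y + t *\<^sub>R b)" "\<lambda>s. partial_dir b f (y + s *\<^sub>R b)"] dd by force
          then show ?thesis by (intro exI[of _ z]) auto
        next
          case 3
          then obtain z where "t < z" "z < 0" "f (y + 0 *\<^sub>R b) - f (y + t *\<^sub>R b) = (0 - t) * partial_dir b f (y + z *\<^sub>R b)"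
            using MVT2[of t 0 "\<lambda>t. f (y + t *\<^sub>R b)" "\<lambda>s. partial_dir b f (y + s *\<^sub>R b)"] dd by force
          then show ?thesis by (intro exI[of _ z]) auto
        qed auto
      qed
      then obtain s where s: "\<bar>s\<bar> \<le> \<bar>t\<bar>" "f (y + t *\<^sub>R b) - f y = t * partial_dir b f (y + s *\<^sub>R b)" by blast
      have "\<bar>f (y + t *\<^sub>R b) - f y - t * partial_dir b f x\<bar> = \<bar>t\<bar> * \<bar>partial_dir b f (y + s *\<^sub>R b) - partial_dir b f x\<bar>"
        unfolding s(2) by (simp add: abs_mult[symmetric] algebra_simps)
      also have "\<dots> \<le> norm h * e'"
        using near[OF b inS[OF s(1)]] Basis_le_norm[OF b, of h] by (intro mult_mono) (auto simp: t_def)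
      finally have A: "\<bar>f (y + t *\<^sub>R b) - f y - t * partial_dir b f x\<bar> \<le> e' * norm h" by (simp add: mult.commute)
      have "\<bar>f y - f x - (\<Sum>b\<in>B. (h \<bullet> b) * partial_dir b f x)\<bar> \<le> card B * (e' * norm h)"
        using insert unfolding y_def by auto
      moreover have "x + (\<Sum>c\<in>insert b B. (h \<bullet> c) *\<^sub>R c) = y + t *\<^sub>R b" using insert by (simp add: y_def t_def algebra_simps)
      moreover have "(\<Sum>c\<in>insert b B. (h \<bullet> c) * partial_dir c f x) = t * partial_dir b f x + (\<Sum>c\<in>B. (h \<bullet> c) * partial_dir c f x)"
        using insert by (simp add: t_def)
      moreover have "real (card (insert b B)) * (e' * norm h) = card B * (e' * norm h) + e' * norm h"
        using insert by (simp add: algebra_simps)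
      ultimately show ?case using A by (simp only: abs_le_iff) linarith
    qed simp
    have "\<bar>f (x + h) - f x - (\<Sum>b\<in>Basis. (h \<bullet> b) * partial_dir b f x)\<bar> \<le> e * norm h" if "norm h < \<delta>" for h
      using ind[OF that order_refl] by (simp add: euclidean_representation e'_def)
    then show ?thesis using \<delta>(1) by blast
  qed
  show ?thesis
    unfolding has_derivative_at_alt
  proof (intro conjI allI impI)
    show "bounded_linear (\<lambda>h. \<Sum>b\<in>Basis. (h \<bullet> b) * partial_dir b f x)"
      by (intro bounded_linear_sum bounded_linear_mult_const bounded_linear_inner_left)
    fix e :: real assume "0 < e"
    from key[OF this] obtain \<delta> where "\<delta> > 0" and *: "\<And>h. norm h < \<delta> \<Longrightarrow> \<bar>f (x + h) - f x - (\<Sum>b\<in>Basis. (h \<bullet> b) * partial_dir b f x)\<bar> \<le> e * norm h"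
      by blast
    show "\<exists>d>0. \<forall>y. norm (y - x) < d \<longrightarrow> norm (f y - f x - (\<Sum>b\<in>Basis. ((y - x) \<bullet> b) * partial_dir b f x)) \<le> e * norm (y - x)"
      using \<open>\<delta> > 0\<close> *[of "y - x" for y] by (intro exI[of _ \<delta>]) auto
  qed
qed

lemma C1_lipschitz:
  fixes f :: "'a::euclidean_space \<Rightarrow> real"
  assumes S: "cball x r \<subseteq> S" "open S"
    and d: "\<And>b y. \<lbrakk>b \<in> Basis; y \<in> S\<rbrakk> \<Longrightarrow> (\<lambda>t. f (y + t *\<^sub>R b)) differentiable (at 0)"
    and c: "\<And>b. b \<in> Basis \<Longrightarrow> continuous_on S (partial_dir b f)"
    and M: "\<And>b y. \<lbrakk>b \<in> Basis; y \<in> cball x r\<rbrakk> \<Longrightarrow> \<bar>partial_dir b f y\<bar> \<le> M"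
    and yz: "y \<in> cball x r" "z \<in> cball x r"
  shows "\<bar>f y - f z\<bar> \<le> real DIM('a) * M * dist y z"
proof -
  have "norm (f y - f z) \<le> (real DIM('a) * M) * norm (y - z)"
  proof (rule differentiable_bound[OF convex_cball _ _ yz])
    fix w assume w: "w \<in> cball x r"
    show "(f has_derivative (\<lambda>h. \<Sum>b\<in>Basis. (h \<bullet> b) * partial_dir b f w)) (at w within cball x r)"
      by (rule has_derivative_at_withinI[OF C1_has_derivative[OF S(2) _ d c]]) (use w S in auto)
    show "onorm (\<lambda>h. \<Sum>b\<in>Basis. (h \<bullet> b) * partial_dir b f w) \<le> real DIM('a) * M"
    proof (rule onorm_bound)
      show "0 \<le> real DIM('a) * M" using M[OF SOME_Basis w] by (auto intro: order_trans[OF abs_ge_zero])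
      fix h :: 'a
      have "norm (\<Sum>b\<in>Basis. (h \<bullet> b) * partial_dir b f w) \<le> (\<Sum>b\<in>(Basis::'a set). norm h * M)"
        by (rule order_trans[OF norm_sum], rule sum_mono)
          (auto simp: abs_mult intro!: mult_mono M[OF _ w] Basis_le_norm)
      then show "norm (\<Sum>b\<in>Basis. (h \<bullet> b) * partial_dir b f w) \<le> real DIM('a) * M * norm h" by (simp add: mult_ac)
    qed
  qed
  then show ?thesis by (simp add: dist_norm)
qed

lemma C1_lhol:
  fixes f :: "'a::euclidean_space \<Rightarrow> real"
  assumes S: "open S"
    and d: "\<And>b y. \<lbrakk>b \<in> Basis; y \<in> S\<rbrakk> \<Longrightarrow> (\<lambda>t. f (y + t *\<^sub>R b)) differentiable (at 0)"
    and c: "\<And>b. b \<in> Basis \<Longrightarrow> continuous_on S (partial_dir b f)"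
  shows "lhol S f"
proof (rule lholI)
  fix x assume "x \<in> S"
  then obtain r where r: "r > 0" "cball x r \<subseteq> S" using S open_contains_cball by blast
  have "\<exists>M. \<forall>y\<in>cball x r. \<bar>partial_dir b f y\<bar> \<le> M" if "b \<in> Basis" for b
  proof -
    have "compact (partial_dir b f ` cball x r)"
      using c[OF that] r by (intro compact_continuous_image) (auto intro: continuous_on_subset)
    from compact_imp_bounded[OF this] show ?thesis by (auto simp: bounded_iff)
  qed
  then obtain M where M: "\<And>b y. b \<in> Basis \<Longrightarrow> y \<in> cball x r \<Longrightarrow> \<bar>partial_dir b f y\<bar> \<le> M b" by metis
  define M' where "M' = Max (M ` Basis)"
  have M': "\<bar>partial_dir b f y\<bar> \<le> M'" if "b \<in> Basis" "y \<in> cball x r" for b y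
    using M[OF that] that(1) by (auto simp: M'_def intro: order_trans)
  have M0: "M' \<ge> 0" using M'[OF SOME_Basis, of x] r by auto
  have "\<bar>f y - f z\<bar> \<le> (real DIM('a) * M') * dist y z powr 1" if "y \<in> ball x r" "z \<in> ball x r" for y z
  proof -
    have "y \<in> cball x r" "z \<in> cball x r" using that by auto
    from C1_lipschitz[OF r(2) S d c M' this] show ?thesis by simp
  qed
  then show "\<exists>r>0. \<exists>\<alpha>>0. \<exists>C\<ge>0. ball x r \<subseteq> S \<and> (\<forall>y\<in>ball x r. \<forall>z\<in>ball x r. \<bar>f y - f z\<bar> \<le> C * dist y z powr \<alpha>)"
    using r M0 by (intro exI[of _ r] conjI exI[of _ 1] exI[of _ "real DIM('a) * M'"]) auto
qed

section \<open>Closure properties of the classes \<open>HC\<close>\<close>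

lemma HC_open: "HC k S (f :: 'a::euclidean_space \<Rightarrow> real) \<Longrightarrow> open S"
proof (induction k arbitrary: f)
  case 0 then show ?case by (simp add: lhol_open)
next
  case (Suc k) then show ?case using SOME_Basis by (metis HC.simps(2))
qed

lemma HC_Suc_D: "HC (Suc k) S f \<Longrightarrow> HC k S f"
proof (induction k arbitrary: f)
  case 0
  then show ?case using C1_lhol[of S f] lhol_continuous HC_open[OF 0] by auto
next
  case (Suc k) then show ?case by (metis HC.simps(2))
qed

lemma HC_mono: "HC k S f \<Longrightarrow> j \<le> k \<Longrightarrow> HC j S f"
proof (induction k)
  case (Suc k) then show ?case using HC_Suc_D[of k S f] by (auto simp only: le_Suc_eq)
qed simp

lemma HC_lhol: "HC k S f \<Longrightarrow> lhol S f" using HC_mono[of k S f 0] by simp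

lemma HC_continuous: "HC k S f \<Longrightarrow> continuous_on S f"
  using HC_lhol lhol_continuous by blast

lemma HC_DERIV: "HC (Suc k) S f \<Longrightarrow> b \<in> Basis \<Longrightarrow> x \<in> S \<Longrightarrow> ((\<lambda>t. f (x + t *\<^sub>R b)) has_real_derivative partial_dir b f x) (at 0)"
  by (rule DERIV_partial) simp

lemma HC_partial: "HC (Suc k) S f \<Longrightarrow> b \<in> Basis \<Longrightarrow> HC k S (partial_dir b f)" by auto

lemma HC_SucI:
  fixes f :: "'a::euclidean_space \<Rightarrow> real"
  assumes "open S" and "\<And>b x. b \<in> Basis \<Longrightarrow> x \<in> S \<Longrightarrow> ((\<lambda>t. f (x + t *\<^sub>R b)) has_real_derivative g b x) (at 0)"
    and "\<And>b. b \<in> Basis \<Longrightarrow> HC k S (g b)"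
  shows "HC (Suc k) S f"
  unfolding HC.simps
proof (intro ballI conjI)
  fix b :: 'a assume b: "b \<in> Basis"
  show "(\<lambda>t. f (x + t *\<^sub>R b)) differentiable (at 0)" if "x \<in> S" for x
    using assms(2)[OF b that] by (rule differentiable_realI)
  show "HC k S (partial_dir b f)"
    by (rule HC_cong[OF assms(1) assms(3)[OF b]]) (simp add: partial_dirI'[OF assms(2)[OF b]])
qed

lemma HC_const: "open S \<Longrightarrow> HC k S (\<lambda>x. c)"
proof (induction k arbitrary: c)
  case 0 then show ?case by (simp add: lhol_const)
next
  case (Suc k) show ?case by (rule HC_SucI[where g="\<lambda>_ _. 0"]) (use Suc in auto)
qed

lemma HC_add: "HC k S f \<Longrightarrow> HC k S g \<Longrightarrow> HC k S (\<lambda>x. f x + g x)"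
proof (induction k arbitrary: f g)
  case 0 then show ?case by (simp add: lhol_add)
next
  case (Suc k) show ?case
    by (rule HC_SucI[where g="\<lambda>b x. partial_dir b f x + partial_dir b g x"])
      (use Suc HC_open[OF Suc(2)] in \<open>auto intro!: DERIV_add DERIV_partial\<close>)
qed

lemma HC_mult:
  fixes f :: "'a::euclidean_space \<Rightarrow> real"
  shows "HC k S f \<Longrightarrow> HC k S g \<Longrightarrow> HC k S (\<lambda>x. f x * g x)"
proof (induction k arbitrary: f g)
  case 0 then show ?case by (simp add: lhol_mult)
next
  case (Suc k) show ?case
  proof (rule HC_SucI[where g="\<lambda>b x. partial_dir b f x * g x + partial_dir b g x * f x"])
    show "open S" using HC_open[OF Suc(2)] .
    fix b x :: 'a assume "b \<in> Basis" "x \<in> S"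
    then show "((\<lambda>t. f (x + t *\<^sub>R b) * g (x + t *\<^sub>R b)) has_real_derivative partial_dir b f x * g x + partial_dir b g x * f x) (at 0)"
      using DERIV_mult[OF HC_DERIV[OF Suc(2)] HC_DERIV[OF Suc(3)], of b x b x] by simp
  next
    fix b :: 'a assume "b \<in> Basis"
    then show "HC k S (\<lambda>x. partial_dir b f x * g x + partial_dir b g x * f x)"
      using Suc(2,3) HC_Suc_D[OF Suc(2)] HC_Suc_D[OF Suc(3)]
      by (intro HC_add Suc.IH) auto
  qed
qed

lemma HC_cmult: "HC k S f \<Longrightarrow> HC k S (\<lambda>x. c * f x)"
  by (rule HC_mult[OF HC_const]) (auto simp: HC_open)

lemma HC_diff: "HC k S f \<Longrightarrow> HC k S g \<Longrightarrow> HC k S (\<lambda>x. f x - g x)"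
  using HC_add[of k S f "\<lambda>x. (-1) * g x"] HC_cmult[of k S g "-1"] by simp

lemma HC_sum: "finite I \<Longrightarrow> open S \<Longrightarrow> (\<And>i. i \<in> I \<Longrightarrow> HC k S (f i)) \<Longrightarrow> HC k S (\<lambda>x. \<Sum>i\<in>I. f i x)"
  by (induction I rule: finite_induct) (auto intro!: HC_add HC_const)

lemma HC_subset: "HC k S f \<Longrightarrow> T \<subseteq> S \<Longrightarrow> open T \<Longrightarrow> HC k T f"
proof (induction k arbitrary: f)
  case 0
  show ?case unfolding HC.simps
  proof (rule lholI)
    fix x assume x: "x \<in> T"
    then obtain r \<alpha> C where 1: "r > 0" "\<alpha> > 0" "C \<ge> 0" "ball x r \<subseteq> S"
     "\<And>y z. \<lbrakk>y \<in> ball x r; z \<in> ball x r\<rbrakk> \<Longrightarrow> \<bar>f y - f z\<bar> \<le> C * dist y z powr \<alpha>"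
      using lholD[of S f x] 0 by (metis HC.simps(1) subsetD)
    obtain r' where "r' > 0" "ball x r' \<subseteq> T" using 0(3) x open_contains_ball by blast
    then show "\<exists>r>0. \<exists>\<alpha>>0. \<exists>C\<ge>0. ball x r \<subseteq> T \<and> (\<forall>y\<in>ball x r. \<forall>z\<in>ball x r. \<bar>f y - f z\<bar> \<le> C * dist y z powr \<alpha>)"
      using 1 by (intro exI[of _ "min r r'"] conjI exI[of _ \<alpha>] exI[of _ C]) auto
  qed
next
  case (Suc k) then show ?case by auto
qed

lemma HC_local:
  fixes f :: "'a::euclidean_space \<Rightarrow> real"
  assumes "\<And>x. x \<in> S \<Longrightarrow> \<exists>r>0. ball x r \<subseteq> S \<and> HC k (ball x r) f"
  shows "HC k S f"
  using assms
proof (induction k arbitrary: f)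
  case 0
  show ?case unfolding HC.simps
  proof (rule lholI)
    fix x assume "x \<in> S"
    then obtain r where r: "r > 0" "ball x r \<subseteq> S" "lhol (ball x r) f" using 0[of x] by auto
    then obtain r' \<alpha> C where "r' > 0" "\<alpha> > 0" "C \<ge> 0" "ball x r' \<subseteq> ball x r"
     "\<And>y z. \<lbrakk>y \<in> ball x r'; z \<in> ball x r'\<rbrakk> \<Longrightarrow> \<bar>f y - f z\<bar> \<le> C * dist y z powr \<alpha>"
      using lholD[OF r(3), of x] by (metis centre_in_ball)
    then show "\<exists>r>0. \<exists>\<alpha>>0. \<exists>C\<ge>0. ball x r \<subseteq> S \<and> (\<forall>y\<in>ball x r. \<forall>z\<in>ball x r. \<bar>f y - f z\<bar> \<le> C * dist y z powr \<alpha>)"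
      using r by (meson order_trans)
  qed
next
  case (Suc k)
  show ?case unfolding HC.simps
  proof (intro ballI conjI)
    fix b :: 'a assume b: "b \<in> Basis"
    show "(\<lambda>t. f (x + t *\<^sub>R b)) differentiable (at 0)" if "x \<in> S" for x
      using Suc(2)[OF that] b by auto
    show "HC k S (partial_dir b f)"
    proof (rule Suc.IH)
      fix x assume "x \<in> S"
      from Suc(2)[OF this] b show "\<exists>r>0. ball x r \<subseteq> S \<and> HC k (ball x r) (partial_dir b f)" by auto
    qed
  qed
qed

section \<open>Smooth functions and composition with them\<close>

lemma smooth_onD: "smooth_on S f \<Longrightarrow> set vs \<subseteq> Basis \<Longrightarrow> continuous_on S (foldr partial_dir vs f)"
  "smooth_on S f \<Longrightarrow> set vs \<subseteq> Basis \<Longrightarrow> v \<in> Basis \<Longrightarrow> x \<in> S \<Longrightarrow> (\<lambda>t. foldr partial_dir vs f (x + t *\<^sub>R v)) differentiable (at 0)"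
  unfolding smooth_on_def by auto

lemma smooth_on_partial: "smooth_on S f \<Longrightarrow> b \<in> Basis \<Longrightarrow> smooth_on S (partial_dir b f)"
  unfolding smooth_on_def
proof (intro allI impI)
  fix vs :: "'a list"
  assume *: "\<forall>vs. set vs \<subseteq> Basis \<longrightarrow> continuous_on S (foldr partial_dir vs f) \<and> (\<forall>v\<in>Basis. \<forall>x\<in>S. (\<lambda>t. foldr partial_dir vs f (x + t *\<^sub>R v)) differentiable at 0)"
    and b: "b \<in> Basis" "set vs \<subseteq> Basis"
  show "continuous_on S (foldr partial_dir vs (partial_dir b f)) \<and> (\<forall>v\<in>Basis. \<forall>x\<in>S. (\<lambda>t. foldr partial_dir vs (partial_dir b f) (x + t *\<^sub>R v)) differentiable at 0)"
    using *[rule_format, of "vs @ [b]"] b by simp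
qed

lemma smooth_on_HC:
  fixes f :: "'a::euclidean_space \<Rightarrow> real"
  assumes "open S" shows "smooth_on S f \<longleftrightarrow> (\<forall>k. HC k S f)"
proof
  assume "smooth_on S f"
  then show "\<forall>k. HC k S f"
  proof (intro allI)
    fix k show "smooth_on S f \<Longrightarrow> HC k S f"
    proof (induction k arbitrary: f)
      case 0
      have "lhol S f"
        by (rule C1_lhol[OF assms])
          (use smooth_onD(2)[OF 0, of "[]"] smooth_onD(1)[OF 0, of "[b]" for b] in auto)
      then show ?case by simp
    next
      case (Suc k) then show ?case using smooth_onD(2)[OF Suc(2), of "[]"] smooth_on_partial[OF Suc(2)] by auto
    qed
  qed
next
  assume a: "\<forall>k. HC k S f"
  have "(\<forall>k. HC k S f) \<longrightarrow> set vs \<subseteq> Basis \<longrightarrow> (\<forall>k. HC k S (foldr partial_dir vs f))" for vs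
  proof (induction vs arbitrary: f rule: rev_induct)
    case (snoc b vs)
    show ?case
    proof (intro impI)
      assume "\<forall>k. HC k S f" "set (vs @ [b]) \<subseteq> Basis"
      then have "\<forall>k. HC k S (partial_dir b f)" "set vs \<subseteq> Basis" using HC_partial[of _ S f b] by auto
      with snoc show "\<forall>k. HC k S (foldr partial_dir (vs @ [b]) f)" by simp
    qed
  qed simp
  then have *: "set vs \<subseteq> Basis \<Longrightarrow> HC k S (foldr partial_dir vs f)" for vs k using a by blast
  show "smooth_on S f" unfolding smooth_on_def
    using HC_continuous[OF *] *[of _ "Suc 0"] by simp
qed

text \<open>\<open>H\<close> is smooth everywhere, so \<open>w\<close> alone limits the order. In
  the base case \<open>w\<close> maps a small ball into a compact ball on which \<open>H\<close> is
  Lipschitz; the step is the chain rule, whose factors \<open>partial_dir c H\<close> are again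
  smooth and fall under the induction hypothesis.\<close>

lemma HC_comp:
  fixes H :: "'b::euclidean_space \<Rightarrow> real" and w :: "'a::euclidean_space \<Rightarrow> 'b"
  assumes "\<And>k. HC k UNIV H" "\<And>c. c \<in> Basis \<Longrightarrow> HC k S (\<lambda>x. w x \<bullet> c)" "open S"
  shows "HC k S (\<lambda>x. H (w x))"
  using assms
proof (induction k arbitrary: H)
  case 0
  have S: "open S" by fact
  show ?case unfolding HC.simps
  proof (rule lholI)
    fix x assume x: "x \<in> S"
    from lhol_common[of "Basis" S "\<lambda>c x. w x \<bullet> c" x] x S 0
    obtain r \<alpha> C where 1: "r > 0" "\<alpha> > 0" "C \<ge> 0" "ball x r \<subseteq> S" "r \<le> 1/2"
      and 2: "\<And>c y z. \<lbrakk>c \<in> Basis; y \<in> ball x r; z \<in> ball x r\<rbrakk> \<Longrightarrow> \<bar>w y \<bullet> c - w z \<bullet> c\<bar> \<le> C * dist y z powr \<alpha>"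
      by auto
    have w: "dist (w y) (w z) \<le> real DIM('b) * C * dist y z powr \<alpha>" if "y \<in> ball x r" "z \<in> ball x r" for y z
    proof -
      have "norm (w y - w z) \<le> (\<Sum>c\<in>Basis. \<bar>(w y - w z) \<bullet> c\<bar>)" by (rule norm_le_l1)
      also have "\<dots> \<le> (\<Sum>c\<in>(Basis::'b set). C * dist y z powr \<alpha>)" using 2[OF _ that] by (intro sum_mono) (auto simp: inner_diff_left)
      finally show ?thesis by (simp add: dist_norm)
    qed
    have H: "lhol UNIV H" using 0(1)[of 0] by simp
    \<comment> \<open>Within the small ball distances to \<open>x\<close> are at most 1, so
      \<open>w\<close> moves by at most \<open>DIM('b) * C\<close>; the added 1 keeps the radius
      positive when \<open>C = 0\<close>.\<close>
    define R where "R = real DIM('b) * C + 1"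
    have R: "R > 0" using 1 by (simp add: R_def add_nonneg_pos)
    have wR: "w y \<in> cball (w x) R" if "y \<in> ball x r" for y
    proof -
      have "dist x y powr \<alpha> \<le> 1 powr \<alpha>" using that 1 by (intro powr_mono2) auto
      then have "real DIM('b) * C * dist x y powr \<alpha> \<le> real DIM('b) * C * 1" using 1 by (intro mult_left_mono) auto
      moreover have "dist (w x) (w y) \<le> real DIM('b) * C * dist x y powr \<alpha>" using w[of x y] that 1 by auto
      ultimately show ?thesis unfolding mem_cball R_def by linarith
    qed
    have HC1: "HC 1 UNIV H" "\<And>k. HC k UNIV H" using 0(1) by auto
    have dH: "\<And>b y. b \<in> Basis \<Longrightarrow> (\<lambda>t. H (y + t *\<^sub>R b)) differentiable (at 0)"
      "\<And>b. b \<in> Basis \<Longrightarrow> continuous_on UNIV (partial_dir b H)"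
      using HC1(1) HC_continuous[of 0 UNIV "partial_dir b H" for b] by auto
    have "\<exists>M. \<forall>y\<in>cball (w x) R. \<bar>partial_dir b H y\<bar> \<le> M" if "b \<in> Basis" for b
    proof -
      have "compact (partial_dir b H ` cball (w x) R)"
        using dH(2)[OF that] by (intro compact_continuous_image) (auto intro: continuous_on_subset)
      from compact_imp_bounded[OF this] show ?thesis by (auto simp: bounded_iff)
    qed
    then obtain M where M: "\<And>b y. b \<in> Basis \<Longrightarrow> y \<in> cball (w x) R \<Longrightarrow> \<bar>partial_dir b H y\<bar> \<le> M b" by metis
    define M' where "M' = Max (M ` Basis)"
    have M': "\<bar>partial_dir b H y\<bar> \<le> M'" if "b \<in> Basis" "y \<in> cball (w x) R" for b y
      using M[OF that] that(1) by (auto simp: M'_def intro: order_trans)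
    have M0: "M' \<ge> 0" using M'[OF SOME_Basis, of "w x"] R by (auto intro: order_trans[OF abs_ge_zero])
    have "\<bar>H (w y) - H (w z)\<bar> \<le> (real DIM('b) * M' * (real DIM('b) * C)) * dist y z powr \<alpha>" if "y \<in> ball x r" "z \<in> ball x r" for y z
    proof -
      have "\<bar>H (w y) - H (w z)\<bar> \<le> real DIM('b) * M' * dist (w y) (w z)"
        by (rule C1_lipschitz[OF _ _ dH M' wR[OF that(1)] wR[OF that(2)]]) auto
      also have "\<dots> \<le> real DIM('b) * M' * (real DIM('b) * C * dist y z powr \<alpha>)"
        using w[OF that] M0 by (intro mult_left_mono) auto
      finally show ?thesis by (simp add: mult_ac)
    qed
    then show "\<exists>r>0. \<exists>\<alpha>>0. \<exists>C\<ge>0. ball x r \<subseteq> S \<and> (\<forall>y\<in>ball x r. \<forall>z\<in>ball x r. \<bar>H (w y) - H (w z)\<bar> \<le> C * dist y z powr \<alpha>)"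
      using 1 M0 by (intro exI[of _ r] conjI exI[of _ \<alpha>] exI[of _ "real DIM('b) * M' * (real DIM('b) * C)"]) auto
  qed
next
  case (Suc k)
  have S: "open S" by fact
  have w: "HC (Suc k) S (\<lambda>x. w x \<bullet> c)" if "c \<in> Basis" for c using Suc(3)[OF that] .
  have Hder: "(H has_derivative (\<lambda>h. \<Sum>b\<in>Basis. (h \<bullet> b) * partial_dir b H y)) (at y)" for y
    by (rule C1_has_derivative[of UNIV]) (use Suc(2)[of 1] in \<open>auto intro: lhol_continuous\<close>)
  show ?case
  proof (rule HC_SucI[OF S, where g="\<lambda>b x. \<Sum>c\<in>Basis. partial_dir c H (w x) * partial_dir b (\<lambda>x. w x \<bullet> c) x"])
    fix b x assume bx: "b \<in> (Basis::'a set)" "x \<in> S"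
    have "((\<lambda>t. w (x + t *\<^sub>R b)) has_vector_derivative (\<Sum>c\<in>Basis. partial_dir b (\<lambda>x. w x \<bullet> c) x *\<^sub>R c)) (at 0)"
    proof -
      have "((\<lambda>t. \<Sum>c\<in>Basis. (w (x + t *\<^sub>R b) \<bullet> c) *\<^sub>R c) has_vector_derivative (\<Sum>c\<in>Basis. partial_dir b (\<lambda>x. w x \<bullet> c) x *\<^sub>R c)) (at 0)"
      proof (rule has_vector_derivative_sum)
        fix c :: 'b assume "c \<in> Basis"
        from HC_DERIV[OF w[OF this] bx]
        have "((\<lambda>t. w (x + t *\<^sub>R b) \<bullet> c) has_vector_derivative partial_dir b (\<lambda>x. w x \<bullet> c) x) (at 0)"
          by (simp add: has_real_derivative_iff_has_vector_derivative)
        from bounded_linear.has_vector_derivative[OF bounded_linear_scaleR_left this]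
        show "((\<lambda>t. (w (x + t *\<^sub>R b) \<bullet> c) *\<^sub>R c) has_vector_derivative partial_dir b (\<lambda>x. w x \<bullet> c) x *\<^sub>R c) (at 0)" .
      qed
      then show ?thesis by (simp add: euclidean_representation)
    qed
    then have "((\<lambda>t. w (x + t *\<^sub>R b)) has_derivative (\<lambda>t. t *\<^sub>R (\<Sum>c\<in>Basis. partial_dir b (\<lambda>x. w x \<bullet> c) x *\<^sub>R c))) (at 0)"
      by (simp add: has_vector_derivative_def)
    moreover have "(H has_derivative (\<lambda>h. \<Sum>b\<in>Basis. (h \<bullet> b) * partial_dir b H (w x))) (at (w (x + 0 *\<^sub>R b)))"
      using Hder[of "w x"] by simp
    ultimately have "((\<lambda>t. H (w (x + t *\<^sub>R b))) has_derivative (\<lambda>t. \<Sum>d\<in>Basis. ((t *\<^sub>R (\<Sum>c\<in>Basis. partial_dir b (\<lambda>x. w x \<bullet> c) x *\<^sub>R c)) \<bullet> d) * partial_dir d H (w x))) (at 0)"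
      using diff_chain_at[of "\<lambda>t. w (x + t *\<^sub>R b)" _ 0 H] unfolding o_def by blast
    then show "((\<lambda>t. H (w (x + t *\<^sub>R b))) has_real_derivative (\<Sum>c\<in>Basis. partial_dir c H (w x) * partial_dir b (\<lambda>x. w x \<bullet> c) x)) (at 0)"
      unfolding has_field_derivative_def
      by (rule has_derivative_eq_rhs) (auto simp: inner_sum_left_Basis sum_distrib_left sum_distrib_right mult_ac intro!: sum.cong)
  next
    fix b :: 'a assume b: "b \<in> Basis"
    show "HC k S (\<lambda>x. \<Sum>c\<in>Basis. partial_dir c H (w x) * partial_dir b (\<lambda>x. w x \<bullet> c) x)"
    proof (intro HC_sum HC_mult S finite_Basis)
      fix c :: 'b assume c: "c \<in> Basis"
      show "HC k S (\<lambda>x. partial_dir c H (w x))"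
      proof (rule Suc.IH[OF _ _ S])
        show "HC k UNIV (partial_dir c H)" for k using HC_partial[OF Suc(2) c] .
        show "HC k S (\<lambda>x. w x \<bullet> d)" if "d \<in> Basis" for d by (rule HC_Suc_D[OF w[OF that]])
      qed
      show "HC k S (partial_dir b (\<lambda>x. w x \<bullet> c))" using w[OF c] b by auto
    qed
  qed
qed

section \<open>The kernels\<close>

text \<open>The polynomial in \<open>1/t\<close> makes the class closed under differentiation;
  \<open>Ebump 1\<close> is the classical function exp(-1/t), flat at 0.\<close>

definition Ebump :: "real poly \<Rightarrow> real \<Rightarrow> real" where
  "Ebump p t = (if t > 0 then poly p (1/t) * exp (- (1/t)) else 0)"

text \<open>With y = 1/t the derivative of p(y) exp(-y) with respect to t is y^2 (p(y) - p'(y))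
  exp(-y).\<close>

definition Eder :: "real poly \<Rightarrow> real poly" where "Eder p = [:0,0,1:] * (p - pderiv p)"

lemma poly_exp_tendsto: "((\<lambda>x. poly q x * exp (- x)) \<longlongrightarrow> 0) at_top" for q :: "real poly"
proof -
  have "((\<lambda>x. \<Sum>i\<le>degree q. coeff q i * (x ^ i / exp x)) \<longlongrightarrow> (\<Sum>i\<le>degree q. coeff q i * 0)) at_top"
    by (intro tendsto_sum tendsto_mult tendsto_const tendsto_power_div_exp_0)
  then show ?thesis by (simp add: poly_altdef sum_distrib_right exp_minus divide_inverse mult.assoc)
qed

lemma Ebump_DERIV: "(Ebump p has_real_derivative Ebump (Eder p) t) (at t)"
proof -
  consider "t > 0" | "t < 0" | "t = 0" by linarith
  then show ?thesis
  proof cases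
    case 1
    have "((\<lambda>t. poly p (1/t) * exp (- (1/t))) has_real_derivative Ebump (Eder p) t) (at t)"
      using 1 by (auto intro!: derivative_eq_intros DERIV_chain2[OF poly_DERIV] simp: Ebump_def Eder_def field_simps power2_eq_square)
    moreover have "\<forall>\<^sub>F s in nhds t. Ebump p s = poly p (1/s) * exp (- (1/s))"
      using eventually_nhds_in_open[of "{0<..}" t] 1 by (auto elim!: eventually_mono simp: Ebump_def)
    ultimately show ?thesis using DERIV_cong_ev[of t t "Ebump p"] by simp
  next
    case 2
    have "((\<lambda>t. 0) has_real_derivative Ebump (Eder p) t) (at t)" using 2 by (simp add: Ebump_def)
    moreover have "\<forall>\<^sub>F s in nhds t. Ebump p s = 0"
      using eventually_nhds_in_open[of "{..<0}" t] 2 by (auto elim!: eventually_mono simp: Ebump_def)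
    ultimately show ?thesis using DERIV_cong_ev[of t t "Ebump p"] by simp
  next
    case 3
    have "((\<lambda>y. Ebump p y / y) \<longlongrightarrow> 0) (at_left 0)"
      by (rule tendsto_eventually, rule eventually_at_leftI[of "-1"]) (auto simp: Ebump_def)
    moreover have "((\<lambda>y. Ebump p y / y) \<longlongrightarrow> 0) (at_right 0)"
    proof -
      \<comment> \<open>The difference quotient at 0 is the same kind of expression in 1/y, with the
        polynomial multiplied by its variable.\<close>
      have "((\<lambda>y. poly (pCons 0 p) (inverse y) * exp (- inverse y)) \<longlongrightarrow> 0) (at_right (0::real))"
        by (rule filterlim_compose[OF poly_exp_tendsto filterlim_inverse_at_top_right])
      moreover have "\<forall>\<^sub>F y in at_right 0. poly (pCons 0 p) (inverse y) * exp (- inverse y) = Ebump p y / y"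
        using eventually_at_right_less[of 0] by eventually_elim (auto simp: Ebump_def field_simps)
      ultimately show ?thesis by (rule Lim_transform_eventually)
    qed
    ultimately have "((\<lambda>y. Ebump p y / y) \<longlongrightarrow> 0) (at 0)" by (simp add: filterlim_split_at)
    then show ?thesis using 3 by (simp add: has_field_derivative_iff Ebump_def)
  qed
qed

lemma Ebump_continuous: "continuous_on A (Ebump p)"
  by (rule continuous_on_subset[OF DERIV_continuous_on[of UNIV]]) (auto intro: Ebump_DERIV)

lemma continuous_on_Ebump [continuous_intros]: "continuous_on A f \<Longrightarrow> continuous_on A (\<lambda>x. Ebump p (f x))"
  by (rule continuous_on_compose2[OF Ebump_continuous[of UNIV]]) auto

text \<open>A set stable under differentiation contains with each function all its derivatives, so
  smoothness follows without computing any of them.\<close>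

lemma HC_real_class:
  fixes F :: "(real \<Rightarrow> real) set"
  assumes "\<And>f. f \<in> F \<Longrightarrow> \<exists>g\<in>F. \<forall>t. (f has_real_derivative g t) (at t)" "f \<in> F"
  shows "HC k UNIV f"
  using assms(2)
proof (induction k arbitrary: f)
  case 0
  obtain g where g: "g \<in> F" "\<And>t. (f has_real_derivative g t) (at t)" using assms(1)[OF 0] by blast
  obtain h where h: "\<And>t. (g has_real_derivative h t) (at t)" using assms(1)[OF g(1)] by blast
  have gc: "continuous_on UNIV g" by (rule DERIV_continuous_on) (auto intro: h)
  have d: "((\<lambda>t. f (x + t *\<^sub>R 1)) has_real_derivative g x) (at 0)" for x
    using DERIV_shift[of f "g x" 0 x] g(2)[of x] by (simp add: add.commute)
  have "partial_dir 1 f = g" using partial_dirI'[OF d] by auto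
  then show ?case using gc differentiable_realI[OF d] by (auto intro!: C1_lhol)
next
  case (Suc k)
  obtain g where g: "g \<in> F" "\<And>t. (f has_real_derivative g t) (at t)" using assms(1)[OF Suc(2)] by blast
  have d: "((\<lambda>t. f (x + t *\<^sub>R 1)) has_real_derivative g x) (at 0)" for x
    using DERIV_shift[of f "g x" 0 x] g(2)[of x] by (simp add: add.commute)
  show ?case by (rule HC_SucI[where g="\<lambda>_. g"]) (use d Suc.IH[OF g(1)] in auto)
qed

lemma HC_Ebump: "HC k UNIV (Ebump p)"
  by (rule HC_real_class[of "range Ebump"]) (auto intro: Ebump_DERIV)

text \<open>Write \<open>\<sigma>\<^sub>s(x) = s\<^sup>-\<^sup>m \<sigma>(x/s)\<close> with \<open>\<sigma>(x) = E(1 - |x|\<^sup>2)\<close>, and \<open>\<nabla>\<sigma> = - x \<rho>\<close>. Then \<open>d/ds \<rho>\<^sub>s = s \<Delta> \<sigma>\<^sub>s\<close>,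
  so \<open>\<kappa> = \<integral>\<^sub>1\<^sup>2 s \<sigma>\<^sub>s ds\<close> satisfies \<open>\<Delta> \<kappa> = \<rho>\<^sub>2 - \<rho>\<close>. The function \<open>kk\<close> is \<open>\<kappa>\<close> as a function of \<open>|x|\<^sup>2\<close>.\<close>

definition kk :: "nat \<Rightarrow> real poly \<Rightarrow> real \<Rightarrow> real" where
  "kk n p t = integral {1..2} (\<lambda>s. s * (1/s)^n * Ebump p (1 - t / s\<^sup>2))"

text \<open>Differentiating under the integral brings out \<open>- (1/s^2)\<close>, which is
  absorbed by raising the power by two: up to sign the functions \<open>kk n p\<close> are closed
  under differentiation.\<close>

lemma kk_DERIV: "(kk n p has_real_derivative - kk (n+2) (Eder p) t) (at t)"
proof -
  have "((\<lambda>x. integral (cbox 1 2) (\<lambda>s. s * (1/s)^n * Ebump p (1 - x / s\<^sup>2))) has_real_derivative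
      integral (cbox 1 2) (\<lambda>s. s * (1/s)^n * (Ebump (Eder p) (1 - t / s\<^sup>2) * (- (1/s\<^sup>2))))) (at t within UNIV)"
  proof (rule leibniz_rule_field_derivative[where fx="\<lambda>x s. s * (1/s)^n * (Ebump (Eder p) (1 - x / s\<^sup>2) * (- (1/s\<^sup>2)))"])
    fix x s :: real assume "s \<in> cbox 1 2"
    then have s: "s \<noteq> 0" by auto
    have "((\<lambda>x. Ebump p (1 - x / s\<^sup>2)) has_real_derivative Ebump (Eder p) (1 - x / s\<^sup>2) * (- (1/s\<^sup>2))) (at x)"
      by (rule DERIV_chain2[OF Ebump_DERIV]) (use s in \<open>auto intro!: derivative_eq_intros simp: field_simps power2_eq_square power4_eq_xxxx\<close>)
    then show "((\<lambda>x. s * (1/s)^n * Ebump p (1 - x / s\<^sup>2)) has_real_derivative s * (1/s)^n * (Ebump (Eder p) (1 - x / s\<^sup>2) * (- (1/s\<^sup>2)))) (at x within UNIV)"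
      by (rule DERIV_cmult)
  next
    fix x :: real
    show "(\<lambda>s. s * (1/s)^n * Ebump p (1 - x / s\<^sup>2)) integrable_on cbox 1 2"
      by (rule integrable_continuous) (auto intro!: continuous_intros)
  next
    show "continuous_on (UNIV \<times> cbox 1 2) (\<lambda>(x, s). s * (1/s)^n * (Ebump (Eder p) (1 - x / s\<^sup>2) * (- (1/s\<^sup>2))))"
      unfolding split_beta by (auto intro!: continuous_intros)
  qed auto
  moreover have "integral (cbox 1 2) (\<lambda>s. s * (1/s)^n * (Ebump (Eder p) (1 - t / s\<^sup>2) * (- (1/s\<^sup>2)))) = - kk (n+2) (Eder p) t"
    unfolding kk_def Henstock_Kurzweil_Integration.integral_neg[symmetric] cbox_interval
    by (intro arg_cong2[where f=integral] ext refl) (simp add: power_add power_one_over field_simps power2_eq_square)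
  ultimately show ?thesis unfolding kk_def[abs_def] by simp
qed

lemma HC_kk: "HC k UNIV (kk n p)"
proof -
  have "HC k UNIV (\<lambda>t. 1 * kk n p t)"
    by (rule HC_real_class[of "{\<lambda>t. c * kk n p t |c n p. True}"])
      (fastforce intro: DERIV_cmult[OF kk_DERIV] exI[of _ "- c" for c])+
  then show ?thesis by simp
qed

text \<open>The 2 comes from differentiating |x|^2 in the gradient of E(1 - |x|^2).\<close>

definition rho0 :: "'a::euclidean_space \<Rightarrow> real" where
  "rho0 x = 2 * Ebump (Eder 1) (1 - x \<bullet> x)"

definition kap0 :: "'a::euclidean_space \<Rightarrow> real" where
  "kap0 x = kk DIM('a) 1 (x \<bullet> x)"

lemma HC_inner: "HC k UNIV (\<lambda>x::'a::euclidean_space. x \<bullet> c)"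
proof -
  have d: "((\<lambda>t. (x + t *\<^sub>R b) \<bullet> c) has_real_derivative b \<bullet> c) (at 0)" for x b
    by (auto intro!: derivative_eq_intros simp: inner_add_left)
  have S: "HC (Suc k) UNIV (\<lambda>x. x \<bullet> c)" for k
    by (rule HC_SucI[where g="\<lambda>b _. b \<bullet> c"]) (use d in \<open>auto intro: HC_const\<close>)
  show ?thesis using HC_Suc_D[OF S] .
qed

lemma HC_norm2: "HC k UNIV (\<lambda>x::'a::euclidean_space. x \<bullet> x)"
proof -
  have "HC k UNIV (\<lambda>x::'a. \<Sum>b\<in>Basis. (x \<bullet> b) * (x \<bullet> b))"
    by (intro HC_sum HC_mult HC_inner) auto
  moreover have "(\<lambda>x::'a. \<Sum>b\<in>Basis. (x \<bullet> b) * (x \<bullet> b)) = (\<lambda>x. x \<bullet> x)"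
    by (simp add: euclidean_inner[symmetric])
  ultimately show ?thesis by simp
qed

lemma HC_rho0: "HC k UNIV (rho0 :: 'a::euclidean_space \<Rightarrow> real)"
  unfolding rho0_def[abs_def]
  by (intro HC_cmult HC_comp[OF HC_Ebump, where w="\<lambda>x. 1 - x \<bullet> x"]) (auto intro!: HC_diff HC_const HC_norm2)

lemma HC_kap0: "HC k UNIV (kap0 :: 'a::euclidean_space \<Rightarrow> real)"
  unfolding kap0_def[abs_def]
  by (rule HC_comp[OF HC_kk, where w="\<lambda>x. x \<bullet> x"]) (auto intro!: HC_norm2)

lemma rho0_ge0: "rho0 x \<ge> 0" and rho0_pos: "norm x < 1 \<Longrightarrow> rho0 x > 0" and rho0_0: "norm x \<ge> 1 \<Longrightarrow> rho0 x = 0"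
proof -
  have "x \<bullet> x < 1 \<longleftrightarrow> norm x < 1" by (simp add: norm_eq_sqrt_inner)
  moreover have "poly (Eder 1) y = y^2" for y by (simp add: Eder_def power2_eq_square pderiv_1)
  ultimately show "rho0 x \<ge> 0" "norm x < 1 \<Longrightarrow> rho0 x > 0" "norm x \<ge> 1 \<Longrightarrow> rho0 x = 0"
    by (auto simp: rho0_def Ebump_def)
qed

lemma kap0_0: "norm x \<ge> 2 \<Longrightarrow> kap0 x = 0"
proof -
  assume "norm x \<ge> 2"
  then have "(norm x)^2 \<ge> 2^2" by (intro power_mono) auto
  then have n: "x \<bullet> x \<ge> 4" by (simp add: power2_norm_eq_inner)
  have "Ebump 1 (1 - x \<bullet> x / s\<^sup>2) = 0" if "s \<in> {1..2}" for s
  proof -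
    have "s\<^sup>2 \<le> 2^2" using that by (intro power_mono) auto
    then have "s\<^sup>2 \<le> x \<bullet> x" using n by simp
    then show ?thesis using that by (simp add: Ebump_def)
  qed
  then have "kap0 x = integral {1..2::real} (\<lambda>s. 0::real)" unfolding kap0_def kk_def
    by (intro Henstock_Kurzweil_Integration.integral_cong) auto
  then show ?thesis by simp
qed

lemma DERIV_inner_line: "((\<lambda>t. (x + t *\<^sub>R b) \<bullet> (x + t *\<^sub>R b)) has_real_derivative 2 * (x \<bullet> b)) (at 0)"
proof -
  have "(\<lambda>t. (x + t *\<^sub>R b) \<bullet> (x + t *\<^sub>R b)) = (\<lambda>t. x \<bullet> x + 2 * (x \<bullet> b) * t + (b \<bullet> b) * t^2)"
    by (auto simp: inner_add_left inner_add_right inner_commute power2_eq_square algebra_simps)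
  moreover have "((\<lambda>t. x \<bullet> x + 2 * (x \<bullet> b) * t + (b \<bullet> b) * t^2) has_real_derivative 2 * (x \<bullet> b)) (at 0)"
    by (auto intro!: derivative_eq_intros)
  ultimately show ?thesis by simp
qed

lemma DERIV_kk_line: "((\<lambda>t. kk n p ((x + t *\<^sub>R b) \<bullet> (x + t *\<^sub>R b))) has_real_derivative - kk (n+2) (Eder p) (x \<bullet> x) * (2 * (x \<bullet> b))) (at 0)"

proof -
  have "(kk n p has_real_derivative - kk (n + 2) (Eder p) (x \<bullet> x)) (at ((x + 0 *\<^sub>R b) \<bullet> (x + 0 *\<^sub>R b)))"
    using kk_DERIV[of n p "x \<bullet> x"] by simp
  from DERIV_chain2[OF this DERIV_inner_line] show ?thesis .
qed

lemma kap0_laplace: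
  fixes x :: "'a::euclidean_space"
  shows "(\<Sum>b\<in>Basis. partial_dir b (partial_dir b kap0) x) = rho0 (x /\<^sub>R 2) / 2^DIM('a) - rho0 x"
proof -
  define m where "m = DIM('a)"
  define p1 where "p1 = Eder 1"
  define p2 where "p2 = Eder p1"
  have 1: "partial_dir b kap0 = (\<lambda>x::'a. - kk (m+2) p1 (x \<bullet> x) * (2 * (x \<bullet> b)))" for b
    unfolding kap0_def[abs_def] m_def p1_def by (rule ext, rule partial_dirI', rule DERIV_kk_line)
  have 2: "partial_dir b (partial_dir b kap0) x = kk (m+4) p2 (x \<bullet> x) * (4 * (x \<bullet> b)^2) - 2 * kk (m+2) p1 (x \<bullet> x)" if "b \<in> Basis" for b
    unfolding 1
  proof (rule partial_dirI')
    have A: "((\<lambda>t. kk (m+2) p1 ((x + t *\<^sub>R b) \<bullet> (x + t *\<^sub>R b))) has_real_derivative - kk (m+4) p2 (x \<bullet> x) * (2 * (x \<bullet> b))) (at 0)"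
      using DERIV_kk_line[of "m+2" p1 x b] unfolding p2_def add.assoc by simp
    have B: "((\<lambda>t. 2 * ((x + t *\<^sub>R b) \<bullet> b)) has_real_derivative 2) (at 0)"
      using that unfolding inner_add_left inner_scaleR_left by (auto intro!: derivative_eq_intros)
    show "((\<lambda>t. - kk (m+2) p1 ((x + t *\<^sub>R b) \<bullet> (x + t *\<^sub>R b)) * (2 * ((x + t *\<^sub>R b) \<bullet> b))) has_real_derivative
        kk (m+4) p2 (x \<bullet> x) * (4 * (x \<bullet> b)^2) - 2 * kk (m+2) p1 (x \<bullet> x)) (at 0)"
      using DERIV_mult[OF DERIV_minus[OF A] B] by (simp add: power2_eq_square algebra_simps)
  qed
  define t where "t = x \<bullet> x"
  have "(\<Sum>b\<in>Basis. partial_dir b (partial_dir b kap0) x) = kk (m+4) p2 t * (4 * (\<Sum>b\<in>Basis. (x \<bullet> b)^2)) - 2 * m * kk (m+2) p1 t"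
  proof -
    have "(\<Sum>b\<in>Basis. partial_dir b (partial_dir b kap0) x) = (\<Sum>b\<in>(Basis::'a set). kk (m+4) p2 t * (4 * (x \<bullet> b)^2) - 2 * kk (m+2) p1 t)"
      unfolding t_def by (rule sum.cong[OF refl 2])
    then show ?thesis by (simp add: sum_subtractf sum_distrib_left m_def)
  qed
  also have "(\<Sum>b\<in>Basis. (x \<bullet> b)^2) = t" unfolding t_def by (subst euclidean_inner) (simp add: power2_eq_square)
  also have "kk (m+4) p2 t * (4 * t) - 2 * m * kk (m+2) p1 t
      = integral {1..2} (\<lambda>s. (4*t) * (s * (1/s)^(m+4) * Ebump p2 (1 - t / s\<^sup>2)) - (2 * m) * (s * (1/s)^(m+2) * Ebump p1 (1 - t / s\<^sup>2)))"
  proof -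
    have "(\<lambda>s. (4*t) * (s * (1/s)^(m+4) * Ebump p2 (1 - t / s\<^sup>2))) integrable_on {1..2}"
      "(\<lambda>s. (2 * m) * (s * (1/s)^(m+2) * Ebump p1 (1 - t / s\<^sup>2))) integrable_on {1..2}"
      by (rule integrable_continuous_real, intro continuous_intros, simp, simp)+
    from Henstock_Kurzweil_Integration.integral_diff[OF this] show ?thesis
      unfolding kk_def integral_mult_right by (simp only: mult_ac)
  qed
  \<comment> \<open>The integrand is the derivative in \<open>s\<close> of
    \<open>2 * (1/s)^m * Ebump p1 (1 - t / s^2)\<close>, that is, of \<open>rho0\<close> rescaled to
    size \<open>s\<close>. Its boundary values at 2 and 1 are the two mollifiers.\<close>
  also have "\<dots> = 2 * (1/2)^m * Ebump p1 (1 - t / 2\<^sup>2) - 2 * (1/1)^m * Ebump p1 (1 - t / 1\<^sup>2)"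
  proof (rule integral_unique, rule fundamental_theorem_of_calculus)
    fix s :: real assume "s \<in> {1..2}"
    then have s: "s > 0" by auto
    have A: "((\<lambda>s. Ebump p1 (1 - t / s\<^sup>2)) has_real_derivative Ebump p2 (1 - t / s\<^sup>2) * (2 * t / s^3)) (at s)"
      unfolding p2_def by (rule DERIV_chain2[OF Ebump_DERIV])
        (use s in \<open>auto intro!: derivative_eq_intros simp: field_simps power2_eq_square power3_eq_cube\<close>)
    have B: "((\<lambda>s. 2 * (1/s)^m) has_real_derivative - 2 * m * (1/s)^(m+1)) (at s)"
    proof -
      have m: "m > 0" by (simp add: m_def)
      have "((\<lambda>s. 1/s) has_real_derivative - ((1/s)^2)) (at s)"
        using s by (auto intro!: derivative_eq_intros simp: field_simps power2_eq_square)
      from DERIV_cmult[OF DERIV_power[OF this, of m], of 2]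
      have "((\<lambda>s. 2 * (1/s)^m) has_real_derivative 2 * (real m * (- ((1/s)^2) * (1/s)^(m - Suc 0)))) (at s)" by simp
      moreover have "(1/s)^2 * (1/s)^(m - Suc 0) = (1/s)^(m+1)"
        using m by (simp only: power_add[symmetric]) simp
      ultimately show ?thesis by (simp add: mult.assoc)
    qed
    have C: "- 2 * m * (1/s)^(m+1) * Ebump p1 (1 - t / s\<^sup>2) + Ebump p2 (1 - t / s\<^sup>2) * (2 * t / s^3) * (2 * (1/s)^m)
      = (4*t) * (s * (1/s)^(m+4) * Ebump p2 (1 - t / s\<^sup>2)) - (2 * m) * (s * (1/s)^(m+2) * Ebump p1 (1 - t / s\<^sup>2))"
      using s by (simp add: power_add field_simps power2_eq_square power3_eq_cube power4_eq_xxxx)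
    show "((\<lambda>s. 2 * (1/s)^m * Ebump p1 (1 - t / s\<^sup>2)) has_vector_derivative
       (4*t) * (s * (1/s)^(m+4) * Ebump p2 (1 - t / s\<^sup>2)) - (2 * m) * (s * (1/s)^(m+2) * Ebump p1 (1 - t / s\<^sup>2))) (at s within {1..2})"
      using DERIV_mult[OF B A] unfolding C
      by (simp add: has_real_derivative_iff_has_vector_derivative has_vector_derivative_at_within)
  qed auto
  also have "\<dots> = rho0 (x /\<^sub>R 2) / 2^DIM('a) - rho0 x"
    by (simp add: rho0_def m_def p1_def t_def power_one_over field_simps)
  finally show ?thesis .
qed

section \<open>Normalisation of the kernels\<close>

lemma rho0_integrable: "integrable lborel (rho0 :: 'a::euclidean_space \<Rightarrow> real)"
proof -
  have "integrable lborel (\<lambda>x::'a. indicator (cball 0 1) x *\<^sub>R rho0 x)"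
    by (rule borel_integrable_compact) (auto intro: continuous_on_subset[OF HC_continuous[OF HC_rho0[of 0]]])
  moreover have "(\<lambda>x::'a. indicator (cball 0 1) x *\<^sub>R rho0 x) = rho0"
    by (rule ext) (auto simp: indicator_def rho0_0)
  ultimately show ?thesis by simp
qed

lemma rho0_integral_pos: "(LBINT x. rho0 (x::'a::euclidean_space)) > 0"
proof (rule ccontr)
  assume "\<not> ?thesis"
  then have "(LBINT x. rho0 (x::'a)) = 0"
    using Bochner_Integration.integral_nonneg_AE[of "rho0 :: 'a \<Rightarrow> real" lborel] rho0_ge0 by (smt (verit) AE_I2)
  then have "AE x in lborel. rho0 (x::'a) = 0"
    using integral_nonneg_eq_0_iff_AE[OF rho0_integrable] rho0_ge0 by auto
  then have "AE x::'a in lborel. x \<notin> ball 0 1" by eventually_elim (use rho0_pos in force)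
  then have "emeasure lborel (ball (0::'a) 1) = 0" by (subst (asm) AE_iff_measurable) auto
  moreover have "measure lborel (ball (0::'a) 1) > 0" by (rule content_ball_pos) simp
  ultimately show False by (simp add: measure_def)
qed

definition rho :: "'a::euclidean_space \<Rightarrow> real" where
  "rho x = (1 / (LBINT y. rho0 (y::'a))) * rho0 x"

text \<open>The same normalising factor as in \<open>rho\<close>, so that the Laplacian identity
  keeps its form.\<close>

definition kap :: "'a::euclidean_space \<Rightarrow> real" where
  "kap x = (1 / (LBINT y. rho0 (y::'a))) * kap0 x"

lemma HC_rho: "HC k UNIV rho" and HC_kap: "HC k UNIV kap"
  unfolding rho_def[abs_def] kap_def[abs_def] by (intro HC_cmult HC_rho0 HC_kap0)+

lemma rho_0: "norm x \<ge> 1 \<Longrightarrow> rho x = 0" and kap_0: "norm x \<ge> 2 \<Longrightarrow> kap x = 0"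
  and rho_ge0: "rho x \<ge> 0" and rho_pos: "norm x < 1 \<Longrightarrow> rho x > 0" and rho_minus: "rho (- x) = rho x"
  using rho0_integral_pos[where 'a='a] rho0_ge0[of x] rho0_pos[of x]
  by (auto simp: rho_def kap_def rho0_0 kap0_0) (simp_all add: rho0_def)

lemma rho_integral: "(LBINT x. rho (x::'a::euclidean_space)) = 1"
  unfolding rho_def[abs_def] using rho0_integrable rho0_integral_pos[where 'a='a] by auto

lemma partial_cmult:
  fixes f :: "'a::euclidean_space \<Rightarrow> real"
  assumes "HC 1 UNIV f" "b \<in> Basis" shows "partial_dir b (\<lambda>x. c * f x) = (\<lambda>x. c * partial_dir b f x)"
  by (rule ext, rule partial_dirI', rule DERIV_cmult) (use assms HC_DERIV[of 0 UNIV f b] in auto)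

lemma kap_laplace:
  fixes x :: "'a::euclidean_space"
  shows "(\<Sum>b\<in>Basis. partial_dir b (partial_dir b kap) x) = rho (x /\<^sub>R 2) / 2^DIM('a) - rho x"
proof -
  have "partial_dir b (partial_dir b kap) x = (1 / (LBINT y. rho0 (y::'a))) * partial_dir b (partial_dir b kap0) x" if "b \<in> Basis" for b :: 'a
  proof -
    have 1: "HC (Suc 0) UNIV (kap0 :: 'a \<Rightarrow> real)" "HC (Suc 0) UNIV (partial_dir b kap0)"
      using HC_kap0 HC_partial[OF HC_kap0 that] by blast+
    show ?thesis unfolding kap_def[abs_def]
      by (simp only: partial_cmult[OF 1(1)[folded One_nat_def] that] partial_cmult[OF 1(2)[folded One_nat_def] that])
  qed
  then show ?thesis
    using kap0_laplace[of x] by (simp add: sum_distrib_left[symmetric] sum_divide_distrib[symmetric] rho_def right_diff_distrib diff_divide_distrib)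
qed

section \<open>Convolution with test functions\<close>

definition bump :: "('a::euclidean_space \<Rightarrow> real) \<Rightarrow> bool" where
  "bump f \<longleftrightarrow> (\<forall>k. HC k UNIV f) \<and> (\<exists>R>0. \<forall>x. R \<le> norm x \<longrightarrow> f x = 0)"

text \<open>Also applied to functions that are controlled only near the support of the kernel;
  \<open>conv_cong\<close> reduces such cases to integrable \<open>w\<close>.\<close>

definition conv :: "('a::euclidean_space \<Rightarrow> real) \<Rightarrow> ('a \<Rightarrow> real) \<Rightarrow> 'a \<Rightarrow> real" where
  "conv k w x = (LBINT y. k (x - y) * w y)"

lemma bump_HC: "bump f \<Longrightarrow> HC k UNIV f" by (simp add: bump_def)

lemma bump_continuous: "bump f \<Longrightarrow> continuous_on A f"
  using HC_continuous[OF bump_HC[of f 0]] continuous_on_subset by blast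

lemma bump_measurable [measurable_dest]: "bump f \<Longrightarrow> f \<in> borel_measurable borel"
  by (rule borel_measurable_continuous_onI[OF bump_continuous])

lemma bump_bounded: assumes "bump f" shows "\<exists>M\<ge>0. \<forall>x. \<bar>f x\<bar> \<le> M"
proof -
  obtain R where R: "R > 0" "\<And>x. R \<le> norm x \<Longrightarrow> f x = 0" using assms by (auto simp: bump_def)
  have "compact (f ` cball 0 R)" using bump_continuous[OF assms] by (intro compact_continuous_image) auto
  from compact_imp_bounded[OF this] obtain M where M: "\<And>x. x \<in> cball 0 R \<Longrightarrow> \<bar>f x\<bar> \<le> M"
    unfolding bounded_iff ball_simps(9) real_norm_def by blast
  have "\<bar>f x\<bar> \<le> max M 0" for x using M[of x] R(2)[of x] by (cases "norm x \<le> R") auto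
  then show ?thesis by (intro exI[of _ "max M 0"]) auto
qed

lemma bump_DERIV: "bump f \<Longrightarrow> b \<in> Basis \<Longrightarrow> ((\<lambda>t. f (x + t *\<^sub>R b)) has_real_derivative partial_dir b f (x + s *\<^sub>R b)) (at s)"
  using bump_HC[of f "Suc 0"] by (intro DERIV_partial_at) auto

lemma bump_DERIV0: "bump f \<Longrightarrow> b \<in> Basis \<Longrightarrow> ((\<lambda>t. f (x + t *\<^sub>R b)) has_real_derivative partial_dir b f x) (at 0)"
  using bump_DERIV[of f b x 0] by simp

text \<open>Where the norm exceeds \<open>R\<close> the function is locally zero, and the sphere
  itself is reached along the dilates \<open>(1 + 1 / real (Suc n)) *\<^sub>R x\<close> by
  continuity of the derivative. Keeping the closed condition \<open>R \<le> norm x\<close> means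
  that the derivatives of a kernel have no larger support radius than the kernel.\<close>

lemma partial_support:
  fixes f :: "'a::euclidean_space \<Rightarrow> real"
  assumes "\<And>x. R \<le> norm x \<Longrightarrow> f x = 0" "bump f" "b \<in> Basis" "R \<le> norm x" shows "partial_dir b f x = 0"
proof -
  have 1: "partial_dir b f y = 0" if "R < norm y" for y
  proof -
    have "open {y::'a. R < norm y}" by (intro open_Collect_less continuous_intros)
    moreover have "((\<lambda>t. (\<lambda>_. 0) (y + t *\<^sub>R b)) has_real_derivative 0) (at 0)" by simp
    ultimately have "((\<lambda>t. f (y + t *\<^sub>R b)) has_real_derivative 0) (at 0)"
      using partial_cong[of "{y. R < norm y}" y "\<lambda>_. 0" f b 0] that assms(1) by simp
    then show ?thesis by (rule partial_dirI')
  qed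
  have c: "isCont (partial_dir b f) x"
    using HC_continuous[of 0 UNIV "partial_dir b f"] bump_HC[OF assms(2), of "Suc 0"] assms(3)
    by (simp add: continuous_on_eq_continuous_at)
  show ?thesis
  proof (cases "R < norm x")
    case False
    then have R: "norm x = R" using assms(4) by simp
    show ?thesis
    proof (cases "R = 0")
      case True
      then have "f = (\<lambda>_. 0)" using assms(1) by auto
      then show ?thesis by (simp add: partial_dirI')
    next
      case False
      have "((\<lambda>n. (1 + 1 / real (Suc n)) *\<^sub>R x) \<longlonglongrightarrow> (1 + 0) *\<^sub>R x)"
        by (intro tendsto_intros LIMSEQ_Suc[OF lim_1_over_n])
      then have "(\<lambda>n. partial_dir b f ((1 + 1 / real (Suc n)) *\<^sub>R x)) \<longlonglongrightarrow> partial_dir b f x"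
        using c by (auto intro: isCont_tendsto_compose)
      moreover have "partial_dir b f ((1 + 1 / real (Suc n)) *\<^sub>R x) = 0" for n
      proof (rule 1)
        have "norm x > 0" using R False by auto
        then have "norm x * 1 < norm x * (1 + 1 / real (Suc n))" by (intro mult_strict_left_mono) auto
        then show "R < norm ((1 + 1 / real (Suc n)) *\<^sub>R x)" using R by (simp add: mult.commute)
      qed
      ultimately show ?thesis by (simp add: LIMSEQ_const_iff)
    qed
  qed (use 1 in auto)
qed

lemma bump_partial: assumes "bump f" "b \<in> Basis" shows "bump (partial_dir b f)"
proof -
  obtain R where R: "R > 0" "\<And>x. R \<le> norm x \<Longrightarrow> f x = 0" using assms by (auto simp: bump_def)
  then have "\<And>x. R \<le> norm x \<Longrightarrow> partial_dir b f x = 0" using partial_support[OF R(2) assms] by auto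
  moreover have "HC k UNIV (partial_dir b f)" for k using bump_HC[OF assms(1), of "Suc k"] assms(2) by auto
  ultimately show ?thesis using R(1) by (auto simp: bump_def)
qed

lemma bumpI: "(\<And>k. HC k UNIV f) \<Longrightarrow> (\<And>x. R \<le> norm x \<Longrightarrow> f x = 0) \<Longrightarrow> bump f"
  unfolding bump_def by (intro conjI allI exI[of _ "max R 1"]) auto

lemma bump_cmult: "bump f \<Longrightarrow> bump (\<lambda>x. c * f x)" unfolding bump_def using HC_cmult by fastforce

lemma bump_add: assumes "bump f" "bump g" shows "bump (\<lambda>x. f x + g x)"
proof -
  obtain R where R: "\<And>x. R \<le> norm x \<Longrightarrow> f x = 0" using assms by (auto simp: bump_def)
  obtain R' where R': "\<And>x. R' \<le> norm x \<Longrightarrow> g x = 0" using assms by (auto simp: bump_def)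
  show ?thesis by (rule bumpI[of _ "max R R'"]) (use assms R R' in \<open>auto intro: HC_add bump_HC\<close>)
qed

lemma bump_zero: "bump (\<lambda>x. 0)" by (rule bumpI[of _ 0]) (auto intro: HC_const)

lemma bump_sum: "finite I \<Longrightarrow> (\<And>i. i \<in> I \<Longrightarrow> bump (f i)) \<Longrightarrow> bump (\<lambda>x. \<Sum>i\<in>I. f i x)"
  by (induction I rule: finite_induct) (auto intro: bump_add bump_zero)

lemma HC_affine:
  fixes f :: "'a::euclidean_space \<Rightarrow> real"
  assumes "\<And>k. HC k UNIV f" shows "HC k UNIV (\<lambda>y. f (x + c *\<^sub>R y))"
proof (rule HC_comp[OF assms])
  fix d :: 'a
  have "HC k UNIV (\<lambda>y. x \<bullet> d + c * (y \<bullet> d))" by (intro HC_add HC_cmult HC_const HC_inner) auto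
  then show "HC k UNIV (\<lambda>y. (x + c *\<^sub>R y) \<bullet> d)" by (simp add: inner_add_left)
qed auto

lemma partial_affine:
  fixes f :: "'a::euclidean_space \<Rightarrow> real"
  assumes "bump f" "b \<in> Basis"
  shows "partial_dir b (\<lambda>y. f (x + c *\<^sub>R y)) = (\<lambda>y. c * partial_dir b f (x + c *\<^sub>R y))"
proof (rule ext, rule partial_dirI')
  fix y :: 'a
  have "((\<lambda>t. c * t) has_real_derivative c) (at 0)" by (auto intro!: derivative_eq_intros)
  from DERIV_chain2[OF _ this, of "\<lambda>t. f ((x + c *\<^sub>R y) + t *\<^sub>R b)"] bump_DERIV0[OF assms, of "x + c *\<^sub>R y"]
  have "((\<lambda>t. f ((x + c *\<^sub>R y) + (c*t) *\<^sub>R b)) has_real_derivative partial_dir b f (x + c *\<^sub>R y) * c) (at 0)" by simp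
  then show "((\<lambda>t. f (x + c *\<^sub>R (y + t *\<^sub>R b))) has_real_derivative c * partial_dir b f (x + c *\<^sub>R y)) (at 0)"
    by (simp add: algebra_simps)
qed

lemma bump_affine:
  fixes f :: "'a::euclidean_space \<Rightarrow> real"
  assumes "bump f" "c \<noteq> 0" shows "bump (\<lambda>y. f (x + c *\<^sub>R y))"
proof -
  obtain R where R: "R > 0" "\<And>x. R \<le> norm x \<Longrightarrow> f x = 0" using assms by (auto simp: bump_def)
  show ?thesis
  proof (rule bumpI[of _ "(R + norm x) / \<bar>c\<bar>"])
    show "HC k UNIV (\<lambda>y. f (x + c *\<^sub>R y))" for k by (rule HC_affine[OF bump_HC[OF assms(1)]])
    fix y :: 'a assume "(R + norm x) / \<bar>c\<bar> \<le> norm y"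
    then have "R + norm x \<le> norm (c *\<^sub>R y)" using assms(2) by (simp add: field_simps)
    then have "R \<le> norm (x + c *\<^sub>R y)" using norm_triangle_ineq4[of "x + c *\<^sub>R y" x] by simp
    then show "f (x + c *\<^sub>R y) = 0" by (rule R(2))
  qed
qed

lemma conv_integrable:
  assumes "bump k" "integrable lborel w" shows "integrable lborel (\<lambda>y. k (x - y) * w y)"
proof -
  obtain M where M: "\<And>x. \<bar>k x\<bar> \<le> M" using bump_bounded[OF assms(1)] by blast
  have [measurable]: "k \<in> borel_measurable borel" using assms(1) by (rule bump_measurable)
  have [measurable]: "w \<in> borel_measurable borel" using borel_measurable_integrable[OF assms(2)] by simp
  show ?thesis
    by (rule Bochner_Integration.integrable_bound[of lborel "\<lambda>y. M * \<bar>w y\<bar>"])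
      (use assms(2) M in \<open>auto simp: abs_mult intro!: mult_right_mono order_trans[OF M abs_ge_self]\<close>)
qed

lemma conv_lipschitz:
  assumes "bump k" "integrable lborel w"
  shows "\<exists>L\<ge>0. \<forall>x y. \<bar>conv k w x - conv k w y\<bar> \<le> L * dist x y"
proof -
  have "\<exists>M. \<forall>y. \<bar>partial_dir b k y\<bar> \<le> M" if "b \<in> Basis" for b
    using bump_bounded[OF bump_partial[OF assms(1) that]] by blast
  then obtain M where M: "\<And>b y. b \<in> Basis \<Longrightarrow> \<bar>partial_dir b k y\<bar> \<le> M b" by metis
  define M' where "M' = Max (M ` Basis)"
  have M': "\<bar>partial_dir b k y\<bar> \<le> M'" if "b \<in> Basis" for b y
    using M[OF that, of y] that by (auto simp: M'_def intro: order_trans)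
  define L where "L = real DIM('a) * M'"
  have L: "\<bar>k x - k y\<bar> \<le> L * dist x y" for x y
    unfolding L_def
    by (rule C1_lipschitz[where S=UNIV and x=x and r="dist x y"])
      (use M' bump_HC[OF assms(1), of 1] bump_continuous[OF bump_partial[OF assms(1)]] in auto)
  have "0 \<le> M'" using order_trans[OF abs_ge_zero M'[OF SOME_Basis]] .
  then have L0: "L \<ge> 0" unfolding L_def by auto
  have "\<bar>conv k w x - conv k w y\<bar> \<le> (L * (LBINT z. \<bar>w z\<bar>)) * dist x y" for x y
  proof -
    have "conv k w x - conv k w y = (LBINT z. k (x - z) * w z - k (y - z) * w z)"
      unfolding conv_def by (rule Bochner_Integration.integral_diff[symmetric]) (intro conv_integrable assms)+
    also have "\<bar>\<dots>\<bar> \<le> (LBINT z. (L * dist x y) * \<bar>w z\<bar>)"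
    proof (rule integral_abs_bound_integral)
      show "integrable lborel (\<lambda>z. k (x - z) * w z - k (y - z) * w z)" by (intro Bochner_Integration.integrable_diff conv_integrable assms)
      show "integrable lborel (\<lambda>z. (L * dist x y) * \<bar>w z\<bar>)" using assms(2) by simp
      fix z
      have "\<bar>k (x - z) * w z - k (y - z) * w z\<bar> = \<bar>k (x - z) - k (y - z)\<bar> * \<bar>w z\<bar>" by (simp add: abs_mult[symmetric] algebra_simps)
      also have "\<dots> \<le> (L * dist (x - z) (y - z)) * \<bar>w z\<bar>" by (intro mult_right_mono L) auto
      finally show "\<bar>k (x - z) * w z - k (y - z) * w z\<bar> \<le> (L * dist x y) * \<bar>w z\<bar>" by (simp add: dist_norm)
    qed
    finally show ?thesis by (simp add: mult_ac)
  qed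
  then show ?thesis using L0 by (intro exI[of _ "L * (LBINT z. \<bar>w z\<bar>)"]) auto
qed

text \<open>The difference quotients of \<open>k\<close> are bounded by \<open>M\<close> uniformly,
  so \<open>M * \<bar>w y\<bar>\<close> dominates the integrands and the derivative falls on the
  kernel.\<close>

lemma conv_DERIV:
  assumes k: "bump k" "b \<in> Basis" and w: "integrable lborel w"
  shows "((\<lambda>t. conv k w (x + t *\<^sub>R b)) has_real_derivative conv (partial_dir b k) w x) (at 0)"
proof -
  obtain M where M: "\<And>x. \<bar>partial_dir b k x\<bar> \<le> M" using bump_bounded[OF bump_partial[OF k]] by blast
  have [measurable]: "k \<in> borel_measurable borel" "partial_dir b k \<in> borel_measurable borel"
    using k bump_partial[OF k] by (auto intro: bump_measurable)
  have [measurable]: "w \<in> borel_measurable borel" using borel_measurable_integrable[OF w] by simp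
  have lip: "\<bar>k (z + t *\<^sub>R b) - k z\<bar> \<le> M * \<bar>t\<bar>" for z t
  proof -
    have "norm (k (z + t *\<^sub>R b) - k (z + 0 *\<^sub>R b)) \<le> M * norm (t - 0)"
      by (rule field_differentiable_bound[where S=UNIV and f="\<lambda>t. k (z + t *\<^sub>R b)" and f'="\<lambda>s. partial_dir b k (z + s *\<^sub>R b)"])
        (use bump_DERIV[OF k] M in auto)
    then show ?thesis by simp
  qed
  have "((\<lambda>t. (conv k w (x + t *\<^sub>R b) - conv k w x) / t) \<longlongrightarrow> conv (partial_dir b k) w x) (at 0)"
    unfolding tendsto_at_iff_sequentially
  proof (intro allI impI)
    fix X :: "nat \<Rightarrow> real" assume X: "\<forall>i. X i \<in> UNIV - {0}" "X \<longlonglongrightarrow> 0"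
    define Q where "Q n y = ((k ((x - y) + X n *\<^sub>R b) - k (x - y)) / X n) * w y" for n y
    have "(\<lambda>n. LBINT y. Q n y) \<longlonglongrightarrow> (LBINT y. partial_dir b k (x - y) * w y)"
    proof (rule integral_dominated_convergence[where w="\<lambda>y. M * \<bar>w y\<bar>"])
      show "integrable lborel (\<lambda>y. M * \<bar>w y\<bar>)" using w by simp
      show "AE y in lborel. (\<lambda>n. Q n y) \<longlonglongrightarrow> partial_dir b k (x - y) * w y"
      proof (rule AE_I2)
        fix y
        have "((\<lambda>h. (k ((x - y) + h *\<^sub>R b) - k (x - y)) / h) \<longlongrightarrow> partial_dir b k (x - y)) (at 0)"
          using bump_DERIV0[OF k, of "x - y"] by (simp add: has_field_derivative_iff)
        then have "(\<lambda>n. (k ((x - y) + X n *\<^sub>R b) - k (x - y)) / X n) \<longlonglongrightarrow> partial_dir b k (x - y)"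
          using X unfolding tendsto_at_iff_sequentially by (auto simp: o_def)
        then show "(\<lambda>n. Q n y) \<longlonglongrightarrow> partial_dir b k (x - y) * w y"
          unfolding Q_def by (rule tendsto_mult_right)
      qed
      fix n
      show "AE y in lborel. norm (Q n y) \<le> M * \<bar>w y\<bar>"
      proof (rule AE_I2)
        fix y
        have "\<bar>k ((x - y) + X n *\<^sub>R b) - k (x - y)\<bar> / \<bar>X n\<bar> \<le> M" using lip[of "x - y" "X n"] X(1) by (simp add: field_simps)
        then have "(\<bar>k ((x - y) + X n *\<^sub>R b) - k (x - y)\<bar> / \<bar>X n\<bar>) * \<bar>w y\<bar> \<le> M * \<bar>w y\<bar>" by (rule mult_right_mono) simp
        then show "norm (Q n y) \<le> M * \<bar>w y\<bar>" by (simp add: Q_def abs_mult)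
      qed
    qed (auto simp: Q_def)
    moreover have "(LBINT y. Q n y) = (conv k w (x + X n *\<^sub>R b) - conv k w x) / X n" for n
    proof -
      have "conv k w (x + X n *\<^sub>R b) - conv k w x = (LBINT y. k ((x + X n *\<^sub>R b) - y) * w y - k (x - y) * w y)"
        unfolding conv_def by (rule Bochner_Integration.integral_diff[symmetric]) (intro conv_integrable k w)+
      then show ?thesis unfolding Q_def 
        by (simp add: algebra_simps diff_divide_distrib flip: integral_divide_zero)
    qed
    ultimately show "((\<lambda>t. (conv k w (x + t *\<^sub>R b) - conv k w x) / t) \<circ> X) \<longlonglongrightarrow> conv (partial_dir b k) w x"
      by (simp add: o_def conv_def[of "partial_dir b k"])
  qed
  then show ?thesis by (simp add: has_field_derivative_iff)
qed

lemma HC_conv: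
  assumes "bump k" "integrable lborel w" shows "HC n UNIV (conv k w)"
  using assms(1)
proof (induction n arbitrary: k)
  case 0
  obtain L where "L \<ge> 0" "\<And>x y. \<bar>conv k w x - conv k w y\<bar> \<le> L * dist x y" using conv_lipschitz[OF 0 assms(2)] by blast
  then have "\<exists>r>0. \<exists>\<alpha>>0. \<exists>C\<ge>0. ball x r \<subseteq> UNIV \<and> (\<forall>y\<in>ball x r. \<forall>z\<in>ball x r. \<bar>conv k w y - conv k w z\<bar> \<le> C * dist y z powr \<alpha>)" for x
    by (intro exI[of _ 1] conjI exI[of _ L]) auto
  then show ?case by (simp add: lholI)
next
  case (Suc n)
  show ?case by (rule HC_SucI[where g="\<lambda>b. conv (partial_dir b k) w"])
      (use Suc assms(2) in \<open>auto intro: conv_DERIV bump_partial\<close>)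
qed

lemma partial_conv: "bump k \<Longrightarrow> b \<in> Basis \<Longrightarrow> integrable lborel w \<Longrightarrow> partial_dir b (conv k w) = conv (partial_dir b k) w"
  by (rule ext, rule partial_dirI', rule conv_DERIV)

lemma conv_continuous: "bump k \<Longrightarrow> integrable lborel w \<Longrightarrow> continuous_on A (conv k w)"
  using HC_continuous[OF HC_conv[of k w 0]] continuous_on_subset by blast

lemma integrable_ind: "integrable lborel w \<Longrightarrow> A \<in> sets borel \<Longrightarrow> integrable lborel (\<lambda>y. indicator A y * \<bar>w y\<bar> :: real)"
  using integrable_mult_indicator[of A lborel "\<lambda>y. \<bar>w y\<bar>"] by simp

lemma conv_bound:
  assumes k: "bump k" "\<And>z. \<bar>k z\<bar> \<le> M" "\<And>z. R \<le> norm z \<Longrightarrow> k z = 0" and w: "integrable lborel w"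
  shows "\<bar>conv k w x\<bar> \<le> M * (LBINT y. indicator (ball x R) y * \<bar>w y\<bar>)"
proof -
  have "\<bar>conv k w x\<bar> \<le> (LBINT y. M * (indicator (ball x R) y * \<bar>w y\<bar>))"
    unfolding conv_def
  proof (rule integral_abs_bound_integral)
    show "integrable lborel (\<lambda>y. k (x - y) * w y)" by (rule conv_integrable[OF k(1) w])
    show "integrable lborel (\<lambda>y. M * (indicator (ball x R) y * \<bar>w y\<bar>))"
      using integrable_ind[OF w] by simp
    fix y
    show "\<bar>k (x - y) * w y\<bar> \<le> M * (indicator (ball x R) y * \<bar>w y\<bar>)"
      using k(2)[of "x - y"] k(3)[of "x - y"]
      by (cases "y \<in> ball x R") (auto simp: abs_mult dist_norm intro: mult_right_mono)
  qed
  then show ?thesis by simp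
qed

lemma conv_eq_0:
  assumes "\<And>z. R \<le> norm z \<Longrightarrow> k z = 0" "\<And>y. y \<in> ball x R \<Longrightarrow> w y = 0"
  shows "conv k w x = 0"
proof -
  have "k (x - y) * w y = 0" for y using assms(1)[of "x - y"] assms(2)[of y] by (cases "y \<in> ball x R") (auto simp: dist_norm)
  then show ?thesis unfolding conv_def by (simp only: Bochner_Integration.integral_zero)
qed

text \<open>The integrands agree at every point, so data may be replaced freely outside the support
  ball of the kernel; this makes the whole method local.\<close>

lemma conv_cong:
  assumes "\<And>z. R \<le> norm z \<Longrightarrow> k z = 0" "\<And>y. y \<in> ball x R \<Longrightarrow> w y = w' y"
  shows "conv k w x = conv k w' x"
proof -
  have "k (x - y) * w y = k (x - y) * w' y" for y using assms(1)[of "x - y"] assms(2)[of y] by (cases "y \<in> ball x R") (auto simp: dist_norm)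
  then show ?thesis unfolding conv_def by presburger
qed

lemma conv_sum: "finite I \<Longrightarrow> (\<And>i. i \<in> I \<Longrightarrow> bump (k i)) \<Longrightarrow> integrable lborel w \<Longrightarrow>
  conv (\<lambda>x. \<Sum>i\<in>I. k i x) w x = (\<Sum>i\<in>I. conv (k i) w x)"
  unfolding conv_def sum_distrib_right
  by (rule Bochner_Integration.integral_sum) (auto intro: conv_integrable)

lemma conv_diff: "bump k \<Longrightarrow> bump l \<Longrightarrow> integrable lborel w \<Longrightarrow> conv (\<lambda>x. k x - l x) w x = conv k w x - conv l w x"
  unfolding conv_def left_diff_distrib
  by (rule Bochner_Integration.integral_diff) (auto intro: conv_integrable)

section \<open>Mollification of integrable functions\<close>

lemma nn_integral_shift:
  fixes f :: "'a::euclidean_space \<Rightarrow> ennreal"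
  assumes [measurable]: "f \<in> borel_measurable borel"
  shows "(NBINT x. f (x + h)) = (NBINT x. f x)"
proof -
  have "(NBINT x. f x) = (\<integral>\<^sup>+x. f x \<partial>distr lborel borel ((+) h))" by (simp add: lborel_distr_plus)
  also have "\<dots> = (NBINT x. f (h + x))" by (rule nn_integral_distr) auto
  finally show ?thesis by (simp add: add.commute)
qed

lemma nn_integral_affine:
  fixes f :: "'a::euclidean_space \<Rightarrow> ennreal"
  assumes [measurable]: "f \<in> borel_measurable borel" and "c \<noteq> 0"
  shows "(NBINT x. f x) = ennreal (\<bar>c\<bar> ^ DIM('a)) * (NBINT x. f (t + c *\<^sub>R x))"
  by (subst lborel_affine[OF assms(2), of t]) (simp add: nn_integral_density nn_integral_distr nn_integral_cmult)

lemma nn_integral_reflect: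
  fixes f :: "'a::euclidean_space \<Rightarrow> ennreal"
  assumes "f \<in> borel_measurable borel"
  shows "(NBINT y. f (x - y)) = (NBINT y. f y)"
  using nn_integral_affine[OF assms, of "-1" x] by simp

lemma integral_affine:
  fixes f :: "'a::euclidean_space \<Rightarrow> real"
  assumes [measurable]: "f \<in> borel_measurable borel" and "c \<noteq> 0"
  shows "(LBINT x. f x) = \<bar>c\<bar> ^ DIM('a) * (LBINT x. f (t + c *\<^sub>R x))"
  by (subst lborel_affine[OF assms(2), of t]) (simp add: integral_density integral_distr)

lemma integral_reflect:
  fixes f :: "'a::euclidean_space \<Rightarrow> real"
  assumes "f \<in> borel_measurable borel"
  shows "(LBINT y. f (x - y)) = (LBINT y. f y)"
  using integral_affine[OF assms, of "-1" x] by simp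

lemma integral_shift:
  fixes f :: "'a::euclidean_space \<Rightarrow> real"
  assumes "f \<in> borel_measurable borel"
  shows "(LBINT y. f (y + x)) = (LBINT y. f y)"
  using integral_affine[OF assms, of 1 x] by (simp add: add.commute)

text \<open>Continuity of translations in L1. Extended non-negative integrals spare integrability
  side conditions.\<close>

definition L1cont :: "('a::euclidean_space \<Rightarrow> real) \<Rightarrow> bool" where
  "L1cont w \<longleftrightarrow> (\<forall>e>0. \<exists>d>0. \<forall>h. norm h < d \<longrightarrow> (NBINT x. ennreal \<bar>w (x + h) - w x\<bar>) \<le> ennreal e)"

lemma L1cont_approx:
  assumes w: "w \<in> borel_measurable borel"
    and ap: "\<And>e. e > 0 \<Longrightarrow> \<exists>g. g \<in> borel_measurable borel \<and> L1cont g \<and> (NBINT x. ennreal \<bar>w x - g x\<bar>) \<le> ennreal e"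
  shows "L1cont w"
  unfolding L1cont_def
proof (intro allI impI)
  fix e :: real assume e: "e > 0"
  obtain g where g: "g \<in> borel_measurable borel" "L1cont g" "(NBINT x. ennreal \<bar>w x - g x\<bar>) \<le> ennreal (e/3)"
    using ap[of "e/3"] e by auto
  note [measurable] = w g(1)
  obtain d where d: "d > 0" "\<And>h. norm h < d \<Longrightarrow> (NBINT x. ennreal \<bar>g (x + h) - g x\<bar>) \<le> ennreal (e/3)"
    using g(2) e unfolding L1cont_def by (metis zero_less_divide_iff zero_less_numeral)
  have "(NBINT x. ennreal \<bar>w (x + h) - w x\<bar>) \<le> ennreal e" if h: "norm h < d" for h
  proof -
    have "(NBINT x. ennreal \<bar>w (x + h) - w x\<bar>)
      \<le> (NBINT x. (ennreal \<bar>w (x + h) - g (x + h)\<bar> + ennreal \<bar>g (x + h) - g x\<bar>) + ennreal \<bar>w x - g x\<bar>)"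
      by (intro nn_integral_mono) (auto simp: ennreal_plus[symmetric] simp del: ennreal_plus intro!: ennreal_leI)
    also have "\<dots> = ((NBINT x. ennreal \<bar>w (x + h) - g (x + h)\<bar>) + (NBINT x. ennreal \<bar>g (x + h) - g x\<bar>)) + (NBINT x. ennreal \<bar>w x - g x\<bar>)"
      by (simp add: nn_integral_add)
    also have "(NBINT x. ennreal \<bar>w (x + h) - g (x + h)\<bar>) = (NBINT x. ennreal \<bar>w x - g x\<bar>)"
      by (rule nn_integral_shift[of "\<lambda>x. ennreal \<bar>w x - g x\<bar>"]) auto
    also have "\<dots> + (NBINT x. ennreal \<bar>g (x + h) - g x\<bar>) + (NBINT x. ennreal \<bar>w x - g x\<bar>) \<le> ennreal (e/3) + ennreal (e/3) + ennreal (e/3)"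
      by (intro add_mono g(3) d(2) h)
    also have "\<dots> = ennreal e" using e by (simp add: ennreal_plus[symmetric] del: ennreal_plus)
    finally show ?thesis .
  qed
  then show "\<exists>d>0. \<forall>h. norm h < d \<longrightarrow> (NBINT x. ennreal \<bar>w (x + h) - w x\<bar>) \<le> ennreal e" using d(1) by blast
qed

lemma L1cont_add:
  assumes [measurable]: "f \<in> borel_measurable borel" "g \<in> borel_measurable borel" and fg: "L1cont f" "L1cont g"
  shows "L1cont (\<lambda>x. f x + g x)"
  unfolding L1cont_def
proof (intro allI impI)
  fix e :: real assume e: "e > 0"
  then have e2: "e/2 > 0" by simp
  obtain d where d: "d > 0" "\<And>h. norm h < d \<Longrightarrow> (NBINT x. ennreal \<bar>g (x + h) - g x\<bar>) \<le> ennreal (e/2)"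
    using fg(2) e2 unfolding L1cont_def by blast
  obtain d' where d': "d' > 0" "\<And>h. norm h < d' \<Longrightarrow> (NBINT x. ennreal \<bar>f (x + h) - f x\<bar>) \<le> ennreal (e/2)"
    using fg(1) e2 unfolding L1cont_def by blast
  have "(NBINT x. ennreal \<bar>f (x + h) + g (x + h) - (f x + g x)\<bar>) \<le> ennreal e" if h: "norm h < min d d'" for h
  proof -
    have "(NBINT x. ennreal \<bar>f (x + h) + g (x + h) - (f x + g x)\<bar>)
       \<le> (NBINT x. ennreal \<bar>f (x + h) - f x\<bar> + ennreal \<bar>g (x + h) - g x\<bar>)"
      by (intro nn_integral_mono) (auto simp: ennreal_plus[symmetric] simp del: ennreal_plus intro!: ennreal_leI)
    also have "\<dots> = (NBINT x. ennreal \<bar>f (x + h) - f x\<bar>) + (NBINT x. ennreal \<bar>g (x + h) - g x\<bar>)"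
      by (simp add: nn_integral_add)
    also have "\<dots> \<le> ennreal (e/2) + ennreal (e/2)" using d(2) d'(2) h by (intro add_mono) auto
    also have "\<dots> = ennreal e" using e by (simp add: ennreal_plus[symmetric] del: ennreal_plus)
    finally show ?thesis .
  qed
  then show "\<exists>d>0. \<forall>h. norm h < d \<longrightarrow> (NBINT x. ennreal \<bar>f (x + h) + g (x + h) - (f x + g x)\<bar>) \<le> ennreal e"
    using d(1) d'(1) by (intro exI[of _ "min d d'"]) auto
qed

lemma L1cont_cmult:
  assumes [measurable]: "f \<in> borel_measurable borel" and f: "L1cont f"
  shows "L1cont (\<lambda>x. c * f x)"
  unfolding L1cont_def
proof (intro allI impI)
  fix e :: real assume e: "e > 0"
  then have e2: "e/(\<bar>c\<bar>+1) > 0" by simp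
  obtain d where d: "d > 0" "\<And>h. norm h < d \<Longrightarrow> (NBINT x. ennreal \<bar>f (x + h) - f x\<bar>) \<le> ennreal (e/(\<bar>c\<bar>+1))"
    using f e2 unfolding L1cont_def by blast
  have "(NBINT x. ennreal \<bar>c * f (x + h) - c * f x\<bar>) \<le> ennreal e" if h: "norm h < d" for h
  proof -
    have "(NBINT x. ennreal \<bar>c * f (x + h) - c * f x\<bar>) = (NBINT x. ennreal \<bar>c\<bar> * ennreal \<bar>f (x + h) - f x\<bar>)"
      by (intro nn_integral_cong) (simp add: ennreal_mult'[symmetric] abs_mult[symmetric] right_diff_distrib)
    also have "\<dots> = ennreal \<bar>c\<bar> * (NBINT x. ennreal \<bar>f (x + h) - f x\<bar>)" by (rule nn_integral_cmult) auto
    also have "\<dots> \<le> ennreal \<bar>c\<bar> * ennreal (e/(\<bar>c\<bar>+1))" by (intro mult_left_mono d h) auto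
    also have "\<dots> = ennreal (\<bar>c\<bar> * (e/(\<bar>c\<bar>+1)))" by (rule ennreal_mult'[OF abs_ge_zero, symmetric])
    also have "\<dots> \<le> ennreal e" using e by (intro ennreal_leI) (simp add: field_simps)
    finally show ?thesis .
  qed
  then show "\<exists>d>0. \<forall>h. norm h < d \<longrightarrow> (NBINT x. ennreal \<bar>c * f (x + h) - c * f x\<bar>) \<le> ennreal e" using d(1) by blast
qed

text \<open>A point of an open set stays in it after small translations, so by dominated convergence
  the overlap of \<open>U\<close> with its translate tends to full measure. The symmetric difference
  has twice the measure of the missing overlap.\<close>

lemma L1cont_open:
  fixes U :: "'a::euclidean_space set"
  assumes U: "open U" "emeasure lborel U < \<infinity>"
  shows "L1cont (indicator U)"
proof (rule ccontr)
  have [measurable]: "U \<in> sets borel" using U by simp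
  assume "\<not> ?thesis"
  then obtain e where e: "e > 0" "\<And>d. d > 0 \<Longrightarrow> \<exists>h. norm h < d \<and> \<not> (NBINT x. ennreal \<bar>indicator U (x + h) - indicator U x\<bar>) \<le> ennreal e"
    unfolding L1cont_def by blast
  have "\<exists>h. norm h < 1 / real (Suc n) \<and> \<not> (NBINT x. ennreal \<bar>indicator U (x + h) - indicator U x\<bar>) \<le> ennreal e" for n
    by (rule e(2)) simp
  then obtain h where h: "\<And>n. norm (h n) < 1 / real (Suc n)"
    "\<And>n. \<not> (NBINT x. ennreal \<bar>indicator U (x + h n) - indicator U x\<bar>) \<le> ennreal e" by metis
  have h0: "h \<longlonglongrightarrow> 0"
    by (rule Lim_null_comparison[OF _ LIMSEQ_Suc[OF lim_1_over_n]]) (use h(1) in \<open>auto intro!: always_eventually less_imp_le\<close>)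
  have int: "integrable lborel (indicator U :: 'a \<Rightarrow> real)" using U by simp
  have ints: "integrable lborel (\<lambda>x. indicator U (x + t) :: real)" for t :: 'a
  proof -
    have "(NBINT x. ennreal (indicator U (x + t))) = (NBINT x. ennreal (indicator U x))"
      by (rule nn_integral_shift[of "\<lambda>x. ennreal (indicator U x)"]) auto
    also have "\<dots> < \<infinity>" using U by (simp add: ennreal_indicator)
    finally show ?thesis by (intro integrableI_bounded) auto
  qed
  have "(\<lambda>n. LBINT x. indicator U x * indicator U (x + h n)) \<longlonglongrightarrow> (LBINT x. (indicator U x :: real))"
  proof (rule integral_dominated_convergence[where w="indicator U", OF _ _ int])
    show "AE x in lborel. (\<lambda>n. indicator U x * indicator U (x + h n)) \<longlonglongrightarrow> (indicator U x :: real)"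
    proof (rule AE_I2)
      fix x :: 'a
      show "(\<lambda>n. indicator U x * indicator U (x + h n)) \<longlonglongrightarrow> (indicator U x :: real)"
      proof (cases "x \<in> U")
        case True
        have "(\<lambda>n. x + h n) \<longlonglongrightarrow> x + 0" by (intro tendsto_intros h0)
        then have "\<forall>\<^sub>F n in sequentially. x + h n \<in> U" using topological_tendstoD[of _ "x + 0" sequentially U] U(1) True by simp
        then have "\<forall>\<^sub>F n in sequentially. indicator U x * indicator U (x + h n) = (indicator U x :: real)"
          by eventually_elim auto
        then show ?thesis by (rule tendsto_eventually)
      qed simp
    qed
  qed (auto simp: indicator_def)
  then have "(\<lambda>n. 2 * (LBINT x. indicator U x) - 2 * (LBINT x. indicator U x * indicator U (x + h n))) \<longlonglongrightarrow> 2 * (LBINT x. (indicator U x :: real)) - 2 * (LBINT x. (indicator U x :: real))"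
    by (intro tendsto_intros)
  then have "\<forall>\<^sub>F n in sequentially. 2 * (LBINT x. indicator U x) - 2 * (LBINT x. indicator U x * indicator U (x + h n)) < e"
    using e(1) by (intro order_tendstoD(2)) auto
  then obtain n where n: "2 * (LBINT x. indicator U x) - 2 * (LBINT x. indicator U x * indicator U (x + h n)) < e"
    using eventually_happens'[OF sequentially_bot] by blast
  have ip: "integrable lborel (\<lambda>x. indicator U x * indicator U (x + h n) :: real)"
    by (rule Bochner_Integration.integrable_bound[OF int]) (auto simp: indicator_def)
  have eq: "\<bar>indicator U (x + h n) - indicator U x\<bar> = indicator U (x + h n) + indicator U x - 2 * (indicator U x * indicator U (x + h n) :: real)" for x
    by (auto simp: indicator_def)
  have "(NBINT x. ennreal \<bar>indicator U (x + h n) - indicator U x\<bar>) = ennreal (LBINT x. \<bar>indicator U (x + h n) - indicator U x\<bar>)"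
    by (rule nn_integral_eq_integral) (use ints int in auto)
  also have "(LBINT x. \<bar>indicator U (x + h n) - indicator U x\<bar>) = (LBINT x. (indicator U (x + h n) :: real)) + (LBINT x. indicator U x) - 2 * (LBINT x. indicator U x * indicator U (x + h n))"
    unfolding eq using ints[of "h n"] int ip by simp
  also have "(LBINT x. indicator U (x + h n)) = (LBINT x. (indicator U x :: real))"
    by (rule integral_shift) simp
  finally show False using h(2)[of n] n by (simp add: ennreal_leI)
qed

text \<open>Open sets are treated directly, Borel sets by outer regularity, and the rest by linear
  combinations and dominated limits; \<open>L1cont_approx\<close> says that the class is closed
  under approximation in L1.\<close>

lemma L1cont_integrable:
  fixes w :: "'a::euclidean_space \<Rightarrow> real"
  assumes "integrable lborel w" shows "L1cont w"
  using assms
proof (induct w rule: integrable_induct)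
  case (base A c)
  then have [measurable]: "A \<in> sets borel" by simp
  have "L1cont (indicator A :: 'a \<Rightarrow> real)"
  proof (rule L1cont_approx)
    fix e :: real assume e: "e > 0"
    obtain U where U: "open U" "A \<subseteq> U" "emeasure lborel (U - A) < ennreal e"
      using outer_regular_lborel[of A e] e by auto
    note [measurable] = borel_open[OF U(1)]
    have "emeasure lborel U \<le> emeasure lborel A + emeasure lborel (U - A)"
      using U(2) emeasure_subadditive[of A lborel "U - A"] by (simp add: Un_absorb1)
    also have "\<dots> < \<infinity>" using base U(3) by (auto simp: less_top[symmetric] intro: order_less_trans)
    finally have "L1cont (indicator U :: 'a \<Rightarrow> real)" using U(1) by (intro L1cont_open) auto
    moreover have "(NBINT x. ennreal \<bar>indicator A x - indicator U x\<bar>) \<le> ennreal e"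
    proof -
      have "(NBINT x. ennreal \<bar>indicator A x - indicator U x\<bar>) = (NBINT x. indicator (U - A) x)"
        using U(2) by (intro nn_integral_cong) (auto simp: indicator_def)
      also have "\<dots> = emeasure lborel (U - A)" by (rule nn_integral_indicator) simp
      finally show ?thesis using U(3) by simp
    qed
    ultimately show "\<exists>g. g \<in> borel_measurable borel \<and> L1cont g \<and> (NBINT x. ennreal \<bar>indicator A x - g x\<bar>) \<le> ennreal e"
      by (intro exI[of _ "indicator U"]) auto
  qed simp
  then have "L1cont (\<lambda>x. c * indicator A x)" by (intro L1cont_cmult) auto
  then show ?case by (simp add: mult.commute)
next
  case (add f g)
  have "f \<in> borel_measurable borel" "g \<in> borel_measurable borel" using add by (auto dest: borel_measurable_integrable)
  then show ?case using add by (intro L1cont_add) auto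
next
  case (lim f s)
  have [measurable]: "f \<in> borel_measurable borel" "\<And>i. s i \<in> borel_measurable borel" using lim by (auto dest: borel_measurable_integrable)
  show ?case
  proof (rule L1cont_approx)
    fix e :: real assume e: "e > 0"
    have "(\<lambda>i. LBINT x. \<bar>f x - s i x\<bar>) \<longlonglongrightarrow> (\<integral>x. (0::real) \<partial>(lborel::'a measure))"
    proof (rule integral_dominated_convergence[where w="\<lambda>x. 3 * \<bar>f x\<bar>"])
      show "integrable lborel (\<lambda>x. 3 * \<bar>f x\<bar>)" using lim by simp
      show "AE x in lborel. (\<lambda>i. \<bar>f x - s i x\<bar>) \<longlonglongrightarrow> 0"
      proof (rule AE_I2)
        fix x
        have "(\<lambda>i. \<bar>f x - s i x\<bar>) \<longlonglongrightarrow> \<bar>f x - f x\<bar>" using lim(3)[of x] by (intro tendsto_intros) auto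
        then show "(\<lambda>i. \<bar>f x - s i x\<bar>) \<longlonglongrightarrow> 0" by simp
      qed
      show "AE x in lborel. norm \<bar>f x - s i x\<bar> \<le> 3 * \<bar>f x\<bar>" for i
      proof (rule AE_I2)
        fix x show "norm \<bar>f x - s i x\<bar> \<le> 3 * \<bar>f x\<bar>" using lim(4)[of x i] by simp
      qed
    qed auto
    then have "\<forall>\<^sub>F i in sequentially. (LBINT x. \<bar>f x - s i x\<bar>) < e" using e by (intro order_tendstoD(2)) auto
    then obtain i where i: "(LBINT x. \<bar>f x - s i x\<bar>) < e" using eventually_happens'[OF sequentially_bot] by blast
    have "(NBINT x. ennreal \<bar>f x - s i x\<bar>) = ennreal (LBINT x. \<bar>f x - s i x\<bar>)"
      by (rule nn_integral_eq_integral) (use lim in auto)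
    then show "\<exists>g. g \<in> borel_measurable borel \<and> L1cont g \<and> (NBINT x. ennreal \<bar>f x - g x\<bar>) \<le> ennreal e"
      using i lim by (intro exI[of _ "s i"]) (auto intro: ennreal_leI)
  qed simp
qed

section \<open>Mollifiers and almost everywhere convergence\<close>

definition mollifier :: "(nat \<Rightarrow> 'a::euclidean_space \<Rightarrow> real) \<Rightarrow> (nat \<Rightarrow> real) \<Rightarrow> bool" where
  "mollifier k r \<longleftrightarrow> (\<forall>n. bump (k n) \<and> (\<forall>z. k n z \<ge> 0) \<and> (LBINT z. k n z) = 1 \<and> (\<forall>z. r n \<le> norm z \<longrightarrow> k n z = 0)) \<and> r \<longlonglongrightarrow> 0"

lemma bump_integrable: assumes "bump k" shows "integrable lborel k"
proof -
  obtain R where R: "R > 0" "\<And>x. R \<le> norm x \<Longrightarrow> k x = 0" using assms by (auto simp: bump_def)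
  have "integrable lborel (\<lambda>x. indicator (cball 0 R) x *\<^sub>R k x)"
    by (rule borel_integrable_compact) (auto intro: bump_continuous assms)
  moreover have "(\<lambda>x. indicator (cball 0 R) x *\<^sub>R k x) = k" using R(2) by (auto simp: indicator_def fun_eq_iff)
  ultimately show ?thesis by simp
qed

lemma mollifier_nn:
  assumes "bump k" "\<And>z. k z \<ge> 0" "(LBINT z. k z) = 1"
  shows "(NBINT y. ennreal (k (x - y))) = 1" "(NBINT x. ennreal (k (x - y))) = 1" "(NBINT y. ennreal (k y)) = 1"
proof -
  note [measurable] = bump_measurable[OF assms(1)]
  show 1: "(NBINT y. ennreal (k y)) = 1"
    using nn_integral_eq_integral[OF bump_integrable[OF assms(1)]] assms by simp
  show "(NBINT y. ennreal (k (x - y))) = 1"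
    using nn_integral_reflect[of "\<lambda>y. ennreal (k y)" x] 1 by simp
  show "(NBINT x. ennreal (k (x - y))) = 1"
    using nn_integral_shift[of "\<lambda>y. ennreal (k y)" "- y"] 1 by simp
qed

text \<open>The error at \<open>x\<close> is the average of \<open>w (x - z) - w x\<close> against
  the probability density \<open>k\<close>; Tonelli moves the integral over \<open>x\<close> inside,
  where only translations by less than \<open>r\<close> occur.\<close>

lemma mollify_L1:
  fixes w :: "'a::euclidean_space \<Rightarrow> real"
  assumes k: "bump k" "\<And>z. k z \<ge> 0" "(LBINT z. k z) = 1" "\<And>z. r \<le> norm z \<Longrightarrow> k z = 0"
    and w: "integrable lborel w"
    and d: "\<And>h. norm h < r \<Longrightarrow> (NBINT x. ennreal \<bar>w (x + h) - w x\<bar>) \<le> e"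
  shows "(NBINT x. ennreal \<bar>conv k w x - w x\<bar>) \<le> e"
proof -
  note [measurable] = bump_measurable[OF k(1)]
  have [measurable]: "w \<in> borel_measurable borel" using borel_measurable_integrable[OF w] by simp
  have "ennreal \<bar>conv k w x - w x\<bar> \<le> (NBINT z. ennreal (k z) * ennreal \<bar>w (x - z) - w x\<bar>)" for x
  proof -
    have ki: "integrable lborel (\<lambda>y. k (x - y) * w x)"
    proof -
      have "(NBINT y. ennreal (norm (k (x - y)))) = 1" using mollifier_nn(1)[OF k(1-3)] k(2) by simp
      then have "integrable lborel (\<lambda>y. k (x - y))" by (intro integrableI_bounded) auto
      then show ?thesis by simp
    qed
    have "(LBINT y. k (x - y) * w x) = w x"
      using integral_reflect[of k x] k(3) by simp
    then have "conv k w x - w x = (LBINT y. k (x - y) * w y - k (x - y) * w x)"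
      unfolding conv_def using conv_integrable[OF k(1) w] ki by simp
    then have "\<bar>conv k w x - w x\<bar> \<le> (LBINT y. \<bar>k (x - y) * w y - k (x - y) * w x\<bar>)" by simp
    then have "ennreal \<bar>conv k w x - w x\<bar> \<le> ennreal (LBINT y. \<bar>k (x - y) * w y - k (x - y) * w x\<bar>)" by (rule ennreal_leI)
    also have "\<dots> = (NBINT y. ennreal \<bar>k (x - y) * w y - k (x - y) * w x\<bar>)"
      by (rule nn_integral_eq_integral[symmetric]) (use conv_integrable[OF k(1) w] ki in auto)
    also have "\<dots> = (NBINT y. ennreal (k (x - y)) * ennreal \<bar>w (x - (x - y)) - w x\<bar>)"
      using k(2) by (intro nn_integral_cong) (simp add: ennreal_mult[symmetric] right_diff_distrib[symmetric] abs_mult)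
    also have "\<dots> = (NBINT z. ennreal (k z) * ennreal \<bar>w (x - z) - w x\<bar>)"
      by (rule nn_integral_reflect[of "\<lambda>z. ennreal (k z) * ennreal \<bar>w (x - z) - w x\<bar>"]) simp
    finally show ?thesis .
  qed
  then have "(NBINT x. ennreal \<bar>conv k w x - w x\<bar>) \<le> (NBINT x. NBINT z. ennreal (k z) * ennreal \<bar>w (x - z) - w x\<bar>)"
    by (intro nn_integral_mono)
  also have "\<dots> = (NBINT z. NBINT x. ennreal (k z) * ennreal \<bar>w (x - z) - w x\<bar>)"
    by (rule lborel_pair.Fubini') simp
  also have "\<dots> = (NBINT z. ennreal (k z) * (NBINT x. ennreal \<bar>w (x + - z) - w x\<bar>))"
    by (simp add: nn_integral_cmult)
  also have "\<dots> \<le> (NBINT z. ennreal (k z) * e)"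
  proof (intro nn_integral_mono)
    fix z :: 'a
    show "ennreal (k z) * (NBINT x. ennreal \<bar>w (x + - z) - w x\<bar>) \<le> ennreal (k z) * e"
      using d[of "- z"] k(4)[of z] by (cases "norm z < r") (auto intro: mult_left_mono)
  qed
  also have "\<dots> = e" using mollifier_nn(3)[OF k(1-3)] by (simp add: nn_integral_multc)
  finally show ?thesis .
qed

text \<open>Convergence in L1 yields an almost everywhere convergent subsequence. That is enough
  wherever Fatou's lemma is applied or a limit has to be identified.\<close>

lemma mollify_AE:
  fixes w :: "'a::euclidean_space \<Rightarrow> real"
  assumes m: "mollifier k r" and w: "integrable lborel w"
  shows "\<exists>s. strict_mono (s::nat\<Rightarrow>nat) \<and> (AE x in lborel. (\<lambda>n. conv (k (s n)) w x) \<longlonglongrightarrow> w x)"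
proof -
  have mk: "bump (k n)" "\<And>z. k n z \<ge> 0" "(LBINT z. k n z) = 1" "\<And>z. r n \<le> norm z \<Longrightarrow> k n z = 0" "r \<longlonglongrightarrow> 0" for n
    using m by (auto simp: mollifier_def)
  have [measurable]: "w \<in> borel_measurable borel" using borel_measurable_integrable[OF w] by simp
  have [measurable]: "conv (k n) w \<in> borel_measurable borel" for n
    by (rule borel_measurable_continuous_onI[OF conv_continuous[OF mk(1) w]])
  define W where "W = (NBINT x. ennreal \<bar>w x\<bar>)"
  have W: "W < \<infinity>" using w unfolding W_def by (simp add: integrable_iff_bounded)
  have "(NBINT x. ennreal \<bar>w (x + h) - w x\<bar>) \<le> W + W" for h
  proof -
    have "(NBINT x. ennreal \<bar>w (x + h) - w x\<bar>) \<le> (NBINT x. ennreal \<bar>w (x + h)\<bar> + ennreal \<bar>w x\<bar>)"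
      by (intro nn_integral_mono) (auto simp: ennreal_plus[symmetric] simp del: ennreal_plus intro!: ennreal_leI)
    also have "\<dots> = W + W" using nn_integral_shift[of "\<lambda>x. ennreal \<bar>w x\<bar>" h] by (simp add: nn_integral_add W_def)
    finally show ?thesis .
  qed
  note WW = this
  have L1: "(NBINT x. ennreal \<bar>conv (k n) w x - w x\<bar>) \<le> W + W" for n
    by (rule mollify_L1[OF mk(1-4) w WW])
  have int: "integrable lborel (\<lambda>x. conv (k n) w x - w x)" for n
  proof (rule integrableI_bounded)
    have "W + W < \<infinity>" using W by (simp add: less_top[symmetric])
    with L1[of n]
    show "(NBINT x. ennreal (norm (conv (k n) w x - w x))) < \<infinity>" by (simp add: order_le_less_trans)
  qed simp
  have "(\<lambda>n. LBINT x. norm (conv (k n) w x - w x)) \<longlonglongrightarrow> 0"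
  proof (rule LIMSEQ_I)
    fix e :: real assume e: "e > 0"
    then obtain d where d: "d > 0" "\<And>h. norm h < d \<Longrightarrow> (NBINT x. ennreal \<bar>w (x + h) - w x\<bar>) \<le> ennreal (e/2)"
      using L1cont_integrable[OF w] unfolding L1cont_def by (meson half_gt_zero)
    from LIMSEQ_D[OF mk(5) d(1)] obtain N where N: "\<And>n. n \<ge> N \<Longrightarrow> r n < d" by force
    have "norm ((LBINT x. norm (conv (k n) w x - w x)) - 0) < e" if "n \<ge> N" for n
    proof -
      have "ennreal (LBINT x. norm (conv (k n) w x - w x)) = (NBINT x. ennreal \<bar>conv (k n) w x - w x\<bar>)"
        using nn_integral_eq_integral[of lborel "\<lambda>x. norm (conv (k n) w x - w x)"] int[of n] by simp
      also have "\<dots> \<le> ennreal (e/2)"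
        by (rule mollify_L1[OF mk(1-4) w]) (use d(2) N[OF that] in auto)
      finally show ?thesis using e by (simp add: ennreal_le_iff)
    qed
    then show "\<exists>no. \<forall>n\<ge>no. norm ((LBINT x. norm (conv (k n) w x - w x)) - 0) < e" by blast
  qed
  from tendsto_L1_AE_subseq[OF int this] obtain s :: "nat \<Rightarrow> nat" where
    s: "strict_mono s" "AE x in lborel. (\<lambda>n. conv (k (s n)) w x - w x) \<longlonglongrightarrow> 0" by blast
  from s(2) have "AE x in lborel. (\<lambda>n. conv (k (s n)) w x) \<longlonglongrightarrow> w x"
    by eventually_elim (simp add: LIM_zero_iff)
  then show ?thesis using s(1) by blast
qed

text \<open>Fatou's lemma along the almost everywhere convergent subsequence: an integral bound
  common to all fine mollifications passes to the function. The integral estimates for the unknown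
  are obtained in this way.\<close>

lemma mollify_bound:
  fixes w :: "'a::euclidean_space \<Rightarrow> real"
  assumes m: "mollifier k r" and w: "integrable lborel w" and A [measurable]: "A \<in> sets borel"
    and bd: "\<And>n. n \<ge> n0 \<Longrightarrow> (NBINT x. indicator A x * ennreal (\<bar>conv (k n) w x\<bar> ^ p)) \<le> M"
  shows "(NBINT x. indicator A x * ennreal (\<bar>w x\<bar> ^ p)) \<le> M"
proof -
  obtain s where s: "strict_mono s" "AE x in lborel. (\<lambda>n. conv (k (s n)) w x) \<longlonglongrightarrow> w x"
    using mollify_AE[OF m w] by blast
  have mk: "bump (k n)" for n using m by (auto simp: mollifier_def)
  have [measurable]: "conv (k n) w \<in> borel_measurable borel" for n
    by (rule borel_measurable_continuous_onI[OF conv_continuous[OF mk w]])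
  have "(NBINT x. indicator A x * ennreal (\<bar>w x\<bar> ^ p)) = (NBINT x. liminf (\<lambda>n. indicator A x * ennreal (\<bar>conv (k (s n)) w x\<bar> ^ p)))"
  proof (rule nn_integral_cong_AE)
    from s(2) show "AE x in lborel. indicator A x * ennreal (\<bar>w x\<bar> ^ p) = liminf (\<lambda>n. indicator A x * ennreal (\<bar>conv (k (s n)) w x\<bar> ^ p))"
    proof eventually_elim
      case (elim x)
      have "(\<lambda>n. ennreal (indicator A x * \<bar>conv (k (s n)) w x\<bar> ^ p)) \<longlonglongrightarrow> ennreal (indicator A x * \<bar>w x\<bar> ^ p)"
        by (intro tendsto_intros elim tendsto_ennrealI)
      then have "liminf (\<lambda>n. ennreal (indicator A x * \<bar>conv (k (s n)) w x\<bar> ^ p)) = ennreal (indicator A x * \<bar>w x\<bar> ^ p)"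
        by (rule lim_imp_Liminf[OF sequentially_bot])
      then show ?case by (simp add: ennreal_mult' ennreal_indicator)
    qed
  qed
  also have "\<dots> \<le> liminf (\<lambda>n. NBINT x. indicator A x * ennreal (\<bar>conv (k (s n)) w x\<bar> ^ p))"
    by (rule nn_integral_liminf) auto
  also have "\<dots> \<le> liminf (\<lambda>n. M)"
  proof (rule Liminf_mono)
    show "\<forall>\<^sub>F n in sequentially. (NBINT x. indicator A x * ennreal (\<bar>conv (k (s n)) w x\<bar> ^ p)) \<le> M"
      using eventually_ge_at_top[of n0]
    proof eventually_elim
      case (elim n)
      then have "n0 \<le> s n" using seq_suble[OF s(1), of n] by simp
      then show ?case by (rule bd)
    qed
  qed
  also have "\<dots> = M" by (simp add: Liminf_const)
  finally show ?thesis .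
qed

text \<open>Cauchy-Schwarz for the probability density \<open>k (x - y)\<close>, split into two
  square roots. Applied twice it also yields the exponent four.\<close>

lemma young_square:
  fixes g :: "'a::euclidean_space \<Rightarrow> ennreal"
  assumes k: "bump k" "\<And>z. k z \<ge> 0" "(LBINT z. k z) = 1" and [measurable]: "g \<in> borel_measurable borel"
  shows "(NBINT y. ennreal (k (x - y)) * g y)^2 \<le> (NBINT y. ennreal (k (x - y)) * (g y)^2)"
proof -
  note [measurable] = bump_measurable[OF k(1)]
  define q where "q y = ennreal (sqrt (k (x - y)))" for y
  have [measurable]: "q \<in> borel_measurable borel" unfolding q_def by measurable
  have q2: "q y ^ 2 = ennreal (k (x - y))" for y using k(2) by (simp add: q_def ennreal_power)
  have "(NBINT y. ennreal (k (x - y)) * g y)^2 = (NBINT y. q y * (q y * g y))^2"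
    by (simp add: q2[symmetric] power2_eq_square mult.assoc)
  also have "\<dots> \<le> (NBINT y. q y ^ 2) * (NBINT y. (q y * g y)^2)"
    by (rule Cauchy_Schwarz_nn_integral) auto
  also have "(NBINT y. q y ^ 2) = 1" unfolding q2 by (rule mollifier_nn(1)[OF k])
  finally show ?thesis by (simp add: power_mult_distrib q2)
qed

lemma young_mass:
  fixes g :: "'a::euclidean_space \<Rightarrow> ennreal"
  assumes k: "bump k" "\<And>z. k z \<ge> 0" "(LBINT z. k z) = 1" and [measurable]: "g \<in> borel_measurable borel"
  shows "(NBINT x. NBINT y. ennreal (k (x - y)) * g y) = (NBINT y. g y)"
proof -
  note [measurable] = bump_measurable[OF k(1)]
  have "(NBINT x. NBINT y. ennreal (k (x - y)) * g y) = (NBINT y. NBINT x. ennreal (k (x - y)) * g y)"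
    by (rule lborel_pair.Fubini') simp
  also have "\<dots> = (NBINT y. g y)" by (simp add: nn_integral_multc mollifier_nn(2)[OF k])
  finally show ?thesis .
qed

lemma young_2:
  fixes g :: "'a::euclidean_space \<Rightarrow> ennreal"
  assumes k: "bump k" "\<And>z. k z \<ge> 0" "(LBINT z. k z) = 1" and [measurable]: "g \<in> borel_measurable borel"
  shows "(NBINT x. (NBINT y. ennreal (k (x - y)) * g y)^2) \<le> (NBINT y. (g y)^2)"
proof -
  have "(NBINT x. (NBINT y. ennreal (k (x - y)) * g y)^2) \<le> (NBINT x. NBINT y. ennreal (k (x - y)) * (g y)^2)"
    by (intro nn_integral_mono young_square k) simp
  also have "\<dots> = (NBINT y. (g y)^2)" by (intro young_mass k) simp
  finally show ?thesis .
qed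

lemma young_4:
  fixes g :: "'a::euclidean_space \<Rightarrow> ennreal"
  assumes k: "bump k" "\<And>z. k z \<ge> 0" "(LBINT z. k z) = 1" and [measurable]: "g \<in> borel_measurable borel"
  shows "(NBINT x. (NBINT y. ennreal (k (x - y)) * g y)^4) \<le> (NBINT y. (g y)^4)"
proof -
  have "(NBINT x. (NBINT y. ennreal (k (x - y)) * g y)^4) \<le> (NBINT x. (NBINT y. ennreal (k (x - y)) * (g y)^2)^2)"
  proof (intro nn_integral_mono)
    fix x
    have "((NBINT y. ennreal (k (x - y)) * g y)^2)^2 \<le> (NBINT y. ennreal (k (x - y)) * (g y)^2)^2"
      by (intro power_mono young_square k) simp_all
    then show "(NBINT y. ennreal (k (x - y)) * g y)^4 \<le> (NBINT y. ennreal (k (x - y)) * (g y)^2)^2" by simp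
  qed
  also have "\<dots> \<le> (NBINT y. ((g y)^2)^2)" by (intro young_2 k) simp
  finally show ?thesis by simp
qed

lemma conv_le_nn:
  assumes "bump k" "\<And>z. k z \<ge> 0" "integrable lborel w"
  shows "ennreal \<bar>conv k w x\<bar> \<le> (NBINT y. ennreal (k (x - y)) * ennreal \<bar>w y\<bar>)"
proof -
  have "ennreal \<bar>conv k w x\<bar> \<le> ennreal (LBINT y. \<bar>k (x - y) * w y\<bar>)"
    unfolding conv_def by (intro ennreal_leI) simp
  also have "\<dots> = (NBINT y. ennreal \<bar>k (x - y) * w y\<bar>)"
    by (rule nn_integral_eq_integral[symmetric]) (use conv_integrable[OF assms(1,3)] in auto)
  also have "\<dots> = (NBINT y. ennreal (k (x - y)) * ennreal \<bar>w y\<bar>)"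
    using assms(2) by (intro nn_integral_cong) (simp add: ennreal_mult[symmetric] abs_mult)
  finally show ?thesis .
qed

section \<open>A Sobolev inequality in dimension at most four\<close>

definition upd :: "'a::euclidean_space \<Rightarrow> 'a \<Rightarrow> real \<Rightarrow> 'a" where
  "upd b x t = x + (t - x \<bullet> b) *\<^sub>R b"

text \<open>The factor 1/2 makes this a mean value, so that functions independent of
  \<open>b\<close> are reproduced and box integrals are preserved.\<close>

definition avg :: "'a::euclidean_space \<Rightarrow> ('a \<Rightarrow> real) \<Rightarrow> 'a \<Rightarrow> real" where
  "avg b h x = (1/2) * integral {-1..1} (\<lambda>t. h (upd b x t))"

definition unitbox :: "'a::euclidean_space set" where
  "unitbox = {x. \<forall>b\<in>Basis. \<bar>x \<bullet> b\<bar> \<le> 1}"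

definition boxint :: "('a::euclidean_space \<Rightarrow> real) \<Rightarrow> real" where
  "boxint h = (LBINT x. indicator unitbox x * h x)"

definition indep_of :: "'a::euclidean_space \<Rightarrow> ('a \<Rightarrow> real) \<Rightarrow> bool" where
  "indep_of b h \<longleftrightarrow> (\<forall>x t. h (upd b x t) = h x)"

lemma unitbox_cbox: "unitbox = cbox (- One) (One::'a::euclidean_space)"
  unfolding unitbox_def cbox_def by (auto simp: abs_le_iff)

lemma unitbox_borel [measurable]: "unitbox \<in> sets borel" unfolding unitbox_cbox by simp

lemma boxint_integrable: "continuous_on UNIV h \<Longrightarrow> integrable lborel (\<lambda>x. indicator unitbox x * h x :: real)"
  using borel_integrable_compact[of unitbox h] by (simp add: unitbox_cbox continuous_on_subset)

lemma upd_inner: "b \<in> Basis \<Longrightarrow> c \<in> Basis \<Longrightarrow> upd b x t \<bullet> c = (if c = b then t else x \<bullet> c)"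
  by (auto simp: upd_def inner_add_left inner_Basis)

lemma upd_upd: "b \<in> Basis \<Longrightarrow> upd b (upd b x s) t = upd b x t"
  by (simp add: upd_def inner_add_left algebra_simps)

lemma upd_comm: "b \<in> Basis \<Longrightarrow> c \<in> Basis \<Longrightarrow> b \<noteq> c \<Longrightarrow> upd b (upd c x s) t = upd c (upd b x t) s"
  by (simp add: upd_def inner_add_left inner_Basis algebra_simps)

lemma upd_continuous: "continuous_on A (\<lambda>(x, t). upd b x t)"
  unfolding upd_def split_beta by (intro continuous_intros)

lemma upd_continuous_t: "continuous_on A (\<lambda>t. upd b x t)"
  unfolding upd_def by (intro continuous_intros)

lemma cont_upd: "continuous_on UNIV h \<Longrightarrow> continuous_on A (\<lambda>t. h (upd b x t))"
  by (rule continuous_on_compose2[OF _ upd_continuous_t]) auto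

lemma avg_continuous: assumes "continuous_on UNIV h" shows "continuous_on UNIV (avg b h)"
proof -
  have "continuous_on UNIV (\<lambda>x. integral (cbox (-1) 1) (\<lambda>t. h (upd b x t)))"
    by (rule integral_continuous_on_param, unfold split_beta)
      (rule continuous_on_compose2[OF assms upd_continuous[unfolded split_beta]], auto)
  then show ?thesis unfolding avg_def[abs_def] by (intro continuous_intros) simp
qed

lemma avg_nonneg: "continuous_on UNIV h \<Longrightarrow> (\<And>x. h x \<ge> 0) \<Longrightarrow> avg b h x \<ge> 0"
  unfolding avg_def by (auto intro!: mult_nonneg_nonneg Henstock_Kurzweil_Integration.integral_nonneg integrable_continuous_real cont_upd)

lemma avg_indep_same: "b \<in> Basis \<Longrightarrow> indep_of b (avg b h)"
  by (simp add: indep_of_def avg_def upd_upd)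

lemma avg_indep: assumes "b \<in> Basis" "c \<in> Basis" "indep_of c h" shows "indep_of c (avg b h)"
proof (cases "b = c")
  case False
  then show ?thesis using assms(3) unfolding indep_of_def avg_def
    by (simp add: upd_comm[OF assms(1,2)])
qed (use assms avg_indep_same in auto)

lemma avg_nn:
  assumes "continuous_on UNIV h" "\<And>x. h x \<ge> 0"
  shows "ennreal (avg b h x) = ennreal (1/2) * (NBINT t. indicator {-1..1} t * ennreal (h (upd b x t)))"
proof -
  have c: "continuous_on {-1..1} (\<lambda>t. h (upd b x t))" by (rule cont_upd[OF assms(1)])
  have "((\<lambda>t. h (upd b x t)) has_integral integral {-1..1} (\<lambda>t. h (upd b x t))) {-1..1}"
    by (rule integrable_integral[OF integrable_continuous_real[OF c]])
  then have "(NBINT t. ennreal (h (upd b x t)) * indicator {-1..1} t) = ennreal (integral {-1..1} (\<lambda>t. h (upd b x t)))"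
    by (intro nn_integral_has_integral_lebesgue') (use assms(2) in auto)
  then show ?thesis unfolding avg_def by (subst ennreal_mult') (auto simp: mult.commute)
qed

lemma boxint_nn: "continuous_on UNIV h \<Longrightarrow> (\<And>x. h x \<ge> 0) \<Longrightarrow>
  ennreal (boxint h) = (NBINT x. indicator unitbox x * ennreal (h x))"
  unfolding boxint_def using nn_integral_eq_integral[OF boxint_integrable, of h]
  by (simp add: ennreal_mult' ennreal_indicator)

lemma boxint_nonneg: "(\<And>x. h x \<ge> 0) \<Longrightarrow> boxint h \<ge> 0"
  unfolding boxint_def by (intro Bochner_Integration.integral_nonneg) auto

text \<open>The Euclidean space is not split as a product, so Fubini along \<open>b\<close> is
  replaced by a translation argument: the segment integral becomes an integral over shifts
  \<open>s\<close> of the argument \<open>x + s *\<^sub>R b\<close>, the order of integration is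
  exchanged, and after translating back in \<open>x\<close> the remaining integral of
  \<open>\<iota> (x \<bullet> b - s)\<close> over \<open>s\<close> equals 2.\<close>

lemma boxint_avg:
  fixes h :: "'a::euclidean_space \<Rightarrow> real"
  assumes b: "b \<in> Basis" and h: "continuous_on UNIV h" "\<And>x. h x \<ge> 0"
  shows "boxint (avg b h) = boxint h"
proof -
  have [measurable]: "h \<in> borel_measurable borel" using h(1) by (rule borel_measurable_continuous_onI)
  define \<iota> where "\<iota> = (indicator {-1..1::real} :: real \<Rightarrow> ennreal)"
  define q where "q = (indicator {x::'a. \<forall>c\<in>Basis - {b}. \<bar>x \<bullet> c\<bar> \<le> 1} :: 'a \<Rightarrow> ennreal)"
  have [measurable]: "\<iota> \<in> borel_measurable borel" "q \<in> borel_measurable borel" unfolding \<iota>_def q_def by measurable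
  define g where "g x = q x * ennreal (h x)" for x
  have [measurable]: "g \<in> borel_measurable borel" unfolding g_def by measurable
  have ub: "indicator unitbox x = \<iota> (x \<bullet> b) * q x" for x
    using b by (auto simp: unitbox_def \<iota>_def q_def indicator_def)
  have qu: "q (upd b x t) = q x" for x t
  proof -
    have "upd b x t \<bullet> c = x \<bullet> c" if "c \<in> Basis - {b}" for c using that b by (simp add: upd_inner)
    then show ?thesis by (simp add: q_def indicator_def)
  qed
  have [measurable]: "(\<lambda>p. upd b (fst p) (snd p)) \<in> borel_measurable (borel \<Otimes>\<^sub>M borel)"
    unfolding upd_def by measurable
  have "ennreal (boxint (avg b h)) = (NBINT x. indicator unitbox x * ennreal (avg b h x))"
    by (intro boxint_nn avg_continuous avg_nonneg h)
  also have "\<dots> = (NBINT x. ennreal (1/2) * (NBINT s. \<iota> (x \<bullet> b) * \<iota> (s + x \<bullet> b) * g (x + s *\<^sub>R b)))"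
  proof (rule nn_integral_cong)
    fix x :: 'a
    have "(NBINT t. \<iota> t * ennreal (h (upd b x t))) = (NBINT s. \<iota> (s + x \<bullet> b) * ennreal (h (upd b x (s + x \<bullet> b))))"
      by (rule nn_integral_shift[symmetric]) (simp add: upd_def)
    then have "indicator unitbox x * ennreal (avg b h x) = \<iota> (x \<bullet> b) * q x * (ennreal (1/2) * (NBINT s. \<iota> (s + x \<bullet> b) * ennreal (h (upd b x (s + x \<bullet> b)))))"
      unfolding ub avg_nn[OF h] \<iota>_def by simp
    also have "\<dots> = ennreal (1/2) * ((\<iota> (x \<bullet> b) * q x) * (NBINT s. \<iota> (s + x \<bullet> b) * ennreal (h (upd b x (s + x \<bullet> b)))))"
      by (simp add: mult_ac)
    also have "(\<iota> (x \<bullet> b) * q x) * (NBINT s. \<iota> (s + x \<bullet> b) * ennreal (h (upd b x (s + x \<bullet> b))))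
       = (NBINT s. (\<iota> (x \<bullet> b) * q x) * (\<iota> (s + x \<bullet> b) * ennreal (h (upd b x (s + x \<bullet> b)))))"
      by (rule nn_integral_cmult[symmetric]) (simp add: upd_def)
    also have "\<dots> = (NBINT s. \<iota> (x \<bullet> b) * \<iota> (s + x \<bullet> b) * g (x + s *\<^sub>R b))"
    proof (rule nn_integral_cong)
      fix s
      have u: "upd b x (s + x \<bullet> b) = x + s *\<^sub>R b" by (simp add: upd_def)
      show "(\<iota> (x \<bullet> b) * q x) * (\<iota> (s + x \<bullet> b) * ennreal (h (upd b x (s + x \<bullet> b)))) = \<iota> (x \<bullet> b) * \<iota> (s + x \<bullet> b) * g (x + s *\<^sub>R b)"
        unfolding g_def u[symmetric] qu by (simp add: mult_ac)
    qed
    finally show "indicator unitbox x * ennreal (avg b h x) = ennreal (1/2) * (NBINT s. \<iota> (x \<bullet> b) * \<iota> (s + x \<bullet> b) * g (x + s *\<^sub>R b))" .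
  qed
  also have "\<dots> = ennreal (1/2) * (NBINT x. (NBINT s. \<iota> (x \<bullet> b) * \<iota> (s + x \<bullet> b) * g (x + s *\<^sub>R b)))"
    by (rule nn_integral_cmult) measurable
  also have "(NBINT x. (NBINT s. \<iota> (x \<bullet> b) * \<iota> (s + x \<bullet> b) * g (x + s *\<^sub>R b)))
     = (NBINT s. (NBINT x. \<iota> (x \<bullet> b) * \<iota> (s + x \<bullet> b) * g (x + s *\<^sub>R b)))"
    by (rule lborel_pair.Fubini') measurable
  also have "\<dots> = (NBINT s. (NBINT x. \<iota> (x \<bullet> b - s) * \<iota> (x \<bullet> b) * g x))"
  proof (rule nn_integral_cong)
    fix s :: real
    have "(NBINT x. \<iota> (x \<bullet> b - s) * \<iota> (x \<bullet> b) * g x) = (NBINT x. \<iota> ((x + s *\<^sub>R b) \<bullet> b - s) * \<iota> ((x + s *\<^sub>R b) \<bullet> b) * g (x + s *\<^sub>R b))"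
      by (rule nn_integral_shift[symmetric]) measurable
    also have "\<dots> = (NBINT x. \<iota> (x \<bullet> b) * \<iota> (s + x \<bullet> b) * g (x + s *\<^sub>R b))"
      using b by (simp add: inner_add_left add.commute)
    finally show "(NBINT x. \<iota> (x \<bullet> b) * \<iota> (s + x \<bullet> b) * g (x + s *\<^sub>R b)) = (NBINT x. \<iota> (x \<bullet> b - s) * \<iota> (x \<bullet> b) * g x)" by simp
  qed
  also have "\<dots> = (NBINT x. (NBINT s. \<iota> (x \<bullet> b - s) * \<iota> (x \<bullet> b) * g x))"
    by (rule lborel_pair.Fubini') measurable
  also have "\<dots> = (NBINT x. ennreal 2 * (\<iota> (x \<bullet> b) * g x))"
  proof (rule nn_integral_cong)
    fix x :: 'a
    have "(NBINT s. \<iota> (x \<bullet> b - s)) = (NBINT s. indicator {x \<bullet> b - 1..x \<bullet> b + 1} s)"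
      by (rule nn_integral_cong) (auto simp: \<iota>_def indicator_def)
    also have "\<dots> = ennreal 2" by (subst nn_integral_indicator) auto
    finally show "(NBINT s. \<iota> (x \<bullet> b - s) * \<iota> (x \<bullet> b) * g x) = ennreal 2 * (\<iota> (x \<bullet> b) * g x)"
      by (simp add: nn_integral_multc mult.assoc)
  qed
  also have "\<dots> = ennreal 2 * (NBINT x. \<iota> (x \<bullet> b) * g x)" by (rule nn_integral_cmult) measurable
  also have "(NBINT x. \<iota> (x \<bullet> b) * g x) = ennreal (boxint h)"
    unfolding boxint_nn[OF h] by (rule nn_integral_cong) (simp add: ub g_def mult_ac)
  also have "ennreal (1/2) * (ennreal 2 * ennreal (boxint h)) = ennreal (boxint h)"
    by (subst ennreal_mult[symmetric], simp, rule boxint_nonneg[OF h(2)],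
        subst ennreal_mult[symmetric]) (auto intro!: boxint_nonneg h(2))
  finally show ?thesis
    using boxint_nonneg[of h] boxint_nonneg[of "avg b h"] h avg_nonneg[OF h] by simp
qed

section \<open>A product inequality of Gagliardo type\<close>

lemma amgm3: fixes a b c :: real assumes "a \<ge> 0" "b \<ge> 0" "c \<ge> 0" shows "a * b * c \<le> (a^3 + b^3 + c^3) / 3"
proof -
  have "0 \<le> (a + b + c) * ((a-b)^2 + (b-c)^2 + (c-a)^2)" using assms by (intro mult_nonneg_nonneg) auto
  also have "\<dots> = 2 * (a^3 + b^3 + c^3 - 3 * (a * b * c))" by (simp add: algebra_simps power2_eq_square power3_eq_cube)
  finally show ?thesis by simp
qed

text \<open>Normalise the three functions and integrate the inequality of arithmetic and geometric
  means. Adding \<open>e\<close> to the means avoids division by zero; it is removed in the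
  limit.\<close>

lemma hoelder3:
  fixes f g h :: "real \<Rightarrow> real"
  assumes c: "continuous_on {-1..1} f" "continuous_on {-1..1} g" "continuous_on {-1..1} h"
    and n: "\<And>t. f t \<ge> 0" "\<And>t. g t \<ge> 0" "\<And>t. h t \<ge> 0"
  shows "(1/2) * integral {-1..1} (\<lambda>t. root 3 (f t) * root 3 (g t) * root 3 (h t))
    \<le> root 3 ((1/2) * integral {-1..1} f) * root 3 ((1/2) * integral {-1..1} g) * root 3 ((1/2) * integral {-1..1} h)"
proof -
  define F where "F = (1/2) * integral {-1..1} f"
  define G where "G = (1/2) * integral {-1..1} g"
  define H where "H = (1/2) * integral {-1..1} h"
  have nn: "F \<ge> 0" "G \<ge> 0" "H \<ge> 0" unfolding F_def G_def H_def
    by (auto intro!: mult_nonneg_nonneg Henstock_Kurzweil_Integration.integral_nonneg integrable_continuous_real c n)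
  have ci: "f integrable_on {-1..1}" "g integrable_on {-1..1}" "h integrable_on {-1..1}" by (auto intro: integrable_continuous_real c)
  have main: "(1/2) * integral {-1..1} (\<lambda>t. root 3 (f t) * root 3 (g t) * root 3 (h t)) \<le> root 3 (F + e) * root 3 (G + e) * root 3 (H + e)" if e: "e > 0" for e
  proof -
    define A where "A = root 3 (F + e)"
    define B where "B = root 3 (G + e)"
    define C where "C = root 3 (H + e)"
    have pos: "A > 0" "B > 0" "C > 0" using nn e by (auto simp: A_def B_def C_def)
    have cube: "A^3 = F + e" "B^3 = G + e" "C^3 = H + e" using nn e by (auto simp: A_def B_def C_def)
    have pw: "root 3 (f t) * root 3 (g t) * root 3 (h t) \<le> (A * B * C / 3) * (f t / A^3 + g t / B^3 + h t / C^3)" for t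
    proof -
      have "(root 3 (f t) / A) * (root 3 (g t) / B) * (root 3 (h t) / C) \<le> ((root 3 (f t) / A)^3 + (root 3 (g t) / B)^3 + (root 3 (h t) / C)^3) / 3"
        using pos n by (intro amgm3) auto
      also have "\<dots> = (f t / A^3 + g t / B^3 + h t / C^3) / 3" using n by (simp add: power_divide)
      finally have "(A * B * C) * ((root 3 (f t) / A) * (root 3 (g t) / B) * (root 3 (h t) / C)) \<le> (A * B * C) * ((f t / A^3 + g t / B^3 + h t / C^3) / 3)"
        using pos by (intro mult_left_mono) auto
      then show ?thesis using pos by simp
    qed
    have "integral {-1..1} (\<lambda>t. root 3 (f t) * root 3 (g t) * root 3 (h t)) \<le> integral {-1..1} (\<lambda>t. (A * B * C / 3) * (f t / A^3 + g t / B^3 + h t / C^3))"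
      by (intro integral_le pw integrable_continuous_real continuous_intros c) (use pos in auto)
    also have "\<dots> = (A * B * C / 3) * (integral {-1..1} f / A^3 + integral {-1..1} g / B^3 + integral {-1..1} h / C^3)"
      using ci by (simp add: Henstock_Kurzweil_Integration.integral_add integrable_on_divide integrable_add)
    also have "\<dots> = 2 * ((A * B * C / 3) * (F / A^3 + G / B^3 + H / C^3))" by (simp add: F_def G_def H_def algebra_simps)
    also have "\<dots> \<le> 2 * ((A * B * C / 3) * (1 + 1 + 1))"
      using pos e nn unfolding cube by (intro mult_left_mono add_mono) auto
    finally show ?thesis by (simp add: A_def B_def C_def)
  qed
  have "((\<lambda>e. root 3 (F + e) * root 3 (G + e) * root 3 (H + e)) \<longlongrightarrow> root 3 (F + 0) * root 3 (G + 0) * root 3 (H + 0)) (at_right 0)"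
    by (intro tendsto_intros)
  then have "(1/2) * integral {-1..1} (\<lambda>t. root 3 (f t) * root 3 (g t) * root 3 (h t)) \<le> root 3 (F + 0) * root 3 (G + 0) * root 3 (H + 0)"
    by (rule tendsto_lowerbound) (use main in \<open>auto intro: eventually_at_rightI[of 0 1]\<close>)
  then show ?thesis by (simp add: F_def G_def H_def)
qed

lemma boxint_mono:
  assumes "continuous_on UNIV f" "continuous_on UNIV g" "\<And>x. x \<in> unitbox \<Longrightarrow> f x \<le> g x"
  shows "boxint f \<le> boxint g"
  unfolding boxint_def
  by (rule integral_mono) (use boxint_integrable assms in \<open>auto simp: indicator_def\<close>)

lemma avg_mult_indep: "indep_of b g \<Longrightarrow> avg b (\<lambda>x. g x * h x) x = g x * avg b h x"
  by (simp add: avg_def indep_of_def)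

text \<open>Averaging along \<open>b\<close> preserves the box integral. The factor
  \<open>j0\<close> does not depend on \<open>b\<close> and comes out; exactly three factors remain,
  which matches Hoelder's inequality with three exponents equal to 3.\<close>

lemma finner_step:
  fixes H :: "nat \<Rightarrow> 'a::euclidean_space \<Rightarrow> real"
  assumes b: "b \<in> Basis" and j0: "j0 < 4" and H: "\<And>j. continuous_on UNIV (H j)" "\<And>j x. H j x \<ge> 0"
    and ind: "indep_of b (H j0)"
  shows "boxint (\<lambda>x. \<Prod>j<4. root 3 (H j x)) \<le> boxint (\<lambda>x. \<Prod>j<4. root 3 ((if j = j0 then H j else avg b (H j)) x))"
proof -
  have "card ({..<4::nat} - {j0}) = 3" using j0 by simp
  then obtain j1 j2 j3 where J: "{..<4} - {j0} = {j1, j2, j3}" "j1 \<noteq> j2" "j2 \<noteq> j3" "j1 \<noteq> j3" unfolding card_3_iff by blast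
  then have J': "{..<4} = {j0, j1, j2, j3}" "j0 \<noteq> j1" "j0 \<noteq> j2" "j0 \<noteq> j3" using j0 by blast+
  have pr: "(\<Prod>j<4. K j) = K j0 * (K j1 * K j2 * K j3)" for K :: "nat \<Rightarrow> real" unfolding J'(1) using J J' by (simp add: mult.assoc)
  have cH: "continuous_on UNIV (\<lambda>x. root 3 (H j x))" for j by (intro continuous_intros H)
  have cP: "continuous_on UNIV (\<lambda>x. root 3 (H j0 x) * (root 3 (H j1 x) * root 3 (H j2 x) * root 3 (H j3 x)))" by (intro continuous_intros cH)
  have "boxint (\<lambda>x. \<Prod>j<4. root 3 (H j x)) = boxint (avg b (\<lambda>x. root 3 (H j0 x) * (root 3 (H j1 x) * root 3 (H j2 x) * root 3 (H j3 x))))"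
    unfolding pr by (rule boxint_avg[symmetric, OF b cP]) (auto intro!: mult_nonneg_nonneg H)
  also have "\<dots> \<le> boxint (\<lambda>x. \<Prod>j<4. root 3 ((if j = j0 then H j else avg b (H j)) x))"
  proof (rule boxint_mono)
    show "continuous_on UNIV (avg b (\<lambda>x. root 3 (H j0 x) * (root 3 (H j1 x) * root 3 (H j2 x) * root 3 (H j3 x))))" by (rule avg_continuous[OF cP])
    have "continuous_on UNIV (if j = j0 then H j else avg b (H j))" for j using H avg_continuous[OF H(1)] by simp
    then show "continuous_on UNIV (\<lambda>x. \<Prod>j<4. root 3 ((if j = j0 then H j else avg b (H j)) x))"
      by (intro continuous_intros)
    fix x
    have "avg b (\<lambda>x. root 3 (H j0 x) * (root 3 (H j1 x) * root 3 (H j2 x) * root 3 (H j3 x))) x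
       = root 3 (H j0 x) * avg b (\<lambda>x. root 3 (H j1 x) * root 3 (H j2 x) * root 3 (H j3 x)) x"
      by (rule avg_mult_indep) (use ind in \<open>simp add: indep_of_def\<close>)
    also have "\<dots> \<le> root 3 (H j0 x) * (root 3 (avg b (H j1) x) * root 3 (avg b (H j2) x) * root 3 (avg b (H j3) x))"
      unfolding avg_def by (intro mult_left_mono hoelder3 cont_upd H) (auto intro: H)
    finally show "avg b (\<lambda>x. root 3 (H j0 x) * (root 3 (H j1 x) * root 3 (H j2 x) * root 3 (H j3 x))) x
      \<le> (\<Prod>j<4. root 3 ((if j = j0 then H j else avg b (H j)) x))"
      unfolding pr using J' by auto
  qed
  finally show ?thesis .
qed

text \<open>One application of \<open>finner_step\<close> per basis vector. Averages keep every box
  integral and every independence gained before, so with \<open>B = Basis\<close> all functions end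
  up independent of all directions.\<close>

lemma finner_iterate:
  fixes H :: "nat \<Rightarrow> 'a::euclidean_space \<Rightarrow> real" and \<iota> :: "'a \<Rightarrow> nat"
  assumes B: "B \<subseteq> Basis" and \<iota>: "\<And>b. b \<in> Basis \<Longrightarrow> \<iota> b < 4"
    and H: "\<And>j. continuous_on UNIV (H j)" "\<And>j x. H j x \<ge> 0" "\<And>b. b \<in> Basis \<Longrightarrow> indep_of b (H (\<iota> b))"
  shows "\<exists>G. (\<forall>j. continuous_on UNIV (G j)) \<and> (\<forall>j x. G j x \<ge> 0) \<and> (\<forall>b\<in>Basis. indep_of b (G (\<iota> b))) \<and>
     (\<forall>j. boxint (G j) = boxint (H j)) \<and> (\<forall>b\<in>B. \<forall>j. indep_of b (G j)) \<and>
     boxint (\<lambda>x. \<Prod>j<4. root 3 (H j x)) \<le> boxint (\<lambda>x. \<Prod>j<4. root 3 (G j x))"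
  using finite_subset[OF B finite_Basis] B
proof (induction B)
  case empty show ?case by (intro exI[of _ H]) (use H in auto)
next
  case (insert b B)
  then have b: "b \<in> Basis" by auto
  obtain G where G: "\<And>j. continuous_on UNIV (G j)" "\<And>j x. G j x \<ge> 0" "\<And>b. b \<in> Basis \<Longrightarrow> indep_of b (G (\<iota> b))"
     "\<And>j. boxint (G j) = boxint (H j)" "\<And>b j. b \<in> B \<Longrightarrow> indep_of b (G j)"
     "boxint (\<lambda>x. \<Prod>j<4. root 3 (H j x)) \<le> boxint (\<lambda>x. \<Prod>j<4. root 3 (G j x))"
  proof -
    assume *: "\<And>G. \<lbrakk>\<And>j. continuous_on UNIV (G j); \<And>j x. G j x \<ge> 0; \<And>b. b \<in> Basis \<Longrightarrow> indep_of b (G (\<iota> b));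
       \<And>j. boxint (G j) = boxint (H j); \<And>b j. b \<in> B \<Longrightarrow> indep_of b (G j);
       boxint (\<lambda>x. \<Prod>j<4. root 3 (H j x)) \<le> boxint (\<lambda>x. \<Prod>j<4. root 3 (G j x))\<rbrakk> \<Longrightarrow> thesis"
    have "B \<subseteq> Basis" using insert by auto
    from insert.IH[OF this] obtain G where
      G0: "(\<forall>j. continuous_on UNIV (G j)) \<and> (\<forall>j x. G j x \<ge> 0) \<and> (\<forall>b\<in>Basis. indep_of b (G (\<iota> b))) \<and>
       (\<forall>j. boxint (G j) = boxint (H j)) \<and> (\<forall>b\<in>B. \<forall>j. indep_of b (G j)) \<and>
       boxint (\<lambda>x. \<Prod>j<4. root 3 (H j x)) \<le> boxint (\<lambda>x. \<Prod>j<4. root 3 (G j x))" ..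
    show thesis by (rule *[of G]) (use G0 in \<open>simp_all only: simp_thms\<close>)
  qed
  define G' where "G' j = (if j = \<iota> b then G j else avg b (G j))" for j
  have "boxint (\<lambda>x. \<Prod>j<4. root 3 (G j x)) \<le> boxint (\<lambda>x. \<Prod>j<4. root 3 (G' j x))"
    unfolding G'_def by (rule finner_step[where H=G, OF b \<iota>[OF b] _ _ G(3)[OF b]]) (rule G)+
  moreover have "continuous_on UNIV (G' j)" for j using G(1) avg_continuous[OF G(1)] by (simp add: G'_def)
  moreover have "G' j x \<ge> 0" for j x using G(2) avg_nonneg[OF G(1,2)] by (simp add: G'_def)
  moreover have "indep_of c (G' (\<iota> c))" if "c \<in> Basis" for c
  proof (cases "\<iota> c = \<iota> b")
    case True
    then have "G' (\<iota> c) = G (\<iota> c)" by (simp add: G'_def)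
    then show ?thesis using G(3)[OF that] by simp
  next
    case False
    then show ?thesis using G(3)[OF that] avg_indep[OF b that] by (simp add: G'_def)
  qed
  moreover have "boxint (G' j) = boxint (H j)" for j using G(4) boxint_avg[OF b G(1,2)] by (simp add: G'_def)
  moreover have "indep_of c (G' j)" if "c \<in> insert b B" for c j
  proof -
    have c: "c \<in> Basis" using that insert by auto
    show ?thesis
    proof (cases "c = b")
      case True then show ?thesis using G(3)[OF b] avg_indep_same[OF b] by (simp add: G'_def)
    next
      case False then show ?thesis using that G(5) avg_indep[OF b c] by (simp add: G'_def)
    qed
  qed
  ultimately show ?case using order_trans[OF G(6)] by (intro exI[of _ G']) blast
qed

lemma indep_const:
  fixes h :: "'a::euclidean_space \<Rightarrow> real"
  assumes "\<And>b. b \<in> Basis \<Longrightarrow> indep_of b h" shows "h x = h 0"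
proof -
  have "h (\<Sum>b\<in>B. (x \<bullet> b) *\<^sub>R b) = h 0" if "B \<subseteq> Basis" for B
    using finite_subset[OF that finite_Basis] that
  proof (induction B)
    case (insert b B)
    have 0: "(\<Sum>b\<in>B. (x \<bullet> b) *\<^sub>R b) \<bullet> b = 0"
    proof (unfold inner_sum_left, intro sum.neutral ballI)
      fix c assume "c \<in> B"
      then have "c \<in> Basis" "c \<noteq> b" "b \<in> Basis" using insert by auto
      then show "(x \<bullet> c) *\<^sub>R c \<bullet> b = 0" by (simp add: inner_not_same_Basis)
    qed
    have "(\<Sum>b\<in>insert b B. (x \<bullet> b) *\<^sub>R b) = upd b (\<Sum>b\<in>B. (x \<bullet> b) *\<^sub>R b) (x \<bullet> b)"
      unfolding upd_def 0 using insert by (simp add: add.commute)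
    then show ?case using insert assms[of b] by (simp add: indep_of_def)
  qed simp
  from this[of Basis] show ?thesis by (simp add: euclidean_representation)
qed

lemma boxint_const: "boxint (\<lambda>x::'a::euclidean_space. c) = c * 2 ^ DIM('a)"
proof -
  have "measure lborel (unitbox :: 'a set) = 2 ^ DIM('a)"
    unfolding unitbox_cbox by (subst content_cbox) (auto simp: inner_diff_left)
  then show ?thesis unfolding boxint_def
    by (subst Bochner_Integration.integral_mult_left) (auto simp: unitbox_cbox emeasure_compact_finite)
qed

text \<open>After averaging along all directions every function is a constant, namely its mean over
  the box, which is at most \<open>Y / 2 ^ DIM('a)\<close>. Below dimension four some indices are
  outside the range of \<open>\<iota>\<close>; their functions are averaged along every
  direction.\<close>

lemma finner:
  fixes H :: "nat \<Rightarrow> 'a::euclidean_space \<Rightarrow> real" and \<iota> :: "'a \<Rightarrow> nat"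
  assumes \<iota>: "\<And>b. b \<in> Basis \<Longrightarrow> \<iota> b < 4"
    and H: "\<And>j. continuous_on UNIV (H j)" "\<And>j x. H j x \<ge> 0" "\<And>b. b \<in> Basis \<Longrightarrow> indep_of b (H (\<iota> b))"
    and Y: "\<And>j. boxint (H j) \<le> Y"
  shows "boxint (\<lambda>x. \<Prod>j<4. root 3 (H j x)) \<le> 2 ^ DIM('a) * (root 3 (Y / 2 ^ DIM('a)))^4"
proof -
  obtain G :: "nat \<Rightarrow> 'a \<Rightarrow> real" where G: "\<And>j. continuous_on UNIV (G j)" "\<And>j x. G j x \<ge> 0"
     "\<And>j. boxint (G j) = boxint (H j)" "\<And>b j. b \<in> Basis \<Longrightarrow> indep_of b (G j)"
     "boxint (\<lambda>x. \<Prod>j<4. root 3 (H j x)) \<le> boxint (\<lambda>x. \<Prod>j<4. root 3 (G j x))"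
  proof -
    assume *: "\<And>G :: nat \<Rightarrow> 'a \<Rightarrow> real. \<lbrakk>\<And>j. continuous_on UNIV (G j); \<And>j x. G j x \<ge> 0; \<And>j. boxint (G j) = boxint (H j);
       \<And>b j. b \<in> Basis \<Longrightarrow> indep_of b (G j); boxint (\<lambda>x. \<Prod>j<4. root 3 (H j x)) \<le> boxint (\<lambda>x. \<Prod>j<4. root 3 (G j x))\<rbrakk> \<Longrightarrow> thesis"
    from finner_iterate[OF order_refl \<iota> H] obtain G :: "nat \<Rightarrow> 'a \<Rightarrow> real" where
      "(\<forall>j. continuous_on UNIV (G j)) \<and> (\<forall>j x. G j x \<ge> 0) \<and> (\<forall>b\<in>Basis. indep_of b (G (\<iota> b))) \<and>
       (\<forall>j. boxint (G j) = boxint (H j)) \<and> (\<forall>b\<in>Basis. \<forall>j. indep_of b (G j)) \<and>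
       boxint (\<lambda>x. \<Prod>j<4. root 3 (H j x)) \<le> boxint (\<lambda>x. \<Prod>j<4. root 3 (G j x))" ..
    then show thesis by (intro *[of G]) auto
  qed
  have c: "G j x = G j 0" for j x by (rule indep_const[OF G(4)])
  have "G j 0 * 2 ^ DIM('a) = boxint (G j)" for j
    using boxint_const[of "G j 0", where 'a='a] c[of j] by (metis (no_types, lifting) ext)
  then have le: "G j 0 \<le> Y / 2 ^ DIM('a)" for j using Y[of j] G(3)[of j] by (simp add: field_simps)
  have "boxint (\<lambda>x. \<Prod>j<4. root 3 (G j x)) = (\<Prod>j<4. root 3 (G j 0)) * 2 ^ DIM('a)"
  proof -
    have "(\<lambda>x. \<Prod>j<4. root 3 (G j x)) = (\<lambda>x. \<Prod>j<4. root 3 (G j 0))"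
      by (intro ext prod.cong refl arg_cong[where f="root 3"] c)
    then show ?thesis using boxint_const[of "\<Prod>j<4. root 3 (G j 0)", where 'a='a] by simp
  qed
  also have "\<dots> \<le> (\<Prod>j<(4::nat). root 3 (Y / 2 ^ DIM('a))) * 2 ^ DIM('a)"
    using le G(2) by (intro mult_right_mono prod_mono) auto
  finally show ?thesis using G(5) by (simp add: mult.commute)
qed

text \<open>Integrate the derivative of v^3 along the line that starts at the face where
  \<open>v\<close> vanishes. The constant is 3 from the power times 2 from the mean value in
  \<open>avg\<close>.\<close>

lemma sobolev_pointwise:
  fixes v :: "'a::euclidean_space \<Rightarrow> real"
  assumes b: "b \<in> Basis" and d: "\<And>x. (\<lambda>t. v (x + t *\<^sub>R b)) differentiable (at 0)"
    and c: "continuous_on UNIV v" "continuous_on UNIV (partial_dir b v)"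
    and s: "\<And>x. \<bar>x \<bullet> b\<bar> \<ge> 1 \<Longrightarrow> v x = 0"
  shows "\<bar>v x\<bar>^3 \<le> 6 * avg b (\<lambda>x. (v x)^2 * \<bar>partial_dir b v x\<bar>) x"
proof (cases "\<bar>x \<bullet> b\<bar> \<ge> 1")
  case True
  then have "v x = 0" by (rule s)
  moreover have "avg b (\<lambda>x. (v x)^2 * \<bar>partial_dir b v x\<bar>) x \<ge> 0"
    by (intro avg_nonneg continuous_intros c) auto
  ultimately show ?thesis by simp
next
  case False
  define F where "F t = v (upd b x t)" for t
  define F' where "F' t = partial_dir b v (upd b x t)" for t
  have dF: "(F has_real_derivative F' t) (at t)" for t
  proof -
    have "((\<lambda>s. v ((x - (x \<bullet> b) *\<^sub>R b) + s *\<^sub>R b)) has_real_derivative partial_dir b v ((x - (x \<bullet> b) *\<^sub>R b) + t *\<^sub>R b)) (at t)"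
      by (rule DERIV_partial_at[OF d])
    then show ?thesis unfolding F_def[abs_def] F'_def upd_def by (simp add: algebra_simps)
  qed
  have cF: "continuous_on A F" "continuous_on A F'" for A
    unfolding F_def F'_def using c by (auto intro: cont_upd)
  have F3: "((\<lambda>t. F t ^ 3) has_real_derivative 3 * (F t)^2 * F' t) (at t)" for t
    by (rule derivative_eq_intros dF refl)+ simp
  have "((\<lambda>t. 3 * (F t)^2 * F' t) has_integral (F (x \<bullet> b) ^ 3 - F (-1) ^ 3)) {-1..x \<bullet> b}"
    by (rule fundamental_theorem_of_calculus)
      (use False F3 in \<open>auto simp: has_real_derivative_iff_has_vector_derivative[symmetric] intro: has_field_derivative_at_within\<close>)
  moreover have "F (-1) = 0" unfolding F_def by (rule s) (use b in \<open>simp add: upd_inner\<close>)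
  ultimately have hi: "((\<lambda>t. 3 * (F t)^2 * F' t) has_integral (F (x \<bullet> b) ^ 3)) {-1..x \<bullet> b}" by simp
  have "F (x \<bullet> b) = v x" by (simp add: F_def upd_def)
  then have "\<bar>v x\<bar>^3 = norm (integral {-1..x \<bullet> b} (\<lambda>t. 3 * (F t)^2 * F' t))" using integral_unique[OF hi] by (simp add: power_abs)
  also have "\<dots> \<le> integral {-1..x \<bullet> b} (\<lambda>t. 3 * (F t)^2 * \<bar>F' t\<bar>)"
    by (rule integral_norm_bound_integral) (auto intro!: integrable_continuous_real continuous_intros cF simp: abs_mult)
  also have "\<dots> \<le> integral {-1..1} (\<lambda>t. 3 * (F t)^2 * \<bar>F' t\<bar>)"
    by (rule integral_subset_le) (use False in \<open>auto intro!: integrable_continuous_real continuous_intros cF\<close>)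
  also have "\<dots> = 3 * integral {-1..1} (\<lambda>t. (F t)^2 * \<bar>F' t\<bar>)" by (simp add: mult.assoc)
  finally show ?thesis by (simp add: avg_def F_def F'_def)
qed

lemma CS_real:
  fixes f g :: "'a \<Rightarrow> real"
  assumes [measurable]: "f \<in> borel_measurable M" "g \<in> borel_measurable M"
    and i: "integrable M (\<lambda>x. (f x)^2)" "integrable M (\<lambda>x. (g x)^2)"
  shows "integrable M (\<lambda>x. f x * g x)" "(\<integral>x. \<bar>f x * g x\<bar> \<partial>M)^2 \<le> (\<integral>x. (f x)^2 \<partial>M) * (\<integral>x. (g x)^2 \<partial>M)"
proof -
  have ab: "\<bar>a * b\<bar> \<le> a^2 + b^2" for a b :: real
  proof -
    have "0 \<le> (\<bar>a\<bar> - \<bar>b\<bar>)^2" by simp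
    then have "2 * (\<bar>a\<bar> * \<bar>b\<bar>) \<le> \<bar>a\<bar>^2 + \<bar>b\<bar>^2" unfolding power2_diff by linarith
    moreover have "0 \<le> \<bar>a\<bar> * \<bar>b\<bar>" by simp
    ultimately have "\<bar>a\<bar> * \<bar>b\<bar> \<le> \<bar>a\<bar>^2 + \<bar>b\<bar>^2" by linarith
    then show ?thesis by (simp add: abs_mult)
  qed
  show fg: "integrable M (\<lambda>x. f x * g x)"
    by (rule Bochner_Integration.integrable_bound[OF Bochner_Integration.integrable_add[OF i]]) (use ab in auto)
  have "(\<integral>\<^sup>+x. ennreal \<bar>f x\<bar> * ennreal \<bar>g x\<bar> \<partial>M)^2 \<le> (\<integral>\<^sup>+x. ennreal \<bar>f x\<bar> ^ 2 \<partial>M) * (\<integral>\<^sup>+x. ennreal \<bar>g x\<bar> ^ 2 \<partial>M)"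
    by (rule Cauchy_Schwarz_nn_integral) auto
  moreover have "(\<integral>\<^sup>+x. ennreal \<bar>f x\<bar> * ennreal \<bar>g x\<bar> \<partial>M) = ennreal (\<integral>x. \<bar>f x * g x\<bar> \<partial>M)"
    using nn_integral_eq_integral[OF integrable_abs[OF fg]] by (simp add: abs_mult ennreal_mult')
  moreover have "(\<integral>\<^sup>+x. ennreal \<bar>f x\<bar> ^ 2 \<partial>M) = ennreal (\<integral>x. (f x)^2 \<partial>M)"
    using nn_integral_eq_integral[OF i(1)] by (simp add: ennreal_power)
  moreover have "(\<integral>\<^sup>+x. ennreal \<bar>g x\<bar> ^ 2 \<partial>M) = ennreal (\<integral>x. (g x)^2 \<partial>M)"
    using nn_integral_eq_integral[OF i(2)] by (simp add: ennreal_power)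
  ultimately show "(\<integral>x. \<bar>f x * g x\<bar> \<partial>M)^2 \<le> (\<integral>x. (f x)^2 \<partial>M) * (\<integral>x. (g x)^2 \<partial>M)"
    by (simp add: ennreal_power ennreal_mult'[symmetric])
qed

text \<open>\<open>sobolev_pointwise\<close> along four directions, multiplied after taking cube
  roots, bounds v^4 by a product that \<open>finner\<close> integrates. Cauchy-Schwarz then bounds
  the integral \<open>P\<close> of v^2 times the gradient by \<open>P^2 \<le> X * Z\<close>. The
  constant 1296 is 6^4.\<close>

theorem sobolev4:
  fixes v :: "'a::euclidean_space \<Rightarrow> real"
  assumes dim: "DIM('a) \<le> 4" and d: "\<And>b x. b \<in> Basis \<Longrightarrow> (\<lambda>t. v (x + t *\<^sub>R b)) differentiable (at 0)"
    and c: "continuous_on UNIV v" "\<And>b. b \<in> Basis \<Longrightarrow> continuous_on UNIV (partial_dir b v)"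
    and s: "\<And>x. norm x \<ge> 1 \<Longrightarrow> v x = 0"
  shows "boxint (\<lambda>x. (v x)^4) \<le> 1296 * (boxint (\<lambda>x. (\<Sum>b\<in>Basis. \<bar>partial_dir b v x\<bar>)^2))^2"
proof -
  obtain \<iota> :: "'a \<Rightarrow> nat" where \<iota>: "inj_on \<iota> Basis" "\<iota> ` Basis \<subseteq> {..<4}"
    using inj_on_iff_card_le[of "Basis::'a set" "{..<4::nat}"] dim by auto
  define g where "g x = (\<Sum>b\<in>Basis. \<bar>partial_dir b v x\<bar>)" for x
  define b0 where "b0 = (SOME b. b \<in> (Basis::'a set))"
  have b0: "b0 \<in> Basis" unfolding b0_def by (rule SOME_Basis)
  \<comment> \<open>An index that \<open>\<iota>\<close> does not hit gets the arbitrary direction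
    \<open>b0\<close>: the pointwise bound holds along every direction, so any choice supplies the
    missing factor.\<close>
  define \<beta> where "\<beta> j = (if j \<in> \<iota> ` Basis then inv_into Basis \<iota> j else b0)" for j
  have \<beta>: "\<beta> j \<in> Basis" for j using b0 by (auto simp: \<beta>_def inv_into_into)
  have \<beta>\<iota>: "\<beta> (\<iota> b) = b" if "b \<in> Basis" for b using \<iota>(1) that by (simp add: \<beta>_def)
  define h where "h b x = (v x)^2 * \<bar>partial_dir b v x\<bar>" for b x
  define H where "H j x = 6 * avg (\<beta> j) (h (\<beta> j)) x" for j x
  have ch: "continuous_on UNIV (h b)" if "b \<in> Basis" for b unfolding h_def by (intro continuous_intros c that)
  have h0: "h b x \<ge> 0" for b x by (simp add: h_def)
  have cg: "continuous_on UNIV g" unfolding g_def by (intro continuous_intros c)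
  have Hc: "continuous_on UNIV (H j)" for j unfolding H_def[abs_def] by (intro continuous_intros avg_continuous ch \<beta>)
  have H0: "H j x \<ge> 0" for j x unfolding H_def using avg_nonneg[OF ch[OF \<beta>] h0] by simp
  have Hi: "indep_of b (H (\<iota> b))" if "b \<in> Basis" for b
    using avg_indep_same[OF that, of "h b"] unfolding H_def[abs_def] \<beta>\<iota>[OF that] by (simp add: indep_of_def)
  define P where "P = boxint (\<lambda>x. (v x)^2 * g x)"
  have HY: "boxint (H j) \<le> 6 * P" for j
  proof -
    have "boxint (H j) = 6 * boxint (avg (\<beta> j) (h (\<beta> j)))" unfolding boxint_def H_def
      by (subst integral_mult_right_zero[symmetric]) (simp only: mult.left_commute)
    also have "boxint (avg (\<beta> j) (h (\<beta> j))) = boxint (h (\<beta> j))" by (rule boxint_avg[OF \<beta> ch[OF \<beta>] h0])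
    also have "\<dots> \<le> P" unfolding P_def
      by (rule boxint_mono[OF ch[OF \<beta>]])
        (auto intro!: continuous_intros c cg mult_left_mono member_le_sum \<beta> simp: h_def g_def)
    finally show ?thesis by simp
  qed
  define X where "X = boxint (\<lambda>x. (v x)^4)"
  define Z where "Z = boxint (\<lambda>x. (g x)^2)"
  have X0: "X \<ge> 0" "Z \<ge> 0" "P \<ge> 0" unfolding X_def Z_def P_def by (auto intro!: boxint_nonneg mult_nonneg_nonneg sum_nonneg simp: g_def)
  have sb: "v x = 0" if "\<bar>x \<bullet> b\<bar> \<ge> 1" "b \<in> Basis" for x b
    by (rule s) (use that Basis_le_norm[of b x] in linarith)
  have v4: "(v x)^4 \<le> (\<Prod>j<4. root 3 (H j x))" for x
  proof -
    have "\<bar>v x\<bar> \<le> root 3 (H j x)" for j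
    proof -
      have "\<bar>v x\<bar>^3 \<le> H j x" unfolding H_def h_def
        by (rule sobolev_pointwise[OF \<beta> d[OF \<beta>] c(1) c(2)[OF \<beta>] sb[OF _ \<beta>]])
      then have "root 3 (\<bar>v x\<bar>^3) \<le> root 3 (H j x)" by simp
      then show ?thesis by (simp add: real_root_power_cancel)
    qed
    then have "(\<Prod>j<(4::nat). \<bar>v x\<bar>) \<le> (\<Prod>j<4. root 3 (H j x))" by (intro prod_mono) auto
    then show ?thesis by simp
  qed
  have "X \<le> boxint (\<lambda>x. \<Prod>j<4. root 3 (H j x))" unfolding X_def
    by (rule boxint_mono) (auto intro!: continuous_intros c Hc v4)
  also have "\<dots> \<le> 2 ^ DIM('a) * (root 3 (6 * P / 2 ^ DIM('a)))^4"
    by (rule finner[where \<iota>=\<iota>]) (use \<iota> Hc H0 Hi HY in auto)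
  finally have X1: "X \<le> 2 ^ DIM('a) * (root 3 (6 * P / 2 ^ DIM('a)))^4" .
  define D where "D = (2::real) ^ DIM('a)"
  have D: "D \<ge> 1" by (simp add: D_def)
  have "X^3 \<le> (D * (root 3 (6 * P / D))^4)^3" using X1 X0 unfolding D_def by (intro power_mono) auto
  also have "\<dots> = D^3 * ((root 3 (6 * P / D))^3)^4" by (simp add: power_mult_distrib power_mult[symmetric])
  also have "(root 3 (6 * P / D))^3 = 6 * P / D" using X0 D by simp
  also have "D^3 * (6 * P / D)^4 = 1296 * P^4 / D" using D by (simp add: power_divide power_mult_distrib field_simps power3_eq_cube power4_eq_xxxx)
  \<comment> \<open>Dropping \<open>D \<ge> 1\<close> makes the constant the same in all dimensions
    up to four.\<close>
  also have "\<dots> \<le> 1296 * P^4 / 1" using D X0 by (intro divide_left_mono) auto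
  finally have X3: "X^3 \<le> 1296 * (P^2)^2" by simp
  have "P^2 \<le> X * Z"
  proof -
    have iq: "indicator unitbox x * (v x)^4 = (indicator unitbox x * (v x)^2)^2" "indicator unitbox x * (g x)^2 = (indicator unitbox x * g x)^2"
      "indicator unitbox x * ((v x)^2 * g x) = (indicator unitbox x * (v x)^2) * (indicator unitbox x * g x)" for x
      by (auto simp: indicator_def)
    have "continuous_on UNIV (\<lambda>x. (v x)^4)" "continuous_on UNIV (\<lambda>x. (g x)^2)" by (intro continuous_intros c cg)+
    from boxint_integrable[OF this(1)] boxint_integrable[OF this(2)]
    have I: "integrable lborel (\<lambda>x. (indicator unitbox x * (v x)^2)^2)" "integrable lborel (\<lambda>x. (indicator unitbox x * g x)^2)" unfolding iq .
    have [measurable]: "v \<in> borel_measurable borel" "g \<in> borel_measurable borel" using c(1) cg by (auto intro: borel_measurable_continuous_onI)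
    have "(LBINT x. \<bar>(indicator unitbox x * (v x)^2) * (indicator unitbox x * g x)\<bar>)^2 \<le> X * Z"
      unfolding X_def Z_def boxint_def iq by (rule CS_real(2)[OF _ _ I]) auto
    moreover have "P = (LBINT x. \<bar>(indicator unitbox x * (v x)^2) * (indicator unitbox x * g x)\<bar>)"
      unfolding P_def boxint_def iq by (rule Bochner_Integration.integral_cong) (auto simp: abs_mult indicator_def g_def intro!: sum_nonneg)
    ultimately show ?thesis by simp
  qed
  then have "(P^2)^2 \<le> (X * Z)^2" using X0 by (intro power_mono) auto
  with X3 have "X^3 \<le> 1296 * (X * Z)^2" by linarith
  then have "X * X^2 \<le> (1296 * Z^2) * X^2" by (simp add: power_mult_distrib power3_eq_cube power2_eq_square mult_ac)
  \<comment> \<open>Absorption: \<open>X\<close> is a finite real number, so its square cancels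
    unless it vanishes.\<close>
  then have "X \<le> 1296 * Z^2" using X0 by (cases "X = 0") auto
  then show ?thesis unfolding X_def Z_def g_def .
qed

section \<open>Dyadic scaling of the kernels\<close>

definition scal :: "real \<Rightarrow> nat \<Rightarrow> ('a::euclidean_space \<Rightarrow> real) \<Rightarrow> 'a \<Rightarrow> real" where
  "scal c j k = (\<lambda>x. c * k (2^j *\<^sub>R x))"

lemma bump_scal: "bump k \<Longrightarrow> bump (scal c j k)"
  unfolding scal_def using bump_cmult[OF bump_affine[of k "2^j" 0], of c] by simp

lemma partial_scal: 
  assumes "bump k" "b \<in> Basis" shows "partial_dir b (scal c j k) = scal (c * 2^j) j (partial_dir b k)"
proof -
  have "bump (\<lambda>x. k (2^j *\<^sub>R x))" using bump_affine[OF assms(1), of "2^j" 0] by simp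
  moreover have "partial_dir b (\<lambda>x. k (2^j *\<^sub>R x)) = (\<lambda>x. 2^j * partial_dir b k (2^j *\<^sub>R x))"
    using partial_affine[OF assms, of 0 "2^j"] by simp
  ultimately show ?thesis unfolding scal_def using assms(2) by (simp add: partial_cmult[OF bump_HC] mult.assoc)
qed

lemma scal_bound: "(\<And>x. \<bar>k x\<bar> \<le> M) \<Longrightarrow> \<bar>scal c j k x\<bar> \<le> \<bar>c\<bar> * M"
  by (simp add: scal_def abs_mult mult_left_mono)

lemma scal_support: "(\<And>x. R \<le> norm x \<Longrightarrow> k x = 0) \<Longrightarrow> R / 2^j \<le> norm x \<Longrightarrow> scal c j k x = 0"
  by (simp add: scal_def field_simps)

definition rhoj :: "nat \<Rightarrow> 'a::euclidean_space \<Rightarrow> real" where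
  "rhoj j = scal (2 ^ (j * DIM('a))) j rho"

text \<open>The factor 4^-j is the gain of two derivatives: each derivative costs 2^j, and the
  Laplacian then has the size of a mollifier at scale 2^-j.\<close>

definition kapj :: "nat \<Rightarrow> 'a::euclidean_space \<Rightarrow> real" where
  "kapj j = scal (2 ^ (j * DIM('a)) / 4 ^ j) j kap"

lemma bump_rho: "bump rho" by (rule bumpI[of _ 1]) (auto intro: HC_rho rho_0)
lemma bump_kap: "bump kap" by (rule bumpI[of _ 2]) (auto intro: HC_kap kap_0)
lemma bump_rhoj: "bump (rhoj j)" unfolding rhoj_def by (rule bump_scal[OF bump_rho])
lemma bump_kapj: "bump (kapj j)" unfolding kapj_def by (rule bump_scal[OF bump_kap])

lemma rhoj_support: "1 / 2^j \<le> norm x \<Longrightarrow> rhoj j x = 0"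
  unfolding rhoj_def by (rule scal_support[of 1]) (auto intro: rho_0)

lemma kapj_support: "2 / 2^j \<le> norm x \<Longrightarrow> kapj j x = 0"
  unfolding kapj_def by (rule scal_support[of 2]) (auto intro: kap_0)

lemma rhoj_ge0: "rhoj j x \<ge> 0" by (simp add: rhoj_def scal_def rho_ge0)

lemma rhoj_minus: "rhoj j (x - y) = rhoj j (y - x)"
  using rho_minus[of "2^j *\<^sub>R (x - y)"] by (simp add: rhoj_def scal_def scaleR_right_diff_distrib)

lemma rhoj_integral: "(LBINT x. rhoj j (x::'a::euclidean_space)) = 1"
proof -
  have "(LBINT x. rho (x::'a)) = \<bar>2^j\<bar> ^ DIM('a) * (LBINT x. rho (0 + 2^j *\<^sub>R (x::'a)))"
    by (rule integral_affine) (auto intro: bump_measurable bump_rho)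
  then show ?thesis by (simp add: rho_integral rhoj_def scal_def power_mult)
qed

lemma mollifier_rhoj: "mollifier (rhoj :: nat \<Rightarrow> 'a::euclidean_space \<Rightarrow> real) (\<lambda>j. 1 / 2^j)"
proof -
  have "(\<lambda>j. (1/2::real)^j) \<longlonglongrightarrow> 0" by (intro LIMSEQ_realpow_zero) auto
  then show ?thesis by (auto simp: mollifier_def bump_rhoj rhoj_ge0 rhoj_integral rhoj_support power_one_over)
qed

text \<open>Scaling by \<open>2^Suc j\<close> turns the wide mollifier in \<open>kap_laplace\<close>
  into \<open>rhoj j\<close>. Since \<open>kap\<close> lives in a ball of radius 2,
  \<open>kapj (Suc j)\<close> and \<open>rhoj j\<close> share the support radius 2^-j.\<close>

lemma kapj_laplace:
  fixes x :: "'a::euclidean_space"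
  shows "(\<Sum>b\<in>Basis. partial_dir b (partial_dir b (kapj (Suc j))) x) = rhoj j x - rhoj (Suc j) x"
proof -
  have "partial_dir b (partial_dir b (kapj (Suc j))) x = 2 ^ (Suc j * DIM('a)) * partial_dir b (partial_dir b kap) (2^Suc j *\<^sub>R x)" if "b \<in> Basis" for b :: 'a
  proof -
    have "(2::real) ^ (Suc j * DIM('a)) / 4 ^ Suc j * 2 ^ Suc j * 2 ^ Suc j = 2 ^ (Suc j * DIM('a)) * ((2 ^ Suc j * 2 ^ Suc j) / 4 ^ Suc j)" by simp
    also have "(2::real) ^ Suc j * 2 ^ Suc j = 4 ^ Suc j" by (simp only: power_mult_distrib[symmetric]) simp
    finally show ?thesis unfolding kapj_def partial_scal[OF bump_kap that] partial_scal[OF bump_partial[OF bump_kap that] that]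
      by (simp add: scal_def)
  qed
  then have "(\<Sum>b\<in>Basis. partial_dir b (partial_dir b (kapj (Suc j))) x) = 2 ^ (Suc j * DIM('a)) * (rho ((2^Suc j *\<^sub>R x) /\<^sub>R 2) / 2 ^ DIM('a) - rho (2^Suc j *\<^sub>R x))"
    by (simp only: sum_distrib_left[symmetric] kap_laplace sum.cong)
  also have "\<dots> = rhoj j x - rhoj (Suc j) x"
    by (simp add: rhoj_def scal_def right_diff_distrib power_add)
  finally show ?thesis .
qed

text \<open>One bound for all kernels of a given dimension. Third derivatives are included because
  the growth of the third derivatives of the mollifications measures the Hoelder continuity of the
  second ones.\<close>

definition kbd :: "'a::euclidean_space itself \<Rightarrow> real" where
  "kbd _ = (SOME M. M \<ge> 0 \<and> (\<forall>x::'a. \<bar>rho x\<bar> \<le> M \<and> \<bar>kap x\<bar> \<le> M) \<and>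
     (\<forall>b\<in>Basis. \<forall>x::'a. \<bar>partial_dir b kap x\<bar> \<le> M) \<and>
     (\<forall>b\<in>Basis. \<forall>c\<in>Basis. \<forall>x::'a. \<bar>partial_dir c (partial_dir b kap) x\<bar> \<le> M) \<and>
     (\<forall>b\<in>Basis. \<forall>c\<in>Basis. \<forall>d\<in>Basis. \<forall>x::'a. \<bar>partial_dir d (partial_dir c (partial_dir b kap)) x\<bar> \<le> M))"

lemma kbd_ex: "\<exists>M. M \<ge> 0 \<and> (\<forall>x::'a::euclidean_space. \<bar>rho x\<bar> \<le> M \<and> \<bar>kap x\<bar> \<le> M) \<and>
     (\<forall>b\<in>Basis. \<forall>x::'a. \<bar>partial_dir b kap x\<bar> \<le> M) \<and>
     (\<forall>b\<in>Basis. \<forall>c\<in>Basis. \<forall>x::'a. \<bar>partial_dir c (partial_dir b kap) x\<bar> \<le> M) \<and>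
     (\<forall>b\<in>Basis. \<forall>c\<in>Basis. \<forall>d\<in>Basis. \<forall>x::'a. \<bar>partial_dir d (partial_dir c (partial_dir b kap)) x\<bar> \<le> M)"
proof -
  define F where "F = {rho, kap :: 'a \<Rightarrow> real} \<union> (\<Union>b\<in>Basis. {partial_dir b kap})
    \<union> (\<Union>b\<in>Basis. \<Union>c\<in>Basis. {partial_dir c (partial_dir b kap)})
    \<union> (\<Union>b\<in>Basis. \<Union>c\<in>Basis. \<Union>d\<in>Basis. {partial_dir d (partial_dir c (partial_dir b kap))})"
  have fin: "finite F" by (simp add: F_def)
  have "bump f" if "f \<in> F" for f
    using that by (auto simp: F_def bump_rho bump_kap intro!: bump_partial)
  then have "\<exists>M\<ge>0. \<forall>x. \<bar>f x\<bar> \<le> M" if "f \<in> F" for f using bump_bounded that by blast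
  then obtain M where M: "\<And>f. f \<in> F \<Longrightarrow> M f \<ge> 0 \<and> (\<forall>x. \<bar>f x\<bar> \<le> M f)" by metis
  define M' where "M' = (\<Sum>f\<in>F. M f)"
  have "M f \<le> M'" if "f \<in> F" for f unfolding M'_def using that fin M by (intro member_le_sum) auto
  then have *: "\<bar>f x\<bar> \<le> M'" if "f \<in> F" for f x using M[OF that] that by (meson order_trans)
  have "M' \<ge> 0" unfolding M'_def using M by (intro sum_nonneg) auto
  moreover have "rho \<in> F" "kap \<in> F" "\<And>b. b \<in> Basis \<Longrightarrow> partial_dir b kap \<in> F"
    "\<And>b c. b \<in> Basis \<Longrightarrow> c \<in> Basis \<Longrightarrow> partial_dir c (partial_dir b kap) \<in> F"
    "\<And>b c d. b \<in> Basis \<Longrightarrow> c \<in> Basis \<Longrightarrow> d \<in> Basis \<Longrightarrow> partial_dir d (partial_dir c (partial_dir b kap)) \<in> F"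
    unfolding F_def
    by (simp, simp, rule UnI1, rule UnI1, rule UnI2, rule UN_I, assumption, rule singletonI,
        rule UnI1, rule UnI2, rule UN_I, assumption, rule UN_I, assumption, rule singletonI,
        rule UnI2, rule UN_I, assumption, rule UN_I, assumption, rule UN_I, assumption, rule singletonI)
  ultimately show ?thesis by (intro exI[of _ M'] conjI allI ballI *)
qed

lemma kbd:
  shows kbd_ge0: "kbd TYPE('a::euclidean_space) \<ge> 0"
    and kbd_rho: "\<And>x::'a. \<bar>rho x\<bar> \<le> kbd TYPE('a)" and kbd_kap: "\<And>x::'a. \<bar>kap x\<bar> \<le> kbd TYPE('a)"
    and kbd1: "\<And>b x::'a. b \<in> Basis \<Longrightarrow> \<bar>partial_dir b kap x\<bar> \<le> kbd TYPE('a)"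
    and kbd2: "\<And>b c x::'a. b \<in> Basis \<Longrightarrow> c \<in> Basis \<Longrightarrow> \<bar>partial_dir c (partial_dir b kap) x\<bar> \<le> kbd TYPE('a)"
    and kbd3: "\<And>b c d x::'a. b \<in> Basis \<Longrightarrow> c \<in> Basis \<Longrightarrow> d \<in> Basis \<Longrightarrow> \<bar>partial_dir d (partial_dir c (partial_dir b kap)) x\<bar> \<le> kbd TYPE('a)"
  using someI_ex[OF kbd_ex[where 'a='a], folded kbd_def[of "TYPE('a)"]] by blast+

lemma rhoj_bound: "\<bar>rhoj j (x::'a::euclidean_space)\<bar> \<le> kbd TYPE('a) * 2 ^ (j * DIM('a))"
  unfolding rhoj_def using scal_bound[where k="rho" and M="kbd TYPE('a)" and c="2 ^ (j * DIM('a))" and j=j and x=x, OF kbd_rho] by (simp add: mult.commute)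

lemma kapj_bound: "\<bar>kapj j (x::'a::euclidean_space)\<bar> \<le> kbd TYPE('a) * (2 ^ (j * DIM('a)) / 4^j)"
  unfolding kapj_def using scal_bound[where k="kap" and M="kbd TYPE('a)" and c="2 ^ (j * DIM('a)) / 4^j" and j=j and x=x, OF kbd_kap] by (simp add: mult.commute)

lemma kapj_partial1:
  assumes "b \<in> (Basis::'a::euclidean_space set)"
  shows "partial_dir b (kapj j) = scal (2 ^ (j * DIM('a)) / 2^j) j (partial_dir b kap)"
proof -
  have "(2::real) ^ (j * DIM('a)) / 4^j * 2^j = 2 ^ (j * DIM('a)) / 2^j"
  proof -
    have "(4::real)^j = 2^j * 2^j" by (simp add: power_mult_distrib[symmetric])
    then show ?thesis by simp
  qed
  then show ?thesis unfolding kapj_def partial_scal[OF bump_kap assms] by simp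
qed

lemma kapj_partial2:
  assumes "b \<in> (Basis::'a::euclidean_space set)" "c \<in> Basis"
  shows "partial_dir c (partial_dir b (kapj j)) = scal (2 ^ (j * DIM('a))) j (partial_dir c (partial_dir b kap))"
  unfolding kapj_partial1[OF assms(1)] partial_scal[OF bump_partial[OF bump_kap assms(1)] assms(2)] by simp

lemma kapj_partial3:
  assumes "b \<in> (Basis::'a::euclidean_space set)" "c \<in> Basis" "d \<in> Basis"
  shows "partial_dir d (partial_dir c (partial_dir b (kapj j))) = scal (2 ^ (j * DIM('a)) * 2^j) j (partial_dir d (partial_dir c (partial_dir b kap)))"
  unfolding kapj_partial2[OF assms(1,2)] partial_scal[OF bump_partial[OF bump_partial[OF bump_kap assms(1)] assms(2)] assms(3)] by simp

lemma kapj_bound1: "b \<in> Basis \<Longrightarrow> \<bar>partial_dir b (kapj j) (x::'a::euclidean_space)\<bar> \<le> kbd TYPE('a) * (2 ^ (j * DIM('a)) / 2^j)"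
  using scal_bound[where k="partial_dir b kap" and M="kbd TYPE('a)" and c="2 ^ (j * DIM('a)) / 2^j" and j=j and x=x, OF kbd1] by (simp add: kapj_partial1 mult.commute)

lemma kapj_bound2: "b \<in> Basis \<Longrightarrow> c \<in> Basis \<Longrightarrow> \<bar>partial_dir c (partial_dir b (kapj j)) (x::'a::euclidean_space)\<bar> \<le> kbd TYPE('a) * 2 ^ (j * DIM('a))"
  using scal_bound[where k="partial_dir c (partial_dir b kap)" and M="kbd TYPE('a)" and c="2 ^ (j * DIM('a))" and j=j and x=x, OF kbd2] by (simp add: kapj_partial2 mult.commute)

lemma kapj_bound3: "b \<in> Basis \<Longrightarrow> c \<in> Basis \<Longrightarrow> d \<in> Basis \<Longrightarrow> \<bar>partial_dir d (partial_dir c (partial_dir b (kapj j))) (x::'a::euclidean_space)\<bar> \<le> kbd TYPE('a) * (2 ^ (j * DIM('a)) * 2^j)"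
  using scal_bound[where k="partial_dir d (partial_dir c (partial_dir b kap))" and M="kbd TYPE('a)" and c="2 ^ (j * DIM('a)) * 2^j" and j=j and x=x, OF kbd3] by (simp add: kapj_partial3 mult.commute)

lemma kapj_support1: "b \<in> Basis \<Longrightarrow> 2 / 2^j \<le> norm x \<Longrightarrow> partial_dir b (kapj j) x = 0"
  by (rule partial_support[OF kapj_support bump_kapj])

lemma kapj_support2: "b \<in> Basis \<Longrightarrow> c \<in> Basis \<Longrightarrow> 2 / 2^j \<le> norm x \<Longrightarrow> partial_dir c (partial_dir b (kapj j)) x = 0"
  by (rule partial_support[OF kapj_support1 bump_partial[OF bump_kapj]])

lemma kapj_support3: "b \<in> Basis \<Longrightarrow> c \<in> Basis \<Longrightarrow> d \<in> Basis \<Longrightarrow> 2 / 2^j \<le> norm x \<Longrightarrow> partial_dir d (partial_dir c (partial_dir b (kapj j))) x = 0"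
  by (rule partial_support[OF kapj_support2 bump_partial[OF bump_partial[OF bump_kapj]]])

lemma rhoj_support1: "b \<in> Basis \<Longrightarrow> 1 / 2^j \<le> norm x \<Longrightarrow> partial_dir b (rhoj j) x = 0"
  by (rule partial_support[OF rhoj_support bump_rhoj])

section \<open>Energy estimates for test functions\<close>

lemma bump_mult: assumes "bump f" "bump g" shows "bump (\<lambda>x. f x * g x)"
proof -
  obtain R where R: "\<And>x. R \<le> norm x \<Longrightarrow> f x = 0" using assms by (auto simp: bump_def)
  show ?thesis by (rule bumpI[of _ R]) (use assms R in \<open>auto intro: HC_mult bump_HC\<close>)
qed

text \<open>Convolving \<open>f\<close> with the indicator of a large ball gives, near 0, the
  constant integral of \<open>f\<close>, so the derivative at 0 vanishes; by
  \<open>conv_DERIV\<close> this derivative is the integral of the partial derivative.\<close>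

lemma bump_integral_partial:
  fixes f :: "'a::euclidean_space \<Rightarrow> real"
  assumes f: "bump f" "b \<in> Basis" shows "(LBINT x. partial_dir b f x) = 0"
proof -
  obtain R where R: "R > 0" "\<And>x. R \<le> norm x \<Longrightarrow> f x = 0" using f by (auto simp: bump_def)
  define w where "w = (indicator (ball 0 (R+1)) :: 'a \<Rightarrow> real)"
  have w: "integrable lborel w" unfolding w_def using emeasure_bounded_finite[of "ball (0::'a) (R+1)"] by simp
  have c: "conv k w x = (LBINT y. k y)" if k: "bump k" "\<And>x. R \<le> norm x \<Longrightarrow> k x = 0" and x: "norm x < 1" for k x
  proof -
    have "k (x - y) * w y = k (x - y)" for y
    proof (cases "norm y < R + 1")
      case False
      have "norm y - norm x \<le> norm (x - y)" by (metis norm_minus_commute norm_triangle_ineq2)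
      then have "k (x - y) = 0" using False x by (intro k) auto
      then show ?thesis by simp
    qed (simp add: w_def)
    then have "conv k w x = (LBINT y. k (x - y))" unfolding conv_def by presburger
    also have "\<dots> = (LBINT y. k y)" by (rule integral_reflect[OF bump_measurable[OF k(1)]])
    finally show ?thesis .
  qed
  have "((\<lambda>t. conv f w (0 + t *\<^sub>R b)) has_real_derivative 0) (at 0)"
  proof (rule partial_cong[of "ball 0 1" 0 "\<lambda>_. \<integral>y. f y \<partial>lborel"])
    show "(LBINT y. f y) = conv f w y" if "y \<in> ball 0 1" for y using c[OF f(1) R(2), of y] that by simp
  qed auto
  moreover have "((\<lambda>t. conv f w (0 + t *\<^sub>R b)) has_real_derivative conv (partial_dir b f) w 0) (at 0)"
    by (rule conv_DERIV[OF f w])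
  ultimately have "conv (partial_dir b f) w 0 = 0" by (rule DERIV_unique[rotated])
  moreover have "conv (partial_dir b f) w 0 = (LBINT x. partial_dir b f x)"
    by (rule c[OF bump_partial[OF f]]) (simp_all add: partial_support[OF R(2) f])
  ultimately show ?thesis by simp
qed

lemma partial_mult_bump:
  assumes "bump f" "bump g" "b \<in> Basis"
  shows "partial_dir b (\<lambda>x. f x * g x) x = partial_dir b f x * g x + f x * partial_dir b g x"
  using DERIV_mult[OF bump_DERIV0[OF assms(1,3), of x] bump_DERIV0[OF assms(2,3), of x]]
  by (intro partial_dirI') (simp add: mult.commute)

lemma bump_IBP:
  assumes "bump f" "bump g" "b \<in> Basis"
  shows "(LBINT x. partial_dir b f x * g x) = - (LBINT x. f x * partial_dir b g x)"
proof -
  have "(LBINT x. partial_dir b f x * g x + f x * partial_dir b g x) = 0"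
    using bump_integral_partial[OF bump_mult[OF assms(1,2)] assms(3)] by (simp add: partial_mult_bump assms)
  moreover have "integrable lborel (\<lambda>x. partial_dir b f x * g x)" "integrable lborel (\<lambda>x. f x * partial_dir b g x)"
    by (intro bump_integrable bump_mult bump_partial assms)+
  ultimately show ?thesis by simp
qed

lemma bump_energy:
  assumes v: "bump v"
  shows "(\<Sum>b\<in>Basis. LBINT x. (partial_dir b v x)^2) = - (LBINT x. v x * (\<Sum>b\<in>Basis. partial_dir b (partial_dir b v) x))"
proof -
  have "(LBINT x. (partial_dir b v x)^2) = - (LBINT x. v x * partial_dir b (partial_dir b v) x)" if "b \<in> Basis" for b
    using bump_IBP[OF v bump_partial[OF v that] that] by (simp add: power2_eq_square)
  moreover have "integrable lborel (\<lambda>x. v x * partial_dir b (partial_dir b v) x)" if "b \<in> Basis" for b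
    by (intro bump_integrable bump_mult bump_partial v that)
  ultimately show ?thesis by (simp add: sum_distrib_left sum_negf)
qed

text \<open>After a translation the support lies in the unit ball about the origin, hence in the
  box, so box integrals are integrals over the whole space.\<close>

lemma sobolev_bump:
  fixes v :: "'a::euclidean_space \<Rightarrow> real"
  assumes dim: "DIM('a) \<le> 4" and v: "bump v" and s: "\<And>x. dist x x0 \<ge> 1 \<Longrightarrow> v x = 0"
  shows "(LBINT x. (v x)^4) \<le> 1296 * (LBINT x. (\<Sum>b\<in>Basis. \<bar>partial_dir b v x\<bar>)^2)^2"
proof -
  define v' where "v' y = v (x0 + 1 *\<^sub>R y)" for y
  have v': "bump v'" unfolding v'_def by (rule bump_affine[OF v]) simp
  have pv: "partial_dir b v' = (\<lambda>y. partial_dir b v (x0 + 1 *\<^sub>R y))" if "b \<in> Basis" for b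
    unfolding v'_def using partial_affine[OF v that, of x0 1] by simp
  have s': "v' x = 0" if "1 \<le> norm x" for x using that unfolding v'_def by (intro s) (simp add: dist_norm)
  have ps: "partial_dir b v' x = 0" if "1 \<le> norm x" "b \<in> Basis" for x b by (rule partial_support[OF s' v' that(2,1)])
  have ub: "norm x < 1 \<Longrightarrow> x \<in> unitbox" for x :: 'a
    unfolding unitbox_def using Basis_le_norm[of _ x] by force
  have bi: "boxint h = (LBINT x. h x)" if "\<And>x. 1 \<le> norm x \<Longrightarrow> h x = 0" for h :: "'a \<Rightarrow> real"
    unfolding boxint_def
  proof (rule Bochner_Integration.integral_cong[OF refl])
    fix x show "indicator unitbox x * h x = h x" using that[of x] ub[of x] by (cases "norm x < 1") auto
  qed
  have "boxint (\<lambda>x. (v' x)^4) \<le> 1296 * (boxint (\<lambda>x. (\<Sum>b\<in>Basis. \<bar>partial_dir b v' x\<bar>)^2))^2"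
    by (rule sobolev4[OF dim]) (use v' s' in \<open>auto intro: bump_continuous bump_partial differentiable_realI[OF bump_DERIV0]\<close>)
  also have "boxint (\<lambda>x. (v' x)^4) = (LBINT x. (v' x)^4)" by (rule bi) (simp add: s')
  also have "boxint (\<lambda>x. (\<Sum>b\<in>Basis. \<bar>partial_dir b v' x\<bar>)^2) = (LBINT x. (\<Sum>b\<in>Basis. \<bar>partial_dir b v' x\<bar>)^2)"
    by (rule bi) (simp add: ps)
  also have "(LBINT x. (v' x)^4) = (LBINT x. (v x)^4)"
  proof -
    note [measurable] = bump_measurable[OF v]
    show ?thesis using integral_affine[of "\<lambda>x. (v x)^4" 1 x0] by (simp add: v'_def)
  qed
  also have "(LBINT x. (\<Sum>b\<in>Basis. \<bar>partial_dir b v' x\<bar>)^2) = (LBINT x. (\<Sum>b\<in>Basis. \<bar>partial_dir b v x\<bar>)^2)"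
  proof -
    have [measurable]: "b \<in> Basis \<Longrightarrow> partial_dir b v \<in> borel_measurable borel" for b by (intro bump_measurable bump_partial v)
    have "(\<lambda>x. (\<Sum>b\<in>Basis. \<bar>partial_dir b v x\<bar>)^2) \<in> borel_measurable borel" by measurable
    from integral_affine[OF this, of 1 x0] show ?thesis by (simp add: pv)
  qed
  finally show ?thesis .
qed

text \<open>Hoelder's inequality with exponents 4, 4, 2 from two uses of Cauchy-Schwarz; the fourth
  power keeps all exponents integral.\<close>

lemma nn_hoelder_424:
  fixes f g h :: "'a \<Rightarrow> ennreal"
  assumes [measurable]: "f \<in> borel_measurable M" "g \<in> borel_measurable M" "h \<in> borel_measurable M"
  shows "(\<integral>\<^sup>+x. f x * (g x * h x) \<partial>M)^4 \<le> (\<integral>\<^sup>+x. f x ^ 4 \<partial>M) * (\<integral>\<^sup>+x. g x ^ 4 \<partial>M) * (\<integral>\<^sup>+x. h x ^ 2 \<partial>M)^2"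
proof -
  have "(\<integral>\<^sup>+x. f x * (g x * h x) \<partial>M)^4 = ((\<integral>\<^sup>+x. (f x * g x) * h x \<partial>M)^2)^2" by (simp add: mult.assoc)
  also have "\<dots> \<le> ((\<integral>\<^sup>+x. (f x * g x)^2 \<partial>M) * (\<integral>\<^sup>+x. h x ^ 2 \<partial>M))^2"
    by (intro power_mono Cauchy_Schwarz_nn_integral) auto
  also have "\<dots> = (\<integral>\<^sup>+x. f x ^ 2 * g x ^ 2 \<partial>M)^2 * (\<integral>\<^sup>+x. h x ^ 2 \<partial>M)^2" by (simp add: power_mult_distrib)
  also have "\<dots> \<le> ((\<integral>\<^sup>+x. (f x ^ 2)^2 \<partial>M) * (\<integral>\<^sup>+x. (g x ^ 2)^2 \<partial>M)) * (\<integral>\<^sup>+x. h x ^ 2 \<partial>M)^2"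
    by (intro mult_right_mono Cauchy_Schwarz_nn_integral) auto
  finally show ?thesis by simp
qed

text \<open>\<open>rhoj\<close> is even, so Tonelli moves the mollifier from \<open>g\<close> onto
  \<open>v\<close>; \<open>young_4\<close> then removes it, and Hoelder with exponents 4, 4, 2 gives
  a bound independent of \<open>j\<close>.\<close>

lemma pairing_bound:
  fixes v g :: "'a::euclidean_space \<Rightarrow> real" and a \<beta> :: "'a \<Rightarrow> real"
  assumes v: "bump v" and g: "integrable lborel g" 
    and [measurable]: "a \<in> borel_measurable borel" "\<beta> \<in> borel_measurable borel"
    and gb: "\<And>x. \<bar>g x\<bar> \<le> C * (a x * \<beta> x)" and nn: "\<And>x. a x \<ge> 0" "\<And>x. \<beta> x \<ge> 0" and C: "C \<ge> 0"
    and ia: "integrable lborel (\<lambda>x. (a x)^4)" "integrable lborel (\<lambda>x. (\<beta> x)^2)"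
  shows "(LBINT x. \<bar>v x * conv (rhoj j) g x\<bar>)^4 \<le> C^4 * (LBINT x. (v x)^4) * (LBINT x. (a x)^4) * (LBINT x. (\<beta> x)^2)^2"
proof -
  have [measurable]: "g \<in> borel_measurable borel" using borel_measurable_integrable[OF g] by simp
  note [measurable] = bump_measurable[OF v] bump_measurable[OF bump_rhoj]
  have [measurable]: "conv (rhoj j) g \<in> borel_measurable borel"
    by (rule borel_measurable_continuous_onI[OF conv_continuous[OF bump_rhoj g]])
  define q where "q y = (NBINT x. ennreal (rhoj j (y - x)) * ennreal \<bar>v x\<bar>)" for y
  have [measurable]: "q \<in> borel_measurable borel" unfolding q_def by measurable
  have q4: "(NBINT y. q y ^ 4) \<le> (NBINT x. ennreal \<bar>v x\<bar> ^ 4)"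
    unfolding q_def by (rule young_4[OF bump_rhoj rhoj_ge0 rhoj_integral]) measurable
  have bv: "bump (\<lambda>x. v x * conv (rhoj j) g x)"
  proof -
    obtain R where R: "\<And>x. R \<le> norm x \<Longrightarrow> v x = 0" using v by (auto simp: bump_def)
    show ?thesis by (rule bumpI[of _ R]) (use R in \<open>auto intro!: HC_mult bump_HC[OF v] HC_conv[OF bump_rhoj g]\<close>)
  qed
  have iv: "integrable lborel (\<lambda>x. v x * conv (rhoj j) g x)" by (rule bump_integrable[OF bv])
  have v4: "integrable lborel (\<lambda>x. (v x)^4)"
  proof -
    have "(\<lambda>x. (v x)^4) = (\<lambda>x. (v x * v x) * (v x * v x))" by (simp add: power4_eq_xxxx mult.assoc)
    then show ?thesis using bump_integrable[OF bump_mult[OF bump_mult[OF v v] bump_mult[OF v v]]] by simp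
  qed
  have "ennreal (LBINT x. \<bar>v x * conv (rhoj j) g x\<bar>) = (NBINT x. ennreal \<bar>v x * conv (rhoj j) g x\<bar>)"
    by (rule nn_integral_eq_integral[symmetric]) (use iv in auto)
  also have "\<dots> \<le> (NBINT x. NBINT y. ennreal \<bar>v x\<bar> * (ennreal (rhoj j (x - y)) * ennreal \<bar>g y\<bar>))"
  proof (rule nn_integral_mono)
    fix x
    have "ennreal \<bar>v x * conv (rhoj j) g x\<bar> = ennreal \<bar>v x\<bar> * ennreal \<bar>conv (rhoj j) g x\<bar>" by (simp add: abs_mult ennreal_mult')
    also have "\<dots> \<le> ennreal \<bar>v x\<bar> * (NBINT y. ennreal (rhoj j (x - y)) * ennreal \<bar>g y\<bar>)"
      by (intro mult_left_mono conv_le_nn bump_rhoj rhoj_ge0 g) auto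
    also have "\<dots> = (NBINT y. ennreal \<bar>v x\<bar> * (ennreal (rhoj j (x - y)) * ennreal \<bar>g y\<bar>))"
      by (rule nn_integral_cmult[symmetric]) measurable
    finally show "ennreal \<bar>v x * conv (rhoj j) g x\<bar> \<le> (NBINT y. ennreal \<bar>v x\<bar> * (ennreal (rhoj j (x - y)) * ennreal \<bar>g y\<bar>))" .
  qed
  also have "\<dots> = (NBINT y. NBINT x. ennreal \<bar>v x\<bar> * (ennreal (rhoj j (x - y)) * ennreal \<bar>g y\<bar>))"
    by (rule lborel_pair.Fubini') measurable
  also have "\<dots> = (NBINT y. q y * ennreal \<bar>g y\<bar>)"
  proof (rule nn_integral_cong)
    fix y
    have "(NBINT x. ennreal \<bar>v x\<bar> * (ennreal (rhoj j (x - y)) * ennreal \<bar>g y\<bar>)) = (NBINT x. (ennreal (rhoj j (y - x)) * ennreal \<bar>v x\<bar>) * ennreal \<bar>g y\<bar>)"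
      by (intro nn_integral_cong) (simp add: mult_ac rhoj_minus[of j _ y])
    also have "\<dots> = q y * ennreal \<bar>g y\<bar>" unfolding q_def by (rule nn_integral_multc) measurable
    finally show "(NBINT x. ennreal \<bar>v x\<bar> * (ennreal (rhoj j (x - y)) * ennreal \<bar>g y\<bar>)) = q y * ennreal \<bar>g y\<bar>" .
  qed
  also have "\<dots> \<le> (NBINT y. ennreal C * (q y * (ennreal (a y) * ennreal (\<beta> y))))"
  proof (rule nn_integral_mono)
    fix y
    have "ennreal \<bar>g y\<bar> \<le> ennreal (C * (a y * \<beta> y))" by (rule ennreal_leI[OF gb])
    also have "\<dots> = ennreal C * (ennreal (a y) * ennreal (\<beta> y))" using C nn by (simp add: ennreal_mult)
    finally show "q y * ennreal \<bar>g y\<bar> \<le> ennreal C * (q y * (ennreal (a y) * ennreal (\<beta> y)))"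
      by (subst mult.left_commute) (rule mult_left_mono, auto)
  qed
  also have "\<dots> = ennreal C * (NBINT y. q y * (ennreal (a y) * ennreal (\<beta> y)))" by (rule nn_integral_cmult) measurable
  finally have "ennreal (LBINT x. \<bar>v x * conv (rhoj j) g x\<bar>)^4 \<le> (ennreal C * (NBINT y. q y * (ennreal (a y) * ennreal (\<beta> y))))^4"
    by (intro power_mono) auto
  also have "\<dots> = ennreal C ^ 4 * (NBINT y. q y * (ennreal (a y) * ennreal (\<beta> y)))^4" by (rule power_mult_distrib)
  also have "\<dots> \<le> ennreal C ^ 4 * ((NBINT y. q y ^ 4) * (NBINT y. ennreal (a y) ^ 4) * (NBINT y. ennreal (\<beta> y) ^ 2)^2)"
    by (intro mult_left_mono nn_hoelder_424) auto
  also have "\<dots> \<le> ennreal C ^ 4 * ((NBINT x. ennreal \<bar>v x\<bar> ^ 4) * (NBINT y. ennreal (a y) ^ 4) * (NBINT y. ennreal (\<beta> y) ^ 2)^2)"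
    by (intro mult_left_mono mult_right_mono q4) auto
  also have "(NBINT x. ennreal \<bar>v x\<bar> ^ 4) = ennreal (LBINT x. (v x)^4)"
    using nn_integral_eq_integral[OF v4] by (simp add: ennreal_power)
  also have "(NBINT y. ennreal (a y) ^ 4) = ennreal (LBINT x. (a x)^4)"
    using nn_integral_eq_integral[OF ia(1)] nn by (simp add: ennreal_power)
  also have "(NBINT y. ennreal (\<beta> y) ^ 2) = ennreal (LBINT x. (\<beta> x)^2)"
    using nn_integral_eq_integral[OF ia(2)] nn by (simp add: ennreal_power)
  finally have "ennreal ((LBINT x. \<bar>v x * conv (rhoj j) g x\<bar>)^4) \<le> ennreal (C^4 * ((LBINT x. (v x)^4) * (LBINT x. (a x)^4) * (LBINT x. (\<beta> x)^2)^2))"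
    using C by (simp add: ennreal_power ennreal_mult'[symmetric] ennreal_mult''[symmetric])
  then have "(LBINT x. \<bar>v x * conv (rhoj j) g x\<bar>)^4 \<le> C^4 * ((LBINT x. (v x)^4) * (LBINT x. (a x)^4) * (LBINT x. (\<beta> x)^2)^2)"
    by (rule ennreal_le_iff[THEN iffD1, rotated]) (auto intro!: mult_nonneg_nonneg Bochner_Integration.integral_nonneg zero_le_power C)
  then show ?thesis by (simp add: mult.assoc)
qed

text \<open>The Sobolev inequality in dual form.\<close>

lemma potential_energy:
  fixes v g :: "'a::euclidean_space \<Rightarrow> real" and a \<beta> :: "'a \<Rightarrow> real"
  assumes dim: "DIM('a) \<le> 4" and v: "bump v" and s: "\<And>x. dist x x0 \<ge> 1 \<Longrightarrow> v x = 0"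
    and lap: "\<And>x. (\<Sum>b\<in>Basis. partial_dir b (partial_dir b v) x) = conv (rhoj J) g x - conv (rhoj K) g x"
    and g: "integrable lborel g" 
    and m: "a \<in> borel_measurable borel" "\<beta> \<in> borel_measurable borel"
    and gb: "\<And>x. \<bar>g x\<bar> \<le> C * (a x * \<beta> x)" and nn: "\<And>x. a x \<ge> 0" "\<And>x. \<beta> x \<ge> 0" and C: "C \<ge> 0"
    and ia: "integrable lborel (\<lambda>x. (a x)^4)" "integrable lborel (\<lambda>x. (\<beta> x)^2)"
  defines "Z \<equiv> \<integral>x. (\<Sum>b\<in>Basis. \<bar>partial_dir b v x\<bar>)^2 \<partial>lborel"
  shows "Z \<le> 2304 * C^2 * sqrt (LBINT x. (a x)^4) * (LBINT x. (\<beta> x)^2)"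
    and "(LBINT x. (v x)^4) \<le> 1296 * Z^2"
proof -
  define X where "X = (LBINT x. (v x)^4)"
  define A where "A = (LBINT x. (a x)^4)"
  define T where "T = (LBINT x. (\<beta> x)^2)"
  define P where "P j = (LBINT x. \<bar>v x * conv (rhoj j) g x\<bar>)" for j
  have 0: "X \<ge> 0" "A \<ge> 0" "T \<ge> 0" "Z \<ge> 0" "P j \<ge> 0" for j
    unfolding X_def A_def T_def P_def Z_def by (auto intro!: Bochner_Integration.integral_nonneg)
  show XZ: "(LBINT x. (v x)^4) \<le> 1296 * Z^2" unfolding Z_def by (rule sobolev_bump[OF dim v s])
  have P4: "P j ^ 4 \<le> C^4 * X * A * T^2" for j
    unfolding P_def X_def A_def T_def by (rule pairing_bound[OF v g m gb nn C ia])
  have iv: "integrable lborel (\<lambda>x. v x * conv (rhoj j) g x)" for j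
  proof -
    obtain R where R: "\<And>x. R \<le> norm x \<Longrightarrow> v x = 0" using v by (auto simp: bump_def)
    show ?thesis
      by (rule bump_integrable, rule bumpI[of _ R]) (use R in \<open>auto intro!: HC_mult bump_HC[OF v] HC_conv[OF bump_rhoj g]\<close>)
  qed
  have ip: "integrable lborel (\<lambda>x. (partial_dir b v x)^2)" if "b \<in> Basis" for b
    unfolding power2_eq_square by (intro bump_integrable bump_mult bump_partial v that)
  define S where "S = (\<Sum>b\<in>Basis. LBINT x. (partial_dir b v x)^2)"
  have S0: "S \<ge> 0" unfolding S_def by (auto intro!: sum_nonneg Bochner_Integration.integral_nonneg)
  have "S = - (LBINT x. v x * (conv (rhoj J) g x - conv (rhoj K) g x))"
    unfolding S_def bump_energy[OF v] lap ..
  also have "\<dots> = (LBINT x. v x * conv (rhoj K) g x) - (LBINT x. v x * conv (rhoj J) g x)"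
    unfolding right_diff_distrib using iv by simp
  also have "\<dots> \<le> P K + P J"
  proof -
    have "\<bar>\<integral>x. v x * conv (rhoj j) g x \<partial>lborel\<bar> \<le> P j" for j unfolding P_def by (rule integral_abs_bound)
    from this[of K] this[of J] show ?thesis by linarith
  qed
  finally have S: "S \<le> P K + P J" .
  have "Z \<le> (LBINT x. DIM('a) * (\<Sum>b\<in>Basis. (partial_dir b v x)^2))"
    unfolding Z_def
  proof (rule integral_mono)
    have le: "(\<Sum>b\<in>Basis. \<bar>partial_dir b v x\<bar>)^2 \<le> DIM('a) * (\<Sum>b\<in>Basis. (partial_dir b v x)^2)" for x
      using sum_squared_le_sum_of_squares[of "\<lambda>b. \<bar>partial_dir b v x\<bar>" Basis] by (simp add: mult.commute)
    show i2: "integrable lborel (\<lambda>x. real DIM('a) * (\<Sum>b\<in>Basis. (partial_dir b v x)^2))"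
      using ip by auto
    have [measurable]: "b \<in> Basis \<Longrightarrow> partial_dir b v \<in> borel_measurable borel" for b by (intro bump_measurable bump_partial v)
    have "(\<lambda>x. (\<Sum>b\<in>Basis. \<bar>partial_dir b v x\<bar>)^2) \<in> borel_measurable lborel" by measurable
    then show "integrable lborel (\<lambda>x. (\<Sum>b\<in>Basis. \<bar>partial_dir b v x\<bar>)^2)"
      by (rule Bochner_Integration.integrable_bound[OF i2]) (auto intro!: AE_I2 order_trans[OF le abs_ge_self])
    show "(\<Sum>b\<in>Basis. \<bar>partial_dir b v x\<bar>)^2 \<le> DIM('a) * (\<Sum>b\<in>Basis. (partial_dir b v x)^2)" for x by (rule le)
  qed
  also have "\<dots> = DIM('a) * S" unfolding S_def using ip by simp
  also have "\<dots> \<le> 4 * (P K + P J)" using dim S S0 0 by (intro mult_mono) auto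
  finally have ZP: "Z \<le> 4 * (P K + P J)" .
  define p where "p = max (P K) (P J)"
  have p: "p \<ge> 0" "p^4 \<le> C^4 * X * A * T^2" "Z \<le> 8 * p" using 0 P4 ZP by (auto simp: p_def max_def)
  \<comment> \<open>In the fourth power \<open>Z\<close> is bounded through \<open>X\<close>, and
    the Sobolev inequality bounds \<open>X\<close> by \<open>Z^2\<close> again, so one factor
    \<open>Z^2\<close> cancels. The 8 is the dimension bound 4 times the two pairings, and 2304 is
    64 times 36.\<close>
  have "Z^4 \<le> (8 * p)^4" using p 0 by (intro power_mono) auto
  also have "\<dots> = 4096 * p^4" by (simp add: power_mult_distrib)
  also have "\<dots> \<le> 4096 * (C^4 * X * A * T^2)" using p by simp
  also have "\<dots> \<le> 4096 * (C^4 * (1296 * Z^2) * A * T^2)"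
    using XZ 0 C unfolding X_def[symmetric] by (intro mult_left_mono mult_right_mono) auto
  also have "\<dots> = (2304 * C^2 * sqrt A * T)^2 * Z^2"
  proof -
    have "(sqrt A)^2 = A" using 0 by simp
    then show ?thesis by (simp add: power_mult_distrib power_mult[symmetric])
  qed
  finally have "Z^2 * Z^2 \<le> (2304 * C^2 * sqrt A * T)^2 * Z^2" by (simp add: power_add[symmetric])
  then have "Z^2 \<le> (2304 * C^2 * sqrt A * T)^2"
  proof (cases "Z = 0")
    case False
    then have "Z^2 > 0" by simp
    with \<open>Z^2 * Z^2 \<le> (2304 * C^2 * sqrt A * T)^2 * Z^2\<close> show ?thesis by (rule mult_right_le_imp_le)
  qed simp
  then show "Z \<le> 2304 * C^2 * sqrt (LBINT x. (a x)^4) * (LBINT x. (\<beta> x)^2)"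
    using 0 C unfolding A_def[symmetric] T_def[symmetric] by (rule_tac power2_le_imp_le) auto
qed

section \<open>Decay of the energy on small balls\<close>

lemma sum_pow4_le:
  fixes f :: "'i \<Rightarrow> real"
  assumes "finite I" shows "(\<Sum>i\<in>I. \<bar>f i\<bar>)^4 \<le> real (card I)^3 * (\<Sum>i\<in>I. (f i)^4)"
proof -
  have 1: "(\<Sum>i\<in>I. \<bar>f i\<bar>)^2 \<le> (\<Sum>i\<in>I. (f i)^2) * card I" using sum_squared_le_sum_of_squares[of "\<lambda>i. \<bar>f i\<bar>" I] by simp
  have 2: "(\<Sum>i\<in>I. (f i)^2)^2 \<le> (\<Sum>i\<in>I. ((f i)^2)^2) * card I" by (rule sum_squared_le_sum_of_squares)
  have "(\<Sum>i\<in>I. \<bar>f i\<bar>)^4 = ((\<Sum>i\<in>I. \<bar>f i\<bar>)^2)^2" by simp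
  also have "\<dots> \<le> ((\<Sum>i\<in>I. (f i)^2) * card I)^2" by (intro power_mono 1) auto
  also have "\<dots> = (\<Sum>i\<in>I. (f i)^2)^2 * (card I)^2" by (simp add: power_mult_distrib)
  also have "\<dots> \<le> ((\<Sum>i\<in>I. ((f i)^2)^2) * card I) * (card I)^2" using 2 by (intro mult_right_mono) auto
  finally show ?thesis by (simp add: power2_eq_square[of "real (card I)"] power3_eq_cube mult_ac)
qed

lemma ball_measure: "r \<ge> 0 \<Longrightarrow> measure lborel (ball (x::'a::euclidean_space) r) = r ^ DIM('a) * measure lborel (ball (0::'a) 1)"
  by (rule content_ball_conv_unit_ball)

lemma integrable_ind_ball: "integrable lborel (indicator (ball (x::'a::euclidean_space) r) :: 'a \<Rightarrow> real)"
  using emeasure_bounded_finite[of "ball x r"] by simp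

lemma integrable_ind_mult: "integrable lborel f \<Longrightarrow> integrable lborel (\<lambda>y. indicator (ball (x::'a::euclidean_space) r) y * f y :: real)"
  using integrable_mult_indicator[of "ball x r" lborel f] by simp

lemma ball_mean2:
  fixes f :: "'a::euclidean_space \<Rightarrow> real"
  assumes [measurable]: "f \<in> borel_measurable borel" and i: "integrable lborel (\<lambda>x. (f x)^2)"
  shows "(LBINT y. indicator (ball x r) y * \<bar>f y\<bar>)^2 \<le> measure lborel (ball x r) * (LBINT y. indicator (ball x r) y * (f y)^2)"
proof -
  have [measurable]: "ball x r \<in> sets borel" by simp
  have e: "(indicator (ball x r) y :: real)^2 = indicator (ball x r) y" "(indicator (ball x r) y * \<bar>f y\<bar>)^2 = indicator (ball x r) y * (f y)^2" for y
    by (auto simp: indicator_def)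
  have "(LBINT y. \<bar>indicator (ball x r) y * (indicator (ball x r) y * \<bar>f y\<bar>)\<bar>)^2 \<le> (LBINT y. (indicator (ball x r) y)^2) * (LBINT y. (indicator (ball x r) y * \<bar>f y\<bar>)^2)"
    by (rule CS_real(2), measurable, measurable) (simp_all only: e integrable_ind_ball integrable_ind_mult[OF i])
  moreover have "\<bar>indicator (ball x r) y * (indicator (ball x r) y * \<bar>f y\<bar>)\<bar> = indicator (ball x r) y * \<bar>f y\<bar>" for y
    by (auto simp: indicator_def)
  ultimately show ?thesis unfolding e by simp
qed

lemma ball_mean4:
  fixes f :: "'a::euclidean_space \<Rightarrow> real"
  assumes [measurable]: "f \<in> borel_measurable borel" and i: "integrable lborel (\<lambda>x. (f x)^4)"
  shows "(LBINT y. indicator (ball x r) y * (f y)^2)^2 \<le> measure lborel (ball x r) * (LBINT y. indicator (ball x r) y * (f y)^4)"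
    "integrable lborel (\<lambda>y. indicator (ball x r) y * (f y)^2)"
    "(LBINT y. indicator (ball x r) y * \<bar>f y\<bar>)^4 \<le> measure lborel (ball x r)^3 * (LBINT y. indicator (ball x r) y * (f y)^4)"
    "integrable lborel (\<lambda>y. indicator (ball x r) y * f y)"
proof -
  let ?I = "\<lambda>y. indicator (ball x r) y :: real"
  have [measurable]: "ball x r \<in> sets borel" by simp
  show 1: "(LBINT y. ?I y * (f y)^2)^2 \<le> measure lborel (ball x r) * (LBINT y. ?I y * (f y)^4)"
    using ball_mean2[of "\<lambda>y. (f y)^2" x r] i by (simp add: power_mult[symmetric])
  have e: "(?I y)^2 = ?I y" "(?I y * (f y)^2)^2 = ?I y * (f y)^4" "?I y * (?I y * (f y)^2) = ?I y * (f y)^2" 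
    "(?I y * f y)^2 = ?I y * (f y)^2" "?I y * (?I y * f y) = ?I y * f y" for y by (auto simp: indicator_def)
  show 2: "integrable lborel (\<lambda>y. ?I y * (f y)^2)"
  proof -
    have "integrable lborel (\<lambda>y. ?I y * (?I y * (f y)^2))"
      by (rule CS_real(1), measurable, measurable) (simp_all only: e integrable_ind_ball integrable_ind_mult[OF i])
    then show ?thesis by (simp only: e)
  qed
  show "integrable lborel (\<lambda>y. ?I y * f y)"
  proof -
    have "integrable lborel (\<lambda>y. ?I y * (?I y * f y))"
      by (rule CS_real(1), measurable, measurable) (simp_all only: e integrable_ind_ball 2)
    then show ?thesis by (simp only: e)
  qed
  have i2: "integrable lborel (\<lambda>y. (?I y * f y)^2)" using 2 by (simp add: e)
  have "(LBINT y. ?I y * \<bar>?I y * f y\<bar>)^2 \<le> measure lborel (ball x r) * (LBINT y. ?I y * (?I y * f y)^2)"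
    by (rule ball_mean2[OF _ i2]) simp
  moreover have "?I y * \<bar>?I y * f y\<bar> = ?I y * \<bar>f y\<bar>" for y by (auto simp: indicator_def)
  ultimately have 3: "(LBINT y. ?I y * \<bar>f y\<bar>)^2 \<le> measure lborel (ball x r) * (LBINT y. ?I y * (f y)^2)" by (simp add: e)
  have "(LBINT y. ?I y * \<bar>f y\<bar>)^4 = ((LBINT y. ?I y * \<bar>f y\<bar>)^2)^2" by simp
  also have "\<dots> \<le> (measure lborel (ball x r) * (LBINT y. ?I y * (f y)^2))^2" by (intro power_mono 3) auto
  also have "\<dots> = measure lborel (ball x r)^2 * (LBINT y. ?I y * (f y)^2)^2" by (simp add: power_mult_distrib)
  also have "\<dots> \<le> measure lborel (ball x r)^2 * (measure lborel (ball x r) * (LBINT y. ?I y * (f y)^4))" by (intro mult_left_mono 1) auto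
  finally show "(LBINT y. ?I y * \<bar>f y\<bar>)^4 \<le> measure lborel (ball x r)^3 * (LBINT y. ?I y * (f y)^4)"
    by (simp add: power2_eq_square power3_eq_cube mult.assoc)
qed

lemma ind_ball_mono:
  fixes f :: "'a::euclidean_space \<Rightarrow> real"
  assumes "integrable lborel f" "\<And>y. f y \<ge> 0" "ball x r \<subseteq> ball x' r'"
  shows "(LBINT y. indicator (ball x r) y * f y) \<le> (LBINT y. indicator (ball x' r') y * f y)"
proof (rule integral_mono)
  fix y show "indicator (ball x r) y * f y \<le> indicator (ball x' r') y * f y"
    using assms(2)[of y] assms(3) by (auto simp: indicator_def)
qed (rule integrable_ind_mult[OF assms(1)])+

text \<open>Split \<open>h\<close> at height \<open>n\<close>: the excess has small total mass, and
  the bounded part is small on small balls by volume. Neither bound depends on the centre.\<close>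

lemma small_ball_integral:
  fixes h :: "'a::euclidean_space \<Rightarrow> real"
  assumes h: "integrable lborel h" "\<And>x. h x \<ge> 0" and e: "e > 0"
  shows "\<exists>r>0. \<forall>x. (LBINT y. indicator (ball x r) y * h y) \<le> e"
proof -
  have [measurable]: "h \<in> borel_measurable borel" using borel_measurable_integrable[OF h(1)] by simp
  have ih: "integrable lborel (\<lambda>y. h y - min (h y) (real n))" for n
    by (rule Bochner_Integration.integrable_bound[OF h(1)]) (use h(2) in \<open>auto simp: min_def\<close>)
  have "(\<lambda>n. LBINT y. h y - min (h y) (real n)) \<longlonglongrightarrow> (\<integral>y. (0::real) \<partial>(lborel::'a measure))"
  proof (rule integral_dominated_convergence[OF _ _ h(1)])
    show "AE y in lborel. (\<lambda>n. h y - min (h y) (real n)) \<longlonglongrightarrow> 0"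
    proof (rule AE_I2, rule tendsto_eventually)
      fix y
      obtain N :: nat where "h y \<le> real N" using real_arch_simple by blast
      then show "\<forall>\<^sub>F n in sequentially. h y - min (h y) (real n) = 0"
        by (intro eventually_sequentiallyI[of N]) auto
    qed
  qed (use h(2) in \<open>auto simp: min_def\<close>)
  then have "\<forall>\<^sub>F n in sequentially. (LBINT y. h y - min (h y) (real n)) < e/2" using e by (intro order_tendstoD(2)) auto
  then obtain n :: nat where n: "(LBINT y. h y - min (h y) (real n)) < e/2" using eventually_happens'[OF sequentially_bot] by blast
  define \<omega> where "\<omega> = measure lborel (ball (0::'a) 1)"
  define r where "r = min 1 (e / (2 * (real n * \<omega> + 1)))"
  have w0: "\<omega> \<ge> 0" "real n * \<omega> + 1 > 0" by (auto simp: \<omega>_def add_nonneg_pos)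
  have r: "r > 0" "r \<le> 1" using e w0 by (auto simp: r_def)
  have "(LBINT y. indicator (ball x r) y * h y) \<le> e" for x
  proof -
    have "(LBINT y. indicator (ball x r) y * h y) \<le> (LBINT y. (h y - min (h y) (real n)) + real n * indicator (ball x r) y)"
    proof (rule integral_mono)
      show "integrable lborel (\<lambda>y. indicator (ball x r) y * h y)" by (rule integrable_ind_mult[OF h(1)])
      show "integrable lborel (\<lambda>y. (h y - min (h y) (real n)) + real n * indicator (ball x r) y)"
        by (intro Bochner_Integration.integrable_add ih integrable_mult_right integrable_ind_ball)
      show "indicator (ball x r) y * h y \<le> (h y - min (h y) (real n)) + real n * indicator (ball x r) y" for y
        using h(2)[of y] by (auto simp: indicator_def min_def)
    qed
    also have "\<dots> = (LBINT y. h y - min (h y) (real n)) + real n * measure lborel (ball x r)"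
      using ih integrable_ind_ball[of x r] by simp
    also have "real n * measure lborel (ball x r) = (real n * \<omega>) * r ^ DIM('a)" using r ball_measure[of r x] unfolding \<omega>_def by (simp only: mult_ac less_imp_le)
    also have "\<dots> \<le> (real n * \<omega> + 1) * r"
    proof (rule mult_mono)
      have "r ^ DIM('a) \<le> r ^ 1" using r by (intro power_decreasing) (auto simp: Suc_leI)
      then show "r ^ DIM('a) \<le> r" by simp
    qed (use r w0 in auto)
    also have "\<dots> \<le> (real n * \<omega> + 1) * (e / (2 * (real n * \<omega> + 1)))" using w0 by (intro mult_left_mono) (auto simp: r_def)
    also have "\<dots> = e/2"
    proof -
      have "q * (e / (2 * q)) = e/2" if "q > 0" for q :: real using that by simp
      then show ?thesis using w0(2) .
    qed
    finally show ?thesis using n by simp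
  qed
  then show ?thesis using r by blast
qed

lemma partial_bump_sum:
  fixes f :: "'i \<Rightarrow> 'a::euclidean_space \<Rightarrow> real"
  shows "finite I \<Longrightarrow> (\<And>i. i \<in> I \<Longrightarrow> bump (f i)) \<Longrightarrow> b \<in> Basis \<Longrightarrow>
   partial_dir b (\<lambda>x. \<Sum>i\<in>I. f i x) = (\<lambda>x. \<Sum>i\<in>I. partial_dir b (f i) x)"
proof (rule ext, rule partial_dirI')
  assume I: "finite I" "\<And>i. i \<in> I \<Longrightarrow> bump (f i)" "b \<in> Basis"
  fix x
  show "((\<lambda>t. \<Sum>i\<in>I. f i (x + t *\<^sub>R b)) has_real_derivative (\<Sum>i\<in>I. partial_dir b (f i) x)) (at 0)"
    by (rule DERIV_sum[of I "\<lambda>t i. f i (x + t *\<^sub>R b)"]) (rule bump_DERIV0[OF I(2,3)])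
qed

text \<open>Taking \<open>q\<close> at most half of \<open>t^p\<close> leaves the other half for the
  source term. The first summand of the constant covers the \<open>p\<close> starting indices, the
  second one the source.\<close>

lemma decay_iteration:
  fixes \<phi> :: "nat \<Rightarrow> real"
  assumes p: "p \<ge> 1" and t: "0 < t" "t \<le> 1" and B: "B \<ge> 0" and M: "M \<ge> 0" "\<And>j. j \<ge> J \<Longrightarrow> \<phi> j \<le> M" and q: "0 \<le> q" "q \<le> t^p / 2"
    and pos: "\<And>j. \<phi> j \<ge> 0"
    and step: "\<And>j. j \<ge> J \<Longrightarrow> \<phi> (j + p) \<le> q * \<phi> j + B * t^j"
    and j: "j \<ge> J"
  shows "\<phi> j \<le> (M / t^(J+p) + 2 * B / t^p) * t^j"
  using j
proof (induction j rule: less_induct)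
  case (less j)
  define C where "C = M / t^(J+p) + 2 * B / t^p"
  have C0: "C \<ge> 0" using M B t by (simp add: C_def)
  show ?case unfolding C_def[symmetric]
  proof (cases "j < J + p")
    case True
    have "\<phi> j \<le> M" using M less by auto
    also have "M = (M / t^(J+p)) * t^(J+p)" using t by simp
    also have "\<dots> \<le> C * t^j"
      using t M B True by (intro mult_mono power_decreasing) (auto simp: C_def)
    finally show "\<phi> j \<le> C * t^j" .
  next
    case False
    define i where "i = j - p"
    have i: "j = i + p" "i \<ge> J" "i < j" using False p by (auto simp: i_def)
    have "\<phi> j \<le> q * \<phi> i + B * t^i" using step[OF i(2)] i(1) by simp
    also have "\<dots> \<le> (t^p/2) * (C * t^i) + B * t^i"
      using less.IH[OF i(3,2)] q pos t C0 unfolding C_def[symmetric] by (intro add_right_mono mult_mono) auto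
    also have "B * t^i \<le> (t^p/2) * (C * t^i)"
    proof -
      have "B = (t^p / 2) * (2 * B / t^p)" using t by simp
      also have "\<dots> \<le> (t^p / 2) * C" using t M by (intro mult_left_mono) (auto simp: C_def)
      finally have "B * t^i \<le> ((t^p / 2) * C) * t^i" using t by (intro mult_right_mono) auto
      then show ?thesis by (simp add: mult_ac)
    qed
    also have "(t^p/2) * (C * t^i) + (t^p/2) * (C * t^i) = C * t^j" unfolding i(1) by (simp add: power_add)
    finally show "\<phi> j \<le> C * t^j" by simp
  qed
qed

text \<open>Kernel form of the Laplace equation on \<open>S\<close>: testing it with a translate of
  \<open>kapj (Suc j)\<close> gives this identity, from which the regularity is derived. The ball
  condition keeps the supports of all three kernels inside \<open>S\<close>.\<close>

definition repr :: "'a::euclidean_space set \<Rightarrow> ('a \<Rightarrow> real) \<Rightarrow> ('a \<Rightarrow> real) \<Rightarrow> bool" where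
  "repr S w G \<longleftrightarrow> (\<forall>j x. cball x (1 / 2^j) \<subseteq> S \<longrightarrow>
     conv (rhoj j) w x - conv (rhoj (Suc j)) w x = conv (kapj (Suc j)) G x)"

text \<open>Kernel form of \<open>d\<close> being the weak derivative of \<open>w\<close> along
  \<open>b\<close>.\<close>

definition grepr :: "'a::euclidean_space set \<Rightarrow> ('a \<Rightarrow> real) \<Rightarrow> 'a \<Rightarrow> ('a \<Rightarrow> real) \<Rightarrow> bool" where
  "grepr S w b d \<longleftrightarrow> (\<forall>j x. cball x (1 / 2^j) \<subseteq> S \<longrightarrow> conv (partial_dir b (rhoj j)) w x = conv (rhoj j) d x)"

lemma kapj_Suc_support: "1 / 2^j \<le> norm x \<Longrightarrow> kapj (Suc j) x = 0"
  by (rule kapj_support) simp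

text \<open>The functions live on the whole space and are integrable there, while the equation is
  imposed on \<open>S\<close>; this is the situation after multiplication by the indicator of a
  ball. \<open>w4\<close> is the critical integrability: with it the right-hand side pairs with test
  functions in L4.\<close>

locale critical_system =
  fixes w :: "'i::finite \<Rightarrow> 'a::euclidean_space \<Rightarrow> real" and d :: "'i \<Rightarrow> 'a \<Rightarrow> 'a \<Rightarrow> real"
    and G :: "'i \<Rightarrow> 'a \<Rightarrow> real" and S :: "'a set" and C :: real
  assumes dim: "DIM('a) \<le> 4"
    and wi: "\<And>i. integrable lborel (w i)" and Gi: "\<And>i. integrable lborel (G i)"
    and di: "\<And>i b. b \<in> Basis \<Longrightarrow> integrable lborel (d i b)"
    and w4: "\<And>i. integrable lborel (\<lambda>x. (w i x)^4)"
    and d2: "\<And>i b. b \<in> Basis \<Longrightarrow> integrable lborel (\<lambda>x. (d i b x)^2)"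
    and C0: "C \<ge> 0"
    and Gb: "\<And>i x. \<bar>G i x\<bar> \<le> C * ((\<Sum>k\<in>UNIV. \<bar>w k x\<bar>) * ((\<Sum>k\<in>UNIV. \<Sum>b\<in>Basis. \<bar>d k b x\<bar>) + (\<Sum>k\<in>UNIV. \<bar>w k x\<bar>)^2))"
    and rep: "\<And>i. repr S (w i) (G i)" and grep: "\<And>i b. b \<in> Basis \<Longrightarrow> grepr S (w i) b (d i b)"
begin

definition a :: "'a \<Rightarrow> real" where "a x = (\<Sum>k\<in>UNIV. \<bar>w k x\<bar>)"
definition dd :: "'a \<Rightarrow> real" where "dd x = (\<Sum>k\<in>UNIV. \<Sum>b\<in>Basis. \<bar>d k b x\<bar>)"
definition bb :: "'a \<Rightarrow> real" where "bb x = dd x + (a x)^2"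
text \<open>The radius is \<open>2/2^j\<close> because a kernel of radius 2^-j centred within 2^-j
  of \<open>x\<close> sees points of that ball.\<close>

definition alp :: "'a \<Rightarrow> nat \<Rightarrow> real" where "alp x j = (LBINT y. indicator (ball x (2/2^j)) y * (a y)^4)"
definition en :: "'a \<Rightarrow> nat \<Rightarrow> real" where "en x j = (LBINT y. indicator (ball x (2/2^j)) y * (dd y)^2)"
definition om :: real where "om = measure lborel (ball (0::'a) 1)"

lemma wm [measurable]: "w i \<in> borel_measurable borel" and Gm [measurable]: "G i \<in> borel_measurable borel"
  and dm [measurable]: "b \<in> Basis \<Longrightarrow> d i b \<in> borel_measurable borel"
  using borel_measurable_integrable[OF wi] borel_measurable_integrable[OF Gi] borel_measurable_integrable[OF di] by auto

lemma am [measurable]: "a \<in> borel_measurable borel" and ddm [measurable]: "dd \<in> borel_measurable borel"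
  unfolding a_def[abs_def] dd_def[abs_def] by measurable

lemma bbm [measurable]: "bb \<in> borel_measurable borel" unfolding bb_def[abs_def] by measurable

lemma a0: "a x \<ge> 0" and dd0: "dd x \<ge> 0" and bb0: "bb x \<ge> 0"
  unfolding a_def dd_def bb_def by (auto intro!: sum_nonneg add_nonneg_nonneg)

lemma wa: "\<bar>w i x\<bar> \<le> a x" unfolding a_def by (rule member_le_sum) auto

lemma ddd: "b \<in> Basis \<Longrightarrow> \<bar>d i b x\<bar> \<le> dd x"
proof -
  assume b: "b \<in> Basis"
  have "\<bar>d i b x\<bar> \<le> (\<Sum>b\<in>Basis. \<bar>d i b x\<bar>)" by (rule member_le_sum) (use b in auto)
  also have "\<dots> \<le> dd x" unfolding dd_def by (rule member_le_sum) (auto intro: sum_nonneg)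
  finally show ?thesis .
qed

lemma Gb': "\<bar>G i x\<bar> \<le> C * (a x * bb x)" using Gb unfolding a_def bb_def dd_def .

lemma a4_le: "(a x)^4 \<le> real CARD('i)^3 * (\<Sum>i\<in>UNIV. (w i x)^4)"
  unfolding a_def by (rule sum_pow4_le) simp

lemma ia4: "integrable lborel (\<lambda>x. (a x)^4)"
  by (rule Bochner_Integration.integrable_bound[of lborel "\<lambda>x. real CARD('i)^3 * (\<Sum>i\<in>UNIV. (w i x)^4)"])
    (auto intro!: AE_I2 order_trans[OF a4_le abs_ge_self] w4)

lemma dd2_le: "(dd x)^2 \<le> real (CARD('i) * DIM('a)) * (\<Sum>i\<in>UNIV. \<Sum>b\<in>Basis. (d i b x)^2)"
proof -
  have "(dd x)^2 = (\<Sum>p\<in>UNIV \<times> Basis. \<bar>d (fst p) (snd p) x\<bar>)^2"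
    unfolding dd_def by (simp add: sum.cartesian_product split_beta)
  also have "\<dots> \<le> (\<Sum>p\<in>UNIV \<times> Basis. \<bar>d (fst p) (snd p) x\<bar>^2) * card (UNIV \<times> Basis :: ('i \<times> 'a) set)"
    by (rule sum_squared_le_sum_of_squares)
  also have "\<dots> = real (CARD('i) * DIM('a)) * (\<Sum>i\<in>UNIV. \<Sum>b\<in>Basis. (d i b x)^2)"
    by (simp add: sum.cartesian_product split_beta card_cartesian_product mult.commute)
  finally show ?thesis .
qed

lemma idd2: "integrable lborel (\<lambda>x. (dd x)^2)"
  by (rule Bochner_Integration.integrable_bound[of lborel "\<lambda>x. real (CARD('i) * DIM('a)) * (\<Sum>i\<in>UNIV. \<Sum>b\<in>Basis. (d i b x)^2)"])
    (rule integrable_mult_right, intro Bochner_Integration.integrable_sum d2, assumption, measurable,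
     rule AE_I2, use order_trans[OF dd2_le abs_ge_self] in simp)

lemma bb2_le: "(bb x)^2 \<le> 2 * ((dd x)^2 + (a x)^4)"
proof -
  have "0 \<le> (dd x - (a x)^2)^2" by simp
  then show ?thesis unfolding bb_def by (simp add: power2_eq_square power4_eq_xxxx algebra_simps)
qed

lemma ibb2: "integrable lborel (\<lambda>x. (bb x)^2)"
proof (rule Bochner_Integration.integrable_bound[of lborel "\<lambda>x. 2 * ((dd x)^2 + (a x)^4)"])
  show "integrable lborel (\<lambda>x. 2 * ((dd x)^2 + (a x)^4))"
    by (rule integrable_mult_right, rule Bochner_Integration.integrable_add[OF idd2 ia4])
  show "AE x in lborel. norm ((bb x)^2) \<le> norm (2 * ((dd x)^2 + (a x)^4))"
    using bb2_le by (intro AE_I2) (metis abs_ge_self order_trans power2_abs real_norm_def abs_of_nonneg zero_le_power2)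
qed measurable

lemma alp0: "alp x j \<ge> 0" and en0: "en x j \<ge> 0" and om0: "om \<ge> 0"
  unfolding alp_def en_def om_def by (auto intro!: Bochner_Integration.integral_nonneg)

lemma bb_int: "(LBINT y. indicator (ball x (2/2^j)) y * (bb y)^2) \<le> 2 * (en x j + alp x j)"
proof -
  have "(LBINT y. indicator (ball x (2/2^j)) y * (bb y)^2)
     \<le> (LBINT y. 2 * (indicator (ball x (2/2^j)) y * (dd y)^2 + indicator (ball x (2/2^j)) y * (a y)^4))"
    by (rule integral_mono) (use integrable_ind_mult[OF ibb2] integrable_ind_mult[OF idd2] integrable_ind_mult[OF ia4] bb2_le in \<open>auto simp: indicator_def\<close>)
  also have "\<dots> = 2 * (en x j + alp x j)"
    unfolding en_def alp_def using integrable_ind_mult[OF idd2] integrable_ind_mult[OF ia4] by simp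
  finally show ?thesis .
qed

lemma ball_meas: "measure lborel (ball (x::'a) (2/2^j)) = 2^DIM('a) * om / 2^(j * DIM('a))"
  unfolding om_def by (subst ball_measure) (auto simp: power_divide power_mult)

text \<open>The part of the solution averaged at the large scale decays like a smooth function.\<close>

lemma average_bound:
  fixes f :: "'a \<Rightarrow> real"
  assumes f: "integrable lborel f" and q: "q \<ge> 1"
    and m: "(LBINT y. indicator (ball x0 (2/2^J)) y * \<bar>f y\<bar>)^q \<le> measure lborel (ball x0 (2/2^J))^(q - 1) * E"
    and p: "p \<ge> 1" and E: "E \<ge> 0"
  shows "(NBINT x. indicator (ball x0 (2/2^(J+p))) x * ennreal (\<bar>conv (rhoj J) f x\<bar>^q))
    \<le> ennreal ((kbd TYPE('a) * 2^DIM('a) * om)^q * ((1/2^(p*DIM('a))) * E))"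
proof -
  define I where "I = (LBINT y. indicator (ball x0 (2/2^J)) y * \<bar>f y\<bar>)"
  define V where "V = measure lborel (ball x0 (2/2^J))"
  define c where "c = kbd TYPE('a) * 2^(J * DIM('a))"
  have nn: "V \<ge> 0" "c \<ge> 0" using kbd_ge0[where 'a='a] by (auto simp: V_def c_def)
  have cb: "\<bar>conv (rhoj J) f x\<bar> \<le> c * I" if x: "x \<in> ball x0 (2/2^(J+p))" for x
  proof -
    \<comment> \<open>\<open>p \<ge> 1\<close> shrinks the ball to radius at most 2^-J, so the
      kernels centred in it stay inside the ball of radius \<open>2/2^J\<close>.\<close>
    have "(2::real)^1 \<le> 2^p" using p by (intro power_increasing) auto
    then have "2/2^(J+p) \<le> (1::real)/2^J" by (simp add: power_add field_simps)
    then have "dist x0 x < 1/2^J" using x by auto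
    then have sub: "ball x (1/2^J) \<subseteq> ball x0 (2/2^J)"
    proof -
      have "dist x0 y < 2/2^J" if "dist x y < 1/2^J" for y
        using dist_triangle[of x0 y x] that \<open>dist x0 x < 1/2^J\<close> by simp
      then show ?thesis by auto
    qed
    have "\<bar>conv (rhoj J) f x\<bar> \<le> c * (LBINT y. indicator (ball x (1/2^J)) y * \<bar>f y\<bar>)"
      unfolding c_def by (rule conv_bound[OF bump_rhoj rhoj_bound rhoj_support f])
    also have "\<dots> \<le> c * I" unfolding I_def using sub f nn by (intro mult_left_mono ind_ball_mono) auto
    finally show ?thesis .
  qed
  have I0: "I \<ge> 0" unfolding I_def by (intro Bochner_Integration.integral_nonneg) auto
  have "(NBINT x. indicator (ball x0 (2/2^(J+p))) x * ennreal (\<bar>conv (rhoj J) f x\<bar>^q))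
     \<le> (NBINT x. ennreal ((c * I)^q) * indicator (ball x0 (2/2^(J+p))) x)"
    by (rule nn_integral_mono) (auto simp: indicator_def intro!: ennreal_leI power_mono cb)
  also have "\<dots> = ennreal ((c * I)^q) * emeasure lborel (ball x0 (2/2^(J+p)))" by (rule nn_integral_cmult_indicator) simp
  also have "emeasure lborel (ball x0 (2/2^(J+p))) = ennreal (measure lborel (ball x0 (2/2^(J+p))))"
    using emeasure_bounded_finite[of "ball x0 (2/2^(J+p))"] by (intro emeasure_eq_ennreal_measure) auto
  also have "ennreal ((c * I)^q) * \<dots> = ennreal ((c * I)^q * measure lborel (ball x0 (2/2^(J+p))))"
    using I0 nn by (simp add: ennreal_mult')
  also have "\<dots> \<le> ennreal ((kbd TYPE('a) * 2^DIM('a) * om)^q * ((1/2^(p*DIM('a))) * E))"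
  proof (rule ennreal_leI)
    have V: "V = 2^DIM('a) * om / 2^(J * DIM('a))" unfolding V_def by (rule ball_meas)
    have "(c * I)^q * measure lborel (ball x0 (2/2^(J+p))) = c^q * I^q * (V / 2^(p * DIM('a)))"
      unfolding ball_meas V by (simp add: power_mult_distrib power_add add_mult_distrib)
    also have "\<dots> \<le> c^q * (V^(q-1) * E) * (V / 2^(p * DIM('a)))"
      using m nn unfolding I_def[symmetric] V_def[symmetric] by (intro mult_right_mono mult_left_mono) auto
    also have "\<dots> = c^q * (V^(q-1) * V) * ((1 / 2^(p * DIM('a))) * E)" by (simp add: mult_ac)
    also have "V^(q-1) * V = V^q" using q by (simp add: power_eq_if mult.commute)
    also have "c^q * V^q = (kbd TYPE('a) * 2^DIM('a) * om)^q"
      unfolding power_mult_distrib[symmetric] c_def V by (simp add: mult_ac)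
    finally show "(c * I)^q * measure lborel (ball x0 (2/2^(J+p))) \<le> (kbd TYPE('a) * 2^DIM('a) * om)^q * ((1/2^(p*DIM('a))) * E)" .
  qed
  finally show ?thesis .
qed

text \<open>\<open>v\<close> is the potential of the right-hand side cut off to the ball of radius
  \<open>2/2^J\<close>, taken with the summed kernel \<open>\<Gamma>\<close> whose Laplacian
  telescopes to \<open>rhoj J\<close> minus \<open>rhoj K\<close>. On the ball of half that radius
  the cut-off is invisible, so there \<open>v\<close> is the difference of two mollifications of the
  solution. The bounds do not depend on \<open>K\<close>.\<close>

lemma potential_exists:
  assumes J: "J \<ge> 2" "K \<ge> J" and x0: "cball x0 (2/2^J) \<subseteq> S"
  shows "\<exists>v Z. bump v \<and> 0 \<le> Z \<and> Z \<le> 4608 * C^2 * sqrt (alp x0 J) * (en x0 J + alp x0 J) \<and>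
    (LBINT x. (v x)^4) \<le> 1296 * Z^2 \<and> (\<forall>b\<in>Basis. (LBINT x. (partial_dir b v x)^2) \<le> Z) \<and>
    (\<forall>x\<in>ball x0 (1/2^J). v x = conv (rhoj J) (w i) x - conv (rhoj K) (w i) x \<and>
      (\<forall>b\<in>Basis. partial_dir b v x = conv (rhoj J) (d i b) x - conv (rhoj K) (d i b) x))"
proof -
  define B where "B = ball x0 (2/2^J)"
  have [measurable]: "B \<in> sets borel" by (simp add: B_def)
  define g where "g x = indicator B x * G i x" for x
  have gi: "integrable lborel g" unfolding g_def B_def by (rule integrable_ind_mult[OF Gi])
  define \<Gamma> where "\<Gamma> x = (\<Sum>j\<in>{J..<K}. kapj (Suc j) x)" for x :: 'a
  have b\<Gamma>: "bump \<Gamma>" unfolding \<Gamma>_def by (intro bump_sum bump_kapj) auto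
  have s\<Gamma>: "\<Gamma> x = 0" if "1/2^J \<le> norm x" for x
    unfolding \<Gamma>_def
  proof (intro sum.neutral ballI kapj_Suc_support)
    fix j assume "j \<in> {J..<K}"
    then have "(1::real)/2^j \<le> 1/2^J" by (intro divide_left_mono power_increasing) auto
    then show "1/2^j \<le> norm x" using that by linarith
  qed
  define v where "v = conv \<Gamma> g"
  \<comment> \<open>The radius \<open>3/2^J\<close> is \<open>2/2^J\<close> from the cut-off of
    \<open>g\<close> plus \<open>1/2^J\<close> from the kernel; \<open>J \<ge> 2\<close> brings it
    below 1, as the Sobolev inequality requires.\<close>
  have v0: "v x = 0" if "3/2^J \<le> dist x x0" for x
    unfolding v_def
  proof (rule conv_eq_0[OF s\<Gamma>])
    fix y assume "y \<in> ball x (1/2^J)"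
    then have "dist x y < 1/2^J" by simp
    then have "2/2^J \<le> dist x0 y" using that dist_triangle[of x x0 y] by (simp add: dist_commute)
    then show "g y = 0" by (simp add: g_def B_def)
  qed
  have bv: "bump v"
  proof (rule bumpI[of _ "norm x0 + 3/2^J"])
    show "HC k UNIV v" for k unfolding v_def by (rule HC_conv[OF b\<Gamma> gi])
    fix x :: 'a assume "norm x0 + 3/2^J \<le> norm x"
    then show "v x = 0" by (intro v0) (use norm_triangle_ineq2[of x x0] in \<open>simp add: dist_norm\<close>)
  qed
  have pv: "partial_dir b v = conv (partial_dir b \<Gamma>) g" if "b \<in> Basis" for b
    unfolding v_def by (rule partial_conv[OF b\<Gamma> that gi])
  have p2\<Gamma>: "partial_dir b (partial_dir b \<Gamma>) = (\<lambda>x. \<Sum>j\<in>{J..<K}. partial_dir b (partial_dir b (kapj (Suc j))) x)" if "b \<in> Basis" for b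
  proof -
    have "partial_dir b \<Gamma> = (\<lambda>x. \<Sum>j\<in>{J..<K}. partial_dir b (kapj (Suc j)) x)"
      unfolding \<Gamma>_def by (rule partial_bump_sum) (auto intro: bump_kapj that)
    then show ?thesis by (simp only:) (rule partial_bump_sum, auto intro: bump_partial bump_kapj that)
  qed
  have lap: "(\<Sum>b\<in>Basis. partial_dir b (partial_dir b v) x) = conv (rhoj J) g x - conv (rhoj K) g x" for x
  proof -
    have "(\<Sum>b\<in>Basis. partial_dir b (partial_dir b v) x) = (\<Sum>b\<in>Basis. conv (partial_dir b (partial_dir b \<Gamma>)) g x)"
      by (intro sum.cong refl) (simp add: pv partial_conv[OF bump_partial[OF b\<Gamma>] _ gi])
    also have "\<dots> = conv (\<lambda>x. \<Sum>b\<in>Basis. partial_dir b (partial_dir b \<Gamma>) x) g x"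
      by (rule conv_sum[symmetric]) (auto intro: bump_partial b\<Gamma> gi)
    also have "(\<lambda>x. \<Sum>b\<in>Basis. partial_dir b (partial_dir b \<Gamma>) x) = (\<lambda>x. rhoj J x - rhoj K x)"
    proof
      fix x :: 'a
      have "(\<Sum>b\<in>Basis. partial_dir b (partial_dir b \<Gamma>) x) = (\<Sum>j\<in>{J..<K}. \<Sum>b\<in>Basis. partial_dir b (partial_dir b (kapj (Suc j))) x)"
        by (simp add: p2\<Gamma>) (rule sum.swap)
      also have "\<dots> = (\<Sum>j\<in>{J..<K}. rhoj j x - rhoj (Suc j) x)" by (simp only: kapj_laplace)
      also have "\<dots> = - (\<Sum>j\<in>{J..<K}. rhoj (Suc j) x - rhoj j x)" by (simp add: sum_negf[symmetric])
      also have "\<dots> = rhoj J x - rhoj K x" by (subst sum_Suc_diff'[OF J(2)]) simp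
      finally show "(\<Sum>b\<in>Basis. partial_dir b (partial_dir b \<Gamma>) x) = rhoj J x - rhoj K x" .
    qed
    also have "conv (\<lambda>x. rhoj J x - rhoj K x) g x = conv (rhoj J) g x - conv (rhoj K) g x"
      by (rule conv_diff[OF bump_rhoj bump_rhoj gi])
    finally show ?thesis .
  qed
  define aB where "aB x = indicator B x * a x" for x
  define bB where "bB x = indicator B x * bb x" for x
  have [measurable]: "aB \<in> borel_measurable borel" "bB \<in> borel_measurable borel" unfolding aB_def bB_def by measurable
  have e: "(aB x)^4 = indicator B x * (a x)^4" "(bB x)^2 = indicator B x * (bb x)^2" for x
    by (auto simp: aB_def bB_def indicator_def)
  define Z where "Z = (LBINT x. (\<Sum>b\<in>Basis. \<bar>partial_dir b v x\<bar>)^2)"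
  have sv: "v x = 0" if "dist x x0 \<ge> 1" for x
  proof (rule v0)
    have "(2::real)^2 \<le> 2^J" using J by (intro power_increasing) auto
    then have "3/2^J \<le> (1::real)" by (simp add: field_simps)
    then show "3/2^J \<le> dist x x0" using that by linarith
  qed
  have gbd: "\<bar>g x\<bar> \<le> C * (aB x * bB x)" for x using Gb'[of i x] by (simp add: g_def aB_def bB_def indicator_def)
  have nnab: "aB x \<ge> 0" "bB x \<ge> 0" for x by (auto simp: aB_def bB_def a0 bb0)
  have iab: "integrable lborel (\<lambda>x. (aB x)^4)" "integrable lborel (\<lambda>x. (bB x)^2)"
    unfolding e B_def by (intro integrable_ind_mult ia4 ibb2)+
  have PE: "Z \<le> 2304 * C^2 * sqrt (LBINT x. (aB x)^4) * (LBINT x. (bB x)^2)" "(LBINT x. (v x)^4) \<le> 1296 * Z^2"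
    unfolding Z_def
    by (rule potential_energy[OF dim bv sv lap gi _ _ gbd nnab C0 iab], measurable)+
  have "(LBINT x. (aB x)^4) = alp x0 J" unfolding e alp_def B_def ..
  moreover have "(LBINT x. (bB x)^2) \<le> 2 * (en x0 J + alp x0 J)" unfolding e B_def by (rule bb_int)
  ultimately have "Z \<le> 2304 * C^2 * sqrt (alp x0 J) * (2 * (en x0 J + alp x0 J))"
    using PE(1) by (smt (verit) mult_left_mono alp0 mult_nonneg_nonneg real_sqrt_ge_zero zero_le_power2)
  then have Zle: "Z \<le> 4608 * C^2 * sqrt (alp x0 J) * (en x0 J + alp x0 J)" by (simp add: algebra_simps)
  have Z0: "Z \<ge> 0" unfolding Z_def by (intro Bochner_Integration.integral_nonneg) auto
  have pZ: "(LBINT x. (partial_dir b v x)^2) \<le> Z" if b: "b \<in> Basis" for b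
    unfolding Z_def
  proof (rule integral_mono)
    have i: "integrable lborel (\<lambda>x. (partial_dir b v x)^2)" if "b \<in> Basis" for b
      unfolding power2_eq_square by (intro bump_integrable bump_mult bump_partial bv that)
    then show "integrable lborel (\<lambda>x. (partial_dir b v x)^2)" using b .
    have [measurable]: "b \<in> Basis \<Longrightarrow> partial_dir b v \<in> borel_measurable borel" for b by (intro bump_measurable bump_partial bv)
    have m1: "(\<lambda>x. (\<Sum>b\<in>Basis. \<bar>partial_dir b v x\<bar>)^2) \<in> borel_measurable lborel" by measurable
    have i1: "integrable lborel (\<lambda>x. real DIM('a) * (\<Sum>b\<in>Basis. (partial_dir b v x)^2))" using i by auto
    have l1: "(\<Sum>b\<in>Basis. \<bar>partial_dir b v x\<bar>)^2 \<le> DIM('a) * (\<Sum>b\<in>Basis. (partial_dir b v x)^2)" for x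
      using sum_squared_le_sum_of_squares[of "\<lambda>b. \<bar>partial_dir b v x\<bar>" Basis] by (simp add: mult.commute)
    show "integrable lborel (\<lambda>x. (\<Sum>b\<in>Basis. \<bar>partial_dir b v x\<bar>)^2)"
      by (rule Bochner_Integration.integrable_bound[OF i1 m1], rule AE_I2)
        (simp only: real_norm_def abs_power2 order_trans[OF l1 abs_ge_self])
    fix x
    have "\<bar>partial_dir b v x\<bar>^2 \<le> (\<Sum>b\<in>Basis. \<bar>partial_dir b v x\<bar>)^2"
      by (intro power_mono member_le_sum b) auto
    then show "(partial_dir b v x)^2 \<le> (\<Sum>b\<in>Basis. \<bar>partial_dir b v x\<bar>)^2" by simp
  qed
  have sub: "cball x (1/2^j) \<subseteq> S" "ball x (1/2^j) \<subseteq> B" if "x \<in> ball x0 (1/2^J)" "j \<ge> J" for x j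
  proof -
    have "(1::real)/2^j \<le> 1/2^J" using that by (intro divide_left_mono power_increasing) auto
    then have "dist x0 y < 2/2^J" if "dist x y \<le> 1/2^j" for y
      using dist_triangle[of x0 y x] that \<open>x \<in> ball x0 (1/2^J)\<close> by simp
    then show "cball x (1/2^j) \<subseteq> S" "ball x (1/2^j) \<subseteq> B" using x0 by (force simp: B_def)+
  qed
  have vx: "v x = conv (rhoj J) (w i) x - conv (rhoj K) (w i) x" if x: "x \<in> ball x0 (1/2^J)" for x
  proof -
    have "v x = (\<Sum>j\<in>{J..<K}. conv (kapj (Suc j)) g x)" unfolding v_def \<Gamma>_def by (rule conv_sum) (auto intro: bump_kapj gi)
    also have "\<dots> = (\<Sum>j\<in>{J..<K}. conv (rhoj j) (w i) x - conv (rhoj (Suc j)) (w i) x)"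
    proof (rule sum.cong[OF refl])
      fix j assume j: "j \<in> {J..<K}"
      have "conv (kapj (Suc j)) g x = conv (kapj (Suc j)) (G i) x"
        by (rule conv_cong[OF kapj_Suc_support]) (use sub(2)[OF x, of j] j in \<open>auto simp: g_def indicator_def\<close>)
      also have "\<dots> = conv (rhoj j) (w i) x - conv (rhoj (Suc j)) (w i) x"
        using rep[of i] sub(1)[OF x, of j] j unfolding repr_def by auto
      finally show "conv (kapj (Suc j)) g x = conv (rhoj j) (w i) x - conv (rhoj (Suc j)) (w i) x" .
    qed
    also have "\<dots> = - (\<Sum>j\<in>{J..<K}. conv (rhoj (Suc j)) (w i) x - conv (rhoj j) (w i) x)" by (simp add: sum_negf[symmetric])
    also have "\<dots> = conv (rhoj J) (w i) x - conv (rhoj K) (w i) x" by (subst sum_Suc_diff'[OF J(2)]) simp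
    finally show ?thesis .
  qed
  have pvx: "partial_dir b v x = conv (rhoj J) (d i b) x - conv (rhoj K) (d i b) x" if x: "x \<in> ball x0 (1/2^J)" and b: "b \<in> Basis" for x b
  proof -
    have "((\<lambda>t. conv (rhoj J) (w i) (x + t *\<^sub>R b) - conv (rhoj K) (w i) (x + t *\<^sub>R b)) has_real_derivative conv (partial_dir b (rhoj J)) (w i) x - conv (partial_dir b (rhoj K)) (w i) x) (at 0)"
      by (intro DERIV_diff conv_DERIV bump_rhoj b wi)
    then have "((\<lambda>t. v (x + t *\<^sub>R b)) has_real_derivative conv (partial_dir b (rhoj J)) (w i) x - conv (partial_dir b (rhoj K)) (w i) x) (at 0)"
      using partial_cong[of "ball x0 (1/2^J)" x "\<lambda>x. conv (rhoj J) (w i) x - conv (rhoj K) (w i) x" v b] x vx by simp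
    then have "partial_dir b v x = conv (partial_dir b (rhoj J)) (w i) x - conv (partial_dir b (rhoj K)) (w i) x" by (rule partial_dirI')
    also have "\<dots> = conv (rhoj J) (d i b) x - conv (rhoj K) (d i b) x"
      using grep[OF b, of i] sub(1)[OF x, of J] sub(1)[OF x, of K] J unfolding grepr_def by auto
    finally show ?thesis .
  qed
  show ?thesis
    by (intro exI[of _ v] exI[of _ Z]) (use bv Z0 Zle PE(2) pZ vx pvx in blast)
qed

end

section \<open>Recursive inequalities and decay of the energy\<close>

context critical_system
begin

lemma pow4_split: "\<bar>x - y\<bar>^4 \<le> 8 * (\<bar>x\<bar>^4 + \<bar>y\<bar>^4)" for x y :: real
proof -
  have "\<bar>x - y\<bar> \<le> \<bar>x\<bar> + \<bar>y\<bar>" by simp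
  then have "\<bar>x - y\<bar>^4 \<le> (\<bar>x\<bar> + \<bar>y\<bar>)^4" by (intro power_mono) auto
  also have "(\<bar>x\<bar> + \<bar>y\<bar>)^4 = ((\<bar>x\<bar> + \<bar>y\<bar>)^2)^2" by simp
  also have "\<dots> \<le> (2 * (\<bar>x\<bar>^2 + \<bar>y\<bar>^2))^2"
    using sum_squares_bound[of "\<bar>x\<bar>" "\<bar>y\<bar>"] by (intro power_mono) (auto simp: power2_sum)
  also have "\<dots> = 4 * (\<bar>x\<bar>^2 + \<bar>y\<bar>^2)^2" by (subst power_mult_distrib) simp
  also have "\<dots> \<le> 4 * (2 * ((\<bar>x\<bar>^2)^2 + (\<bar>y\<bar>^2)^2))"
    using sum_squares_bound[of "\<bar>x\<bar>^2" "\<bar>y\<bar>^2"] unfolding power2_sum by (intro mult_left_mono) auto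
  finally show ?thesis by (simp add: power_mult[symmetric])
qed

lemma pow2_split: "\<bar>x - y\<bar>^2 \<le> 2 * (\<bar>x\<bar>^2 + \<bar>y\<bar>^2)" for x y :: real
proof -
  have "0 \<le> (x + y)^2" by simp
  then show ?thesis by (simp add: power2_eq_square algebra_simps)
qed

lemma nn_to_real:
  assumes "integrable lborel f" "\<And>x. f x \<ge> 0" "(NBINT x. ennreal (f x)) \<le> ennreal M" "M \<ge> 0"
  shows "(LBINT x. f x) \<le> M"
  using assms nn_integral_eq_integral[OF assms(1)] by (simp add: ennreal_le_iff)

lemma ennreal_ind: "ennreal (indicator A x * f) = indicator A x * ennreal f"
  by (auto simp: indicator_def)

text \<open>On the smaller ball the mollification at scale \<open>K\<close> is the one at scale
  \<open>J\<close> minus \<open>v\<close>. Both bounds are uniform in \<open>K\<close>, so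
  \<open>mollify_bound\<close> carries their sum to \<open>f\<close>. Used with exponent 4 for the
  solution and 2 for its gradient.\<close>

lemma split_bound:
  assumes f: "integrable lborel f" and fq: "integrable lborel (\<lambda>x. \<bar>f x\<bar>^q)" and c: "c \<ge> 0"
    and sp: "\<And>x y::real. \<bar>x - y\<bar>^q \<le> c * (\<bar>x\<bar>^q + \<bar>y\<bar>^q)"
    and av: "(NBINT x. indicator (ball x0 (2/2^(J+p))) x * ennreal (\<bar>conv (rhoj J) f x\<bar>^q)) \<le> ennreal M1"
    and h: "\<And>K. K \<ge> J \<Longrightarrow> \<exists>v. integrable lborel (\<lambda>x. \<bar>v x\<bar>^q) \<and> v \<in> borel_measurable borel \<and> (LBINT x. \<bar>v x\<bar>^q) \<le> M2 \<and>
       (\<forall>x\<in>ball x0 (1/2^J). v x = conv (rhoj J) f x - conv (rhoj K) f x)"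
    and M: "M1 \<ge> 0" "M2 \<ge> 0" and p: "p \<ge> 1"
  shows "(LBINT x. indicator (ball x0 (2/2^(J+p))) x * \<bar>f x\<bar>^q) \<le> c * (M1 + M2)"
proof -
  define B where "B = ball x0 (2/2^(J+p))"
  have Bm [measurable]: "B \<in> sets borel" by (simp add: B_def)
  have "(2::real)^1 \<le> 2^p" using p by (intro power_increasing) auto
  then have "2/2^(J+p) \<le> (1::real)/2^J" by (simp add: power_add field_simps)
  then have Bsub: "B \<subseteq> ball x0 (1/2^J)" unfolding B_def by (rule subset_ball)
  have cm [measurable]: "conv (rhoj j) f \<in> borel_measurable borel" for j
    by (rule borel_measurable_continuous_onI[OF conv_continuous[OF bump_rhoj f]])
  have "(NBINT x. indicator B x * ennreal (\<bar>f x\<bar>^q)) \<le> ennreal (c * (M1 + M2))"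
  proof (rule mollify_bound[OF mollifier_rhoj f Bm, where ?n0.0=J])
    fix K assume K: "K \<ge> J"
    obtain v where v: "integrable lborel (\<lambda>x. \<bar>v x\<bar>^q)" "v \<in> borel_measurable borel" "(LBINT x. \<bar>v x\<bar>^q) \<le> M2"
       "\<And>x. x\<in>ball x0 (1/2^J) \<Longrightarrow> v x = conv (rhoj J) f x - conv (rhoj K) f x" using h[OF K] by blast
    note [measurable] = v(2)
    have "(NBINT x. indicator B x * ennreal (\<bar>conv (rhoj K) f x\<bar>^q))
      \<le> (NBINT x. ennreal c * (indicator B x * ennreal (\<bar>conv (rhoj J) f x\<bar>^q) + ennreal (\<bar>v x\<bar>^q)))"
    proof (rule nn_integral_mono)
      fix x
      show "indicator B x * ennreal (\<bar>conv (rhoj K) f x\<bar>^q) \<le> ennreal c * (indicator B x * ennreal (\<bar>conv (rhoj J) f x\<bar>^q) + ennreal (\<bar>v x\<bar>^q))"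
      proof (cases "x \<in> B")
        case True
        then have "conv (rhoj K) f x = conv (rhoj J) f x - v x" using v(4)[of x] Bsub by auto
        then have "\<bar>conv (rhoj K) f x\<bar>^q \<le> c * (\<bar>conv (rhoj J) f x\<bar>^q + \<bar>v x\<bar>^q)" using sp by simp
        then have "ennreal (\<bar>conv (rhoj K) f x\<bar>^q) \<le> ennreal (c * (\<bar>conv (rhoj J) f x\<bar>^q + \<bar>v x\<bar>^q))" by (rule ennreal_leI)
        also have "\<dots> = ennreal c * (ennreal (\<bar>conv (rhoj J) f x\<bar>^q) + ennreal (\<bar>v x\<bar>^q))" using c by (simp add: ennreal_mult)
        finally show ?thesis using True by simp
      qed simp
    qed
    also have "\<dots> = ennreal c * ((NBINT x. indicator B x * ennreal (\<bar>conv (rhoj J) f x\<bar>^q)) + (NBINT x. ennreal (\<bar>v x\<bar>^q)))"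
      by (subst nn_integral_cmult, measurable, subst nn_integral_add, measurable)
    also have "\<dots> \<le> ennreal c * (ennreal M1 + ennreal M2)"
    proof (intro mult_left_mono add_mono)
      show "(NBINT x. indicator B x * ennreal (\<bar>conv (rhoj J) f x\<bar>^q)) \<le> ennreal M1" using av by (simp add: B_def)
      show "(NBINT x. ennreal (\<bar>v x\<bar>^q)) \<le> ennreal M2" using nn_integral_eq_integral[OF v(1)] v(3) by (simp add: ennreal_leI)
    qed simp
    also have "\<dots> = ennreal (c * (M1 + M2))" using c M by (simp add: ennreal_mult)
    finally show "(NBINT x. indicator B x * ennreal (\<bar>conv (rhoj K) f x\<bar>^q)) \<le> ennreal (c * (M1 + M2))" .
  qed
  then show ?thesis unfolding B_def[symmetric]
    by (intro nn_to_real) (auto simp: ennreal_ind c M B_def intro!: integrable_ind_mult fq mult_nonneg_nonneg)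
qed

lemma ind_sum_le:
  fixes f :: "'k \<Rightarrow> 'a \<Rightarrow> real"
  assumes I: "finite I" and f: "\<And>i. i \<in> I \<Longrightarrow> integrable lborel (f i)" and h: "integrable lborel h"
    and le: "\<And>x. h x \<le> c * (\<Sum>i\<in>I. f i x)" and M: "\<And>i. i \<in> I \<Longrightarrow> (LBINT x. indicator (ball x0 r) x * f i x) \<le> M" and c: "c \<ge> 0"
  shows "(LBINT x. indicator (ball x0 r) x * h x) \<le> c * (real (card I) * M)"
proof -
  have "(LBINT x. indicator (ball x0 r) x * h x) \<le> (LBINT x. c * (\<Sum>i\<in>I. indicator (ball x0 r) x * f i x))"
  proof (rule integral_mono)
    show "integrable lborel (\<lambda>x. indicator (ball x0 r) x * h x)" by (rule integrable_ind_mult[OF h])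
    show "integrable lborel (\<lambda>x. c * (\<Sum>i\<in>I. indicator (ball x0 r) x * f i x))"
      by (intro integrable_mult_right Bochner_Integration.integrable_sum integrable_ind_mult f)
    fix x show "indicator (ball x0 r) x * h x \<le> c * (\<Sum>i\<in>I. indicator (ball x0 r) x * f i x)"
      using le[of x] by (cases "x \<in> ball x0 r") auto
  qed
  also have "\<dots> = c * (\<Sum>i\<in>I. LBINT x. indicator (ball x0 r) x * f i x)"
    by (simp add: Bochner_Integration.integral_sum integrable_ind_mult f)
  also have "\<dots> \<le> c * (real (card I) * M)" using M c by (intro mult_left_mono sum_bounded_above) auto
  finally show ?thesis .
qed

text \<open>Collects the constants of both inequalities in \<open>step\<close>: of the four powers
  of \<open>CARD('i)\<close> three come from \<open>sum_pow4_le\<close> and one from summing the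
  components, and 10368 is 8 times 1296. The summand 1 ensures
  \<open>sqrt Q \<le> Q\<close>.\<close>

definition Q :: real where
  "Q = 1 + real CARD('i)^4 * (8 * (kbd TYPE('a) * 2^DIM('a) * om)^4 + 10368 * (4608 * C^2)^2)
     + (real (CARD('i) * DIM('a)))^2 * (2 * (kbd TYPE('a) * 2^DIM('a) * om)^2 + 2 * (4608 * C^2))"

lemma Q1: "Q \<ge> 1"
  using C0 om0 unfolding Q_def by (auto intro!: add_nonneg_nonneg mult_nonneg_nonneg)

text \<open>The mollification at the large scale contributes the linear term: it is bounded by a
  mean, and the volume has shrunk by 2^(-p m). The potential contributes the term of higher order,
  because \<open>potential_exists\<close> bounds it by \<open>sqrt (alp x0 J)\<close> times energy
  plus L4 mass.\<close>

lemma step: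
  assumes J: "J \<ge> 2" and p: "p \<ge> 1" and x0: "cball x0 (2/2^J) \<subseteq> S"
  shows "alp x0 (J+p) \<le> Q * (alp x0 J / 2^(p*DIM('a)) + alp x0 J * (en x0 J + alp x0 J)^2)"
    and "en x0 (J+p) \<le> Q * (en x0 J / 2^(p*DIM('a)) + sqrt (alp x0 J) * (en x0 J + alp x0 J))"
proof -
  define \<alpha> where "\<alpha> = alp x0 J"
  define e where "e = en x0 J"
  define T where "T = 4608 * C^2"
  define W where "W = kbd TYPE('a) * 2^DIM('a) * om"
  define n where "n = real CARD('i)"
  define nm where "nm = real (CARD('i) * DIM('a))"
  have nn: "\<alpha> \<ge> 0" "e \<ge> 0" "T \<ge> 0" "n \<ge> 0" "nm \<ge> 0" "W \<ge> 0"
    using alp0 en0 kbd_ge0[where 'a='a] om0 by (auto simp: \<alpha>_def e_def T_def n_def nm_def W_def)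
  let ?B = "ball x0 (2/2^J)"
  have 4: "(LBINT x. indicator (ball x0 (2/2^(J+p))) x * (w i x)^4) \<le> 8 * (W^4 * (1/2^(p*DIM('a)) * \<alpha>) + 1296 * (T * sqrt \<alpha> * (e + \<alpha>))^2)" for i
  proof -
    have le: "(LBINT y. indicator ?B y * (w i y)^4) \<le> \<alpha>" unfolding \<alpha>_def alp_def
    proof (rule integral_mono)
      fix y 
      have "\<bar>w i y\<bar>^4 \<le> (a y)^4" by (intro power_mono wa) auto
      then show "indicator ?B y * (w i y)^4 \<le> indicator ?B y * (a y)^4" by (auto simp: indicator_def)
    qed (intro integrable_ind_mult w4 ia4)+
    have "(LBINT y. indicator ?B y * \<bar>w i y\<bar>)^4 \<le> measure lborel ?B^(4-1) * \<alpha>"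
    proof -
      have "(LBINT y. indicator ?B y * \<bar>w i y\<bar>)^4 \<le> measure lborel ?B^3 * (LBINT y. indicator ?B y * (w i y)^4)"
        by (rule ball_mean4(3)[OF wm w4])
      also have "\<dots> \<le> measure lborel ?B^3 * \<alpha>" by (intro mult_left_mono le) auto
      finally show ?thesis by simp
    qed
    from average_bound[OF wi _ this p nn(1)]
    have av: "(NBINT x. indicator (ball x0 (2/2^(J+p))) x * ennreal (\<bar>conv (rhoj J) (w i) x\<bar>^4)) \<le> ennreal (W^4 * (1/2^(p*DIM('a)) * \<alpha>))"
      by (simp add: W_def)
    have "(LBINT x. indicator (ball x0 (2/2^(J+p))) x * \<bar>w i x\<bar>^4) \<le> 8 * (W^4 * (1/2^(p*DIM('a)) * \<alpha>) + 1296 * (T * sqrt \<alpha> * (e + \<alpha>))^2)"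
    proof (rule split_bound[OF wi _ _ pow4_split av _ _ _ p])
      show "integrable lborel (\<lambda>x. \<bar>w i x\<bar>^4)" using w4[of i] by simp
      fix K assume "K \<ge> J"
      from potential_exists[OF J this x0, of i] obtain v Z where v: "bump v" "0 \<le> Z" "Z \<le> T * sqrt \<alpha> * (e + \<alpha>)"
        "(LBINT x. (v x)^4) \<le> 1296 * Z^2" "\<forall>x\<in>ball x0 (1/2^J). v x = conv (rhoj J) (w i) x - conv (rhoj K) (w i) x"
        unfolding T_def \<alpha>_def e_def by blast
      have "(\<lambda>x. \<bar>v x\<bar>^4) = (\<lambda>x. (v x * v x) * (v x * v x))" by (simp add: power4_eq_xxxx mult.assoc fun_eq_iff abs_mult[symmetric])
      then have i4: "integrable lborel (\<lambda>x. \<bar>v x\<bar>^4)" using bump_integrable[OF bump_mult[OF bump_mult[OF v(1,1)] bump_mult[OF v(1,1)]]] by simp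
      have "Z^2 \<le> (T * sqrt \<alpha> * (e + \<alpha>))^2" using v by (intro power_mono) auto
      then have "(LBINT x. \<bar>v x\<bar>^4) \<le> 1296 * (T * sqrt \<alpha> * (e + \<alpha>))^2" using v(4) by simp
      then show "\<exists>v. integrable lborel (\<lambda>x. \<bar>v x\<bar>^4) \<and> v \<in> borel_measurable borel \<and> (LBINT x. \<bar>v x\<bar>^4) \<le> 1296 * (T * sqrt \<alpha> * (e + \<alpha>))^2 \<and>
       (\<forall>x\<in>ball x0 (1/2^J). v x = conv (rhoj J) (w i) x - conv (rhoj K) (w i) x)"
        using i4 v(5) bump_measurable[OF v(1)] by blast
    qed (use nn in auto)
    then show ?thesis by simp
  qed
  have 2: "(LBINT x. indicator (ball x0 (2/2^(J+p))) x * (d i b x)^2) \<le> 2 * (W^2 * (1/2^(p*DIM('a)) * e) + T * sqrt \<alpha> * (e + \<alpha>))" if b: "b \<in> Basis" for i b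
  proof -
    have le: "(LBINT y. indicator ?B y * (d i b y)^2) \<le> e" unfolding e_def en_def
    proof (rule integral_mono)
      fix y 
      have "\<bar>d i b y\<bar>^2 \<le> (dd y)^2" by (intro power_mono ddd b) auto
      then show "indicator ?B y * (d i b y)^2 \<le> indicator ?B y * (dd y)^2" by (auto simp: indicator_def)
    qed (intro integrable_ind_mult d2[OF b] idd2)+
    have "(LBINT y. indicator ?B y * \<bar>d i b y\<bar>)^2 \<le> measure lborel ?B^(2-1) * e"
    proof -
      have "(LBINT y. indicator ?B y * \<bar>d i b y\<bar>)^2 \<le> measure lborel ?B * (LBINT y. indicator ?B y * (d i b y)^2)"
        by (rule ball_mean2[OF dm[OF b] d2[OF b]])
      also have "\<dots> \<le> measure lborel ?B * e" by (intro mult_left_mono le) auto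
      finally show ?thesis by simp
    qed
    from average_bound[OF di[OF b] _ this p nn(2)]
    have av: "(NBINT x. indicator (ball x0 (2/2^(J+p))) x * ennreal (\<bar>conv (rhoj J) (d i b) x\<bar>^2)) \<le> ennreal (W^2 * (1/2^(p*DIM('a)) * e))"
      by (simp add: W_def)
    have "(LBINT x. indicator (ball x0 (2/2^(J+p))) x * \<bar>d i b x\<bar>^2) \<le> 2 * (W^2 * (1/2^(p*DIM('a)) * e) + T * sqrt \<alpha> * (e + \<alpha>))"
    proof (rule split_bound[OF di[OF b] _ _ pow2_split av _ _ _ p])
      show "integrable lborel (\<lambda>x. \<bar>d i b x\<bar>^2)" using d2[OF b, of i] by simp
      fix K assume "K \<ge> J"
      from potential_exists[OF J this x0, of i] obtain v Z where v: "bump v" "0 \<le> Z" "Z \<le> T * sqrt \<alpha> * (e + \<alpha>)"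
        "\<forall>b\<in>Basis. (LBINT x. (partial_dir b v x)^2) \<le> Z" 
        "\<forall>x\<in>ball x0 (1/2^J). \<forall>b\<in>Basis. partial_dir b v x = conv (rhoj J) (d i b) x - conv (rhoj K) (d i b) x"
        unfolding T_def \<alpha>_def e_def by blast
      have bp: "bump (partial_dir b v)" by (rule bump_partial[OF v(1) b])
      have i2: "integrable lborel (\<lambda>x. \<bar>partial_dir b v x\<bar>^2)" using bump_integrable[OF bump_mult[OF bp bp]] by (simp add: power2_eq_square)
      have "(LBINT x. \<bar>partial_dir b v x\<bar>^2) \<le> T * sqrt \<alpha> * (e + \<alpha>)" using v(3,4) b by fastforce
      then show "\<exists>v. integrable lborel (\<lambda>x. \<bar>v x\<bar>^2) \<and> v \<in> borel_measurable borel \<and> (LBINT x. \<bar>v x\<bar>^2) \<le> T * sqrt \<alpha> * (e + \<alpha>) \<and>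
       (\<forall>x\<in>ball x0 (1/2^J). v x = conv (rhoj J) (d i b) x - conv (rhoj K) (d i b) x)"
        using i2 v(5) b bump_measurable[OF bp] by (intro exI[of _ "partial_dir b v"]) auto
    qed (use nn in auto)
    then show ?thesis by simp
  qed
  have "alp x0 (J+p) \<le> real CARD('i)^3 * (real (card (UNIV :: 'i set)) * (8 * (W^4 * (1/2^(p*DIM('a)) * \<alpha>) + 1296 * (T * sqrt \<alpha> * (e + \<alpha>))^2)))"
    unfolding alp_def by (rule ind_sum_le[where f="\<lambda>i x. (w i x)^4", OF _ w4 ia4 a4_le 4]) auto
  also have "\<dots> = n^4 * (8 * W^4 * (\<alpha> / 2^(p*DIM('a))) + 10368 * T^2 * (\<alpha> * (e + \<alpha>)^2))"
  proof -
    have "(T * sqrt \<alpha> * (e + \<alpha>))^2 = T^2 * (\<alpha> * (e + \<alpha>)^2)" using nn by (simp add: power_mult_distrib)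
    moreover have "n^4 = n^3 * n" by (simp add: power3_eq_cube power4_eq_xxxx)
    ultimately show ?thesis by (simp only: n_def) (simp add: algebra_simps)
  qed
  also have "\<dots> \<le> n^4 * ((8 * W^4 + 10368 * T^2) * (\<alpha> / 2^(p*DIM('a))) + (8 * W^4 + 10368 * T^2) * (\<alpha> * (e + \<alpha>)^2))"
    using nn by (intro mult_left_mono add_mono mult_right_mono) auto
  also have "\<dots> = (n^4 * (8 * W^4 + 10368 * T^2)) * (\<alpha> / 2^(p*DIM('a)) + \<alpha> * (e + \<alpha>)^2)" by (simp add: algebra_simps)
  also have "\<dots> \<le> Q * (\<alpha> / 2^(p*DIM('a)) + \<alpha> * (e + \<alpha>)^2)"
    using nn unfolding Q_def W_def[symmetric] T_def[symmetric] n_def[symmetric] nm_def[symmetric] by (intro mult_right_mono) auto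
  finally show "alp x0 (J+p) \<le> Q * (alp x0 J / 2^(p*DIM('a)) + alp x0 J * (en x0 J + alp x0 J)^2)" by (simp add: \<alpha>_def e_def)
  have "en x0 (J+p) \<le> real (CARD('i) * DIM('a)) * (real (card (UNIV \<times> Basis :: ('i \<times> 'a) set)) * (2 * (W^2 * (1/2^(p*DIM('a)) * e) + T * sqrt \<alpha> * (e + \<alpha>))))"
    unfolding en_def
  proof (rule ind_sum_le[where f="\<lambda>k x. (d (fst k) (snd k) x)^2"])
    fix x show "(dd x)^2 \<le> real (CARD('i) * DIM('a)) * (\<Sum>k\<in>UNIV \<times> Basis. (d (fst k) (snd k) x)^2)"
      using dd2_le[of x] by (simp add: sum.cartesian_product split_beta)
  qed (use d2 idd2 2 in auto)
  also have "\<dots> = nm^2 * (2 * W^2 * (e / 2^(p*DIM('a))) + 2 * T * (sqrt \<alpha> * (e + \<alpha>)))"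
    by (simp add: nm_def card_cartesian_product algebra_simps power2_eq_square)
  also have "\<dots> \<le> nm^2 * ((2 * W^2 + 2 * T) * (e / 2^(p*DIM('a))) + (2 * W^2 + 2 * T) * (sqrt \<alpha> * (e + \<alpha>)))"
    using nn by (intro mult_left_mono add_mono mult_right_mono) auto
  also have "\<dots> = (nm^2 * (2 * W^2 + 2 * T)) * (e / 2^(p*DIM('a)) + sqrt \<alpha> * (e + \<alpha>))" by (simp add: algebra_simps)
  also have "\<dots> \<le> Q * (e / 2^(p*DIM('a)) + sqrt \<alpha> * (e + \<alpha>))"
    using nn unfolding Q_def W_def[symmetric] T_def[symmetric] n_def[symmetric] nm_def[symmetric] by (intro mult_right_mono) auto
  finally show "en x0 (J+p) \<le> Q * (en x0 J / 2^(p*DIM('a)) + sqrt (alp x0 J) * (en x0 J + alp x0 J))" by (simp add: \<alpha>_def e_def)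
qed

text \<open>The iteration yields energy decay like \<open>tau\<^sup>6\<^sup>j = r\<^sup>3\<^sup>m\<^sup>/\<^sup>4\<close> at the scale \<open>r = 2\<^sup>-\<^sup>j\<close>; boundedness of the
  solution only needs an exponent above \<open>m - 2\<close>.\<close>

definition tau :: real where "tau = root 8 (1 / 2^DIM('a))"

lemma tau: "0 < tau" "tau < 1" "tau^8 = 1 / 2^DIM('a)" "sqrt (1/2) \<le> tau"
proof -
  show 0: "0 < tau" by (simp add: tau_def)
  show 8: "tau^8 = 1 / 2^DIM('a)" by (simp add: tau_def)
  have "tau^8 < 1^8" unfolding 8 by simp
  then show "tau < 1" by (rule power_less_imp_less_base) simp
  \<comment> \<open>Here dimension at most four enters the exponents: \<open>tau^8\<close> is 2^-m,
    hence at least 2^-4.\<close>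
  have "sqrt (1/2)^8 = ((sqrt (1/2))^2)^4" by (simp only: power_mult[symmetric]) simp
  also have "\<dots> = 1/2^4" by (simp add: power_one_over)
  also have "\<dots> \<le> tau^8" unfolding 8 using dim by (intro divide_left_mono power_increasing) auto
  finally have "sqrt (1/2) ^ Suc 7 \<le> tau ^ Suc 7" by simp
  then show "sqrt (1/2) \<le> tau" by (rule power_le_imp_le_base) (use 0 in simp)
qed

lemma tau_pow: "1 / 2^(p*DIM('a)) = tau^(8*p)"
  by (simp add: power_mult tau(3) power_one_over mult.commute[of p])

text \<open>The square root makes the L4 mass quadratic in the solution, like the energy, so that
  the nonlinear term of the recursion is quadratic in \<open>psi\<close>.\<close>

definition psi :: "'a \<Rightarrow> nat \<Rightarrow> real" where "psi x j = en x j + sqrt (alp x j)"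

lemma psi0: "psi x j \<ge> 0" using en0 alp0 by (simp add: psi_def)

lemma en_alp_le: "psi x j \<le> 1 \<Longrightarrow> en x j + alp x j \<le> psi x j"
proof -
  assume "psi x j \<le> 1"
  then have "sqrt (alp x j) \<le> 1" using en0[of x j] unfolding psi_def by linarith
  then have "sqrt (alp x j) * sqrt (alp x j) \<le> 1 * sqrt (alp x j)" by (intro mult_right_mono) (auto simp: alp0)
  then show ?thesis using alp0[of x j] by (simp add: psi_def)
qed

text \<open>The square root halves the volume gain of the L4 mass from \<open>tau^(8*p)\<close> to
  \<open>tau^(4*p)\<close>, and this weaker rate governs \<open>psi\<close>; the energy alone keeps
  the full gain and sees \<open>psi\<close> through its square. Smallness allows \<open>alp\<close>
  to be replaced by its square root.\<close>

lemma psi_step: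
  assumes J: "J \<ge> 2" and p: "p \<ge> 1" and x0: "cball x0 (2/2^J) \<subseteq> S" and s: "psi x0 J \<le> 1"
  shows "psi x0 (J+p) \<le> Q * (tau^(4*p) + 2 * psi x0 J) * psi x0 J"
    and "en x0 (J+p) \<le> Q * tau^(8*p) * en x0 J + Q * (psi x0 J)^2"
proof -
  define \<alpha> where "\<alpha> = alp x0 J"
  define e where "e = en x0 J"
  define P where "P = psi x0 J"
  have nn: "\<alpha> \<ge> 0" "e \<ge> 0" "P \<ge> 0" using alp0 en0 psi0 by (auto simp: \<alpha>_def e_def P_def)
  have le: "e + \<alpha> \<le> P" "sqrt \<alpha> \<le> P" "e \<le> P" "e + sqrt \<alpha> = P"
    using en_alp_le[OF s] nn by (auto simp: \<alpha>_def e_def P_def psi_def)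
  have t4: "0 \<le> tau^(4*p)" "tau^(8*p) \<le> tau^(4*p)" using tau by (auto intro!: power_decreasing)
  have sa: "sqrt \<alpha> * (e + \<alpha>) \<le> P * P" using le nn by (intro mult_mono) auto
  have "en x0 (J+p) \<le> Q * (e * tau^(8*p) + sqrt \<alpha> * (e + \<alpha>))"
    using step(2)[OF J p x0] tau_pow[of p] by (simp add: \<alpha>_def e_def divide_inverse)
  also have en1: "\<dots> \<le> Q * (e * tau^(8*p) + P * P)" using sa Q1 by (intro mult_left_mono add_left_mono) auto
  finally have en1: "en x0 (J+p) \<le> Q * (e * tau^(8*p) + P * P)" .
  then show "en x0 (J+p) \<le> Q * tau^(8*p) * en x0 J + Q * (psi x0 J)^2" by (simp add: e_def P_def power2_eq_square algebra_simps)
  have "sqrt (alp x0 (J+p)) \<le> sqrt (Q * (\<alpha> * tau^(8*p) + \<alpha> * (e + \<alpha>)^2))"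
    using step(1)[OF J p x0] tau_pow[of p] by (simp add: \<alpha>_def e_def divide_inverse)
  also have "\<dots> = sqrt Q * sqrt (\<alpha> * (tau^(4*p))^2 + \<alpha> * (e + \<alpha>)^2)"
    by (simp add: real_sqrt_mult power_mult[symmetric] mult.commute)
  also have "\<dots> \<le> Q * (sqrt (\<alpha> * (tau^(4*p))^2) + sqrt (\<alpha> * (e + \<alpha>)^2))"
  proof (intro mult_mono)
    show "sqrt Q \<le> Q" using Q1 by (simp add: sqrt_le_D real_le_lsqrt self_le_power)
    show "sqrt (\<alpha> * (tau^(4*p))^2 + \<alpha> * (e + \<alpha>)^2) \<le> sqrt (\<alpha> * (tau^(4*p))^2) + sqrt (\<alpha> * (e + \<alpha>)^2)"
      using nn by (intro sqrt_add_le_add_sqrt) auto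
  qed (use Q1 nn in auto)
  also have "\<dots> = Q * (sqrt \<alpha> * tau^(4*p) + sqrt \<alpha> * (e + \<alpha>))" using nn t4 by (simp add: real_sqrt_mult)
  also have "\<dots> \<le> Q * (sqrt \<alpha> * tau^(4*p) + P * P)" using sa Q1 by (intro mult_left_mono add_left_mono) auto
  finally have al1: "sqrt (alp x0 (J+p)) \<le> Q * (sqrt \<alpha> * tau^(4*p) + P * P)" .
  have "Q * (e * tau^(8*p) + P * P) \<le> Q * (e * tau^(4*p) + P * P)" using Q1 t4 nn by (intro mult_left_mono add_right_mono) auto
  then have "psi x0 (J+p) \<le> Q * (e * tau^(4*p) + P * P) + Q * (sqrt \<alpha> * tau^(4*p) + P * P)"
    using al1 en1 unfolding psi_def by linarith
  also have "\<dots> = Q * ((e + sqrt \<alpha>) * tau^(4*p) + 2 * P * P)" by (simp add: algebra_simps)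
  also have "\<dots> = Q * (tau^(4*p) + 2 * P) * P" unfolding le(4) by (simp add: algebra_simps)
  finally show "psi x0 (J+p) \<le> Q * (tau^(4*p) + 2 * psi x0 J) * psi x0 J" by (simp add: P_def)
qed

text \<open>The source of smallness: absolute continuity of the two integrals, uniformly in the
  centre.\<close>

lemma small_psi: assumes "\<delta> > 0" shows "\<exists>J. \<forall>x. \<forall>j\<ge>J. psi x j \<le> \<delta>"
proof -
  have d: "\<delta>/2 > 0" "(\<delta>/2)^2 > 0" using assms by auto
  obtain r1 where r1: "r1 > 0" "\<And>x. (LBINT y. indicator (ball x r1) y * (dd y)^2) \<le> \<delta>/2"
    using small_ball_integral[OF idd2 _ d(1)] by auto
  have "\<And>x. (a x)^4 \<ge> 0" by simp
  from small_ball_integral[OF ia4 this d(2)]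
  obtain r2 where r2: "r2 > 0" "\<And>x. (LBINT y. indicator (ball x r2) y * (a y)^4) \<le> (\<delta>/2)^2" by blast
  have "(\<lambda>j. 2 * (1/2::real)^j) \<longlonglongrightarrow> 2 * 0" by (intro tendsto_intros LIMSEQ_realpow_zero) auto
  then have "\<forall>\<^sub>F j in sequentially. 2 * (1/2::real)^j < min r1 r2" using r1 r2 by (intro order_tendstoD(2)) auto
  then obtain J where J: "\<And>j. j \<ge> J \<Longrightarrow> 2/2^j < min r1 r2" unfolding eventually_sequentially by (auto simp: power_one_over)
  have "psi x j \<le> \<delta>" if "j \<ge> J" for x j
  proof -
    have s: "ball x (2/2^j) \<subseteq> ball x r1" "ball x (2/2^j) \<subseteq> ball x r2" using J[OF that] by (auto intro!: subset_ball)
    have "en x j \<le> \<delta>/2" unfolding en_def by (rule order_trans[OF ind_ball_mono[OF idd2 _ s(1)] r1(2)]) simp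
    moreover have "alp x j \<le> (\<delta>/2)^2" unfolding alp_def by (rule order_trans[OF ind_ball_mono[OF ia4 _ s(2)] r2(2)]) simp
    then have "sqrt (alp x j) \<le> \<delta>/2" using assms by (intro real_le_lsqrt) auto
    ultimately show ?thesis by (simp add: psi_def)
  qed
  then show ?thesis by blast
qed

text \<open>Two rounds of \<open>decay_iteration\<close>. For \<open>psi\<close> the quadratic term
  is absorbed by smallness, which gives the rate \<open>tau^3\<close> per scale; the energy then
  satisfies a linear recursion with a source of size \<open>psi^2\<close>, which gives the rate
  \<open>tau^6\<close>.\<close>

theorem energy_decay:
  "\<exists>J A. J \<ge> 2 \<and> J \<ge> J0 \<and> A \<ge> 0 \<and> (\<forall>x0. cball x0 (2/2^J) \<subseteq> S \<longrightarrow> (\<forall>j\<ge>J. psi x0 j \<le> 1 \<and> psi x0 j \<le> A * tau^(3*j) \<and> en x0 j \<le> A * tau^(6*j)))"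
proof -
  have "(\<lambda>p. Q * tau^p) \<longlonglongrightarrow> Q * 0" using tau by (intro tendsto_intros LIMSEQ_realpow_zero) auto
  then have "\<forall>\<^sub>F p in sequentially. Q * tau^p < 1/4" by (intro order_tendstoD(2)) auto
  then obtain p0 where "\<And>p. p \<ge> p0 \<Longrightarrow> Q * tau^p < 1/4" unfolding eventually_sequentially by blast
  then obtain p where p: "p \<ge> 1" "Q * tau^p \<le> 1/4" by (metis less_imp_le max.cobounded1 max.cobounded2)
  \<comment> \<open>With \<open>Q * tau^p \<le> 1/4\<close> the linear part takes
    \<open>tau^(3*p)/4\<close>; this \<open>\<delta>\<close> makes the quadratic part, with its
    factor 2, take another \<open>tau^(3*p)/4\<close>.\<close>
  define \<delta> where "\<delta> = min 1 (tau^(3*p) / (8*Q))"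
  have \<delta>: "\<delta> > 0" "\<delta> \<le> 1" "\<delta> \<le> tau^(3*p) / (8*Q)" using tau Q1 by (auto simp: \<delta>_def)
  obtain J1 where J1: "\<And>x j. j \<ge> J1 \<Longrightarrow> psi x j \<le> \<delta>" using small_psi[OF \<delta>(1)] by blast
  define J where "J = max (max 2 J0) J1"
  have J: "J \<ge> 2" "\<And>x j. j \<ge> J \<Longrightarrow> psi x j \<le> \<delta>" "J \<ge> J0" using J1 by (auto simp: J_def)
  define A1 where "A1 = 1 / (tau^3)^(J+p)"
  define A2 where "A2 = 1 / (tau^6)^(J+p) + 2 * (Q * A1^2) / (tau^6)^p"
  have A0: "A1 \<ge> 0" "A2 \<ge> 0" using tau Q1 by (auto simp: A1_def A2_def)
  have main: "psi x0 j \<le> 1 \<and> psi x0 j \<le> A1 * tau^(3*j) \<and> en x0 j \<le> A2 * tau^(6*j)" if x0: "cball x0 (2/2^J) \<subseteq> S" and j: "j \<ge> J" for x0 j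
  proof -
    have p1: "psi x0 j \<le> 1" if "j \<ge> J" for j using J(2)[OF that, of x0] \<delta>(2) by linarith
    have sub: "cball x0 (2/2^j) \<subseteq> S" if "j \<ge> J" for j
    proof -
      have "(2::real)/2^j \<le> 2/2^J" using that by (intro divide_left_mono power_increasing) auto
      then show ?thesis using x0 subset_cball[of "2/2^j" "2/2^J" x0] by blast
    qed
    have st: "psi x0 (j+p) \<le> ((tau^3)^p/2) * psi x0 j + 0 * (tau^3)^j" if j: "j \<ge> J" for j
    proof -
      have "Q * (tau^(4*p) + 2 * psi x0 j) \<le> tau^(3*p)/2"
      proof -
        have "Q * tau^(4*p) = (Q * tau^p) * tau^(3*p)" by (simp add: power_add[symmetric])
        also have "\<dots> \<le> (1/4) * tau^(3*p)" using p tau by (intro mult_right_mono) auto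
        finally have 1: "Q * tau^(4*p) \<le> tau^(3*p)/4" by simp
        have "Q * psi x0 j \<le> Q * (tau^(3*p) / (8*Q))" using J(2)[OF j, of x0] \<delta>(3) Q1 by (intro mult_left_mono) auto
        also have "\<dots> = tau^(3*p)/8" using Q1 by simp
        finally show ?thesis using 1 by (simp add: algebra_simps)
      qed
      then have "Q * (tau^(4*p) + 2 * psi x0 j) * psi x0 j \<le> (tau^(3*p)/2) * psi x0 j" by (intro mult_right_mono psi0)
      then show ?thesis using psi_step(1)[OF _ p(1) sub[OF j] p1[OF j]] j J(1) by (simp add: power_mult)
    qed
    have psi: "psi x0 j \<le> A1 * (tau^3)^j" if "j \<ge> J" for j
      using decay_iteration[of p "tau^3" 0 1 J "psi x0" "(tau^3)^p/2" j, OF p(1) _ _ _ _ p1 _ _ psi0 st that] tau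
      by (simp add: A1_def power_le_one)
    have st2: "en x0 (j+p) \<le> ((tau^6)^p/2) * en x0 j + (Q * A1^2) * (tau^6)^j" if j: "j \<ge> J" for j
    proof -
      have "Q * tau^(8*p) = (Q * tau^p) * (tau^p * tau^(6*p))" by (simp add: power_add[symmetric])
      also have "\<dots> \<le> (1/4) * (1 * tau^(6*p))"
        using p tau Q1 by (intro mult_mono power_le_one) auto
      also have "\<dots> \<le> tau^(6*p)/2" using tau by simp
      finally have "Q * tau^(8*p) * en x0 j \<le> (tau^(6*p)/2) * en x0 j" by (intro mult_right_mono en0)
      moreover have "Q * (psi x0 j)^2 \<le> Q * (A1 * (tau^3)^j)^2"
        using psi[OF j] psi0 Q1 by (intro mult_left_mono power_mono) auto
      moreover have "(A1 * (tau^3)^j)^2 = A1^2 * (tau^6)^j" by (simp add: power_mult_distrib power_mult[symmetric] mult.commute)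
      ultimately show ?thesis using psi_step(2)[OF _ p(1) sub[OF j] p1[OF j]] j J(1) by (simp add: power_mult)
    qed
    have en1: "en x0 j \<le> 1" if "j \<ge> J" for j using p1[OF that] alp0[of x0 j] by (simp add: psi_def) (smt (verit) real_sqrt_ge_zero)
    have "en x0 j \<le> A2 * (tau^6)^j"
      using decay_iteration[of p "tau^6" "Q * A1^2" 1 J "en x0" "(tau^6)^p/2" j, OF p(1) _ _ _ _ en1 _ _ en0 st2 j] tau Q1
      by (simp add: A2_def power_le_one)
    then show ?thesis using psi[OF j] p1[OF j] by (simp add: power_mult)
  qed
  define A where "A = max A1 A2"
  have "A1 * tau^(3*j) \<le> A * tau^(3*j)" "A2 * tau^(6*j) \<le> A * tau^(6*j)" for j
    using tau by (auto intro!: mult_right_mono simp: A_def)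
  then have "psi x0 j \<le> 1 \<and> psi x0 j \<le> A * tau^(3*j) \<and> en x0 j \<le> A * tau^(6*j)" if "cball x0 (2/2^J) \<subseteq> S" "j \<ge> J" for x0 j
    using main[OF that] by (meson order_trans)
  then show ?thesis using J(1,3) A0 by (intro exI[of _ J] exI[of _ A]) (auto simp: A_def)
qed

end

section \<open>Pointwise bounds for the potential and its derivatives\<close>

context critical_system
begin

text \<open>Hoelder on the ball: volume to the power 1/4, the L4 norm of \<open>a\<close> and the L2
  norm of \<open>bb\<close>, stated for fourth powers to avoid roots. The 4 is the square of the 2
  in \<open>bb_int\<close>.\<close>

lemma G_int4:
  assumes "psi x j \<le> 1"
  shows "(LBINT y. indicator (ball x (2/2^j)) y * \<bar>G i y\<bar>)^4 \<le> C^4 * (measure lborel (ball x (2/2^j)) * 4 * (psi x j)^4)"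
proof -
  let ?I = "\<lambda>y. indicator (ball x (2/2^j)) y :: real"
  have [measurable]: "ball x (2/2^j) \<in> sets borel" by simp
  define p where "p = (LBINT y. \<bar>(?I y * a y) * (?I y * bb y)\<bar>)"
  define V where "V = measure lborel (ball x (2/2^j))"
  have e: "(?I y * a y)^2 = ?I y * (a y)^2" "(?I y * bb y)^2 = ?I y * (bb y)^2" for y by (auto simp: indicator_def)
  have i2: "integrable lborel (\<lambda>y. (?I y * a y)^2)" "integrable lborel (\<lambda>y. (?I y * bb y)^2)"
    unfolding e by (rule ball_mean4(2)[OF am ia4], rule integrable_ind_mult[OF ibb2])
  have m: "(\<lambda>y. ?I y * a y) \<in> borel_measurable lborel" "(\<lambda>y. ?I y * bb y) \<in> borel_measurable lborel" by measurable
  have p2: "p^2 \<le> (LBINT y. ?I y * (a y)^2) * (LBINT y. ?I y * (bb y)^2)"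
    using CS_real(2)[OF m i2] unfolding p_def e .
  have ip: "integrable lborel (\<lambda>y. \<bar>(?I y * a y) * (?I y * bb y)\<bar>)" by (rule integrable_abs[OF CS_real(1)[OF m i2]])
  have nn: "0 \<le> (LBINT y. ?I y * (a y)^2)" "0 \<le> (LBINT y. ?I y * (bb y)^2)" "p \<ge> 0" "V \<ge> 0"
    unfolding p_def V_def by (auto intro!: Bochner_Integration.integral_nonneg)
  have "(LBINT y. ?I y * \<bar>G i y\<bar>) \<le> (LBINT y. C * \<bar>(?I y * a y) * (?I y * bb y)\<bar>)"
  proof (rule integral_mono)
    show "integrable lborel (\<lambda>y. ?I y * \<bar>G i y\<bar>)" by (intro integrable_ind_mult integrable_abs Gi)
    show "integrable lborel (\<lambda>y. C * \<bar>(?I y * a y) * (?I y * bb y)\<bar>)" by (rule integrable_mult_right[OF ip])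
    fix y show "?I y * \<bar>G i y\<bar> \<le> C * \<bar>(?I y * a y) * (?I y * bb y)\<bar>"
      using Gb'[of i y] a0[of y] bb0[of y] by (auto simp: indicator_def abs_mult)
  qed
  also have "\<dots> = C * p" unfolding p_def by simp
  finally have "(LBINT y. ?I y * \<bar>G i y\<bar>)^4 \<le> (C * p)^4"
    by (intro power_mono) (auto intro!: Bochner_Integration.integral_nonneg)
  also have "\<dots> = C^4 * (p^2)^2" by (simp add: power_mult_distrib)
  also have "\<dots> \<le> C^4 * ((LBINT y. ?I y * (a y)^2) * (LBINT y. ?I y * (bb y)^2))^2"
    using p2 nn C0 by (intro mult_left_mono power_mono) auto
  also have "\<dots> = C^4 * ((LBINT y. ?I y * (a y)^2)^2 * (LBINT y. ?I y * (bb y)^2)^2)" by (simp add: power_mult_distrib)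
  also have "\<dots> \<le> C^4 * ((V * (psi x j)^2) * (2 * psi x j)^2)"
  proof (intro mult_left_mono mult_mono)
    have "(LBINT y. ?I y * (a y)^2)^2 \<le> V * alp x j" unfolding V_def alp_def by (rule ball_mean4(1)[OF am ia4])
    also have "alp x j = (sqrt (alp x j))^2" using alp0 by simp
    also have "\<dots> \<le> (psi x j)^2" using en0[of x j] alp0 by (intro power_mono) (auto simp: psi_def)
    finally show "(LBINT y. ?I y * (a y)^2)^2 \<le> V * (psi x j)^2" using nn by (simp add: mult_left_mono)
    show "(LBINT y. ?I y * (bb y)^2)^2 \<le> (2 * psi x j)^2"
      using nn bb_int[of x j] en_alp_le[OF assms] by (intro power_mono) auto
  qed (use nn C0 in auto)
  also have "\<dots> = C^4 * (V * 4 * (psi x j)^4)" by (simp add: power_mult_distrib power2_eq_square power4_eq_xxxx)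
  finally show ?thesis unfolding V_def .
qed

text \<open>The gain per dyadic scale; as 2^(-1/2) it corresponds to the Hoelder exponent
  1/2.\<close>

definition sg :: real where "sg = sqrt (1/2)"

lemma sg: "0 < sg" "sg < 1" "1/2 < sg" "sg * sg = 1/2" "sg \<le> tau"
proof -
  show "0 < sg" "sg < 1" by (auto simp: sg_def)
  show "sg * sg = 1/2" by (simp add: sg_def)
  have "sqrt ((1/2)^2) < sqrt (1/2)" by (subst real_sqrt_less_iff) (simp add: power2_eq_square)
  then show "1/2 < sg" by (simp add: sg_def)
  show "sg \<le> tau" using tau(4) by (simp add: sg_def)
qed

lemma two_pow: "2^(j*DIM('a)) = 1 / tau^(8*j)"
  unfolding tau_pow[symmetric] by simp

text \<open>Kernel size against decay of the right-hand side: in these units the kernels have size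
  tau^(-8j) times 4^-j, 2^-j or 1, and \<open>sg \<le> tau\<close> reduces each product to a power
  of \<open>sg\<close>. The exponents 5 and 7 are those of the first and the second pass.\<close>

lemma tau_sg:
  "2^(j*DIM('a)) / 4^j * tau^(5*j) \<le> sg^j" "2^(j*DIM('a)) / 2^j * tau^(7*j) \<le> sg^j" "2^(j*DIM('a)) * tau^(7*j) \<le> (2 * sg)^j"
proof -
  have 2: "(1/2::real) = sg * sg" by (simp add: sg(4))
  have "sg^4 = (sg * sg)^2" by (simp add: power2_eq_square power4_eq_xxxx mult.assoc)
  then have 4: "(1/4::real) = sg^4" unfolding sg(4) by (simp add: power2_eq_square)
  have t: "tau \<noteq> 0" using tau by simp
  have r: "sg / tau \<le> 1" "0 \<le> sg / tau" using sg tau by auto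
  have "2^(j*DIM('a)) / 4^j * tau^(5*j) = (1/4)^j * (tau^(5*j) / tau^(8*j))" by (simp add: two_pow power_one_over)
  also have "tau^(5*j) / tau^(8*j) = 1 / tau^(3*j)" using t by (simp add: field_simps power_add[symmetric])
  also have "(1/4)^j * (1 / tau^(3*j)) = sg^j * ((sg/tau)^3)^j"
  proof -
    have "sg * sg^3 = sg^4" by (simp add: power3_eq_cube power4_eq_xxxx mult.assoc)
    then have "sg^j * (sg^3)^j = (sg^4)^j" by (simp only: power_mult_distrib[symmetric])
    then show ?thesis unfolding 4 power_mult power_divide by simp
  qed
  also have "\<dots> \<le> sg^j * 1" using r sg by (intro mult_left_mono power_le_one) auto
  finally show "2^(j*DIM('a)) / 4^j * tau^(5*j) \<le> sg^j" by simp
  have A: "2^(j*DIM('a)) * tau^(7*j) = 1 / tau^j"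
  proof -
    have "tau^(8*j) = tau^(7*j) * tau^j" by (simp add: power_add[symmetric])
    then show ?thesis using t by (simp add: two_pow)
  qed
  have B: "1 / tau^j = (1/sg)^j * (sg/tau)^j" using sg t by (simp add: power_divide)
  have Cc: "1/sg = 2 * sg" using sg by (simp add: field_simps)
  show C': "2^(j*DIM('a)) * tau^(7*j) \<le> (2 * sg)^j"
    unfolding A B Cc using r sg by (intro mult_left_le power_le_one) auto
  have "2^(j*DIM('a)) / 2^j * tau^(7*j) = (1/2)^j * (2^(j*DIM('a)) * tau^(7*j))" by (simp add: power_one_over)
  also have "\<dots> \<le> (1/2)^j * (2 * sg)^j" using C' by (intro mult_left_mono) auto
  also have "\<dots> = ((1/2) * (2 * sg))^j" by (rule power_mult_distrib[symmetric])
  also have "\<dots> = sg^j" by simp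
  finally show "2^(j*DIM('a)) / 2^j * tau^(7*j) \<le> sg^j" .
qed

lemma ball_meas_tau: "measure lborel (ball (x::'a) (2/2^j)) = 2^DIM('a) * om * tau^(8*j)"
  unfolding ball_meas two_pow by simp

text \<open>\<open>K \<le> (1 + K)^4\<close> yields a usable constant without a fourth root of
  \<open>K\<close>.\<close>

lemma pow4_root: "0 \<le> y \<Longrightarrow> x^4 \<le> K * y^4 \<Longrightarrow> K \<ge> 0 \<Longrightarrow> x \<le> (1 + K) * y" for x y K :: real
proof -
  assume a: "0 \<le> y" "x^4 \<le> K * y^4" "K \<ge> 0"
  have "K \<le> (1+K)^4" using a(3) self_le_power[of "1+K" 4] by simp
  then have "K * y^4 \<le> (1+K)^4 * y^4" using a by (intro mult_right_mono) auto
  with a(2) have "x ^ Suc 3 \<le> ((1+K) * y) ^ Suc 3" by (simp add: power_mult_distrib)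
  then show ?thesis by (rule power_le_imp_le_base) (use a in auto)
qed

lemma kap_conv_bound:
  assumes "\<And>z. \<bar>k z\<bar> \<le> kbd TYPE('a) * c" "\<And>z. 2/2^j \<le> norm z \<Longrightarrow> k z = 0" "bump k" "c \<ge> 0"
    and "(LBINT y. indicator (ball x (2/2^j)) y * \<bar>G i y\<bar>) \<le> L * t" "c * t \<le> s" "L \<ge> 0"
  shows "\<bar>conv k (G i) x\<bar> \<le> kbd TYPE('a) * L * s"
proof -
  have "\<bar>conv k (G i) x\<bar> \<le> (kbd TYPE('a) * c) * (LBINT y. indicator (ball x (2/2^j)) y * \<bar>G i y\<bar>)"
    by (rule conv_bound[OF assms(3,1,2) Gi])
  also have "\<dots> \<le> (kbd TYPE('a) * c) * (L * t)" using assms kbd_ge0[where 'a='a] by (intro mult_left_mono) auto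
  also have "\<dots> = (kbd TYPE('a) * L) * (c * t)" by (simp add: mult_ac)
  also have "\<dots> \<le> (kbd TYPE('a) * L) * s" using assms kbd_ge0[where 'a='a] by (intro mult_left_mono) auto
  finally show ?thesis .
qed

text \<open>First pass: the volume \<open>tau^(8*j)\<close> times the fourth power of
  \<open>tau^(3*j)\<close> is \<open>tau^(20*j)\<close>, so the mass of the right-hand side on the
  ball is of order \<open>tau^(5*j)\<close>.\<close>

lemma potential_decay:
  "\<exists>J A. J \<ge> 2 \<and> J \<ge> J0 \<and> A \<ge> 0 \<and> (\<forall>x. cball x (2/2^J) \<subseteq> S \<longrightarrow> (\<forall>j\<ge>J. en x j \<le> A * tau^(6*j) \<and> (\<forall>i. \<bar>conv (kapj j) (G i) x\<bar> \<le> A * sg^j)))"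
proof -
  obtain J A where J: "J \<ge> 2" "A \<ge> 0" and J0: "J \<ge> J0" and dec: "\<And>x0 j. cball x0 (2/2^J) \<subseteq> S \<Longrightarrow> j \<ge> J \<Longrightarrow> psi x0 j \<le> 1 \<and> psi x0 j \<le> A * tau^(3*j) \<and> en x0 j \<le> A * tau^(6*j)"
    using energy_decay[of J0] by blast
  define K where "K = C^4 * (2^DIM('a) * om * 4 * A^4)"
  have K: "K \<ge> 0" using om0 J C0 unfolding K_def by (intro mult_nonneg_nonneg zero_le_power) auto
  have main: "\<bar>conv (kapj j) (G i) x\<bar> \<le> kbd TYPE('a) * (1+K) * sg^j" if x: "cball x (2/2^J) \<subseteq> S" "j \<ge> J" for x i j
  proof (rule kap_conv_bound[OF kapj_bound kapj_support bump_kapj])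
    have "(LBINT y. indicator (ball x (2/2^j)) y * \<bar>G i y\<bar>)^4 \<le> C^4 * (measure lborel (ball x (2/2^j)) * 4 * (psi x j)^4)"
      using dec[OF x] by (intro G_int4) auto
    also have "\<dots> \<le> C^4 * (measure lborel (ball x (2/2^j)) * 4 * (A * tau^(3*j))^4)"
      using dec[OF x] psi0 C0 by (intro mult_left_mono power_mono) auto
    also have "\<dots> = K * (tau^(8*j) * (tau^(3*j))^4)" unfolding ball_meas_tau K_def by (simp add: power_mult_distrib)
    also have "tau^(8*j) * (tau^(3*j))^4 = (tau^(5*j))^4" by (simp add: power_mult[symmetric] power_add[symmetric])
    finally show "(LBINT y. indicator (ball x (2/2^j)) y * \<bar>G i y\<bar>) \<le> (1+K) * tau^(5*j)"
      using tau K by (intro pow4_root) auto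
  qed (use tau_sg(1) K in auto)
  define A' where "A' = A + kbd TYPE('a) * (1+K)"
  have A': "A' \<ge> 0" "A \<le> A'" "kbd TYPE('a) * (1+K) \<le> A'" using J K kbd_ge0[where 'a='a] by (auto simp: A'_def)
  have "en x j \<le> A' * tau^(6*j)" if x: "cball x (2/2^J) \<subseteq> S" "j \<ge> J" for x j
  proof -
    have "A * tau^(6*j) \<le> A' * tau^(6*j)" using tau A' by (intro mult_right_mono) auto
    then show ?thesis using dec[OF x] by linarith
  qed
  moreover have "\<bar>conv (kapj j) (G i) x\<bar> \<le> A' * sg^j" if x: "cball x (2/2^J) \<subseteq> S" "j \<ge> J" for x j i
  proof -
    have "kbd TYPE('a) * (1+K) * sg^j \<le> A' * sg^j" using sg A' by (intro mult_right_mono) auto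
    then show ?thesis using main[OF x, of i] by linarith
  qed
  ultimately show ?thesis using J(1) J0 A'(1) by (intro exI[of _ J] exI[of _ A']) blast
qed

text \<open>By \<open>repr\<close> the potentials are the increments of the mollifications, and they
  are dominated by a geometric series; so the mollifications are bounded and their almost everywhere
  limits inherit the bound. The energy decay is repeated in the conclusion so that the second pass
  works with the same \<open>J\<close> and \<open>A\<close>.\<close>

lemma bounded_solution:
  "\<exists>J A M. J \<ge> 2 \<and> J \<ge> J0 \<and> A \<ge> 0 \<and> M \<ge> 0 \<and> (\<forall>x. cball x (2/2^J) \<subseteq> S \<longrightarrow> (\<forall>j\<ge>J. en x j \<le> A * tau^(6*j) \<and> (\<forall>i. \<bar>conv (kapj j) (G i) x\<bar> \<le> A * sg^j)))
    \<and> (AE x in lborel. cball x (2/2^J) \<subseteq> S \<longrightarrow> a x \<le> M)"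
proof -
  obtain J A where J: "J \<ge> 2" "A \<ge> 0" and J0: "J \<ge> J0" and dec: "\<And>x j i. cball x (2/2^J) \<subseteq> S \<Longrightarrow> j \<ge> J \<Longrightarrow> en x j \<le> A * tau^(6*j)"
    "\<And>x j i. cball x (2/2^J) \<subseteq> S \<Longrightarrow> j \<ge> J \<Longrightarrow> \<bar>conv (kapj j) (G i) x\<bar> \<le> A * sg^j"
    using potential_decay[of J0] by blast
  define M where "M i = kbd TYPE('a) * 2^(J*DIM('a)) * (LBINT y. \<bar>w i y\<bar>) + A / (1 - sg)" for i
  have bd: "\<bar>conv (rhoj K) (w i) x\<bar> \<le> M i" if x: "cball x (2/2^J) \<subseteq> S" and K: "K \<ge> J" for x i K
  proof -
    have st: "\<bar>conv (rhoj j) (w i) x - conv (rhoj (Suc j)) (w i) x\<bar> \<le> A * sg^j" if j: "j \<ge> J" for j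
    proof -
      have "(1::real)/2^j \<le> 2/2^J" using j by (intro frac_le power_increasing) auto
      then have "cball x (1/2^j) \<subseteq> S" using x subset_cball[of "1/2^j" "2/2^J" x] by blast
      then have "\<bar>conv (rhoj j) (w i) x - conv (rhoj (Suc j)) (w i) x\<bar> = \<bar>conv (kapj (Suc j)) (G i) x\<bar>"
        using rep[of i] unfolding repr_def by simp
      also have "\<dots> \<le> A * sg^(Suc j)" using j by (intro dec(2)[OF x]) auto
      also have "\<dots> \<le> A * sg^j" using sg J by (intro mult_left_mono power_decreasing) auto
      finally show ?thesis .
    qed
    have "\<bar>conv (rhoj J) (w i) x - conv (rhoj K) (w i) x\<bar> \<le> (\<Sum>j\<in>{J..<K}. A * sg^j)"
    proof -
      have "conv (rhoj J) (w i) x - conv (rhoj K) (w i) x = - (\<Sum>j\<in>{J..<K}. conv (rhoj (Suc j)) (w i) x - conv (rhoj j) (w i) x)"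
        by (subst sum_Suc_diff'[OF K]) simp
      also have "\<dots> = (\<Sum>j\<in>{J..<K}. conv (rhoj j) (w i) x - conv (rhoj (Suc j)) (w i) x)" by (simp add: sum_negf[symmetric])
      finally show ?thesis using st by (auto intro!: order_trans[OF sum_abs] sum_mono)
    qed
    also have "\<dots> \<le> (\<Sum>j<K. A * sg^j)" using J sg by (intro sum_mono2) auto
    also have "\<dots> = A * ((1 - sg^K) / (1 - sg))" using sg by (simp add: sum_distrib_left[symmetric] sum_gp_strict)
    also have "\<dots> \<le> A * (1 / (1 - sg))" using J sg by (intro mult_left_mono divide_right_mono) auto
    finally have 1: "\<bar>conv (rhoj J) (w i) x - conv (rhoj K) (w i) x\<bar> \<le> A / (1 - sg)" by simp
    have "\<bar>conv (rhoj J) (w i) x\<bar> \<le> kbd TYPE('a) * 2^(J*DIM('a)) * (LBINT y. indicator (ball x (1/2^J)) y * \<bar>w i y\<bar>)"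
      by (rule conv_bound[OF bump_rhoj rhoj_bound rhoj_support wi])
    also have "\<dots> \<le> kbd TYPE('a) * 2^(J*DIM('a)) * (LBINT y. \<bar>w i y\<bar>)"
    proof (intro mult_left_mono integral_mono)
      show "integrable lborel (\<lambda>y. indicator (ball x (1/2^J)) y * \<bar>w i y\<bar>)" by (intro integrable_ind_mult integrable_abs wi)
    qed (use wi kbd_ge0[where 'a='a] in \<open>auto simp: indicator_def\<close>)
    finally show ?thesis using 1 unfolding M_def by linarith
  qed
  have ae: "AE x in lborel. cball x (2/2^J) \<subseteq> S \<longrightarrow> \<bar>w i x\<bar> \<le> M i" for i
  proof -
    obtain s where s: "strict_mono s" "AE x in lborel. (\<lambda>n. conv (rhoj (s n)) (w i) x) \<longlonglongrightarrow> w i x"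
      using mollify_AE[OF mollifier_rhoj wi] by blast
    from s(2) show ?thesis
    proof eventually_elim
      case (elim x)
      show ?case
      proof
        assume x: "cball x (2/2^J) \<subseteq> S"
        have "(\<lambda>n. \<bar>conv (rhoj (s n)) (w i) x\<bar>) \<longlonglongrightarrow> \<bar>w i x\<bar>" by (intro tendsto_intros elim)
        moreover have "\<exists>N. \<forall>n\<ge>N. \<bar>conv (rhoj (s n)) (w i) x\<bar> \<le> M i"
          using bd[OF x] seq_suble[OF s(1)] by (intro exI[of _ J]) (meson order_trans)
        ultimately show "\<bar>w i x\<bar> \<le> M i" by (rule LIMSEQ_le_const2)
      qed
    qed
  qed
  have M0: "M i \<ge> 0" for i unfolding M_def using kbd_ge0[where 'a='a] J sg
    by (intro add_nonneg_nonneg mult_nonneg_nonneg Bochner_Integration.integral_nonneg) auto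
  have "AE x in lborel. \<forall>i\<in>UNIV. cball x (2/2^J) \<subseteq> S \<longrightarrow> \<bar>w i x\<bar> \<le> M i"
    by (rule AE_finite_allI) (use ae in auto)
  then have "AE x in lborel. cball x (2/2^J) \<subseteq> S \<longrightarrow> a x \<le> (\<Sum>i\<in>UNIV. M i)"
    by eventually_elim (auto simp: a_def intro: sum_mono)
  then show ?thesis using J J0 dec M0 by (intro exI[of _ J] exI[of _ A] exI[of _ "\<Sum>i\<in>UNIV. M i"]) (auto intro: sum_nonneg)
qed

text \<open>Second pass: with \<open>a\<close> bounded by \<open>M\<close> the right-hand side is at
  most affine in \<open>dd\<close>, and Cauchy-Schwarz with the decay of \<open>en\<close> gives
  mass of order \<open>tau^(7*j)\<close>, two powers better than before. The radius
  \<open>4/2^J\<close> makes room for the balls of radius \<open>2/2^J\<close> around all points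
  seen by the kernel.\<close>

theorem potential_bounds:
  "\<exists>J A. J \<ge> 2 \<and> J \<ge> J0 \<and> A \<ge> 0 \<and> (\<forall>i x j. j \<ge> J \<longrightarrow> cball x (4/2^J) \<subseteq> S \<longrightarrow>
     \<bar>conv (kapj j) (G i) x\<bar> \<le> A * sg^j \<and>
     (\<forall>b\<in>Basis. \<bar>conv (partial_dir b (kapj j)) (G i) x\<bar> \<le> A * sg^j \<and>
        (\<forall>c\<in>Basis. \<bar>conv (partial_dir c (partial_dir b (kapj j))) (G i) x\<bar> \<le> A * (2 * sg)^j)))"
proof -
  obtain J A M where J: "J \<ge> 2" "A \<ge> 0" "M \<ge> 0" and J0: "J \<ge> J0" and dec: "\<And>x j. cball x (2/2^J) \<subseteq> S \<Longrightarrow> j \<ge> J \<Longrightarrow> en x j \<le> A * tau^(6*j)"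
    "\<And>x j i. cball x (2/2^J) \<subseteq> S \<Longrightarrow> j \<ge> J \<Longrightarrow> \<bar>conv (kapj j) (G i) x\<bar> \<le> A * sg^j"
    and ae: "AE x in lborel. cball x (2/2^J) \<subseteq> S \<longrightarrow> a x \<le> M"
    using bounded_solution[of J0] by blast
  define V where "V = 2^DIM('a) * om"
  define L where "L = C * M * (1 + V * A + M^2 * V)"
  have V0: "V \<ge> 0" "L \<ge> 0" using om0 J C0 by (auto simp: V_def L_def intro!: mult_nonneg_nonneg add_nonneg_nonneg)
  have Gint: "(LBINT y. indicator (ball x (2/2^j)) y * \<bar>G i y\<bar>) \<le> L * tau^(7*j)" if x: "cball x (4/2^J) \<subseteq> S" and j: "j \<ge> J" for x i j
  proof -
    let ?I = "\<lambda>y. indicator (ball x (2/2^j)) y :: real"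
    have mB: "measure lborel (ball x (2/2^j)) = V * tau^(8*j)" by (simp add: ball_meas_tau V_def)
    have r: "(2::real)/2^j \<le> 2/2^J" using j by (intro divide_left_mono power_increasing) auto
    have sub: "cball y (2/2^J) \<subseteq> S" if "y \<in> ball x (2/2^j)" for y
    proof -
      have "dist x z \<le> 4/2^J" if "dist y z \<le> 2/2^J" for z
        using dist_triangle[of x z y] that \<open>y \<in> ball x (2/2^j)\<close> r by simp
      then show ?thesis using x by (auto simp: subset_iff)
    qed
    have x2: "cball x (2/2^J) \<subseteq> S" using x subset_cball[of "2/2^J" "4/2^J" x] by (auto simp: divide_right_mono)
    have idd: "integrable lborel (\<lambda>y. ?I y * dd y)"
    proof -
      have [measurable]: "ball x (2/2^j) \<in> sets borel" by simp
      have e: "(?I y)^2 = ?I y" for y by (auto simp: indicator_def)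
      show ?thesis by (rule CS_real(1), measurable, measurable) (simp_all only: e integrable_ind_ball idd2)
    qed
    have ddi: "(LBINT y. ?I y * dd y) \<le> (1 + V * A) * tau^(7*j)"
    proof -
      have "(LBINT y. ?I y * \<bar>dd y\<bar>)^2 \<le> measure lborel (ball x (2/2^j)) * en x j"
        unfolding en_def by (rule ball_mean2[OF ddm idd2])
      also have "\<dots> \<le> (V * tau^(8*j)) * (A * tau^(6*j))" unfolding mB using dec(1)[OF x2 j] V0 tau by (intro mult_left_mono) auto
      also have "\<dots> = (V * A) * (tau^(7*j))^2" by (simp add: power_mult[symmetric] power_add[symmetric] mult_ac)
      also have "\<dots> \<le> (1 + V * A)^2 * (tau^(7*j))^2"
      proof (intro mult_right_mono)
        have "y \<le> (1 + y)^2" if "0 \<le> y" for y :: real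
          unfolding power2_sum using that zero_le_power2[of y] by simp
        then show "V * A \<le> (1 + V * A)^2" using V0 J by simp
      qed simp
      finally have "(LBINT y. ?I y * dd y)^2 \<le> ((1 + V * A) * tau^(7*j))^2" using dd0 by (simp add: power_mult_distrib)
      then show ?thesis by (rule power2_le_imp_le) (use V0 J tau in auto)
    qed
    have "(LBINT y. ?I y * \<bar>G i y\<bar>) \<le> (LBINT y. C * M * (?I y * dd y + M^2 * ?I y))"
    proof (rule integral_mono_AE)
      show "integrable lborel (\<lambda>y. ?I y * \<bar>G i y\<bar>)" by (intro integrable_ind_mult integrable_abs Gi)
      show "integrable lborel (\<lambda>y. C * M * (?I y * dd y + M^2 * ?I y))"
        by (intro integrable_mult_right Bochner_Integration.integrable_add idd integrable_ind_ball)
      from ae show "AE y in lborel. ?I y * \<bar>G i y\<bar> \<le> C * M * (?I y * dd y + M^2 * ?I y)"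
      proof eventually_elim
        case (elim y)
        show ?case
        proof (cases "y \<in> ball x (2/2^j)")
          case True
          then have aM: "a y \<le> M" using elim sub by blast
          have "\<bar>G i y\<bar> \<le> C * (a y * bb y)" by (rule Gb')
          also have "\<dots> \<le> C * (M * (dd y + M^2))" unfolding bb_def
            using aM a0[of y] dd0[of y] C0 J by (intro mult_left_mono mult_mono add_left_mono power_mono) auto
          finally show ?thesis using True by (simp add: mult.assoc)
        qed simp
      qed
    qed
    also have "\<dots> = C * M * ((LBINT y. ?I y * dd y) + M^2 * (V * tau^(8*j)))"
      using idd integrable_ind_ball[of x "2/2^j"] by (simp add: mB)
    also have "\<dots> \<le> C * M * ((1 + V * A) * tau^(7*j) + M^2 * (V * tau^(7*j)))"
    proof -
      have "tau^(8*j) \<le> tau^(7*j)" using tau by (intro power_decreasing) auto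
      then show ?thesis using ddi V0 C0 J by (intro mult_left_mono add_mono) auto
    qed
    also have "\<dots> = L * tau^(7*j)" by (simp add: L_def algebra_simps)
    finally show ?thesis .
  qed
  define A' where "A' = A + kbd TYPE('a) * L"
  have le: "A * s \<le> A' * s" "kbd TYPE('a) * L * s \<le> A' * s" if "s \<ge> 0" for s
    using that J V0 kbd_ge0[where 'a='a] by (auto simp: A'_def intro!: mult_right_mono)
  have main: "\<bar>conv (kapj j) (G i) x\<bar> \<le> A' * sg^j" "b \<in> Basis \<Longrightarrow> \<bar>conv (partial_dir b (kapj j)) (G i) x\<bar> \<le> A' * sg^j"
    "b \<in> Basis \<Longrightarrow> c \<in> Basis \<Longrightarrow> \<bar>conv (partial_dir c (partial_dir b (kapj j))) (G i) x\<bar> \<le> A' * (2 * sg)^j"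
    if x: "cball x (4/2^J) \<subseteq> S" and j: "j \<ge> J" for i x j b c
  proof -
    have x2: "cball x (2/2^J) \<subseteq> S" using x subset_cball[of "2/2^J" "4/2^J" x] by (auto simp: divide_right_mono)
    show "\<bar>conv (kapj j) (G i) x\<bar> \<le> A' * sg^j" by (rule order_trans[OF dec(2)[OF x2 j] le(1)]) (use sg in auto)
    show "\<bar>conv (partial_dir b (kapj j)) (G i) x\<bar> \<le> A' * sg^j" if b: "b \<in> Basis"
      by (rule order_trans[OF kap_conv_bound[OF kapj_bound1[OF b] kapj_support1[OF b] bump_partial[OF bump_kapj b] _ Gint[OF x j] tau_sg(2) V0(2)] le(2)])
        (use sg in auto)
    show "\<bar>conv (partial_dir c (partial_dir b (kapj j))) (G i) x\<bar> \<le> A' * (2 * sg)^j" if b: "b \<in> Basis" and c: "c \<in> Basis"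
      by (rule order_trans[OF kap_conv_bound[OF kapj_bound2[OF b c] kapj_support2[OF b c] bump_partial[OF bump_partial[OF bump_kapj b] c] _ Gint[OF x j] tau_sg(3) V0(2)] le(2)])
        (use sg in auto)
  qed
  have "A' \<ge> 0" using J V0 kbd_ge0[where 'a='a] by (auto simp: A'_def)
  then show ?thesis using J(1) J0 main by (intro exI[of _ J] exI[of _ A']) blast
qed

end

section \<open>Regularity of limits of dyadic mollifications\<close>

text \<open>The candidate for the regular representative. Where the mollifications diverge
  \<open>lim\<close> is an arbitrary value.\<close>

definition Lf :: "(nat \<Rightarrow> 'a::euclidean_space \<Rightarrow> real) \<Rightarrow> ('a \<Rightarrow> real) \<Rightarrow> 'a \<Rightarrow> real" where
  "Lf K w x = lim (\<lambda>j. conv (K j) w x)"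

text \<open>Dyadic characterisation of Hoelder continuity with exponent \<alpha>, where
  \<open>s\<close> is 2^(-\<alpha>); the extra factor 2 per scale is the cost of one
  derivative.\<close>

definition rate :: "(nat \<Rightarrow> 'a::euclidean_space \<Rightarrow> real) \<Rightarrow> ('a \<Rightarrow> real) \<Rightarrow> 'a set \<Rightarrow> real \<Rightarrow> real \<Rightarrow> nat \<Rightarrow> bool" where
  "rate K w U A s J \<longleftrightarrow> (\<forall>j\<ge>J. \<forall>x\<in>U. \<bar>conv (K j) w x - conv (K (Suc j)) w x\<bar> \<le> A * s^j \<and>
     (\<forall>b\<in>Basis. \<bar>conv (partial_dir b (K j)) w x - conv (partial_dir b (K (Suc j))) w x\<bar> \<le> A * (2 * s)^j))"

lemma dyadic_telescope:
  fixes f :: "nat \<Rightarrow> real"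
  assumes s: "0 < s" "s < 1" and A: "A \<ge> 0" and st: "\<And>j. j \<ge> J \<Longrightarrow> \<bar>f j - f (Suc j)\<bar> \<le> A * s^j"
  shows "convergent f" "\<And>j. j \<ge> J \<Longrightarrow> \<bar>f j - lim f\<bar> \<le> A / (1 - s) * s^j"
proof -
  have step: "\<bar>f j - f (j + n)\<bar> \<le> A / (1 - s) * (s^j - s^(j+n))" if "j \<ge> J" for j n
  proof (induction n)
    case (Suc n)
    have "\<bar>f (j+n) - f (Suc (j+n))\<bar> \<le> A * s^(j+n)" using that by (intro st) auto
    also have "\<dots> = A / (1 - s) * (s^(j+n) - s^(j+Suc n))" using s by (simp add: field_simps)
    finally have "\<bar>f j - f (j + Suc n)\<bar> \<le> A / (1 - s) * (s^j - s^(j+n)) + A / (1 - s) * (s^(j+n) - s^(j+Suc n))"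
      using Suc by simp
    then show ?case by (simp add: algebra_simps)
  qed simp
  have le: "\<bar>f j - f m\<bar> \<le> A / (1 - s) * s^j" if "j \<ge> J" "m \<ge> j" for j m
  proof -
    have "\<bar>f j - f m\<bar> \<le> A / (1 - s) * (s^j - s^m)" using step[OF that(1), of "m - j"] that(2) by simp
    also have "\<dots> \<le> A / (1 - s) * s^j" using s A by (intro mult_left_mono) auto
    finally show ?thesis .
  qed
  have "(\<lambda>j. A / (1 - s) * s^j) \<longlonglongrightarrow> A / (1 - s) * 0" using s by (intro tendsto_intros LIMSEQ_realpow_zero) auto
  then have z: "(\<lambda>j. A / (1 - s) * s^j) \<longlonglongrightarrow> 0" by simp
  have "Cauchy f"
  proof (rule CauchyI)
    fix e :: real assume "e > 0"
    then have "\<forall>\<^sub>F j in sequentially. A / (1 - s) * s^j < e/2" by (intro order_tendstoD(2)[OF z]) auto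
    then obtain N where N: "\<And>j. j \<ge> N \<Longrightarrow> A / (1 - s) * s^j < e/2" unfolding eventually_sequentially by blast
    define M where "M = max N J"
    have "norm (f m - f n) < e" if "m \<ge> M" "n \<ge> M" for m n
    proof -
      have "\<bar>f M - f m\<bar> \<le> A / (1 - s) * s^M" "\<bar>f M - f n\<bar> \<le> A / (1 - s) * s^M" by (rule le; use that in \<open>simp add: M_def\<close>)+
      moreover have "A / (1 - s) * s^M < e/2" by (rule N) (simp add: M_def)
      ultimately show ?thesis unfolding real_norm_def by linarith
    qed
    then show "\<exists>M. \<forall>m\<ge>M. \<forall>n\<ge>M. norm (f m - f n) < e" by blast
  qed
  then show conv: "convergent f" by (rule real_Cauchy_convergent)
  then have L: "f \<longlonglongrightarrow> lim f" by (simp add: convergent_LIMSEQ_iff)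
  show "\<bar>f j - lim f\<bar> \<le> A / (1 - s) * s^j" if j: "j \<ge> J" for j
  proof (rule LIMSEQ_le_const2)
    show "(\<lambda>m. \<bar>f j - f m\<bar>) \<longlonglongrightarrow> \<bar>f j - lim f\<bar>" by (intro tendsto_intros L)
    show "\<exists>N. \<forall>m\<ge>N. \<bar>f j - f m\<bar> \<le> A / (1 - s) * s^j" using le[OF j] by blast
  qed
qed

lemma rate_limit:
  assumes "rate K w U A s J" "0 < s" "s < 1" "A \<ge> 0" "x \<in> U"
  shows "(\<lambda>j. conv (K j) w x) \<longlonglongrightarrow> Lf K w x" "\<And>j. j \<ge> J \<Longrightarrow> \<bar>conv (K j) w x - Lf K w x\<bar> \<le> A / (1 - s) * s^j"
proof -
  have st: "\<bar>conv (K j) w x - conv (K (Suc j)) w x\<bar> \<le> A * s^j" if "j \<ge> J" for j using assms that by (auto simp: rate_def)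
  show "(\<lambda>j. conv (K j) w x) \<longlonglongrightarrow> Lf K w x"
    using dyadic_telescope(1)[OF assms(2-4) st] by (simp add: Lf_def convergent_LIMSEQ_iff)
  show "\<bar>conv (K j) w x - Lf K w x\<bar> \<le> A / (1 - s) * s^j" if "j \<ge> J" for j
    unfolding Lf_def using dyadic_telescope(2)[OF assms(2-4) st that] .
qed

text \<open>Picks the dyadic scale comparable to the distance \<open>h\<close>, at which the
  estimates for coarse and fine scales balance.\<close>

lemma dyadic_choice:
  fixes h :: real
  assumes "0 < h" "h \<le> (1/2)^J" shows "\<exists>N\<ge>J. h \<le> (1/2)^N \<and> (1/2)^N < 2 * h"
proof -
  have "\<exists>n. (1/2::real)^n < h" using assms(1) real_arch_pow_inv[of h "1/2"] by auto
  define n where "n = (LEAST n. (1/2::real)^n < h)"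
  have n: "(1/2::real)^n < h" unfolding n_def using \<open>\<exists>n. (1/2::real)^n < h\<close> by (rule LeastI_ex)
  have nJ: "n > J"
  proof (rule ccontr)
    assume "\<not> n > J"
    then have "(1/2::real)^J \<le> (1/2)^n" by (intro power_decreasing) auto
    then show False using n assms by linarith
  qed
  have "\<not> (1/2::real)^(n-1) < h" unfolding n_def by (rule not_less_Least) (use nJ n_def in auto)
  then show ?thesis using n nJ by (intro exI[of _ "n-1"]) (auto simp: power_eq_if split: if_splits)
qed

text \<open>Hoelder continuity follows by comparing with the mollification at the scale of the distance.\<close>

lemma rate_lhol:
  fixes K :: "nat \<Rightarrow> 'a::euclidean_space \<Rightarrow> real"
  assumes r: "rate K w U A s J" and s: "1/2 < s" "s < 1" and A: "A \<ge> 0" and U: "open U"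
    and K: "\<And>j. bump (K j)" and w: "integrable lborel w"
  shows "lhol U (Lf K w)"
proof (rule lholI)
  fix x0 assume "x0 \<in> U"
  then obtain r0 where r0: "r0 > 0" "cball x0 r0 \<subseteq> U" using U open_contains_cball by blast
  \<comment> \<open>The factor 1/2 keeps distances inside the ball at most 2^-J, so that the
    comparison scale \<open>N\<close> found below is at least \<open>J\<close>.\<close>
  define R where "R = min r0 ((1/2)^J / 2)"
  have R: "R > 0" "cball x0 R \<subseteq> U" "2 * R \<le> (1/2)^J"
    using r0 by (auto simp: R_def min_def intro: order_trans[OF subset_cball])
  define \<alpha> where "\<alpha> = - log 2 s"
  have s2: "s = (1/2) powr \<alpha>"
  proof -
    have "2 powr (- \<alpha>) = s" using s by (simp add: \<alpha>_def)
    then show ?thesis by (simp add: powr_minus_divide powr_divide)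
  qed
  have \<alpha>: "0 < \<alpha>" "\<alpha> \<le> 1"
  proof -
    have "log 2 s < log 2 1" using s by (subst log_less_cancel_iff) auto
    then show "0 < \<alpha>" by (simp add: \<alpha>_def)
    have "log 2 (1/2) \<le> log 2 s" using s by (subst log_le_cancel_iff) auto
    then show "\<alpha> \<le> 1" by (simp add: \<alpha>_def log_divide)
  qed
  obtain L where L: "L \<ge> 0" "\<And>x y. \<bar>conv (K J) w x - conv (K J) w y\<bar> \<le> L * dist x y" using conv_lipschitz[OF K w] by blast
  define C where "C = (L + real DIM('a) * A / (2 * s - 1) + 2 * A / (1 - s)) * 2"
  have C0: "C \<ge> 0" using L A s by (auto simp: C_def intro!: mult_nonneg_nonneg add_nonneg_nonneg divide_nonneg_nonneg)
  have main: "\<bar>Lf K w y - Lf K w z\<bar> \<le> C * dist y z powr \<alpha>" if y: "y \<in> ball x0 R" and z: "z \<in> ball x0 R" for y z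
  proof (cases "y = z")
    case False
    define h where "h = dist y z"
    have h: "h > 0" using False by (simp add: h_def)
    have "h \<le> 2 * R" using dist_triangle[of y z x0] y z by (simp add: h_def dist_commute)
    then obtain N where N: "N \<ge> J" "h \<le> (1/2)^N" "(1/2)^N < 2 * h" using dyadic_choice[OF h, of J] R(3) by auto
    have yU: "y \<in> U" "z \<in> U" using y z R(2) by auto
    have inc: "\<bar>(conv (K j) w y - conv (K (Suc j)) w y) - (conv (K j) w z - conv (K (Suc j)) w z)\<bar> \<le> real DIM('a) * (A * (2 * s)^j) * h" if "j \<ge> J" for j
      unfolding h_def
    proof (rule C1_lipschitz[where S=UNIV and x=x0 and r=R])
      have H: "HC (Suc 0) UNIV (\<lambda>x. conv (K j) w x - conv (K (Suc j)) w x)" by (intro HC_diff HC_conv K w)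
      show "(\<lambda>t. conv (K j) w (y + t *\<^sub>R b) - conv (K (Suc j)) w (y + t *\<^sub>R b)) differentiable at 0" if "b \<in> Basis" for b y
        using H that by auto
      show "continuous_on UNIV (partial_dir b (\<lambda>x. conv (K j) w x - conv (K (Suc j)) w x))" if "b \<in> Basis" for b
        using HC_continuous[OF HC_partial[OF H that]] .
      fix b y assume b: "b \<in> (Basis::'a set)" and y: "y \<in> cball x0 R"
      have "partial_dir b (\<lambda>x. conv (K j) w x - conv (K (Suc j)) w x) y = conv (partial_dir b (K j)) w y - conv (partial_dir b (K (Suc j))) w y"
        by (intro partial_dirI' DERIV_diff conv_DERIV K b w)
      then show "\<bar>partial_dir b (\<lambda>x. conv (K j) w x - conv (K (Suc j)) w x) y\<bar> \<le> A * (2 * s)^j"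
        using r that b y R(2) unfolding rate_def by auto
    qed (use y z in auto)
    have tel: "conv (K J) w x - conv (K N) w x = (\<Sum>j\<in>{J..<N}. conv (K j) w x - conv (K (Suc j)) w x)" for x
    proof -
      have "(\<Sum>j\<in>{J..<N}. conv (K j) w x - conv (K (Suc j)) w x) = - (\<Sum>j\<in>{J..<N}. conv (K (Suc j)) w x - conv (K j) w x)"
        by (simp add: sum_negf[symmetric])
      then show ?thesis using sum_Suc_diff'[OF N(1), of "\<lambda>j. conv (K j) w x"] by simp
    qed
    have "\<bar>(conv (K J) w y - conv (K N) w y) - (conv (K J) w z - conv (K N) w z)\<bar> \<le> (\<Sum>j\<in>{J..<N}. real DIM('a) * (A * (2 * s)^j) * h)"
      unfolding tel sum_subtractf[symmetric] by (rule order_trans[OF sum_abs]) (rule sum_mono, rule inc, simp)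
    also have "\<dots> \<le> (\<Sum>j<N. real DIM('a) * (A * (2 * s)^j) * h)" using A s h by (intro sum_mono2) auto
    also have "\<dots> = real DIM('a) * A * h * (\<Sum>j<N. (2 * s)^j)" by (simp add: sum_distrib_left mult_ac)
    \<comment> \<open>Since \<open>2 * s > 1\<close>, the geometric sum is governed by its last
      term, the one at the scale of the distance.\<close>
    also have "(\<Sum>j<N. (2 * s)^j) = ((2 * s)^N - 1) / (2 * s - 1)" using s by (subst geometric_sum) auto
    also have "real DIM('a) * A * h * (((2 * s)^N - 1) / (2 * s - 1)) \<le> real DIM('a) * A * h * ((2 * s)^N / (2 * s - 1))"
      using A s h by (intro mult_left_mono divide_right_mono) auto
    also have "\<dots> = real DIM('a) * A / (2 * s - 1) * (h * (2 * s)^N)" by simp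
    also have "\<dots> \<le> real DIM('a) * A / (2 * s - 1) * s^N"
    proof (rule mult_left_mono)
      have "h * (2 * s)^N \<le> (1/2)^N * (2 * s)^N" using N s by (intro mult_right_mono) auto
      also have "\<dots> = ((1/2) * (2 * s))^N" by (rule power_mult_distrib[symmetric])
      finally show "h * (2 * s)^N \<le> s^N" by simp
    qed (use A s in auto)
    finally have 1: "\<bar>(conv (K J) w y - conv (K N) w y) - (conv (K J) w z - conv (K N) w z)\<bar> \<le> real DIM('a) * A / (2 * s - 1) * s^N" .
    have 2: "\<bar>conv (K J) w y - conv (K J) w z\<bar> \<le> L * s^N"
    proof -
      have "(1/2::real)^N \<le> s^N" using s by (intro power_mono) auto
      then have "h \<le> s^N" using N(2) by linarith
      then show ?thesis using L(2)[of y z] L(1) mult_left_mono[of h "s^N" L] by (simp add: h_def)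
    qed
    have 3: "\<bar>conv (K N) w x - Lf K w x\<bar> \<le> A / (1 - s) * s^N" if "x \<in> U" for x
      by (rule rate_limit(2)[OF r _ s(2) A that N(1)]) (use s in auto)
    have "\<bar>Lf K w y - Lf K w z\<bar> \<le> L * s^N + real DIM('a) * A / (2 * s - 1) * s^N + (A / (1 - s) * s^N + A / (1 - s) * s^N)"
      using 1 2 3[OF yU(1)] 3[OF yU(2)] by linarith
    also have "\<dots> = (C / 2) * s^N" by (simp add: C_def algebra_simps)
    also have "\<dots> \<le> (C / 2) * (2 * h powr \<alpha>)"
    proof (rule mult_left_mono)
      have "s^N = ((1/2)^N) powr \<alpha>" unfolding s2 by (simp add: powr_realpow[symmetric] powr_powr mult.commute)
      also have "\<dots> \<le> (2 * h) powr \<alpha>" using N \<alpha> by (intro powr_mono2) auto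
      also have "\<dots> = 2 powr \<alpha> * h powr \<alpha>" using h by (simp add: powr_mult)
      also have "\<dots> \<le> 2 powr 1 * h powr \<alpha>" using \<alpha> by (intro mult_right_mono powr_mono) auto
      finally show "s^N \<le> 2 * h powr \<alpha>" by simp
    qed (use C0 in auto)
    finally show ?thesis by (simp add: h_def)
  qed (use C0 in auto)
  show "\<exists>r>0. \<exists>\<alpha>>0. \<exists>C\<ge>0. ball x0 r \<subseteq> U \<and> (\<forall>y\<in>ball x0 r. \<forall>z\<in>ball x0 r. \<bar>Lf K w y - Lf K w z\<bar> \<le> C * dist y z powr \<alpha>)"
    using R \<alpha> C0 main by (intro exI[of _ R] conjI exI[of _ \<alpha>] exI[of _ C]) (auto intro: order_trans[OF ball_subset_cball])
qed

text \<open>Along a short segment the derivatives of the mollifications converge uniformly by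
  \<open>rb\<close>, so differentiation and limit commute.\<close>

lemma rate_DERIV:
  fixes K :: "nat \<Rightarrow> 'a::euclidean_space \<Rightarrow> real"
  assumes r: "rate K w U A s J" and rb: "rate (\<lambda>j. partial_dir b (K j)) w U A s J" and s: "0 < s" "s < 1" and A: "A \<ge> 0" and U: "open U"
    and K: "\<And>j. bump (K j)" and w: "integrable lborel w" and b: "b \<in> Basis" and x: "x \<in> U"
  shows "((\<lambda>t. Lf K w (x + t *\<^sub>R b)) has_real_derivative Lf (\<lambda>j. partial_dir b (K j)) w x) (at 0)"
proof -
  obtain e where e: "e > 0" "ball x e \<subseteq> U" using U x open_contains_ball by blast
  define T where "T = {-e<..<e}"
  have inU: "x + t *\<^sub>R b \<in> U" if "t \<in> T" for t
    using that b e by (auto simp: T_def dist_norm intro!: subsetD[OF e(2)])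
  define D where "D t = Lf (\<lambda>j. partial_dir b (K j)) w (x + t *\<^sub>R b)" for t
  have z: "(\<lambda>n. A / (1 - s) * s^n) \<longlonglongrightarrow> 0"
    using tendsto_mult[OF tendsto_const LIMSEQ_realpow_zero[of s], of "A / (1 - s)"] s by simp
  have "\<exists>g. \<forall>t\<in>T. (\<lambda>n. conv (K n) w (x + t *\<^sub>R b)) \<longlonglongrightarrow> g t \<and> (g has_derivative (\<lambda>h. h * D t)) (at t within T)"
  proof (rule has_derivative_sequence)
    show "convex T" by (simp add: T_def)
    show "(0::real) \<in> T" using e by (simp add: T_def)
    show "(\<lambda>n. conv (K n) w (x + 0 *\<^sub>R b)) \<longlonglongrightarrow> Lf K w x" using rate_limit(1)[OF r s A x] by simp
    fix n t assume "t \<in> T"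
    have "((\<lambda>u. conv (K n) w ((x + t *\<^sub>R b) + u *\<^sub>R b)) has_real_derivative conv (partial_dir b (K n)) w (x + t *\<^sub>R b)) (at 0)"
      by (rule conv_DERIV[OF K b w])
    then have "((\<lambda>u. conv (K n) w (x + (u + t) *\<^sub>R b)) has_real_derivative conv (partial_dir b (K n)) w (x + t *\<^sub>R b)) (at 0)"
      by (simp add: algebra_simps)
    then have "((\<lambda>u. conv (K n) w (x + u *\<^sub>R b)) has_real_derivative conv (partial_dir b (K n)) w (x + t *\<^sub>R b)) (at t)"
      using DERIV_shift[of "\<lambda>u. conv (K n) w (x + u *\<^sub>R b)" _ 0 t] by simp
    then show "((\<lambda>u. conv (K n) w (x + u *\<^sub>R b)) has_derivative (\<lambda>h. h * conv (partial_dir b (K n)) w (x + t *\<^sub>R b))) (at t within T)"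
      by (simp add: has_field_derivative_def has_derivative_at_withinI mult_commute_abs)
  next
    fix \<epsilon> :: real assume "\<epsilon> > 0"
    then have "\<forall>\<^sub>F n in sequentially. A / (1 - s) * s^n < \<epsilon>" by (rule order_tendstoD(2)[OF z])
    then show "\<forall>\<^sub>F n in sequentially. \<forall>t\<in>T. \<forall>h. norm (h * conv (partial_dir b (K n)) w (x + t *\<^sub>R b) - h * D t) \<le> \<epsilon> * norm h"
      using eventually_ge_at_top[of J]
    proof eventually_elim
      case (elim n)
      show ?case
      proof (intro ballI allI)
        fix t h :: real assume "t \<in> T"
        have "\<bar>conv (partial_dir b (K n)) w (x + t *\<^sub>R b) - D t\<bar> \<le> A / (1 - s) * s^n"
          unfolding D_def by (rule rate_limit(2)[OF rb s A inU[OF \<open>t \<in> T\<close>] elim(2)])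
        then have "\<bar>h\<bar> * \<bar>conv (partial_dir b (K n)) w (x + t *\<^sub>R b) - D t\<bar> \<le> \<bar>h\<bar> * \<epsilon>" using elim(1) by (intro mult_left_mono) auto
        then show "norm (h * conv (partial_dir b (K n)) w (x + t *\<^sub>R b) - h * D t) \<le> \<epsilon> * norm h"
          by (simp add: abs_mult[symmetric] right_diff_distrib mult.commute)
      qed
    qed
  qed
  then obtain g where g: "\<And>t. t \<in> T \<Longrightarrow> (\<lambda>n. conv (K n) w (x + t *\<^sub>R b)) \<longlonglongrightarrow> g t"
    "\<And>t. t \<in> T \<Longrightarrow> (g has_derivative (\<lambda>h. h * D t)) (at t within T)" by blast
  have gL: "g t = Lf K w (x + t *\<^sub>R b)" if "t \<in> T" for t
    using LIMSEQ_unique[OF g(1)[OF that] rate_limit(1)[OF r s A inU[OF that]]] .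
  have T0: "open T" "0 \<in> T" using e by (auto simp: T_def)
  have "(g has_derivative (\<lambda>h. h * D 0)) (at 0)" using g(2)[OF T0(2)] at_within_open[OF T0(2,1)] by simp
  then have "(g has_real_derivative D 0) (at 0)" by (simp add: has_field_derivative_def mult_commute_abs)
  moreover have "\<forall>\<^sub>F t in nhds 0. g t = Lf K w (x + t *\<^sub>R b)"
    using eventually_nhds_in_open[OF T0] by (rule eventually_mono) (rule gL)
  ultimately have "((\<lambda>t. Lf K w (x + t *\<^sub>R b)) has_real_derivative D 0) (at 0)"
    using DERIV_cong_ev[of 0 0 g "\<lambda>t. Lf K w (x + t *\<^sub>R b)"] by simp
  then show ?thesis by (simp add: D_def)
qed

lemma rate_HC1:
  fixes K :: "nat \<Rightarrow> 'a::euclidean_space \<Rightarrow> real"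
  assumes r: "rate K w U A s J" and rb: "\<And>b. b \<in> Basis \<Longrightarrow> rate (\<lambda>j. partial_dir b (K j)) w U A s J"
    and s: "1/2 < s" "s < 1" and A: "A \<ge> 0" and U: "open U" and K: "\<And>j. bump (K j)" and w: "integrable lborel w"
  shows "HC (Suc 0) U (Lf K w)"
proof (rule HC_SucI[OF U, where g="\<lambda>b. Lf (\<lambda>j. partial_dir b (K j)) w"])
  fix b x :: 'a assume b: "b \<in> Basis"
  show "HC 0 U (Lf (\<lambda>j. partial_dir b (K j)) w)" using rate_lhol[OF rb[OF b] s A U bump_partial[OF K b] w] by simp
  assume x: "x \<in> U"
  show "((\<lambda>t. Lf K w (x + t *\<^sub>R b)) has_real_derivative Lf (\<lambda>j. partial_dir b (K j)) w x) (at 0)"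
    by (rule rate_DERIV[OF r rb[OF b] _ s(2) A U K w b x]) (use s in auto)
qed

lemma rate_HC2:
  fixes K :: "nat \<Rightarrow> 'a::euclidean_space \<Rightarrow> real"
  assumes r: "rate K w U A s J" and rb: "\<And>b. b \<in> Basis \<Longrightarrow> rate (\<lambda>j. partial_dir b (K j)) w U A s J"
    and rc: "\<And>b c. b \<in> Basis \<Longrightarrow> c \<in> Basis \<Longrightarrow> rate (\<lambda>j. partial_dir c (partial_dir b (K j))) w U A s J"
    and s: "1/2 < s" "s < 1" and A: "A \<ge> 0" and U: "open U" and K: "\<And>j. bump (K j)" and w: "integrable lborel w"
  shows "HC (Suc (Suc 0)) U (Lf K w)"
proof (rule HC_SucI[OF U, where g="\<lambda>b. Lf (\<lambda>j. partial_dir b (K j)) w"])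
  fix b x :: 'a assume b: "b \<in> Basis"
  show "HC (Suc 0) U (Lf (\<lambda>j. partial_dir b (K j)) w)" by (rule rate_HC1[OF rb[OF b] rc[OF b] s A U bump_partial[OF K b] w])
  assume x: "x \<in> U"
  show "((\<lambda>t. Lf K w (x + t *\<^sub>R b)) has_real_derivative Lf (\<lambda>j. partial_dir b (K j)) w x) (at 0)"
    by (rule rate_DERIV[OF r rb[OF b] _ s(2) A U K w b x]) (use s in auto)
qed

text \<open>Both sides are differentiated along \<open>b\<close>; every derivative falls on a
  kernel, so \<open>w\<close> and \<open>G\<close> remain as they are.\<close>

lemma rep_deriv:
  assumes U: "open U" and eq: "\<And>x. x \<in> U \<Longrightarrow> conv k1 w x - conv k2 w x = conv k3 G x"
    and k: "bump k1" "bump k2" "bump k3" and w: "integrable lborel w" "integrable lborel G" and b: "b \<in> Basis" and x: "x \<in> U"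
  shows "conv (partial_dir b k1) w x - conv (partial_dir b k2) w x = conv (partial_dir b k3) G x"
proof -
  have "((\<lambda>t. conv k1 w (x + t *\<^sub>R b) - conv k2 w (x + t *\<^sub>R b)) has_real_derivative conv (partial_dir b k1) w x - conv (partial_dir b k2) w x) (at 0)"
    by (intro DERIV_diff conv_DERIV k b w)
  then have "((\<lambda>t. conv k3 G (x + t *\<^sub>R b)) has_real_derivative conv (partial_dir b k1) w x - conv (partial_dir b k2) w x) (at 0)"
    using partial_cong[OF U x, of "\<lambda>x. conv k1 w x - conv k2 w x" "conv k3 G" b] eq by simp
  then show ?thesis using conv_DERIV[OF k(3) b w(2), of x] by (rule DERIV_unique)
qed

lemma conv_rhoj_tendsto:
  fixes w :: "'a::euclidean_space \<Rightarrow> real"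
  assumes w: "integrable lborel w" and c: "isCont w x"
  shows "(\<lambda>j. conv (rhoj j) w x) \<longlonglongrightarrow> w x"
proof (rule LIMSEQ_I)
  fix e :: real assume e: "e > 0"
  then obtain d where d: "d > 0" "\<And>y. dist y x < d \<Longrightarrow> dist (w y) (w x) < e/2"
    using c unfolding continuous_at_eps_delta by (metis half_gt_zero)
  have "(\<lambda>j. (1/2::real)^j) \<longlonglongrightarrow> 0" by (intro LIMSEQ_realpow_zero) auto
  then have "\<forall>\<^sub>F j in sequentially. (1/2::real)^j < d" using d by (intro order_tendstoD(2)) auto
  then obtain N where N: "\<And>j. j \<ge> N \<Longrightarrow> 1/2^j < d" unfolding eventually_sequentially by (auto simp: power_one_over)
  have "norm (conv (rhoj j) w x - w x) < e" if j: "j \<ge> N" for j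
  proof -
    have ri: "integrable lborel (\<lambda>y. rhoj j (x - y))"
    proof -
      have "bump (\<lambda>y. rhoj j (x + (-1) *\<^sub>R y))" by (rule bump_affine[OF bump_rhoj]) simp
      then show ?thesis using bump_integrable by fastforce
    qed
    have r1: "(LBINT y. rhoj j (x - y)) = 1"
      using integral_reflect[OF bump_measurable[OF bump_rhoj], of j x] rhoj_integral[of j] by simp
    have iw: "integrable lborel (\<lambda>y. rhoj j (x - y) * w y)" by (rule conv_integrable[OF bump_rhoj w])
    have "conv (rhoj j) w x - w x = (LBINT y. rhoj j (x - y) * w y - rhoj j (x - y) * w x)"
      unfolding conv_def using iw ri r1 by simp
    also have "\<bar>\<dots>\<bar> \<le> (LBINT y. rhoj j (x - y) * (e/2))"
    proof (rule integral_abs_bound_integral)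
      fix y
      have "\<bar>rhoj j (x - y) * w y - rhoj j (x - y) * w x\<bar> = rhoj j (x - y) * \<bar>w y - w x\<bar>"
        by (simp add: right_diff_distrib[symmetric] abs_mult rhoj_ge0)
      also have "\<dots> \<le> rhoj j (x - y) * (e/2)"
      proof (cases "1/2^j \<le> norm (x - y)")
        case False
        then have "dist y x < d" using N[OF j] by (simp add: dist_norm norm_minus_commute)
        then show ?thesis using d(2)[of y] by (intro mult_left_mono rhoj_ge0) (auto simp: dist_real_def)
      qed (simp add: rhoj_support)
      finally show "\<bar>rhoj j (x - y) * w y - rhoj j (x - y) * w x\<bar> \<le> rhoj j (x - y) * (e/2)" .
    qed (use iw ri in auto)
    also have "\<dots> = e/2" using r1 by simp
    finally show ?thesis using e by simp
  qed
  then show "\<exists>no. \<forall>j\<ge>no. norm (conv (rhoj j) w x - w x) < e" by blast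
qed

section \<open>Schauder estimates\<close>

text \<open>Compactness of the ball. The room \<open>e\<close> is used to differentiate at
  \<open>x\<close>, which involves balls about neighbouring points.\<close>

lemma cball_enlarge:
  fixes x :: "'a::euclidean_space"
  assumes "open S" "cball x r \<subseteq> S" "r > 0" shows "\<exists>e>0. cball x (r + e) \<subseteq> S"
proof -
  obtain e where e: "e > 0" "(\<Union>y\<in>cball x r. cball y e) \<subseteq> S"
    using compact_subset_open_imp_cball_epsilon_subset[OF compact_cball assms(1,2)] by blast
  have "y \<in> S" if y: "dist x y \<le> r + e" for y
  proof -
    define z where "z = x + (r / (r + e)) *\<^sub>R (y - x)"
    have n: "norm (y - x) \<le> r + e" using y by (simp add: dist_norm norm_minus_commute)
    have "dist x z = (r / (r + e)) * norm (y - x)" using assms(3) e by (simp add: z_def dist_norm)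
    also have "\<dots> \<le> (r / (r + e)) * (r + e)" using n assms(3) e by (intro mult_left_mono) auto
    finally have 1: "dist x z \<le> r" using assms(3) e by simp
    have "y - z = (1 - r / (r + e)) *\<^sub>R (y - x)" by (simp add: z_def algebra_simps)
    then have "dist z y = \<bar>1 - r / (r + e)\<bar> * norm (y - x)" by (simp add: dist_norm norm_minus_commute[of z])
    also have "1 - r / (r + e) = e / (r + e)" using assms(3) e by (simp add: field_simps)
    also have "\<bar>e / (r + e)\<bar> * norm (y - x) \<le> \<bar>e / (r + e)\<bar> * (r + e)" using n by (intro mult_left_mono) auto
    finally have "dist z y \<le> e" using assms(3) e by simp
    with 1 have "y \<in> (\<Union>y\<in>cball x r. cball y e)" by auto
    then show ?thesis using e(2) by blast
  qed
  then show ?thesis using e(1) by (intro exI[of _ e]) auto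
qed

section \<open>Differentiating the kernel form of the equation\<close>

lemma integrable_cball: "continuous_on (cball x r) f \<Longrightarrow> integrable lborel (\<lambda>y. indicator (cball (x::'a::euclidean_space) r) y * f y :: real)"
  using borel_integrable_compact[of "cball x r" f] by simp

text \<open>\<open>p\<close> is only once differentiable. Its difference quotients have integral
  zero by translation invariance and are bounded with support in a fixed ball, so dominated
  convergence gives integral zero for the derivative.\<close>

lemma integral_partial_zero:
  fixes p :: "'a::euclidean_space \<Rightarrow> real"
  assumes p: "HC (Suc 0) UNIV p" and R: "\<And>x. R \<le> norm x \<Longrightarrow> p x = 0" and b: "b \<in> Basis"
  shows "(LBINT x. partial_dir b p x) = 0"
proof -
  have c: "continuous_on A p" "continuous_on A (partial_dir b p)" for A
    using HC_continuous[OF p] HC_continuous[OF HC_partial[OF p b]] continuous_on_subset by blast+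
  have pz: "partial_dir b p y = 0" if "R < norm y" for y
  proof -
    have "open {y::'a. R < norm y}" by (intro open_Collect_less continuous_intros)
    then have "((\<lambda>t. p (y + t *\<^sub>R b)) has_real_derivative 0) (at 0)"
      using partial_cong[of "{y. R < norm y}" y "\<lambda>_. 0" p b 0] that R by simp
    then show ?thesis by (rule partial_dirI')
  qed
  have "compact (partial_dir b p ` cball 0 R)" using c by (intro compact_continuous_image) auto
  from compact_imp_bounded[OF this] obtain M0 where M0: "\<And>x. x \<in> cball 0 R \<Longrightarrow> \<bar>partial_dir b p x\<bar> \<le> M0"
    unfolding bounded_iff ball_simps(9) real_norm_def by blast
  define M where "M = max M0 0"
  have M: "\<bar>partial_dir b p x\<bar> \<le> M" for x using M0[of x] pz[of x] by (cases "norm x \<le> R") (auto simp: M_def)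
  have lip: "\<bar>p (z + t *\<^sub>R b) - p z\<bar> \<le> M * \<bar>t\<bar>" for z t
  proof -
    have "norm (p (z + t *\<^sub>R b) - p (z + 0 *\<^sub>R b)) \<le> M * norm (t - 0)"
      by (rule field_differentiable_bound[where S=UNIV and f="\<lambda>t. p (z + t *\<^sub>R b)" and f'="\<lambda>s. partial_dir b p (z + s *\<^sub>R b)"])
        (use p b M in \<open>auto intro: DERIV_partial_at\<close>)
    then show ?thesis by simp
  qed
  have [measurable]: "p \<in> borel_measurable borel" using c(1) by (rule borel_measurable_continuous_onI)
  have [measurable]: "partial_dir b p \<in> borel_measurable borel" using c(2) by (rule borel_measurable_continuous_onI)
  have pI: "p = (\<lambda>x. indicator (cball 0 R) x * p x)" using R by (auto simp: indicator_def fun_eq_iff)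
  have ip: "integrable lborel p" by (subst pI) (rule integrable_cball[OF c(1)])
  define X where "X n = 1 / real (Suc n)" for n
  have X: "X n \<noteq> 0" "0 < X n" "X n \<le> 1" for n by (auto simp: X_def)
  have X0: "X \<longlonglongrightarrow> 0" unfolding X_def by (rule LIMSEQ_Suc[OF lim_1_over_n])
  have ish: "integrable lborel (\<lambda>x. p (x + t *\<^sub>R b))" for t
  proof -
    have "(NBINT x. ennreal (norm (p (x + t *\<^sub>R b)))) = (NBINT x. ennreal (norm (p x)))"
      by (rule nn_integral_shift[of "\<lambda>x. ennreal (norm (p x))"]) measurable
    then show ?thesis using ip by (simp add: integrable_iff_bounded)
  qed
  have "(\<lambda>n. LBINT x. (p (x + X n *\<^sub>R b) - p x) / X n) \<longlonglongrightarrow> (LBINT x. partial_dir b p x)"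
  proof (rule integral_dominated_convergence[where w="\<lambda>x. M * indicator (ball 0 (R + 2)) x"])
    show "integrable lborel (\<lambda>x. M * indicator (ball (0::'a) (R + 2)) x)" by (intro integrable_mult_right integrable_ind_ball)
    show "AE x in lborel. (\<lambda>n. (p (x + X n *\<^sub>R b) - p x) / X n) \<longlonglongrightarrow> partial_dir b p x"
    proof (rule AE_I2)
      fix x
      have "((\<lambda>h. (p (x + h *\<^sub>R b) - p x) / h) \<longlongrightarrow> partial_dir b p x) (at 0)"
        using HC_DERIV[OF p b, of x] by (simp add: has_field_derivative_iff)
      then show "(\<lambda>n. (p (x + X n *\<^sub>R b) - p x) / X n) \<longlonglongrightarrow> partial_dir b p x"
        using X X0 unfolding tendsto_at_iff_sequentially by (auto simp: o_def)
    qed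
    fix n
    show "AE x in lborel. norm ((p (x + X n *\<^sub>R b) - p x) / X n) \<le> M * indicator (ball 0 (R + 2)) x"
    proof (rule AE_I2)
      fix x
      show "norm ((p (x + X n *\<^sub>R b) - p x) / X n) \<le> M * indicator (ball 0 (R + 2)) x"
      proof (cases "norm x < R + 2")
        case True
        have "\<bar>p (x + X n *\<^sub>R b) - p x\<bar> / \<bar>X n\<bar> \<le> M" using lip[of x "X n"] X(2)[of n] by (simp add: field_simps)
        then show ?thesis using True by simp
      next
        case False
        have "norm (X n *\<^sub>R b) \<le> 1" using X[of n] b by simp
        then have "R \<le> norm (x + X n *\<^sub>R b)" using False norm_triangle_ineq4[of "x + X n *\<^sub>R b" "X n *\<^sub>R b"] by simp
        then show ?thesis using False R[of x] R[of "x + X n *\<^sub>R b"] by simp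
      qed
    qed
  qed measurable
  moreover have "(LBINT x. (p (x + X n *\<^sub>R b) - p x) / X n) = 0" for n
    using ip ish integral_shift[of p "X n *\<^sub>R b"] by simp
  ultimately have "(\<lambda>n::nat. 0::real) \<longlonglongrightarrow> (LBINT x. partial_dir b p x)" by (simp only:)
  then show ?thesis by (simp only: LIMSEQ_const_iff)
qed

text \<open>The kernel vanishes outside the ball, so its product with \<open>w\<close> is of class
  \<open>HC (Suc 0)\<close> on the whole space, whatever \<open>w\<close> does off \<open>S\<close>;
  the integral of its derivative is zero.\<close>

lemma conv_IBP:
  fixes k w :: "'a::euclidean_space \<Rightarrow> real"
  assumes k: "bump k" "\<And>z. r \<le> norm z \<Longrightarrow> k z = 0" and S: "open S" "cball x r \<subseteq> S" and w: "HC (Suc 0) S w" and b: "b \<in> Basis"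
  shows "conv (partial_dir b k) w x = conv k (partial_dir b w) x"
proof -
  define q where "q y = k (x + (-1) *\<^sub>R y)" for y
  have q: "bump q" unfolding q_def by (rule bump_affine[OF k(1)]) simp
  have pq: "partial_dir b q y = - partial_dir b k (x - y)" for y
    unfolding q_def using partial_affine[OF k(1) b, of x "-1"] by simp
  have qk: "q y = k (x - y)" for y by (simp add: q_def)
  have q0: "q y = 0" if "r \<le> dist x y" for y using that by (simp add: qk k(2) dist_norm)
  define p where "p y = q y * w y" for y
  have out: "r < dist x y" if "y \<notin> S" for y using that S(2) by (meson mem_cball not_le subsetD)
  have oo: "open {y. r < dist x y}" by (intro open_Collect_less continuous_intros)
  have HCp: "HC (Suc 0) UNIV p"
  proof (rule HC_local)
    fix y :: 'a
    show "\<exists>e>0. ball y e \<subseteq> UNIV \<and> HC (Suc 0) (ball y e) p"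
    proof (cases "y \<in> S")
      case True
      then obtain e where e: "e > 0" "ball y e \<subseteq> S" using S(1) open_contains_ball by blast
      have "HC (Suc 0) (ball y e) p" unfolding p_def
        by (intro HC_mult HC_subset[OF bump_HC[OF q]] HC_subset[OF w e(2)]) auto
      then show ?thesis using e(1) by blast
    next
      case False
      then obtain e where e: "e > 0" "ball y e \<subseteq> {y. r < dist x y}" using out oo open_contains_ball by blast
      have "HC (Suc 0) (ball y e) p"
        by (rule HC_cong[OF _ HC_const[of _ _ 0]]) (use e(2) q0 in \<open>auto simp: p_def subset_iff\<close>)
      then show ?thesis using e(1) by blast
    qed
  qed
  obtain R where R: "R > 0" "\<And>y. R \<le> norm y \<Longrightarrow> q y = 0" using q by (auto simp: bump_def)
  have 0: "(LBINT y. partial_dir b p y) = 0"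
    by (rule integral_partial_zero[OF HCp _ b, of R]) (simp add: p_def R)
  have pp: "partial_dir b p y = k (x - y) * partial_dir b w y - partial_dir b k (x - y) * w y" for y
  proof (cases "y \<in> S")
    case True
    show ?thesis
      using DERIV_mult[OF bump_DERIV0[OF q b, of y] HC_DERIV[OF w b True]]
      by (intro partial_dirI') (simp add: p_def pq qk algebra_simps)
  next
    case False
    then have o: "r < dist x y" by (rule out)
    have "((\<lambda>t. p (y + t *\<^sub>R b)) has_real_derivative 0) (at 0)"
      using partial_cong[OF oo, of y "\<lambda>_. 0" p b 0] o q0 by (simp add: p_def)
    then have "partial_dir b p y = 0" by (rule partial_dirI')
    moreover have "k (x - y) = 0" "partial_dir b k (x - y) = 0"
      using o k(2) partial_support[OF k(2) k(1) b] by (auto simp: dist_norm)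
    ultimately show ?thesis by simp
  qed
  have i: "integrable lborel (\<lambda>y. l (x - y) * v y)" if l: "bump l" "\<And>z. r \<le> norm z \<Longrightarrow> l z = 0" and v: "continuous_on S v" for l v
  proof -
    have "continuous_on (cball x r) (\<lambda>y. l (x - y) * v y)"
      by (intro continuous_intros continuous_on_compose2[OF bump_continuous[OF l(1), of UNIV]] continuous_on_subset[OF v S(2)]) auto
    from integrable_cball[OF this] have "integrable lborel (\<lambda>y. indicator (cball x r) y * (l (x - y) * v y))" .
    moreover have "(\<lambda>y. indicator (cball x r) y * (l (x - y) * v y)) = (\<lambda>y. l (x - y) * v y)"
      using l(2) by (auto simp: indicator_def dist_norm fun_eq_iff)
    ultimately show ?thesis by simp
  qed
  have i1: "integrable lborel (\<lambda>y. k (x - y) * partial_dir b w y)"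
    by (rule i[OF k HC_continuous[OF HC_partial[OF w b]]])
  have i2: "integrable lborel (\<lambda>y. partial_dir b k (x - y) * w y)"
    by (rule i[OF bump_partial[OF k(1) b] partial_support[OF k(2) k(1) b] HC_continuous[OF w]])
  show ?thesis using 0 unfolding pp conv_def using i1 i2 by simp
qed

text \<open>As \<open>w\<close> is controlled on \<open>S\<close> only, it is cut off to a slightly
  larger ball, where \<open>conv_DERIV\<close> applies; near \<open>x\<close> the convolution does
  not notice the cut, and \<open>conv_IBP\<close> moves the derivative from the kernel onto
  \<open>w\<close>.\<close>

lemma conv_DERIV_local:
  fixes k w :: "'a::euclidean_space \<Rightarrow> real"
  assumes k: "bump k" "\<And>z. r \<le> norm z \<Longrightarrow> k z = 0" and r: "r > 0" and S: "open S" "cball x r \<subseteq> S" and w: "HC (Suc 0) S w" and b: "b \<in> Basis"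
  shows "((\<lambda>t. conv k w (x + t *\<^sub>R b)) has_real_derivative conv k (partial_dir b w) x) (at 0)"
proof -
  obtain e where e: "e > 0" "cball x (r + e) \<subseteq> S" using cball_enlarge[OF S r] by blast
  define w1 where "w1 y = indicator (cball x (r + e)) y * w y" for y
  have w1: "integrable lborel w1" unfolding w1_def
    by (rule integrable_cball) (rule continuous_on_subset[OF HC_continuous[OF w] e(2)])
  have eq: "conv k w1 z = conv k w z" if "z \<in> ball x e" for z
  proof (rule conv_cong[OF k(2)])
    fix y assume "y \<in> ball z r"
    then have "dist x y \<le> r + e" using that dist_triangle[of x y z] by simp
    then show "w1 y = w y" by (simp add: w1_def)
  qed
  have "conv (partial_dir b k) w1 x = conv (partial_dir b k) w x"
    by (rule conv_cong[OF partial_support[OF k(2) k(1) b]]) (use e in \<open>auto simp: w1_def\<close>)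
  also have "\<dots> = conv k (partial_dir b w) x" by (rule conv_IBP[OF k S w b])
  finally have "((\<lambda>t. conv k w1 (x + t *\<^sub>R b)) has_real_derivative conv k (partial_dir b w) x) (at 0)"
    using conv_DERIV[OF k(1) b w1, of x] by simp
  then show ?thesis using partial_cong[of "ball x e" x "conv k w1" "conv k w" b] eq e by simp
qed

text \<open>Derivatives of a solution solve the differentiated equation, which lets the Schauder
  estimate be iterated. The identity is differentiated at \<open>x\<close>, hence needed on a
  neighbourhood, which the enlarged ball provides.\<close>

lemma repr_partial:
  assumes S: "open S" and w: "HC (Suc 0) S w" and G: "HC (Suc 0) S G" and r: "repr S w G" and b: "b \<in> Basis"
  shows "repr S (partial_dir b w) (partial_dir b G)"
  unfolding repr_def
proof (intro allI impI)
  fix j x assume x: "cball x (1/2^j) \<subseteq> S"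
  have le: "(1::real)/2^Suc j \<le> 1/2^j" by (intro divide_left_mono power_increasing) auto
  have sup: "1/2^j \<le> norm z \<Longrightarrow> rhoj (Suc j) z = 0" for z :: 'a using le by (intro rhoj_support) linarith
  obtain e where e: "e > 0" "cball x (1/2^j + e) \<subseteq> S" using cball_enlarge[OF S x] by auto
  have eq: "conv (rhoj j) w z - conv (rhoj (Suc j)) w z = conv (kapj (Suc j)) G z" if z: "z \<in> ball x e" for z
  proof -
    have "cball z (1/2^j) \<subseteq> cball x (1/2^j + e)"
    proof
      fix y assume "y \<in> cball z (1/2^j)"
      then show "y \<in> cball x (1/2^j + e)" using z dist_triangle[of x y z] by simp
    qed
    then show ?thesis using r e unfolding repr_def by blast
  qed
  have 1: "((\<lambda>t. conv (rhoj j) w (x + t *\<^sub>R b) - conv (rhoj (Suc j)) w (x + t *\<^sub>R b)) has_real_derivative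
     conv (rhoj j) (partial_dir b w) x - conv (rhoj (Suc j)) (partial_dir b w) x) (at 0)"
    by (intro DERIV_diff conv_DERIV_local[where r="1/2^j" and S=S] bump_rhoj rhoj_support sup S x w b) auto
  have 2: "((\<lambda>t. conv (kapj (Suc j)) G (x + t *\<^sub>R b)) has_real_derivative conv (kapj (Suc j)) (partial_dir b G) x) (at 0)"
    by (intro conv_DERIV_local[where r="1/2^j" and S=S] bump_kapj kapj_Suc_support S x G b) auto
  have "((\<lambda>t. conv (kapj (Suc j)) G (x + t *\<^sub>R b)) has_real_derivative
     conv (rhoj j) (partial_dir b w) x - conv (rhoj (Suc j)) (partial_dir b w) x) (at 0)"
    using partial_cong[of "ball x e" x "\<lambda>x. conv (rhoj j) w x - conv (rhoj (Suc j)) w x" "conv (kapj (Suc j)) G" b] eq e 1 by simp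
  then show "conv (rhoj j) (partial_dir b w) x - conv (rhoj (Suc j)) (partial_dir b w) x = conv (kapj (Suc j)) (partial_dir b G) x"
    using 2 by (rule DERIV_unique)
qed

section \<open>Hoelder bounds for second derivatives\<close>

lemma conv_size:
  fixes k G :: "'a::euclidean_space \<Rightarrow> real"
  assumes k: "bump k" "\<And>z. \<bar>k z\<bar> \<le> c" "\<And>z. R \<le> norm z \<Longrightarrow> k z = 0" and G: "integrable lborel G"
    and M: "\<And>y. y \<in> ball x R \<Longrightarrow> \<bar>G y\<bar> \<le> M" and c: "c \<ge> 0"
  shows "\<bar>conv k G x\<bar> \<le> c * (M * measure lborel (ball x R))"
proof -
  have "\<bar>conv k G x\<bar> \<le> c * (LBINT y. indicator (ball x R) y * \<bar>G y\<bar>)" by (rule conv_bound[OF k G])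
  also have "\<dots> \<le> c * (LBINT y. M * indicator (ball x R) y)"
  proof (intro mult_left_mono integral_mono c)
    show "integrable lborel (\<lambda>y. indicator (ball x R) y * \<bar>G y\<bar>)" by (intro integrable_ind_mult integrable_abs G)
    show "integrable lborel (\<lambda>y. M * indicator (ball x R) y)" by (intro integrable_mult_right integrable_ind_ball)
    fix y show "indicator (ball x R) y * \<bar>G y\<bar> \<le> M * indicator (ball x R) y" using M[of y] by (auto simp: indicator_def)
  qed
  also have "\<dots> = c * (M * measure lborel (ball x R))" using integrable_ind_ball[of x R] by simp
  finally show ?thesis .
qed

text \<open>A kernel of mean zero does not see the constant \<open>G x\<close>, so only the
  oscillation of \<open>G\<close> on the ball counts.\<close>

lemma conv_cancel:
  fixes k G :: "'a::euclidean_space \<Rightarrow> real"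
  assumes k: "bump k" "\<And>z. \<bar>k z\<bar> \<le> c" "\<And>z. R \<le> norm z \<Longrightarrow> k z = 0" "(LBINT z. k z) = 0" and G: "integrable lborel G"
    and M: "\<And>y. y \<in> ball x R \<Longrightarrow> \<bar>G y - G x\<bar> \<le> M" and c: "c \<ge> 0"
  shows "\<bar>conv k G x\<bar> \<le> c * (M * measure lborel (ball x R))"
proof -
  define H where "H y = indicator (ball x R) y * (G y - G x)" for y
  define I where "I y = indicator (ball x R) y * G x" for y
  have iI: "integrable lborel I" unfolding I_def by (intro integrable_mult_left integrable_ind_ball)
  have iG: "integrable lborel (\<lambda>y. indicator (ball x R) y * G y)" by (rule integrable_ind_mult[OF G])
  have iH: "integrable lborel H"
    unfolding H_def right_diff_distrib using iG iI[unfolded I_def] by (rule Bochner_Integration.integrable_diff)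
  have "conv k G x = conv k (\<lambda>y. H y + I y) x" by (rule conv_cong[OF k(3)]) (auto simp: H_def I_def)
  also have "\<dots> = conv k H x + conv k I x"
    unfolding conv_def distrib_left by (rule Bochner_Integration.integral_add) (intro conv_integrable k iH iI)+
  also have "conv k I x = conv k (\<lambda>_. G x) x" by (rule conv_cong[OF k(3)]) (auto simp: I_def)
  also have "conv k (\<lambda>_. G x) x = 0" unfolding conv_def using integral_reflect[OF bump_measurable[OF k(1)], of x] k(4) by simp
  finally have "conv k G x = conv k H x" by simp
  moreover have "\<bar>conv k H x\<bar> \<le> c * (M * measure lborel (ball x R))"
  proof (rule conv_size[OF k(1-3) iH _ c])
    fix y assume "y \<in> ball x R"
    then show "\<bar>H y\<bar> \<le> M" using M[of y] unfolding H_def by simp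
  qed
  ultimately show ?thesis by simp
qed

text \<open>Convolution with second derivatives of \<open>kapj\<close> gains nothing by size; having
  mean zero, they gain \<open>s^j\<close> from the Hoelder continuity of \<open>G\<close>. Orders
  zero and one are handled by size, with factors 4^-j and 2^-j, orders two and three by
  cancellation, and together these give the rates that \<open>rate_HC2\<close> asks for.\<close>

lemma schauder_local:
  fixes w G :: "'a::euclidean_space \<Rightarrow> real"
  assumes w: "integrable lborel w" and G: "integrable lborel G" and M: "\<And>y. y \<in> ball x0 R \<Longrightarrow> \<bar>G y\<bar> \<le> M"
    and H: "\<And>y z. y \<in> ball x0 R \<Longrightarrow> z \<in> ball x0 R \<Longrightarrow> \<bar>G y - G z\<bar> \<le> H * dist y z powr \<alpha>" and H0: "H \<ge> 0" and \<alpha>: "0 < \<alpha>" "\<alpha> \<le> 1/2"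
    and J: "2/2^J \<le> R/2" and rep: "\<And>x j. x \<in> ball x0 (R/2) \<Longrightarrow> j \<ge> J \<Longrightarrow> conv (rhoj j) w x - conv (rhoj (Suc j)) w x = conv (kapj (Suc j)) G x"
  shows "HC (Suc (Suc 0)) (ball x0 (R/2)) (Lf rhoj w)"
proof -
  define s where "s = (1/2::real) powr \<alpha>"
  define V where "V = 2^DIM('a) * measure lborel (ball (0::'a) 1)"
  define k where "k = kbd TYPE('a)"
  have k0: "k \<ge> 0" "V \<ge> 0" using kbd_ge0[where 'a='a] by (auto simp: k_def V_def)
  have R: "R > 0" 
  proof -
    have "(0::real) < 2/2^J" by simp
    then show ?thesis using J by linarith
  qed
  have M0: "M \<ge> 0" using M[of x0] R by (auto intro: order_trans[OF abs_ge_zero])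
  have s: "1/2 < s" "s < 1"
  proof -
    have "(1/2::real) powr 1 < (1/2) powr \<alpha>" using \<alpha> by (intro powr_less_mono') auto
    then show "1/2 < s" by (simp add: s_def)
    have "(1/2::real) powr \<alpha> < (1/2) powr 0" using \<alpha> by (intro powr_less_mono') auto
    then show "s < 1" by (simp add: s_def)
  qed
  have sj: "(1/2^j) powr \<alpha> = s^j" for j
    unfolding s_def by (simp add: powr_realpow[symmetric] powr_powr powr_divide mult.commute)
  have meas: "measure lborel (ball x (2/2^j)) = V / 2^(j*DIM('a))" for x :: 'a and j
    unfolding V_def by (subst ball_measure) (auto simp: power_divide power_mult)
  have sub: "ball x (2/2^j) \<subseteq> ball x0 R" if "x \<in> ball x0 (R/2)" "j \<ge> J" for x j
  proof
    fix y assume "y \<in> ball x (2/2^j)"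
    moreover have "(2::real)/2^j \<le> 2/2^J" using that by (intro divide_left_mono power_increasing) auto
    ultimately show "y \<in> ball x0 R" using that J dist_triangle[of x0 y x] by simp
  qed
  have size: "\<bar>conv l G x\<bar> \<le> k * M * V * c" if l: "bump l" "\<And>z. \<bar>l z\<bar> \<le> k * (2^(j*DIM('a)) * c)" "\<And>z. 2/2^j \<le> norm z \<Longrightarrow> l z = 0"
    and c: "c \<ge> 0" and x: "x \<in> ball x0 (R/2)" "j \<ge> J" for l j c x
  proof -
    have "\<bar>conv l G x\<bar> \<le> k * (2^(j*DIM('a)) * c) * (M * measure lborel (ball x (2/2^j)))"
      by (rule conv_size[OF l G]) (use sub[OF x] M k0 c in auto)
    also have "\<dots> = k * M * V * c" unfolding meas by simp
    finally show ?thesis .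
  qed
  have canc: "\<bar>conv l G x\<bar> \<le> k * (2 * H) * V * (c * s^j)" if l: "bump l" "\<And>z. \<bar>l z\<bar> \<le> k * (2^(j*DIM('a)) * c)" "\<And>z. 2/2^j \<le> norm z \<Longrightarrow> l z = 0"
     "(LBINT z. l z) = 0" and c: "c \<ge> 0" and x: "x \<in> ball x0 (R/2)" "j \<ge> J" for l j c x
  proof -
    have "\<bar>conv l G x\<bar> \<le> k * (2^(j*DIM('a)) * c) * ((2 * H * s^j) * measure lborel (ball x (2/2^j)))"
    proof (rule conv_cancel[OF l G])
      fix y assume y: "y \<in> ball x (2/2^j)"
      have xR: "x \<in> ball x0 R" using x R by auto
      have "\<bar>G y - G x\<bar> \<le> H * dist y x powr \<alpha>" by (rule H) (use y sub[OF x] xR in auto)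
      also have "\<dots> \<le> H * (2/2^j) powr \<alpha>" using y H0 \<alpha> by (intro mult_left_mono powr_mono2) (auto simp: dist_commute)
      also have "(2/2^j) powr \<alpha> = 2 powr \<alpha> * s^j" unfolding sj[symmetric] by (simp add: powr_mult[symmetric])
      also have "H * (2 powr \<alpha> * s^j) \<le> H * (2 powr 1 * s^j)" using \<alpha> H0 s by (intro mult_left_mono mult_right_mono powr_mono) auto
      finally show "\<bar>G y - G x\<bar> \<le> 2 * H * s^j" by simp
    qed (use k0 c in auto)
    also have "\<dots> = k * (2 * H) * V * (c * s^j)" unfolding meas by simp
    finally show ?thesis .
  qed
  define A where "A = k * M * V + 2 * (k * (2 * H) * V)"
  have A0: "A \<ge> 0" "k * M * V \<le> A" "k * (2 * H) * V \<le> A" "2 * (k * (2 * H) * V) \<le> A"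
    using k0 M0 H0 by (auto simp: A_def)
  have h1: "(1/2)^j \<le> s^j" "s^Suc j \<le> s^j" "(1/2)^j \<le> (1::real)" "1 \<le> (2 * s)^j" "s^j \<le> (2 * s)^j" for j
    using s power_mono[of "1/2" s j] power_mono[of s "2 * s" j] one_le_power[of "2 * s" j] power_le_one[of "1/2::real" j] power_decreasing[of j "Suc j" s]
    by (simp_all del: power_mult_distrib)
  have U: "open (ball x0 (R/2))" by simp
  have e1: "conv (partial_dir b (rhoj j)) w x - conv (partial_dir b (rhoj (Suc j))) w x = conv (partial_dir b (kapj (Suc j))) G x"
    if "x \<in> ball x0 (R/2)" "j \<ge> J" "b \<in> Basis" for x j b
    by (rule rep_deriv[OF U rep[OF _ that(2)] bump_rhoj bump_rhoj bump_kapj w G that(3,1)])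
  have e2: "conv (partial_dir c (partial_dir b (rhoj j))) w x - conv (partial_dir c (partial_dir b (rhoj (Suc j)))) w x = conv (partial_dir c (partial_dir b (kapj (Suc j)))) G x"
    if "x \<in> ball x0 (R/2)" "j \<ge> J" "b \<in> Basis" "c \<in> Basis" for x j b c
    by (rule rep_deriv[OF U e1[OF _ that(2,3)] _ _ _ w G that(4,1)]) (assumption | intro bump_partial bump_rhoj bump_kapj that)+
  have e3: "conv (partial_dir d (partial_dir c (partial_dir b (rhoj j)))) w x - conv (partial_dir d (partial_dir c (partial_dir b (rhoj (Suc j))))) w x = conv (partial_dir d (partial_dir c (partial_dir b (kapj (Suc j))))) G x"
    if "x \<in> ball x0 (R/2)" "j \<ge> J" "b \<in> Basis" "c \<in> Basis" "d \<in> Basis" for x j b c d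
    by (rule rep_deriv[OF U e2[OF _ that(2,3,4)] _ _ _ w G that(5,1)]) (assumption | intro bump_partial bump_rhoj bump_kapj that)+
  have c0: "\<bar>conv (kapj (Suc j)) G x\<bar> \<le> A * s^j" if x: "x \<in> ball x0 (R/2)" "j \<ge> J" for x j
  proof -
    have "\<bar>conv (kapj (Suc j)) G x\<bar> \<le> k * M * V * (1/4^Suc j)"
    proof (rule size[where j="Suc j" and c="1/4^Suc j", OF bump_kapj _ kapj_support _ x(1)])
      fix z :: 'a
      show "\<bar>kapj (Suc j) z\<bar> \<le> k * (2^(Suc j*DIM('a)) * (1/4^Suc j))" using kapj_bound[of "Suc j" z] by (simp add: k_def)
    qed (use x(2) in auto)
    also have "\<dots> \<le> A * s^j"
    proof (rule mult_mono)
      have "(1::real)/4^Suc j \<le> 1/2^j"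
        by (intro divide_left_mono) (auto intro: order_trans[OF power_mono[of 2 4 j]])
      then show "1/4^Suc j \<le> s^j" using h1(1)[of j] by (simp add: power_one_over)
    qed (use A0 in auto)
    finally show ?thesis .
  qed
  have c1: "\<bar>conv (partial_dir b (kapj (Suc j))) G x\<bar> \<le> A * s^j" if x: "x \<in> ball x0 (R/2)" "j \<ge> J" and b: "b \<in> Basis" for x j b
  proof -
    have "\<bar>conv (partial_dir b (kapj (Suc j))) G x\<bar> \<le> k * M * V * (1/2^Suc j)"
    proof (rule size[where j="Suc j" and c="1/2^Suc j", OF bump_partial[OF bump_kapj b] _ kapj_support1[OF b] _ x(1)])
      fix z :: 'a
      show "\<bar>partial_dir b (kapj (Suc j)) z\<bar> \<le> k * (2^(Suc j*DIM('a)) * (1/2^Suc j))" using kapj_bound1[OF b, of "Suc j" z] by (simp add: k_def)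
    qed (use x(2) in auto)
    also have "\<dots> \<le> A * s^j"
    proof (rule mult_mono)
      have "(1::real)/2^Suc j \<le> 1/2^j" by (intro divide_left_mono power_increasing) auto
      then show "1/2^Suc j \<le> s^j" using h1(1)[of j] by (simp add: power_one_over)
    qed (use A0 in auto)
    finally show ?thesis .
  qed
  have c2: "\<bar>conv (partial_dir c (partial_dir b (kapj (Suc j)))) G x\<bar> \<le> A * s^j" if x: "x \<in> ball x0 (R/2)" "j \<ge> J" and b: "b \<in> Basis" "c \<in> Basis" for x j b c
  proof -
    have "\<bar>conv (partial_dir c (partial_dir b (kapj (Suc j)))) G x\<bar> \<le> k * (2 * H) * V * (1 * s^Suc j)"
    proof (rule canc[where j="Suc j" and c=1, OF bump_partial[OF bump_partial[OF bump_kapj b(1)] b(2)] _ kapj_support2[OF b] bump_integral_partial[OF bump_partial[OF bump_kapj b(1)] b(2)] _ x(1)])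
      fix z :: 'a
      show "\<bar>partial_dir c (partial_dir b (kapj (Suc j))) z\<bar> \<le> k * (2^(Suc j*DIM('a)) * 1)" using kapj_bound2[OF b, of "Suc j" z] by (simp add: k_def)
    qed (use x(2) in auto)
    also have "\<dots> \<le> A * s^j" using A0 h1(2)[of j] s by (intro mult_mono) auto
    finally show ?thesis .
  qed
  have c3: "\<bar>conv (partial_dir d (partial_dir c (partial_dir b (kapj (Suc j))))) G x\<bar> \<le> A * (2 * s)^j" if x: "x \<in> ball x0 (R/2)" "j \<ge> J" and b: "b \<in> Basis" "c \<in> Basis" "d \<in> Basis" for x j b c d
  proof -
    have "\<bar>conv (partial_dir d (partial_dir c (partial_dir b (kapj (Suc j))))) G x\<bar> \<le> k * (2 * H) * V * (2^Suc j * s^Suc j)"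
    proof (rule canc[where j="Suc j" and c="2^Suc j", OF bump_partial[OF bump_partial[OF bump_partial[OF bump_kapj b(1)] b(2)] b(3)] _ kapj_support3[OF b] bump_integral_partial[OF bump_partial[OF bump_partial[OF bump_kapj b(1)] b(2)] b(3)] _ x(1)])
      fix z :: 'a
      show "\<bar>partial_dir d (partial_dir c (partial_dir b (kapj (Suc j)))) z\<bar> \<le> k * (2^(Suc j*DIM('a)) * 2^Suc j)" using kapj_bound3[OF b, of "Suc j" z] by (simp add: k_def)
    qed (use x(2) in auto)
    also have "\<dots> = (2 * (k * (2 * H) * V)) * (s * (2 * s)^j)" by (simp add: power_mult_distrib mult_ac)
    also have "\<dots> \<le> A * (1 * (2 * s)^j)" using A0 s by (intro mult_mono mult_right_mono) auto
    finally show ?thesis by simp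
  qed
  have up: "A * s^j \<le> A * (2 * s)^j" for j using A0 h1(5)[of j] by (intro mult_left_mono) auto
  have r0: "rate rhoj w (ball x0 (R/2)) A s J"
    unfolding rate_def using c0 order_trans[OF c1 up] rep e1 by auto
  have r1: "rate (\<lambda>j. partial_dir b (rhoj j)) w (ball x0 (R/2)) A s J" if "b \<in> Basis" for b
    unfolding rate_def using c1 order_trans[OF c2 up] e1 e2 that by auto
  have r2: "rate (\<lambda>j. partial_dir c (partial_dir b (rhoj j))) w (ball x0 (R/2)) A s J" if "b \<in> Basis" "c \<in> Basis" for b c
    unfolding rate_def using c2 c3 e2 e3 that by auto
  show ?thesis by (rule rate_HC2[OF r0 r1 r2 s A0(1) U bump_rhoj w])
qed

text \<open>Cutting \<open>w\<close> and \<open>G\<close> to a small closed ball makes them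
  integrable and leaves the identity intact on the ball of half the radius at fine scales; there
  continuity identifies the limit of the mollifications with \<open>w\<close>.\<close>

lemma schauder_base:
  fixes w G :: "'a::euclidean_space \<Rightarrow> real"
  assumes S: "open S" and w: "continuous_on S w" and G: "lhol S G" and r: "repr S w G"
  shows "HC (Suc (Suc 0)) S w"
proof (rule HC_local)
  fix x0 assume x0: "x0 \<in> S"
  obtain r1 \<alpha> H where H: "r1 > 0" "\<alpha> > 0" "H \<ge> 0" "r1 \<le> 1/2" "\<alpha> \<le> 1/2" "ball x0 r1 \<subseteq> S"
    "\<And>y z. \<lbrakk>y\<in>ball x0 r1; z\<in>ball x0 r1\<rbrakk> \<Longrightarrow> \<bar>G y - G z\<bar> \<le> H * dist y z powr \<alpha>"
    using lholD[OF G x0] by blast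
  define R where "R = r1 / 2"
  have R: "R > 0" "cball x0 R \<subseteq> ball x0 r1" "cball x0 R \<subseteq> S" using H by (auto simp: R_def)
  define w1 where "w1 y = indicator (cball x0 R) y * w y" for y
  define G1 where "G1 y = indicator (cball x0 R) y * G y" for y
  have iw: "integrable lborel w1" unfolding w1_def by (rule integrable_cball[OF continuous_on_subset[OF w R(3)]])
  have iG: "integrable lborel G1" unfolding G1_def by (rule integrable_cball[OF continuous_on_subset[OF lhol_continuous[OF G] R(3)]])
  have G1b: "\<bar>G1 y\<bar> \<le> \<bar>G x0\<bar> + H" if "y \<in> ball x0 R" for y
  proof -
    have "\<bar>G y - G x0\<bar> \<le> H * dist y x0 powr \<alpha>" using that R H(1) by (intro H(7)) (auto simp: R_def)
    also have "\<dots> \<le> H * 1 powr \<alpha>" using that H by (intro mult_left_mono powr_mono2) (auto simp: R_def dist_commute)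
    finally show ?thesis using that by (auto simp: G1_def)
  qed
  have "(\<lambda>j. 2 * (1/2::real)^j) \<longlonglongrightarrow> 2 * 0" by (intro tendsto_intros LIMSEQ_realpow_zero) auto
  then have z: "(\<lambda>j. 2 * (1/2::real)^j) \<longlonglongrightarrow> 0" by simp
  have "\<forall>\<^sub>F j in sequentially. 2 * (1/2::real)^j < R/2" using R by (intro order_tendstoD(2)[OF z]) auto
  then obtain J where "2 * (1/2::real)^J < R/2" unfolding eventually_sequentially by blast
  then have J: "2/2^J \<le> R/2" by (simp add: power_one_over)
  have rep: "conv (rhoj j) w1 x - conv (rhoj (Suc j)) w1 x = conv (kapj (Suc j)) G1 x" if x: "x \<in> ball x0 (R/2)" and j: "j \<ge> J" for x j
  proof -
    have le: "(1::real)/2^j \<le> 1/2^J" "(1::real)/2^Suc j \<le> 1/2^j" using j by (intro divide_left_mono power_increasing; simp)+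
    have sub: "cball x (1/2^j) \<subseteq> cball x0 R"
    proof
      fix y assume "y \<in> cball x (1/2^j)"
      then have "dist x y \<le> R/2" using le J by simp
      then show "y \<in> cball x0 R" using x dist_triangle[of x0 y x] by simp
    qed
    have in1: "y \<in> cball x0 R" if "y \<in> ball x (1/2^j)" for y
      by (rule subsetD[OF sub]) (use that in auto)
    have "conv (rhoj j) w1 x = conv (rhoj j) w x" by (rule conv_cong[OF rhoj_support]) (use in1 in \<open>auto simp: w1_def indicator_def\<close>)
    moreover have "conv (rhoj (Suc j)) w1 x = conv (rhoj (Suc j)) w x"
      by (rule conv_cong[OF rhoj_support]) (use in1 le(2) in \<open>auto simp: w1_def indicator_def\<close>)
    moreover have "conv (kapj (Suc j)) G1 x = conv (kapj (Suc j)) G x"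
      by (rule conv_cong[OF kapj_Suc_support]) (use in1 in \<open>auto simp: G1_def indicator_def\<close>)
    moreover have "conv (rhoj j) w x - conv (rhoj (Suc j)) w x = conv (kapj (Suc j)) G x"
      using r sub R(3) unfolding repr_def by blast
    ultimately show ?thesis by simp
  qed
  have "HC (Suc (Suc 0)) (ball x0 (R/2)) (Lf rhoj w1)"
  proof (rule schauder_local[OF iw iG G1b _ H(3) H(2) H(5) J rep])
    fix y z assume "y \<in> ball x0 R" "z \<in> ball x0 R"
    then show "\<bar>G1 y - G1 z\<bar> \<le> H * dist y z powr \<alpha>" using H(7)[of y z] H(1) by (auto simp: G1_def R_def)
  qed
  moreover have "Lf rhoj w1 x = w x" if x: "x \<in> ball x0 (R/2)" for x
  proof -
    have xR: "x \<in> ball x0 R" using x R by auto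
    have "isCont w x" using w S xR R(3) continuous_on_eq_continuous_at[OF S] ball_subset_cball by blast
    moreover have "\<forall>\<^sub>F y in nhds x. w y = w1 y"
      using eventually_nhds_in_open[OF open_ball xR] by (rule eventually_mono) (auto simp: w1_def)
    ultimately have "isCont w1 x" using isCont_cong by blast
    from conv_rhoj_tendsto[OF iw this] have "(\<lambda>j. conv (rhoj j) w1 x) \<longlonglongrightarrow> w1 x" .
    then have "Lf rhoj w1 x = w1 x" unfolding Lf_def by (rule limI)
    then show ?thesis using xR by (simp add: w1_def)
  qed
  ultimately have "HC (Suc (Suc 0)) (ball x0 (R/2)) w" by (rule HC_cong[OF open_ball])
  moreover have "ball x0 (R/2) \<subseteq> S" using R by (auto simp: subset_iff)
  ultimately show "\<exists>r>0. ball x0 r \<subseteq> S \<and> HC (Suc (Suc 0)) (ball x0 r) w" using R(1) by (intro exI[of _ "R/2"]) auto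
qed

text \<open>Each derivative of \<open>w\<close> solves the equation with the corresponding
  derivative of \<open>G\<close>, so the base estimate propagates by induction on the order of
  \<open>G\<close>.\<close>

theorem schauder:
  fixes w G :: "'a::euclidean_space \<Rightarrow> real"
  assumes "open S" "continuous_on S w" "HC k S G" "repr S w G"
  shows "HC (Suc (Suc k)) S w"
  using assms
proof (induction k arbitrary: w G)
  case 0 then show ?case by (intro schauder_base) auto
next
  case (Suc k)
  have G1: "HC (Suc 0) S G" by (rule HC_mono[OF Suc(4)]) simp
  have w2: "HC (Suc (Suc 0)) S w" by (rule schauder_base[OF Suc(2,3) HC_lhol[OF Suc(4)] Suc(5)])
  have w1: "HC (Suc 0) S w" by (rule HC_Suc_D[OF w2])
  have "HC (Suc (Suc k)) S (partial_dir b w)" if b: "b \<in> Basis" for b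
    by (rule Suc.IH[OF Suc(2) HC_continuous[OF HC_partial[OF w1 b]] HC_partial[OF Suc(4) b] repr_partial[OF Suc(2) w1 G1 Suc(5) b]])
  then show ?case using w1 by (subst HC.simps) auto
qed

section \<open>First regularity step\<close>

lemma conv_L2:
  fixes w :: "'a::euclidean_space \<Rightarrow> real"
  assumes w: "integrable lborel w"
  shows "(NBINT x. ennreal ((conv (rhoj j) w x)^2)) \<le> (NBINT x. ennreal ((w x)^2))"
proof -
  have [measurable]: "w \<in> borel_measurable borel" using borel_measurable_integrable[OF w] by simp
  have "(NBINT x. ennreal ((conv (rhoj j) w x)^2)) \<le> (NBINT x. (NBINT y. ennreal (rhoj j (x - y)) * ennreal \<bar>w y\<bar>)^2)"
  proof (rule nn_integral_mono)
    fix x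
    have "ennreal ((conv (rhoj j) w x)^2) = (ennreal \<bar>conv (rhoj j) w x\<bar>)^2" by (simp add: ennreal_power)
    also have "\<dots> \<le> (NBINT y. ennreal (rhoj j (x - y)) * ennreal \<bar>w y\<bar>)^2"
      by (intro power_mono conv_le_nn bump_rhoj rhoj_ge0 w) auto
    finally show "ennreal ((conv (rhoj j) w x)^2) \<le> (NBINT y. ennreal (rhoj j (x - y)) * ennreal \<bar>w y\<bar>)^2" .
  qed
  also have "\<dots> \<le> (NBINT y. (ennreal \<bar>w y\<bar>)^2)"
    by (rule young_2[OF bump_rhoj rhoj_ge0 rhoj_integral]) measurable
  finally show ?thesis by (simp add: ennreal_power)
qed

text \<open>The Sobolev inequality is applied to a cut-off times a mollification of
  \<open>U\<close>, with a bound independent of the scale, and \<open>mollify_bound\<close> removes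
  the mollification. The cut-off lives in radius \<open>2 * R\<close> and the mollifiers used have
  radius below \<open>R\<close>, whence \<open>3 * R\<close>.\<close>

lemma local_L4:
  fixes U :: "'a::euclidean_space \<Rightarrow> real" and D :: "'a \<Rightarrow> 'a \<Rightarrow> real"
  assumes dim: "DIM('a) \<le> 4" and U: "integrable lborel U" "integrable lborel (\<lambda>x. (U x)^2)"
    and D: "\<And>b. b \<in> Basis \<Longrightarrow> integrable lborel (D b)" "\<And>b. b \<in> Basis \<Longrightarrow> integrable lborel (\<lambda>x. (D b x)^2)"
    and g: "\<And>b. b \<in> Basis \<Longrightarrow> grepr S U b (D b)" and R: "0 < R" "R \<le> 1/2" "cball x0 (3 * R) \<subseteq> S"
  shows "integrable lborel (\<lambda>x. indicator (ball x0 R) x * (U x)^4)"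
proof -
  have [measurable]: "U \<in> borel_measurable borel" using borel_measurable_integrable[OF U(1)] by simp
  have Bm [measurable]: "ball x0 R \<in> sets borel" by simp
  \<comment> \<open>Rescaling by \<open>1 / (2 * R)\<close> places the support of \<open>rho\<close>
    on the ball of radius \<open>2 * R\<close>; the ball of radius \<open>R\<close> then corresponds
    to half the unit ball, on which \<open>rho\<close> has a positive minimum
    \<open>c\<close>.\<close>
  define t where "t = 1 / (2 * R)"
  have t: "t > 0" using R by (simp add: t_def)
  define \<eta> where "\<eta> y = rho (- (t *\<^sub>R x0) + t *\<^sub>R y)" for y
  have \<eta>: "bump \<eta>" unfolding \<eta>_def by (rule bump_affine[OF bump_rho]) (use t in simp)
  have arg: "norm (- (t *\<^sub>R x0) + t *\<^sub>R y) = t * dist y x0" for y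
  proof -
    have "- (t *\<^sub>R x0) + t *\<^sub>R y = t *\<^sub>R (y - x0)" by (simp add: algebra_simps)
    then show ?thesis using t by (simp add: dist_norm)
  qed
  have \<eta>0: "\<eta> y = 0" if "2 * R \<le> dist y x0" for y
  proof -
    have "1 \<le> t * dist y x0" using that R by (simp add: t_def field_simps)
    then show ?thesis unfolding \<eta>_def by (intro rho_0) (simp only: arg)
  qed
  have p\<eta>: "partial_dir b \<eta> y = t * partial_dir b rho (- (t *\<^sub>R x0) + t *\<^sub>R y)" if "b \<in> Basis" for b y
    unfolding \<eta>_def by (simp only: partial_affine[OF bump_rho that])
  have p\<eta>0: "partial_dir b \<eta> y = 0" if "2 * R \<le> dist y x0" "b \<in> Basis" for b y
  proof -
    have "1 \<le> t * dist y x0" using that R by (simp add: t_def field_simps)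
    then have "1 \<le> norm (- (t *\<^sub>R x0) + t *\<^sub>R y)" by (simp only: arg)
    then show ?thesis unfolding p\<eta>[OF that(2)] using partial_support[OF rho_0 bump_rho that(2)] by simp
  qed
  have "compact (rho ` cball (0::'a) (1/2))" by (intro compact_continuous_image bump_continuous bump_rho) simp
  moreover have "rho ` cball (0::'a) (1/2) \<noteq> {}" by simp
  ultimately obtain z where z: "z \<in> cball (0::'a) (1/2)" "\<And>y. y \<in> cball (0::'a) (1/2) \<Longrightarrow> rho z \<le> rho y"
    using compact_attains_inf[of "rho ` cball (0::'a) (1/2)"] by (metis (no_types, lifting) imageE imageI)
  define c where "c = rho z"
  have c: "c > 0" unfolding c_def by (rule rho_pos) (use z in auto)
  have \<eta>c: "c \<le> \<eta> y" if "y \<in> ball x0 R" for y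
  proof -
    have "t * dist y x0 \<le> 1/2" using that R by (simp add: t_def field_simps dist_commute)
    then have "norm (- (t *\<^sub>R x0) + t *\<^sub>R y) \<le> 1/2" by (simp only: arg)
    then show ?thesis unfolding \<eta>_def c_def by (intro z(2)) simp
  qed
  have "\<exists>M\<ge>0. \<forall>x. \<bar>partial_dir b \<eta> x\<bar> \<le> M" if "b \<in> Basis" for b by (rule bump_bounded[OF bump_partial[OF \<eta> that]])
  then obtain Mb where Mb: "\<And>b. b \<in> Basis \<Longrightarrow> Mb b \<ge> 0 \<and> (\<forall>x. \<bar>partial_dir b \<eta> x\<bar> \<le> Mb b)" by metis
  obtain M1 where M1: "M1 \<ge> 0" "\<And>x. \<bar>\<eta> x\<bar> \<le> M1" using bump_bounded[OF \<eta>] by blast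
  define M where "M = M1 + (\<Sum>b\<in>Basis. Mb b)"
  have M: "M \<ge> 0" "\<bar>\<eta> x\<bar> \<le> M" "b \<in> Basis \<Longrightarrow> \<bar>partial_dir b \<eta> x\<bar> \<le> M" for x b
  proof -
    have s0: "(\<Sum>b\<in>Basis. Mb b) \<ge> 0" using Mb by (intro sum_nonneg) auto
    show "M \<ge> 0" using s0 M1 by (simp add: M_def)
    show "\<bar>\<eta> x\<bar> \<le> M" using s0 M1(2)[of x] by (simp add: M_def)
    assume b: "b \<in> Basis"
    have "Mb b \<le> (\<Sum>b\<in>Basis. Mb b)" by (rule member_le_sum) (use b Mb in auto)
    moreover have "\<bar>partial_dir b \<eta> x\<bar> \<le> Mb b" using Mb[OF b] by blast
    ultimately show "\<bar>partial_dir b \<eta> x\<bar> \<le> M" using M1 by (simp add: M_def)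
  qed
  define T where "T = real DIM('a) * (2 * M^2 * (\<Sum>b\<in>Basis. (LBINT x. (U x)^2) + (LBINT x. (D b x)^2)))"
  have T0: "T \<ge> 0" unfolding T_def by (intro mult_nonneg_nonneg sum_nonneg add_nonneg_nonneg Bochner_Integration.integral_nonneg) auto
  have "(\<lambda>j. (1/2::real)^j) \<longlonglongrightarrow> 0" by (intro LIMSEQ_realpow_zero) auto
  then have "\<forall>\<^sub>F j in sequentially. (1/2::real)^j < R" using R by (intro order_tendstoD(2)) auto
  then obtain n0 where n0: "\<And>j. j \<ge> n0 \<Longrightarrow> 1/2^j < R" unfolding eventually_sequentially by (auto simp: power_one_over)
  have "(NBINT x. indicator (ball x0 R) x * ennreal (\<bar>U x\<bar>^4)) \<le> ennreal (1296 * T^2 / c^4)"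
  proof (rule mollify_bound[OF mollifier_rhoj U(1) Bm, where ?n0.0=n0])
    fix K assume K: "K \<ge> n0"
    define wK where "wK = conv (rhoj K) U"
    define dK where "dK b = conv (rhoj K) (D b)" for b
    have [measurable]: "wK \<in> borel_measurable borel" unfolding wK_def
      by (rule borel_measurable_continuous_onI[OF conv_continuous[OF bump_rhoj U(1)]])
    have [measurable]: "b \<in> Basis \<Longrightarrow> dK b \<in> borel_measurable borel" for b unfolding dK_def
      by (rule borel_measurable_continuous_onI[OF conv_continuous[OF bump_rhoj D(1)]])
    define v where "v x = \<eta> x * wK x" for x
    obtain Rb where Rb: "\<And>x. Rb \<le> norm x \<Longrightarrow> \<eta> x = 0" using \<eta> by (auto simp: bump_def)
    have bv: "bump v"
    proof (rule bumpI[of _ Rb])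
      show "HC k UNIV v" for k unfolding v_def[abs_def] wK_def by (intro HC_mult bump_HC[OF \<eta>] HC_conv[OF bump_rhoj U(1)])
      show "v x = 0" if "Rb \<le> norm x" for x using Rb[OF that] by (simp add: v_def)
    qed
    have v0: "v x = 0" if "dist x x0 \<ge> 1" for x using \<eta>0[of x] that R by (simp add: v_def)
    have pv: "\<bar>partial_dir b v x\<bar> \<le> M * \<bar>wK x\<bar> + M * \<bar>dK b x\<bar>" if b: "b \<in> Basis" for b x
    proof -
      have "((\<lambda>t. v (x + t *\<^sub>R b)) has_real_derivative partial_dir b \<eta> x * wK x + conv (partial_dir b (rhoj K)) U x * \<eta> x) (at 0)"
        using DERIV_mult[OF bump_DERIV0[OF \<eta> b, of x] conv_DERIV[OF bump_rhoj[of K] b U(1), of x]] by (simp add: v_def wK_def)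
      then have e: "partial_dir b v x = partial_dir b \<eta> x * wK x + conv (partial_dir b (rhoj K)) U x * \<eta> x" by (rule partial_dirI')
      show ?thesis
      proof (cases "dist x x0 < 2 * R")
        case True
        have "cball x (1/2^K) \<subseteq> cball x0 (3 * R)"
        proof
          fix y assume "y \<in> cball x (1/2^K)"
          then show "y \<in> cball x0 (3 * R)" using True n0[OF K] dist_triangle[of x0 y x] by (simp add: dist_commute)
        qed
        then have "conv (partial_dir b (rhoj K)) U x = dK b x" using g[OF b] R(3) unfolding grepr_def dK_def by blast
        then have "\<bar>partial_dir b v x\<bar> \<le> \<bar>partial_dir b \<eta> x\<bar> * \<bar>wK x\<bar> + \<bar>dK b x\<bar> * \<bar>\<eta> x\<bar>" unfolding e by (metis abs_mult abs_triangle_ineq)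
        also have "\<dots> \<le> M * \<bar>wK x\<bar> + \<bar>dK b x\<bar> * M" using M(2)[of x] M(3)[OF b, of x] by (intro add_mono mult_right_mono mult_left_mono) auto
        finally show ?thesis by (simp add: mult.commute)
      next
        case False
        then have "partial_dir b v x = 0" unfolding e using \<eta>0[of x] p\<eta>0[of x b] b by simp
        then show ?thesis using M(1) by simp
      qed
    qed
    have sq: "(\<Sum>b\<in>Basis. \<bar>partial_dir b v x\<bar>)^2 \<le> real DIM('a) * (2 * M^2 * (\<Sum>b\<in>Basis. (wK x)^2 + (dK b x)^2))" for x
    proof -
      have "(\<Sum>b\<in>Basis. \<bar>partial_dir b v x\<bar>)^2 \<le> DIM('a) * (\<Sum>b\<in>Basis. (partial_dir b v x)^2)"
        using sum_squared_le_sum_of_squares[of "\<lambda>b. \<bar>partial_dir b v x\<bar>" Basis] by (simp add: mult.commute)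
      also have "\<dots> \<le> DIM('a) * (\<Sum>b\<in>Basis. 2 * M^2 * ((wK x)^2 + (dK b x)^2))"
      proof (intro mult_left_mono sum_mono)
        fix b :: 'a assume b: "b \<in> Basis"
        have "\<bar>partial_dir b v x\<bar>^2 \<le> (M * \<bar>wK x\<bar> + M * \<bar>dK b x\<bar>)^2" by (intro power_mono pv b) auto
        also have "\<dots> \<le> 2 * ((M * \<bar>wK x\<bar>)^2 + (M * \<bar>dK b x\<bar>)^2)"
          using sum_squares_bound[of "M * \<bar>wK x\<bar>" "M * \<bar>dK b x\<bar>"] by (simp add: power2_sum)
        finally show "(partial_dir b v x)^2 \<le> 2 * M^2 * ((wK x)^2 + (dK b x)^2)" by (simp add: power_mult_distrib algebra_simps)
      qed simp
      finally show ?thesis by (simp add: sum_distrib_left)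
    qed
    have [measurable]: "b \<in> Basis \<Longrightarrow> partial_dir b v \<in> borel_measurable borel" for b by (intro bump_measurable bump_partial bv)
    have nnT: "(NBINT x. ennreal ((\<Sum>b\<in>Basis. \<bar>partial_dir b v x\<bar>)^2)) \<le> ennreal T"
    proof -
      have "(NBINT x. ennreal ((\<Sum>b\<in>Basis. \<bar>partial_dir b v x\<bar>)^2))
         \<le> (NBINT x. ennreal (real DIM('a) * (2 * M^2)) * (\<Sum>b\<in>Basis. ennreal ((wK x)^2) + ennreal ((dK b x)^2)))"
      proof (rule nn_integral_mono)
        fix x
        have "ennreal ((\<Sum>b\<in>Basis. \<bar>partial_dir b v x\<bar>)^2) \<le> ennreal ((real DIM('a) * (2 * M^2)) * (\<Sum>b\<in>Basis. (wK x)^2 + (dK b x)^2))"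
          by (rule ennreal_leI) (use sq[of x] in \<open>simp add: mult.assoc\<close>)
        also have "\<dots> = ennreal (real DIM('a) * (2 * M^2)) * ennreal (\<Sum>b\<in>Basis. (wK x)^2 + (dK b x)^2)"
          by (rule ennreal_mult') auto
        also have "ennreal (\<Sum>b\<in>Basis. (wK x)^2 + (dK b x)^2) = (\<Sum>b\<in>Basis. ennreal ((wK x)^2) + ennreal ((dK b x)^2))"
          by (subst sum_ennreal[symmetric]) auto
        finally show "ennreal ((\<Sum>b\<in>Basis. \<bar>partial_dir b v x\<bar>)^2) \<le> ennreal (real DIM('a) * (2 * M^2)) * (\<Sum>b\<in>Basis. ennreal ((wK x)^2) + ennreal ((dK b x)^2))" .
      qed
      also have "\<dots> = ennreal (real DIM('a) * (2 * M^2)) * (\<Sum>b\<in>Basis. (NBINT x. ennreal ((wK x)^2)) + (NBINT x. ennreal ((dK b x)^2)))"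
        by (subst nn_integral_cmult, measurable, subst nn_integral_sum, measurable)
          (auto intro!: arg_cong2[where f="(*)"] sum.cong nn_integral_add)
      also have "\<dots> \<le> ennreal (real DIM('a) * (2 * M^2)) * (\<Sum>b\<in>Basis. ennreal (LBINT x. (U x)^2) + ennreal (LBINT x. (D b x)^2))"
      proof (intro mult_left_mono sum_mono add_mono)
        show "(NBINT x. ennreal ((wK x)^2)) \<le> ennreal (LBINT x. (U x)^2)"
          using conv_L2[OF U(1), of K] nn_integral_eq_integral[OF U(2)] by (simp add: wK_def)
        fix b :: 'a assume b: "b \<in> Basis"
        show "(NBINT x. ennreal ((dK b x)^2)) \<le> ennreal (LBINT x. (D b x)^2)"
          using conv_L2[OF D(1)[OF b], of K] nn_integral_eq_integral[OF D(2)[OF b]] by (simp add: dK_def)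
      qed auto
      also have "(\<Sum>b\<in>Basis. ennreal (LBINT x. (U x)^2) + ennreal (LBINT x. (D b x)^2)) = ennreal (\<Sum>b\<in>Basis. (LBINT x. (U x)^2) + (LBINT x. (D b x)^2))"
        by (subst sum_ennreal[symmetric]) auto
      also have "ennreal (real DIM('a) * (2 * M^2)) * \<dots> = ennreal T"
        unfolding T_def by (subst ennreal_mult'[symmetric]) (auto simp: mult.assoc)
      finally show ?thesis .
    qed
    have iS: "integrable lborel (\<lambda>x. (\<Sum>b\<in>Basis. \<bar>partial_dir b v x\<bar>)^2)"
      by (rule integrableI_bounded) (measurable, use nnT in \<open>auto intro: order_le_less_trans\<close>)
    have "(LBINT x. (\<Sum>b\<in>Basis. \<bar>partial_dir b v x\<bar>)^2) \<le> T"
      using nnT T0 nn_integral_eq_integral[OF iS] by (simp add: ennreal_le_iff)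
    then have "(LBINT x. (\<Sum>b\<in>Basis. \<bar>partial_dir b v x\<bar>)^2)^2 \<le> T^2"
      by (intro power_mono Bochner_Integration.integral_nonneg) auto
    moreover have "(LBINT x. (v x)^4) \<le> 1296 * (LBINT x. (\<Sum>b\<in>Basis. \<bar>partial_dir b v x\<bar>)^2)^2"
      by (rule sobolev_bump[OF dim bv v0])
    ultimately have v4: "(LBINT x. (v x)^4) \<le> 1296 * T^2" by linarith
    have "(\<lambda>x. (v x)^4) = (\<lambda>x. (v x * v x) * (v x * v x))" by (simp add: power4_eq_xxxx mult.assoc)
    then have iv4: "integrable lborel (\<lambda>x. (v x)^4)" using bump_integrable[OF bump_mult[OF bump_mult[OF bv bv] bump_mult[OF bv bv]]] by simp
    have "(NBINT x. indicator (ball x0 R) x * ennreal (\<bar>conv (rhoj K) U x\<bar>^4)) \<le> (NBINT x. ennreal ((v x)^4 / c^4))"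
    proof (rule nn_integral_mono)
      fix x
      show "indicator (ball x0 R) x * ennreal (\<bar>conv (rhoj K) U x\<bar>^4) \<le> ennreal ((v x)^4 / c^4)"
      proof (cases "x \<in> ball x0 R")
        case True
        have "(c * \<bar>wK x\<bar>)^4 \<le> (\<eta> x * \<bar>wK x\<bar>)^4" using \<eta>c[OF True] c by (intro power_mono mult_right_mono) auto
        also have "\<dots> = (v x)^4" by (simp add: v_def power_mult_distrib)
        finally have "\<bar>wK x\<bar>^4 \<le> (v x)^4 / c^4" using c by (simp add: power_mult_distrib field_simps)
        then show ?thesis using True by (simp add: wK_def ennreal_leI)
      qed simp
    qed
    also have "\<dots> = ennreal (LBINT x. (v x)^4 / c^4)" by (rule nn_integral_eq_integral) (use iv4 in auto)
    also have "\<dots> \<le> ennreal (1296 * T^2 / c^4)"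
      using v4 c by (intro ennreal_leI) (simp add: divide_right_mono)
    finally show "(NBINT x. indicator (ball x0 R) x * ennreal (\<bar>conv (rhoj K) U x\<bar>^4)) \<le> ennreal (1296 * T^2 / c^4)" .
  qed
  then have fin: "(NBINT x. indicator (ball x0 R) x * ennreal (\<bar>U x\<bar>^4)) < \<infinity>" by (rule order_le_less_trans) simp
  show ?thesis
  proof (rule integrableI_bounded)
    show "(\<lambda>x. indicator (ball x0 R) x * (U x)^4) \<in> borel_measurable lborel" by measurable
    have "(NBINT x. ennreal (norm (indicator (ball x0 R) x * (U x)^4))) = (NBINT x. indicator (ball x0 R) x * ennreal (\<bar>U x\<bar>^4))"
      by (rule nn_integral_cong) (auto simp: indicator_def)
    then show "(NBINT x. ennreal (norm (indicator (ball x0 R) x * (U x)^4))) < \<infinity>" using fin by simp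
  qed
qed

text \<open>Square integrability only: the L4 bound of \<open>critical_system\<close> comes from
  \<open>local_L4\<close> on small balls, and the integrability of the right-hand side from the
  structure bound there.\<close>

locale weak_system =
  fixes U :: "'i::finite \<Rightarrow> 'a::euclidean_space \<Rightarrow> real" and D :: "'i \<Rightarrow> 'a \<Rightarrow> 'a \<Rightarrow> real"
    and G :: "'i \<Rightarrow> 'a \<Rightarrow> real" and S :: "'a set" and C :: real
  assumes dim: "DIM('a) \<le> 4" and S: "open S"
    and Ui: "\<And>i. integrable lborel (U i)" and U2: "\<And>i. integrable lborel (\<lambda>x. (U i x)^2)"
    and Di: "\<And>i b. b \<in> Basis \<Longrightarrow> integrable lborel (D i b)"
    and D2: "\<And>i b. b \<in> Basis \<Longrightarrow> integrable lborel (\<lambda>x. (D i b x)^2)"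
    and Gm: "\<And>i. G i \<in> borel_measurable borel"
    and C0: "C \<ge> 0"
    and Gb: "\<And>i x. \<bar>G i x\<bar> \<le> C * ((\<Sum>k\<in>UNIV. \<bar>U k x\<bar>) * ((\<Sum>k\<in>UNIV. \<Sum>b\<in>Basis. \<bar>D k b x\<bar>) + (\<Sum>k\<in>UNIV. \<bar>U k x\<bar>)^2))"
    and rep: "\<And>i. repr S (U i) (G i)" and grep: "\<And>i b. b \<in> Basis \<Longrightarrow> grepr S (U i) b (D i b)"
begin

text \<open>On a small ball the data times the indicator form a \<open>critical_system\<close>, and
  \<open>potential_bounds\<close> gives the rates for the mollifications and their first
  derivatives. For large \<open>j\<close> the kernels centred in the half ball do not see the
  indicator, so the limits are those of \<open>U\<close> and \<open>D\<close> themselves.\<close>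

lemma local_regularity:
  assumes x0: "x0 \<in> S"
  shows "\<exists>r>0. ball x0 r \<subseteq> S \<and> (\<forall>i. HC (Suc 0) (ball x0 r) (Lf rhoj (U i)) \<and>
    (\<forall>x\<in>ball x0 r. (\<lambda>j. conv (rhoj j) (U i) x) \<longlonglongrightarrow> Lf rhoj (U i) x \<and>
      (\<forall>b\<in>Basis. (\<lambda>j. conv (rhoj j) (D i b) x) \<longlonglongrightarrow> partial_dir b (Lf rhoj (U i)) x)))"
proof -
  obtain e where e: "e > 0" "cball x0 e \<subseteq> S" using S x0 open_contains_cball by blast
  define R where "R = min (1/2) (e/3)"
  have R: "0 < R" "R \<le> 1/2" "3 * R \<le> e" using e by (auto simp: R_def)
  then have R3: "cball x0 (3 * R) \<subseteq> S" using e(2) subset_cball[of "3 * R" e x0] by blast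
  have BS: "ball x0 R \<subseteq> S" using R3 R(1) by (auto simp: subset_iff)
  let ?I = "\<lambda>y. indicator (ball x0 R) y :: real"
  have [measurable]: "ball x0 R \<in> sets borel" by simp
  define w where "w i y = ?I y * U i y" for i y
  define d where "d i b y = ?I y * D i b y" for i b y
  define H where "H i y = ?I y * G i y" for i y
  have e4: "(w i y)^4 = ?I y * (U i y)^4" "(w i y)^2 = ?I y * (U i y)^2" "(d i b y)^2 = ?I y * (D i b y)^2" for i b y
    by (auto simp: w_def d_def indicator_def)
  have wi: "integrable lborel (w i)" "integrable lborel (\<lambda>x. (w i x)^2)" for i
    unfolding e4 unfolding w_def by (intro integrable_ind_mult Ui U2)+
  have di: "integrable lborel (d i b)" "integrable lborel (\<lambda>x. (d i b x)^2)" if "b \<in> Basis" for i b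
    unfolding e4 unfolding d_def by (intro integrable_ind_mult Di D2 that)+
  have w4: "integrable lborel (\<lambda>x. (w i x)^4)" for i
    unfolding e4 by (rule local_L4[OF dim Ui U2 Di D2 grep R(1,2) R3])
  have [measurable]: "w i \<in> borel_measurable borel" for i using borel_measurable_integrable[OF wi(1)] by simp
  have [measurable]: "b \<in> Basis \<Longrightarrow> d i b \<in> borel_measurable borel" for i b using borel_measurable_integrable[OF di(1)] by simp
  note Gm[measurable]
  define a where "a x = (\<Sum>k\<in>UNIV. \<bar>w k x\<bar>)" for x
  define dd where "dd x = (\<Sum>k\<in>UNIV. \<Sum>b\<in>Basis. \<bar>d k b x\<bar>)" for x
  have [measurable]: "a \<in> borel_measurable borel" "dd \<in> borel_measurable borel" unfolding a_def dd_def by measurable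
  have Hb: "\<bar>H i x\<bar> \<le> C * (a x * (dd x + (a x)^2))" for i x
    using Gb[of i x] C0 by (cases "x \<in> ball x0 R") (auto simp: H_def a_def dd_def w_def d_def)
  have ia2: "integrable lborel (\<lambda>x. (a x)^2)"
  proof (rule Bochner_Integration.integrable_bound[of lborel "\<lambda>x. real CARD('i) * (\<Sum>i\<in>UNIV. (w i x)^2)"])
    show "integrable lborel (\<lambda>x. real CARD('i) * (\<Sum>i\<in>UNIV. (w i x)^2))" by (intro integrable_mult_right Bochner_Integration.integrable_sum wi)
    have "(a x)^2 \<le> real CARD('i) * (\<Sum>i\<in>UNIV. (w i x)^2)" for x
      unfolding a_def using sum_squared_le_sum_of_squares[of "\<lambda>i. \<bar>w i x\<bar>" UNIV] by (simp add: mult.commute)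
    then show "AE x in lborel. norm ((a x)^2) \<le> norm (real CARD('i) * (\<Sum>i\<in>UNIV. (w i x)^2))"
      by (intro AE_I2) (metis abs_ge_self abs_power2 order_trans real_norm_def)
  qed measurable
  have ia4: "integrable lborel (\<lambda>x. (a x)^4)"
  proof (rule Bochner_Integration.integrable_bound[of lborel "\<lambda>x. real CARD('i)^3 * (\<Sum>i\<in>UNIV. (w i x)^4)"])
    show "integrable lborel (\<lambda>x. real CARD('i)^3 * (\<Sum>i\<in>UNIV. (w i x)^4))" by (intro integrable_mult_right Bochner_Integration.integrable_sum w4)
    have "(a x)^4 \<le> real CARD('i)^3 * (\<Sum>i\<in>UNIV. (w i x)^4)" for x unfolding a_def by (rule sum_pow4_le) simp
    then show "AE x in lborel. norm ((a x)^4) \<le> norm (real CARD('i)^3 * (\<Sum>i\<in>UNIV. (w i x)^4))"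
      by (intro AE_I2) (smt (verit) real_norm_def zero_le_even_power even_numeral)
  qed measurable
  have idd2: "integrable lborel (\<lambda>x. (dd x)^2)"
  proof (rule Bochner_Integration.integrable_bound[of lborel "\<lambda>x. real (CARD('i) * DIM('a)) * (\<Sum>i\<in>UNIV. \<Sum>b\<in>Basis. (d i b x)^2)"])
    show "integrable lborel (\<lambda>x. real (CARD('i) * DIM('a)) * (\<Sum>i\<in>UNIV. \<Sum>b\<in>Basis. (d i b x)^2))"
      by (intro integrable_mult_right Bochner_Integration.integrable_sum di)
    have "(dd x)^2 \<le> real (CARD('i) * DIM('a)) * (\<Sum>i\<in>UNIV. \<Sum>b\<in>Basis. (d i b x)^2)" for x
    proof -
      have "(dd x)^2 = (\<Sum>p\<in>UNIV \<times> Basis. \<bar>d (fst p) (snd p) x\<bar>)^2"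
        unfolding dd_def by (simp add: sum.cartesian_product split_beta)
      also have "\<dots> \<le> (\<Sum>p\<in>UNIV \<times> Basis. \<bar>d (fst p) (snd p) x\<bar>^2) * card (UNIV \<times> Basis :: ('i \<times> 'a) set)"
        by (rule sum_squared_le_sum_of_squares)
      also have "\<dots> = real (CARD('i) * DIM('a)) * (\<Sum>i\<in>UNIV. \<Sum>b\<in>Basis. (d i b x)^2)"
        by (simp add: sum.cartesian_product split_beta card_cartesian_product mult.commute)
      finally show ?thesis .
    qed
    then show "AE x in lborel. norm ((dd x)^2) \<le> norm (real (CARD('i) * DIM('a)) * (\<Sum>i\<in>UNIV. \<Sum>b\<in>Basis. (d i b x)^2))"
      by (intro AE_I2) (simp only: real_norm_def abs_power2 order_trans[OF _ abs_ge_self])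
  qed measurable
  have ibb2: "integrable lborel (\<lambda>x. (dd x + (a x)^2)^2)"
  proof (rule Bochner_Integration.integrable_bound[of lborel "\<lambda>x. 2 * ((dd x)^2 + (a x)^4)"])
    show "integrable lborel (\<lambda>x. 2 * ((dd x)^2 + (a x)^4))" by (intro integrable_mult_right Bochner_Integration.integrable_add idd2 ia4)
    have "(dd x + (a x)^2)^2 \<le> 2 * ((dd x)^2 + (a x)^4)" for x
      using sum_squares_bound[of "dd x" "(a x)^2"] by (simp add: power2_sum)
    then show "AE x in lborel. norm ((dd x + (a x)^2)^2) \<le> norm (2 * ((dd x)^2 + (a x)^4))"
      by (intro AE_I2) (simp only: real_norm_def abs_power2 order_trans[OF _ abs_ge_self])
  qed measurable
  have Hi: "integrable lborel (H i)" for i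
  proof (rule Bochner_Integration.integrable_bound[of lborel "\<lambda>x. C * (a x * (dd x + (a x)^2))"])
    show "integrable lborel (\<lambda>x. C * (a x * (dd x + (a x)^2)))"
      by (intro integrable_mult_right CS_real(1) ia2 ibb2) measurable
    show "H i \<in> borel_measurable lborel" unfolding H_def by measurable
    show "AE x in lborel. norm (H i x) \<le> norm (C * (a x * (dd x + (a x)^2)))" by (intro AE_I2) (simp only: real_norm_def order_trans[OF Hb abs_ge_self])
  qed
  have cw: "conv k (w i) x = conv k (U i) x" "conv k (d i b) x = conv k (D i b) x" "conv k (H i) x = conv k (G i) x"
    if k: "\<And>z. r \<le> norm z \<Longrightarrow> k z = 0" and x: "ball x r \<subseteq> ball x0 R" for k x r i b
    using x by (auto intro!: conv_cong[OF k] simp: w_def d_def H_def)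
  have le: "(1::real)/2^Suc j \<le> 1/2^j" for j by (intro divide_left_mono power_increasing) auto
  have supS: "1/2^j \<le> norm z \<Longrightarrow> rhoj (Suc j) z = 0" for j and z :: 'a using le[of j] by (intro rhoj_support) linarith
  have rw: "repr (ball x0 R) (w i) (H i)" for i
    unfolding repr_def
  proof (intro allI impI)
    fix j x assume x: "cball x (1/2^j) \<subseteq> ball x0 R"
    then have b: "ball x (1/2^j) \<subseteq> ball x0 R" using ball_subset_cball by blast
    have "conv (rhoj j) (U i) x - conv (rhoj (Suc j)) (U i) x = conv (kapj (Suc j)) (G i) x"
      using rep[of i] x BS unfolding repr_def by blast
    then show "conv (rhoj j) (w i) x - conv (rhoj (Suc j)) (w i) x = conv (kapj (Suc j)) (H i) x"
      using cw(1)[where k="rhoj j", OF rhoj_support b] cw(1)[where k="rhoj (Suc j)", OF supS b] cw(3)[where k="kapj (Suc j)", OF kapj_Suc_support b] by simp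
  qed
  have gw: "grepr (ball x0 R) (w i) b (d i b)" if b: "b \<in> Basis" for i b
    unfolding grepr_def
  proof (intro allI impI)
    fix j x assume x: "cball x (1/2^j) \<subseteq> ball x0 R"
    then have bb: "ball x (1/2^j) \<subseteq> ball x0 R" using ball_subset_cball by blast
    have "conv (partial_dir b (rhoj j)) (U i) x = conv (rhoj j) (D i b) x"
      using grep[OF b, of i] x BS unfolding grepr_def by blast
    then show "conv (partial_dir b (rhoj j)) (w i) x = conv (rhoj j) (d i b) x"
      using cw(1)[where k="partial_dir b (rhoj j)", OF rhoj_support1[OF b] bb] cw(2)[where k="rhoj j", OF rhoj_support bb] by simp
  qed
  interpret critical_system w d H "ball x0 R" C
    by unfold_locales (use dim wi Hi di w4 C0 Hb rw gw in \<open>auto simp: a_def dd_def\<close>)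
  have "(\<lambda>j. 4 * (1/2::real)^j) \<longlonglongrightarrow> 4 * 0" by (intro tendsto_intros LIMSEQ_realpow_zero) auto
  then have zz: "(\<lambda>j. 4 * (1/2::real)^j) \<longlonglongrightarrow> 0" by simp
  have "\<forall>\<^sub>F j in sequentially. 4 * (1/2::real)^j < R/2" using R by (intro order_tendstoD(2)[OF zz]) auto
  then obtain J0 where J0: "\<And>j. j \<ge> J0 \<Longrightarrow> 4/2^j < R/2" unfolding eventually_sequentially by (auto simp: power_one_over)
  obtain J A where J: "J \<ge> J0" "A \<ge> 0" and bnd: "\<And>i x j. j \<ge> J \<Longrightarrow> cball x (4/2^J) \<subseteq> ball x0 R \<Longrightarrow>
     \<bar>conv (kapj j) (H i) x\<bar> \<le> A * sg^j \<and>
     (\<forall>b\<in>Basis. \<bar>conv (partial_dir b (kapj j)) (H i) x\<bar> \<le> A * sg^j \<and>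
        (\<forall>c\<in>Basis. \<bar>conv (partial_dir c (partial_dir b (kapj j))) (H i) x\<bar> \<le> A * (2 * sg)^j))"
    using potential_bounds[of J0] by blast
  define V where "V = ball x0 (R/2)"
  have Vo: "open V" by (simp add: V_def)
  have sub: "cball x (4/2^J) \<subseteq> ball x0 R" if "x \<in> V" for x
  proof
    fix y assume "y \<in> cball x (4/2^J)"
    then show "y \<in> ball x0 R" using that J0[OF J(1)] dist_triangle[of x0 y x] by (simp add: V_def)
  qed
  have subj: "cball x (1/2^j) \<subseteq> ball x0 R" if "x \<in> V" "j \<ge> J" for x j
  proof -
    have "(1::real)/2^j \<le> 4/2^J" using that by (intro frac_le power_increasing) auto
    then show ?thesis using sub[OF that(1)] subset_cball[of "1/2^j" "4/2^J" x] by blast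
  qed
  have r0: "conv (rhoj j) (w i) x - conv (rhoj (Suc j)) (w i) x = conv (kapj (Suc j)) (H i) x" if "x \<in> V" "j \<ge> J" for i x j
    using rw[of i] subj[OF that] unfolding repr_def by blast
  have r1: "conv (partial_dir b (rhoj j)) (w i) x - conv (partial_dir b (rhoj (Suc j))) (w i) x = conv (partial_dir b (kapj (Suc j))) (H i) x"
    if "x \<in> V" "j \<ge> J" "b \<in> Basis" for i x j b
    by (rule rep_deriv[OF Vo r0[OF _ that(2)] bump_rhoj bump_rhoj bump_kapj wi(1) Hi that(3,1)])
  have r2: "conv (partial_dir c (partial_dir b (rhoj j))) (w i) x - conv (partial_dir c (partial_dir b (rhoj (Suc j)))) (w i) x = conv (partial_dir c (partial_dir b (kapj (Suc j)))) (H i) x"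
    if "x \<in> V" "j \<ge> J" "b \<in> Basis" "c \<in> Basis" for i x j b c
    by (rule rep_deriv[OF Vo r1[OF _ that(2,3)] _ _ _ wi(1) Hi that(4,1)]) (assumption | intro bump_partial bump_rhoj bump_kapj that)+
  \<comment> \<open>The factor 2 pays for the shift from \<open>Suc j\<close> to \<open>j\<close> in
    \<open>(2 * sg)^Suc j\<close>.\<close>
  define A' where "A' = 2 * A"
  have A': "A' \<ge> 0" using J by (simp add: A'_def)
  have up: "A * sg^Suc j \<le> A' * sg^j" "A * sg^Suc j \<le> A' * (2 * sg)^j" "A * (2 * sg)^Suc j \<le> A' * (2 * sg)^j" for j
  proof -
    have s1: "sg^Suc j \<le> sg^j" using sg by (intro power_decreasing) auto
    have s2: "sg^j \<le> (2 * sg)^j" using sg by (intro power_mono) auto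
    have s0: "0 \<le> sg^j" using sg by simp
    show "A * sg^Suc j \<le> A' * sg^j" unfolding A'_def using s1 s0 J sg by (intro mult_mono) auto
    show "A * sg^Suc j \<le> A' * (2 * sg)^j" unfolding A'_def using order_trans[OF s1 s2] sg J by (intro mult_mono) auto
    have "(2 * sg)^Suc j = (2 * sg) * (2 * sg)^j" by (rule power_Suc)
    also have "\<dots> \<le> 2 * (2 * sg)^j" using sg by (intro mult_right_mono) auto
    finally show "A * (2 * sg)^Suc j \<le> A' * (2 * sg)^j" unfolding A'_def using J mult_left_mono[of "(2 * sg)^Suc j" "2 * (2 * sg)^j" A] by (simp only: mult_ac)
  qed
  have b0: "\<bar>conv (kapj (Suc j)) (H i) x\<bar> \<le> A * sg^Suc j" "b \<in> Basis \<Longrightarrow> \<bar>conv (partial_dir b (kapj (Suc j))) (H i) x\<bar> \<le> A * sg^Suc j"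
    "b \<in> Basis \<Longrightarrow> c \<in> Basis \<Longrightarrow> \<bar>conv (partial_dir c (partial_dir b (kapj (Suc j)))) (H i) x\<bar> \<le> A * (2 * sg)^Suc j"
    if "x \<in> V" "j \<ge> J" for i x j b c
    using bnd[OF le_SucI[OF that(2)] sub[OF that(1)], of i] by blast+
  have rt0: "rate rhoj (w i) V A' sg J" for i
    unfolding rate_def
  proof (intro allI impI ballI conjI)
    fix j x assume j: "J \<le> j" and x: "x \<in> V"
    show "\<bar>conv (rhoj j) (w i) x - conv (rhoj (Suc j)) (w i) x\<bar> \<le> A' * sg^j"
      unfolding r0[OF x j] by (rule order_trans[OF b0(1)[OF x j] up(1)])
    fix b :: 'a assume b: "b \<in> Basis"
    show "\<bar>conv (partial_dir b (rhoj j)) (w i) x - conv (partial_dir b (rhoj (Suc j))) (w i) x\<bar> \<le> A' * (2 * sg)^j"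
      unfolding r1[OF x j b] by (rule order_trans[OF b0(2)[OF x j b] up(2)])
  qed
  have rt1: "rate (\<lambda>j. partial_dir b (rhoj j)) (w i) V A' sg J" if b: "b \<in> Basis" for i b
    unfolding rate_def
  proof (intro allI impI ballI conjI)
    fix j x assume j: "J \<le> j" and x: "x \<in> V"
    show "\<bar>conv (partial_dir b (rhoj j)) (w i) x - conv (partial_dir b (rhoj (Suc j))) (w i) x\<bar> \<le> A' * sg^j"
      unfolding r1[OF x j b] by (rule order_trans[OF b0(2)[OF x j b] up(1)])
    fix c :: 'a assume c: "c \<in> Basis"
    show "\<bar>conv (partial_dir c (partial_dir b (rhoj j))) (w i) x - conv (partial_dir c (partial_dir b (rhoj (Suc j)))) (w i) x\<bar> \<le> A' * (2 * sg)^j"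
      unfolding r2[OF x j b c] by (rule order_trans[OF b0(3)[OF x j b c] up(3)])
  qed
  have hc: "HC (Suc 0) V (Lf rhoj (w i))" for i
    by (rule rate_HC1[OF rt0 rt1 sg(3,2) A' Vo bump_rhoj wi(1)])
  have lim0: "(\<lambda>j. conv (rhoj j) (w i) x) \<longlonglongrightarrow> Lf rhoj (w i) x" if "x \<in> V" for i x
    by (rule rate_limit(1)[OF rt0 sg(1,2) A' that])
  have lim1: "(\<lambda>j. conv (partial_dir b (rhoj j)) (w i) x) \<longlonglongrightarrow> partial_dir b (Lf rhoj (w i)) x" if x: "x \<in> V" and b: "b \<in> Basis" for i x b
    using rate_limit(1)[OF rt1[OF b] sg(1,2) A' x, of i] partial_dirI'[OF rate_DERIV[OF rt0 rt1[OF b] sg(1,2) A' Vo bump_rhoj wi(1) b x, of i]] by simp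
  have ev: "\<forall>\<^sub>F j in sequentially. conv (rhoj j) (w i) x = conv (rhoj j) (U i) x \<and> (\<forall>b\<in>Basis. conv (partial_dir b (rhoj j)) (w i) x = conv (rhoj j) (D i b) x)"
    if x: "x \<in> V" for i x
    using eventually_ge_at_top[of J]
  proof eventually_elim
    case (elim j)
    have b: "ball x (1/2^j) \<subseteq> ball x0 R" using subj[OF x elim] ball_subset_cball by blast
    have "conv (partial_dir b (rhoj j)) (w i) x = conv (rhoj j) (D i b) x" if "b \<in> Basis" for b
      using gw[OF that, of i] subj[OF x elim] cw(2)[where k="rhoj j", OF rhoj_support b] unfolding grepr_def by simp
    then show ?case using cw(1)[where k="rhoj j", OF rhoj_support b] by blast
  qed
  have limU: "(\<lambda>j. conv (rhoj j) (U i) x) \<longlonglongrightarrow> Lf rhoj (w i) x" if x: "x \<in> V" for i x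
    by (rule Lim_transform_eventually[OF lim0[OF x]]) (use ev[OF x, of i] in \<open>simp add: eventually_conj_iff\<close>)
  have LU: "Lf rhoj (U i) x = Lf rhoj (w i) x" if x: "x \<in> V" for i x
    unfolding Lf_def[of _ "U i"] by (rule limI[OF limU[OF x]])
  have hcU: "HC (Suc 0) V (Lf rhoj (U i))" for i by (rule HC_cong[OF Vo hc]) (simp add: LU)
  have pLU: "partial_dir b (Lf rhoj (U i)) x = partial_dir b (Lf rhoj (w i)) x" if x: "x \<in> V" and b: "b \<in> Basis" for i x b
    by (rule partial_diff_cong(2)[OF Vo x LU]) (use hcU[of i] b x in auto)
  have limD: "(\<lambda>j. conv (rhoj j) (D i b) x) \<longlonglongrightarrow> partial_dir b (Lf rhoj (U i)) x" if x: "x \<in> V" and b: "b \<in> Basis" for i x b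
    unfolding pLU[OF x b] by (rule Lim_transform_eventually[OF lim1[OF x b]]) (rule eventually_mono[OF ev[OF x, of i]], use b in blast)
  have "V \<subseteq> S" using BS R(1) by (auto simp: V_def subset_iff)
  then show ?thesis
    using R(1) hcU limU LU limD unfolding V_def by (intro exI[of _ "R/2"]) auto
qed

text \<open>The mollifications converge everywhere on \<open>S\<close> to the regular function and
  along a subsequence almost everywhere to the given one.\<close>

theorem regularity:
  "HC (Suc 0) S (Lf rhoj (U i))" "AE x in lborel. x \<in> S \<longrightarrow> U i x = Lf rhoj (U i) x"
  "b \<in> Basis \<Longrightarrow> AE x in lborel. x \<in> S \<longrightarrow> D i b x = partial_dir b (Lf rhoj (U i)) x"
proof -
  show "HC (Suc 0) S (Lf rhoj (U i))" by (rule HC_local) (use local_regularity in blast)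
  have l0: "(\<lambda>j. conv (rhoj j) (U i) x) \<longlonglongrightarrow> Lf rhoj (U i) x" if "x \<in> S" for x
    using local_regularity[OF that] centre_in_ball by metis
  have l1: "(\<lambda>j. conv (rhoj j) (D i b) x) \<longlonglongrightarrow> partial_dir b (Lf rhoj (U i)) x" if "x \<in> S" "b \<in> Basis" for x b
    using local_regularity[OF that(1)] that(2) centre_in_ball by metis
  have ae: "AE x in lborel. x \<in> S \<longrightarrow> f x = h x" if f: "integrable lborel f" and h: "\<And>x. x \<in> S \<Longrightarrow> (\<lambda>j. conv (rhoj j) f x) \<longlonglongrightarrow> h x" for f h
  proof -
    obtain s where s: "strict_mono s" "AE x in lborel. (\<lambda>n. conv (rhoj (s n)) f x) \<longlonglongrightarrow> f x"
      using mollify_AE[OF mollifier_rhoj f] by blast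
    from s(2) show ?thesis
    proof eventually_elim
      case (elim x)
      show ?case
      proof
        assume "x \<in> S"
        from LIMSEQ_subseq_LIMSEQ[OF h[OF this] s(1)] have "(\<lambda>n. conv (rhoj (s n)) f x) \<longlonglongrightarrow> h x" by (simp add: o_def)
        with elim show "f x = h x" by (rule LIMSEQ_unique)
      qed
    qed
  qed
  show "AE x in lborel. x \<in> S \<longrightarrow> U i x = Lf rhoj (U i) x" by (rule ae[OF Ui l0])
  show "AE x in lborel. x \<in> S \<longrightarrow> D i b x = partial_dir b (Lf rhoj (U i)) x" if "b \<in> Basis" by (rule ae[OF Di[OF that] l1[OF _ that]])
qed

end

section \<open>Vector-valued functions and their components\<close>

lemma partial_dir_nth:
  fixes h :: "'a::euclidean_space \<Rightarrow> real^'n"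
  assumes "(\<lambda>t. h (x + t *\<^sub>R b)) differentiable (at 0)"
  shows "(\<lambda>t. h (x + t *\<^sub>R b) $ k) differentiable (at 0)" "partial_dir b (\<lambda>y. h y $ k) x = partial_dir b h x $ k"
proof -
  have "((\<lambda>t. h (x + t *\<^sub>R b)) has_vector_derivative partial_dir b h x) (at 0)"
    unfolding partial_dir_def using assms by (simp add: vector_derivative_works)
  from bounded_linear.has_vector_derivative[OF bounded_linear_vec_nth this, of k]
  have d: "((\<lambda>t. h (x + t *\<^sub>R b) $ k) has_vector_derivative partial_dir b h x $ k) (at 0)" .
  show "(\<lambda>t. h (x + t *\<^sub>R b) $ k) differentiable (at 0)" by (rule differentiableI_vector[OF d])
  show "partial_dir b (\<lambda>y. h y $ k) x = partial_dir b h x $ k" by (rule partial_dirI[OF d])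
qed

lemma foldr_partial_nth:
  fixes f :: "'a::euclidean_space \<Rightarrow> real^'n"
  assumes f: "smooth_on UNIV f" and vs: "set vs \<subseteq> Basis"
  shows "foldr partial_dir vs (\<lambda>x. f x $ k) = (\<lambda>x. foldr partial_dir vs f x $ k)"
  using vs
proof (induction vs)
  case (Cons v vs)
  then have v: "set vs \<subseteq> Basis" "v \<in> Basis" by auto
  show ?case using Cons.IH[OF v(1)] by (intro ext) (simp add: partial_dir_nth(2)[OF smooth_onD(2)[OF f v]])
qed simp

lemma smooth_on_nth:
  fixes f :: "'a::euclidean_space \<Rightarrow> real^'n"
  assumes f: "smooth_on UNIV f" shows "smooth_on UNIV (\<lambda>x. f x $ k)"
  unfolding smooth_on_def
proof (intro allI impI conjI ballI)
  fix vs :: "'a list" assume vs: "set vs \<subseteq> Basis"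
  show "continuous_on UNIV (foldr partial_dir vs (\<lambda>x. f x $ k))"
    unfolding foldr_partial_nth[OF f vs] by (intro continuous_on_component smooth_onD(1)[OF f vs])
  show "(\<lambda>t. foldr partial_dir vs (\<lambda>x. f x $ k) (x + t *\<^sub>R v)) differentiable (at 0)" if "v \<in> Basis" for v x
    unfolding foldr_partial_nth[OF f vs] by (rule partial_dir_nth(1)[OF smooth_onD(2)[OF f vs that]]) simp
qed

lemma has_vector_derivative_vec_lambda:
  fixes h :: "'n::finite \<Rightarrow> real \<Rightarrow> real"
  assumes "\<And>k. (h k has_vector_derivative d k) F"
  shows "((\<lambda>t. \<chi> k. h k t) has_vector_derivative (\<chi> k. d k)) F"
proof -
  have e: "(\<chi> k. c k) = (\<Sum>k\<in>UNIV. c k *\<^sub>R axis k (1::real))" for c :: "'n \<Rightarrow> real"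
    by (simp add: vec_eq_iff axis_def if_distrib cong: if_cong)
  show ?thesis unfolding e
    by (intro has_vector_derivative_sum bounded_linear.has_vector_derivative[OF bounded_linear_scaleR_left] assms)
qed

text \<open>Off \<open>S\<close> the iterated derivatives of the components carry no information, so
  the vector-valued ones are identified with them on \<open>S\<close> only; as \<open>S\<close> is
  open, this suffices to differentiate once more.\<close>

lemma smooth_on_vec_lambda:
  fixes v :: "'n::finite \<Rightarrow> 'a::euclidean_space \<Rightarrow> real"
  assumes S: "open S" and v: "\<And>k. smooth_on S (v k)" shows "smooth_on S (\<lambda>x. \<chi> k. v k x)"
proof -
  let ?v = "\<lambda>x. \<chi> k. v k x"
  have D: "((\<lambda>t. g (x + t *\<^sub>R b)) has_vector_derivative (\<chi> k. partial_dir b (foldr partial_dir vs (v k)) x)) (at 0)"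
    if g: "\<And>y. y \<in> S \<Longrightarrow> g y = (\<chi> k. foldr partial_dir vs (v k) y)" and vs: "set vs \<subseteq> Basis" and b: "b \<in> Basis" and x: "x \<in> S" for g vs b x
  proof (rule has_vector_derivative_transform_within_open)
    show "((\<lambda>t. \<chi> k. foldr partial_dir vs (v k) (x + t *\<^sub>R b)) has_vector_derivative (\<chi> k. partial_dir b (foldr partial_dir vs (v k)) x)) (at 0)"
      using DERIV_partial[OF smooth_onD(2)[OF v vs b x]]
      by (intro has_vector_derivative_vec_lambda) (simp add: has_real_derivative_iff_has_vector_derivative)
    show "open ((\<lambda>t. x + t *\<^sub>R b) -` S)" by (intro open_vimage S continuous_intros)
    show "(\<chi> k. foldr partial_dir vs (v k) (x + t *\<^sub>R b)) = g (x + t *\<^sub>R b)" if "t \<in> (\<lambda>t. x + t *\<^sub>R b) -` S" for t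
      using g that by simp
  qed (use x in simp)
  have e: "\<forall>x\<in>S. foldr partial_dir vs ?v x = (\<chi> k. foldr partial_dir vs (v k) x)" if "set vs \<subseteq> Basis" for vs
    using that
  proof (induction vs)
    case (Cons b vs)
    then have vs: "set vs \<subseteq> Basis" "b \<in> Basis" by auto
    from Cons.IH[OF vs(1)] have "y \<in> S \<Longrightarrow> foldr partial_dir vs ?v y = (\<chi> k. foldr partial_dir vs (v k) y)" for y by blast
    then show ?case using partial_dirI[where f="foldr partial_dir vs ?v" and b=b, OF D[OF _ vs]] by simp
  qed simp
  show ?thesis unfolding smooth_on_def
  proof (intro allI impI conjI ballI)
    fix vs :: "'a list" assume vs: "set vs \<subseteq> Basis"
    have "continuous_on S (\<lambda>x. \<chi> k. foldr partial_dir vs (v k) x)"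
      by (intro continuous_on_vec_lambda smooth_onD(1)[OF v vs])
    then show "continuous_on S (foldr partial_dir vs ?v)" by (rule continuous_on_eq) (use e[OF vs] in simp)
    show "(\<lambda>t. foldr partial_dir vs ?v (x + t *\<^sub>R b)) differentiable (at 0)" if "b \<in> Basis" "x \<in> S" for b x
      using differentiableI_vector[OF D[OF bspec[OF e[OF vs]] vs that]] .
  qed
qed

section \<open>Bootstrapping\<close>

text \<open>The right-hand side contains first derivatives, so it is one order worse than the
  solution; the Schauder estimate gains two orders, a net gain of one per round.\<close>

lemma bootstrap:
  fixes f :: "(real^'n) \<times> (real^'n^'m) \<Rightarrow> real^'n" and g :: "real^'n \<Rightarrow> real^'n" and V :: "'n \<Rightarrow> real^'m \<Rightarrow> real"
  assumes f: "smooth_on UNIV f" and g: "smooth_on UNIV g" and S: "open S" and V: "\<And>k. HC (Suc 0) S (V k)"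
    and r: "\<And>k. repr S (V k) (\<lambda>x. (f (\<chi> k. V k x, \<chi> i k. partial_dir (axis i 1) (V k) x) + g (\<chi> k. V k x)) $ k)"
  shows "smooth_on S (\<lambda>x. \<chi> k. V k x)"
proof -
  define v where "v x = (\<chi> k. V k x)" for x
  define Dv where "Dv x = (\<chi> i k. partial_dir (axis i 1) (V k) x)" for x
  have "\<forall>k. HC (Suc n) S (V k)" for n
  proof (induction n)
    case (Suc n)
    have ax: "axis i 1 \<in> (Basis :: (real^'m) set)" for i by (simp add: axis_in_Basis_iff)
    have HV: "HC n S (V k)" for k by (rule HC_Suc_D[OF Suc[rule_format]])
    have HD: "HC n S (partial_dir (axis i 1) (V k))" for i k by (rule HC_partial[OF Suc[rule_format] ax])
    have c1: "HC n S (\<lambda>x. v x \<bullet> c)" if "c \<in> Basis" for c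
      using that HV by (auto simp: Basis_vec_def v_def inner_axis)
    have c2: "HC n S (\<lambda>x. Dv x \<bullet> c)" if "c \<in> Basis" for c
      using that HD by (auto simp: Basis_vec_def Dv_def inner_axis)
    have "HC n S (\<lambda>x. f (v x, Dv x) $ k + g (v x) $ k)" for k
    proof (intro HC_add)
      show "HC n S (\<lambda>x. f (v x, Dv x) $ k)"
      proof (rule HC_comp[where w="\<lambda>x. (v x, Dv x)" and H="\<lambda>p. f p $ k"])
        show "HC j UNIV (\<lambda>p. f p $ k)" for j using smooth_on_nth[OF f] smooth_on_HC[OF open_UNIV] by blast
        show "HC n S (\<lambda>x. (v x, Dv x) \<bullet> c)" if "c \<in> Basis" for c
          using that c1 c2 by (auto simp: Basis_prod_def)
      qed (rule S)
      show "HC n S (\<lambda>x. g (v x) $ k)"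
      proof (rule HC_comp[where w=v and H="\<lambda>p. g p $ k"])
        show "HC j UNIV (\<lambda>p. g p $ k)" for j using smooth_on_nth[OF g] smooth_on_HC[OF open_UNIV] by blast
      qed (use c1 S in auto)
    qed
    then have "HC n S (\<lambda>x. (f (\<chi> k. V k x, \<chi> i k. partial_dir (axis i 1) (V k) x) + g (\<chi> k. V k x)) $ k)" for k
      by (simp add: v_def Dv_def)
    from schauder[OF S HC_continuous[OF V] this r] show ?case by blast
  qed (use V in blast)
  then have "smooth_on S (V k)" for k
    unfolding smooth_on_HC[OF S] using HC_Suc_D by blast
  then show ?thesis by (rule smooth_on_vec_lambda[OF S])
qed

lemma conv_cong_AE:
  fixes k :: "'a::euclidean_space \<Rightarrow> real"
  assumes k: "bump k" "\<And>z. R \<le> norm z \<Longrightarrow> k z = 0" and S: "open S" "ball x R \<subseteq> S"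
    and w: "w \<in> borel_measurable borel" and w': "continuous_on S w'" and e: "AE y in lborel. y \<in> S \<longrightarrow> w y = w' y"
  shows "conv k w x = conv k w' x"
proof -
  have [measurable]: "(\<lambda>y. indicator S y *\<^sub>R w' y) \<in> borel_measurable borel" using S w' by (intro borel_measurable_continuous_on_indicator) auto
  have [measurable]: "k \<in> borel_measurable borel" "w \<in> borel_measurable borel" using bump_measurable[OF k(1)] w by auto
  have "conv k w' x = conv k (\<lambda>y. indicator S y *\<^sub>R w' y) x"
    by (rule conv_cong[OF k(2)]) (use S(2) in auto)
  also have "\<dots> = conv k w x" unfolding conv_def
  proof (rule integral_cong_AE)
    show "AE y in lborel. k (x - y) * (indicator S y *\<^sub>R w' y) = k (x - y) * w y"
      using e
    proof eventually_elim
      case (elim y)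
      show ?case
      proof (cases "y \<in> S")
        case False
        then have "R \<le> norm (x - y)" using S(2) by (auto simp: dist_norm subset_iff not_less[symmetric])
        then show ?thesis using k(2) by simp
      qed (use elim in simp)
    qed
  qed measurable
  finally show ?thesis by simp
qed

section \<open>From distributions to kernel identities\<close>

text \<open>The kernel calculus runs over Borel functions on the whole space, while the data are
  Lebesgue measurable on a subset; changing them on a null set and extending by zero passes between
  the two.\<close>

lemma borel_representative:
  fixes h :: "'a::euclidean_space \<Rightarrow> real"
  assumes S: "S \<in> sets borel" and h: "h \<in> borel_measurable (lebesgue_on S)"
  shows "\<exists>U. U \<in> borel_measurable borel \<and> (\<forall>x. x \<notin> S \<longrightarrow> U x = 0) \<and> (AE x in lborel. x \<in> S \<longrightarrow> h x = U x)"
proof -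
  have "(\<lambda>x. indicator S x *\<^sub>R h x) \<in> borel_measurable lebesgue"
    using h S by (subst (asm) borel_measurable_restrict_space_iff) (auto simp: mult.commute)
  from completion_ex_borel_measurable_real[OF this] obtain U where U: "U \<in> borel_measurable lborel" "AE x in lborel. indicator S x *\<^sub>R h x = U x" by blast
  have [measurable]: "U \<in> borel_measurable borel" "S \<in> sets borel" using U S by auto
  show ?thesis
  proof (intro exI[of _ "\<lambda>x. indicator S x * U x"] conjI)
    show "(\<lambda>x. indicator S x * U x) \<in> borel_measurable borel" by measurable
    show "AE x in lborel. x \<in> S \<longrightarrow> h x = indicator S x * U x" using U(2) by eventually_elim auto
  qed auto
qed

lemma integral_lebesgue_on_nth:
  fixes h :: "'a::euclidean_space \<Rightarrow> real^'n"
  assumes S: "S \<in> sets borel" and h: "integrable (lebesgue_on S) h" and H: "H \<in> borel_measurable borel"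
    and e: "AE x in lborel. x \<in> S \<longrightarrow> h x $ k = H x" and H0: "\<And>x. x \<notin> S \<Longrightarrow> H x = 0"
  shows "(\<integral>x. h x \<partial>lebesgue_on S) $ k = (LBINT x. H x)"
proof -
  have i: "integrable (lebesgue_on S) (\<lambda>x. h x $ k)" by (rule integrable_bounded_linear[OF bounded_linear_vec_nth h])
  have "(\<integral>x. h x \<partial>lebesgue_on S) $ k = (\<integral>x. h x $ k \<partial>lebesgue_on S)" by (rule integral_bounded_linear[OF bounded_linear_vec_nth h, symmetric])
  also have "\<dots> = (\<integral>x. indicator S x *\<^sub>R (h x $ k) \<partial>lebesgue)" using S by (subst integral_restrict_space) auto
  also have "\<dots> = (\<integral>x. H x \<partial>lebesgue)"
  proof (rule integral_cong_AE)
    show "(\<lambda>x. indicator S x *\<^sub>R (h x $ k)) \<in> borel_measurable lebesgue"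
      using i S by (subst (asm) integrable_restrict_space) auto
    show "H \<in> borel_measurable lebesgue" using H by (simp add: measurable_completion)
    show "AE x in lebesgue. indicator S x *\<^sub>R (h x $ k) = H x"
      by (rule AE_completion) (use e H0 in \<open>auto elim!: eventually_mono simp: indicator_def\<close>)
  qed
  also have "\<dots> = (LBINT x. H x)" using H by (intro integral_completion) simp
  finally show ?thesis .
qed

lemma test_function_kernel:
  fixes k :: "'a::euclidean_space \<Rightarrow> real"
  assumes k: "bump k" "\<And>z. r \<le> norm z \<Longrightarrow> k z = 0" and x: "cball x r \<subseteq> S"
  shows "test_function S (\<lambda>y. k (x - y))"
proof -
  have "bump (\<lambda>y. k (x - y))" using bump_affine[OF k(1), of "-1" x] by simp
  then have "smooth_on UNIV (\<lambda>y. k (x - y))" unfolding smooth_on_HC[OF open_UNIV] by (simp add: bump_HC)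
  then show ?thesis unfolding test_function_def
    by (intro conjI exI[of _ "cball x r"]) (use k(2) x in \<open>auto simp: dist_norm\<close>)
qed

lemma partial_dir_reflect:
  fixes k :: "'a::euclidean_space \<Rightarrow> real"
  assumes "bump k" "b \<in> Basis" shows "partial_dir b (\<lambda>y. k (x - y)) = (\<lambda>y. - partial_dir b k (x - y))"
  using partial_affine[OF assms, of x "-1"] by simp

lemma sum_Basis_axis:
  fixes P :: "real^'m \<Rightarrow> real"
  shows "(\<Sum>b\<in>Basis. P b) = (\<Sum>i\<in>UNIV. P (axis i 1))"
proof -
  have "(Basis :: (real^'m) set) = range (\<lambda>i. axis i 1)" by (auto simp: Basis_vec_def)
  moreover have "inj (\<lambda>i. axis i 1 :: real^'m)" by (auto simp: inj_def axis_eq_axis)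
  then have "(\<Sum>b\<in>range (\<lambda>i. axis i 1 :: real^'m). P b) = (\<Sum>i\<in>UNIV. P (axis i 1))" by (simp add: sum.reindex)
  ultimately show ?thesis by (simp only:)
qed

text \<open>Reflecting the argument changes the sign once for each of the two derivatives.\<close>

lemma laplacian_kapj:
  fixes x y :: "real^'m"
  shows "laplacian (\<lambda>y. kapj (Suc j) (x - y)) y = rhoj j (x - y) - rhoj (Suc j) (x - y)"
proof -
  have "partial_dir b (partial_dir b (\<lambda>y. kapj (Suc j) (x - y))) y = partial_dir b (partial_dir b (kapj (Suc j))) (x - y)"
    if b: "b \<in> Basis" for b
  proof -
    have bk: "bump (partial_dir b (kapj (Suc j)))" by (rule bump_partial[OF bump_kapj b])
    have d: "((\<lambda>t. partial_dir b (kapj (Suc j)) (x - (y + t *\<^sub>R b))) has_real_derivative - partial_dir b (partial_dir b (kapj (Suc j))) (x - y)) (at 0)"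
      using bump_DERIV0[OF bump_affine[OF bk, of "-1" x] b, of y]
      by (simp only: scaleR_minus1_left add_uminus_conv_diff partial_dir_reflect[OF bk b])
    show ?thesis unfolding partial_dir_reflect[OF bump_kapj b]
      by (rule partial_dirI') (use DERIV_minus[OF d] in simp)
  qed
  then show ?thesis unfolding laplacian_def kapj_laplace[symmetric]
    by (simp add: sum_Basis_axis axis_in_Basis_iff)
qed

lemma abs_le_one_plus_square: "\<bar>t\<bar> \<le> 1 + t^2" for t :: real
proof -
  have "0 \<le> (\<bar>t\<bar> - 1)^2" by simp
  then have "2 * \<bar>t\<bar> \<le> t^2 + 1" by (simp add: power2_diff)
  then show ?thesis using zero_le_power2[of t] by linarith
qed

lemma borel_measurable_vec_nth:
  "(\<lambda>z. z $ k) \<in> borel_measurable (borel :: ('b::euclidean_space^'j) measure)"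
  by (rule borel_measurable_continuous_onI) (intro continuous_intros)

lemma integrable_lebesgue_on_subset:
  fixes h :: "'a::euclidean_space \<Rightarrow> 'b::euclidean_space"
  assumes "integrable (lebesgue_on S) h" "K \<subseteq> S" "S \<in> sets lebesgue" "K \<in> sets lebesgue"
  shows "integrable (lebesgue_on K) h"
proof -
  have "integrable lebesgue (\<lambda>x. indicator S x *\<^sub>R h x)" using assms by (simp add: integrable_restrict_space)
  then have "integrable lebesgue (\<lambda>x. indicator K x *\<^sub>R (indicator S x *\<^sub>R h x))" by (rule integrable_mult_indicator[OF assms(4)])
  also have "(\<lambda>x. indicator K x *\<^sub>R (indicator S x *\<^sub>R h x)) = (\<lambda>x. indicator K x *\<^sub>R h x)" using assms(2) by (auto simp: indicator_def fun_eq_iff)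
  finally show ?thesis using assms by (simp add: integrable_restrict_space)
qed

lemma L2_on_integrable:
  assumes S: "S \<in> lmeasurable" and h: "L2_on S h" shows "integrable (lebesgue_on S) h"
proof (rule Bochner_Integration.integrable_bound)
  interpret finite_measure "lebesgue_on S" by (rule finite_measure_lebesgue_on[OF S])
  show "integrable (lebesgue_on S) (\<lambda>x. 1 + (norm (h x))\<^sup>2)" using h by (auto simp: L2_on_def)
  have "t \<le> 1 + t^2" for t :: real using abs_le_one_plus_square[of t] by linarith
  then show "AE x in lebesgue_on S. norm (h x) \<le> norm (1 + (norm (h x))\<^sup>2)" by (intro AE_I2) simp
  show "h \<in> borel_measurable (lebesgue_on S)" using h by (simp add: L2_on_def)
qed

text \<open>Passes from the vector-valued integrals over \<open>S\<close> in the hypotheses to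
  \<open>conv\<close>. Integrability of \<open>h\<close> is asked on the support ball of the kernel,
  because the right-hand side of the equation is only locally integrable.\<close>

lemma integral_kernel_nth:
  fixes h :: "real^'m \<Rightarrow> real^'n"
  assumes S: "S \<in> sets borel" and k: "bump k" "\<And>z. r \<le> norm z \<Longrightarrow> k z = 0" and x: "cball x r \<subseteq> S"
    and h: "integrable (lebesgue_on (cball x r)) h" and H: "H \<in> borel_measurable borel"
    and e: "AE y in lborel. y \<in> S \<longrightarrow> h y $ i = H y" and H0: "\<And>y. y \<notin> S \<Longrightarrow> H y = 0"
  shows "(\<integral>y. k (x - y) *\<^sub>R h y \<partial>lebesgue_on S) $ i = conv k H x"
  unfolding conv_def
proof (rule integral_lebesgue_on_nth[OF S])
  have [measurable]: "k \<in> borel_measurable borel" "H \<in> borel_measurable borel" using bump_measurable[OF k(1)] H by auto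
  have "(\<lambda>y. k (x - y)) \<in> borel_measurable borel" by measurable
  then have km': "(\<lambda>y. k (x - y)) \<in> borel_measurable (lebesgue_on K)" for K
    by (intro measurable_restrict_space1) (simp add: measurable_completion)
  obtain M where M: "M \<ge> 0" "\<And>z. \<bar>k z\<bar> \<le> M" using bump_bounded[OF k(1)] by blast
  have Sl: "S \<in> sets lebesgue" using S by simp
  have k0: "k (x - y) = 0" if "\<not> dist x y \<le> r" for y by (rule k(2)) (use that in \<open>simp add: dist_norm\<close>)
  have "integrable (lebesgue_on (cball x r)) (\<lambda>y. k (x - y) *\<^sub>R h y)"
  proof (rule Bochner_Integration.integrable_bound)
    show "integrable (lebesgue_on (cball x r)) (\<lambda>y. M *\<^sub>R h y)" using h by simp
    show "(\<lambda>y. k (x - y) *\<^sub>R h y) \<in> borel_measurable (lebesgue_on (cball x r))"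
      by (intro borel_measurable_scaleR km' borel_measurable_integrable[OF h])
    show "AE y in lebesgue_on (cball x r). norm (k (x - y) *\<^sub>R h y) \<le> norm (M *\<^sub>R h y)"
      using M by (intro AE_I2) (auto intro!: mult_right_mono)
  qed
  then have "integrable lebesgue (\<lambda>y. indicator (cball x r) y *\<^sub>R (k (x - y) *\<^sub>R h y))" by (simp add: integrable_restrict_space)
  also have "(\<lambda>y. indicator (cball x r) y *\<^sub>R (k (x - y) *\<^sub>R h y)) = (\<lambda>y. indicator S y *\<^sub>R (k (x - y) *\<^sub>R h y))"
    using x k0 by (auto simp: indicator_def fun_eq_iff)
  finally show "integrable (lebesgue_on S) (\<lambda>y. k (x - y) *\<^sub>R h y)" using Sl by (simp add: integrable_restrict_space)
  show "(\<lambda>y. k (x - y) * H y) \<in> borel_measurable borel" by measurable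
  show "AE y in lborel. y \<in> S \<longrightarrow> (k (x - y) *\<^sub>R h y) $ i = k (x - y) * H y" using e by eventually_elim simp
qed (use H0 in simp)

text \<open>On a set of finite measure square integrability gives integrability through |t| \<le> 1
  + t^2.\<close>

lemma representative_L2:
  fixes U h :: "'a::euclidean_space \<Rightarrow> real"
  assumes S: "S \<in> sets borel" "emeasure lborel S < \<infinity>" and h: "h \<in> borel_measurable (lebesgue_on S)" "integrable (lebesgue_on S) (\<lambda>x. (h x)^2)"
    and U: "U \<in> borel_measurable borel" "\<And>x. x \<notin> S \<Longrightarrow> U x = 0" and e: "AE x in lborel. x \<in> S \<longrightarrow> h x = U x"
  shows "integrable lborel U" "integrable lborel (\<lambda>x. (U x)^2)"
proof -
  have [measurable]: "U \<in> borel_measurable borel" using U by simp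
  have i: "integrable lebesgue (\<lambda>x. indicator S x *\<^sub>R (h x)^2)" using h(2) S by (simp add: integrable_restrict_space)
  have "integrable lebesgue (\<lambda>x. (U x)^2)"
  proof (rule integrable_cong_AE_imp[OF i])
    show "(\<lambda>x. (U x)^2) \<in> borel_measurable lebesgue" by (rule measurable_completion) measurable
    show "AE x in lebesgue. indicator S x *\<^sub>R (h x)^2 = (U x)^2"
      by (rule AE_completion) (use e U(2) in \<open>auto elim!: eventually_mono simp: indicator_def\<close>)
  qed
  then show U2: "integrable lborel (\<lambda>x. (U x)^2)" by (subst (asm) integrable_completion) measurable
  show "integrable lborel U"
  proof (rule Bochner_Integration.integrable_bound)
    show "integrable lborel (\<lambda>x. indicator S x + (U x)^2)" using U2 S by (intro Bochner_Integration.integrable_add integrable_real_indicator) auto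
    have "\<bar>t\<bar> \<le> 1 + t^2" for t :: real by (rule abs_le_one_plus_square)
    then have "\<bar>U x\<bar> \<le> indicator S x + (U x)^2" for x using U(2)[of x] by (cases "x \<in> S") auto
    then show "AE x in lborel. norm (U x) \<le> norm (indicator S x + (U x)^2)"
      by (intro AE_I2) (simp only: real_norm_def order_trans[OF _ abs_ge_self])
  qed measurable
qed

lemma norm_le_sum_nth_nth:
  fixes A :: "real^'n^'m"
  shows "norm A \<le> (\<Sum>k\<in>UNIV. \<Sum>i\<in>UNIV. \<bar>A $ i $ k\<bar>)"
proof -
  have "norm A \<le> (\<Sum>i\<in>UNIV. norm (A $ i))" unfolding norm_vec_def by (rule L2_set_le_sum) simp
  also have "\<dots> \<le> (\<Sum>i\<in>UNIV. \<Sum>k\<in>UNIV. \<bar>A $ i $ k\<bar>)" by (intro sum_mono norm_le_l1_cart)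
  finally show ?thesis by (subst sum.swap)
qed

theorem mainTheorem9:
  fixes f :: "(real^'n) \<times> (real^'n^'m) \<Rightarrow> real^'n"
    and g :: "real^'n \<Rightarrow> real^'n"
    and u :: "real^'m \<Rightarrow> real^'n"
    and Du :: "real^'m \<Rightarrow> real^'n^'m"
    and C :: real
  assumes "CARD('m) \<le> 4"
    and "smooth_on UNIV f" and "smooth_on UNIV g"
    and "C > 0"
    and "\<And>\<xi> \<Xi>. norm (f (\<xi>, \<Xi>)) \<le> C * norm \<xi> * norm \<Xi>"
    and "\<And>\<xi>. norm (g \<xi>) \<le> C * norm \<xi> ^ 3"
    and "W12_with_gradient (ball 0 1) u Du"
    and "distr_laplace_eq (ball 0 1) u (\<lambda>x. f (u x, Du x) + g (u x))"
  shows "\<exists>v. smooth_on (ball 0 1) v \<and> (AE x in lebesgue_on (ball 0 1). u x = v x)"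
proof -
  define S where "S = (ball 0 1 :: (real^'m) set)"
  define F where "F x = f (u x, Du x) + g (u x)" for x
  have So: "open S" and Sb: "S \<in> sets borel" and Sl: "S \<in> sets lebesgue" "S \<in> lmeasurable" and Sf: "emeasure lborel S < \<infinity>"
    using emeasure_lborel_ball_finite[of "0::real^'m" 1] by (auto simp: S_def)
  have L2u: "L2_on S u" and L2D: "L2_on S Du" and wg: "weak_gradient_on S u Du"
    using assms(7) by (auto simp: W12_with_gradient_def S_def)
  have Fl: "locally_integrable_on S F" and eq: "\<And>\<phi>. test_function S \<phi> \<Longrightarrow>
      (\<integral>x. laplacian \<phi> x *\<^sub>R u x \<partial>lebesgue_on S) = (\<integral>x. \<phi> x *\<^sub>R F x \<partial>lebesgue_on S)"
    using assms(8) by (auto simp: distr_laplace_eq_def S_def F_def[abs_def])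
  have ax: "axis i 1 \<in> (Basis :: (real^'m) set)" for i by (simp add: axis_in_Basis_iff)
  note nthm = borel_measurable_vec_nth
  have um: "(\<lambda>x. u x $ k) \<in> borel_measurable (lebesgue_on S)" for k
    using measurable_compose[OF _ nthm] L2u by (auto simp: L2_on_def)
  have Dm: "(\<lambda>x. Du x $ i $ k) \<in> borel_measurable (lebesgue_on S)" for i k
    using measurable_compose[OF measurable_compose[OF _ nthm] nthm] L2D by (auto simp: L2_on_def)
  have u2: "integrable (lebesgue_on S) (\<lambda>x. (u x $ k)^2)" for k
  proof (rule Bochner_Integration.integrable_bound)
    show "integrable (lebesgue_on S) (\<lambda>x. (norm (u x))^2)" using L2u by (simp add: L2_on_def)
    show "AE x in lebesgue_on S. norm ((u x $ k)^2) \<le> norm ((norm (u x))^2)"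
      by (intro AE_I2) (simp add: abs_le_square_iff[symmetric] component_le_norm_cart)
  qed (intro borel_measurable_power um)
  have D2: "integrable (lebesgue_on S) (\<lambda>x. (Du x $ i $ k)^2)" for i k
  proof (rule Bochner_Integration.integrable_bound)
    show "integrable (lebesgue_on S) (\<lambda>x. (norm (Du x))^2)" using L2D by (simp add: L2_on_def)
    have "\<bar>A $ i $ k\<bar> \<le> norm A" for A :: "real^'n^'m"
      using component_le_norm_cart[of "A $ i" k] Finite_Cartesian_Product.norm_nth_le[of A i] by linarith
    then show "AE x in lebesgue_on S. norm ((Du x $ i $ k)^2) \<le> norm ((norm (Du x))^2)"
      by (intro AE_I2) (simp add: abs_le_square_iff[symmetric])
  qed (intro borel_measurable_power Dm)
  define Rep where "Rep h W \<longleftrightarrow> W \<in> borel_measurable borel \<and> (\<forall>x. x \<notin> S \<longrightarrow> W x = 0) \<and> (AE x in lborel. x \<in> S \<longrightarrow> h x = W x)"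
    for h W :: "real^'m \<Rightarrow> real"
  have "\<exists>W. Rep (\<lambda>x. u x $ k) W" for k unfolding Rep_def by (rule borel_representative[OF Sb um])
  then obtain U where RU: "\<And>k. Rep (\<lambda>x. u x $ k) (U k)" using choice[of "\<lambda>k. Rep (\<lambda>x. u x $ k)"] by blast
  have U: "U k \<in> borel_measurable borel" "x \<notin> S \<Longrightarrow> U k x = 0" "AE x in lborel. x \<in> S \<longrightarrow> u x $ k = U k x" for k x
    using RU[of k] unfolding Rep_def by blast+
  have "\<exists>W. Rep (\<lambda>x. Du x $ i $ k) W" for k i unfolding Rep_def by (rule borel_representative[OF Sb Dm])
  then have "\<exists>W. \<forall>p. Rep (\<lambda>x. Du x $ snd p $ fst p) (W p)" by (intro choice allI)
  then obtain E0 where RE0: "\<And>p. Rep (\<lambda>x. Du x $ snd p $ fst p) (E0 p)" by blast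
  define E where "E k i = E0 (k, i)" for k i
  have RE: "Rep (\<lambda>x. Du x $ i $ k) (E k i)" for k i using RE0[of "(k, i)"] by (simp add: E_def)
  have E: "E k i \<in> borel_measurable borel" "x \<notin> S \<Longrightarrow> E k i x = 0" "AE x in lborel. x \<in> S \<longrightarrow> Du x $ i $ k = E k i x" for k i x
    using RE[where k=k and i=i] unfolding Rep_def by blast+
  \<comment> \<open>The locales index gradients by basis vectors, \<open>Du\<close> by coordinates;
    \<open>DE\<close> evaluates the description.\<close>
  define D where "D k b = E k (THE i. b = axis i 1)" for k and b :: "real^'m"
  have DE: "D k (axis i 1) = E k i" for k i by (simp add: D_def axis_eq_axis)
  note iU = representative_L2[OF Sb Sf um u2 U(1,2,3)] and iE = representative_L2[OF Sb Sf Dm D2 E(1,2,3)]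
  define ub where "ub x = (\<chi> k. U k x)" for x
  define Eb where "Eb x = (\<chi> i k. E k i x)" for x
  \<comment> \<open>Built from the Borel representatives, so that it is Borel measurable and
    satisfies the structure bound everywhere rather than almost everywhere.\<close>
  define G where "G k x = (f (ub x, Eb x) + g (ub x)) $ k" for k x
  have fc: "continuous_on UNIV f" and gc: "continuous_on UNIV g"
    using smooth_onD(1)[OF assms(2), of "[]"] smooth_onD(1)[OF assms(3), of "[]"] by simp_all
  have ubm: "ub \<in> borel_measurable borel" and Ebm: "Eb \<in> borel_measurable borel"
    unfolding ub_def[abs_def] Eb_def[abs_def] using U(1) E(1)
    by (auto simp: borel_measurable_euclidean_space[where 'c="real^'n"] borel_measurable_euclidean_space[where 'c="real^'n^'m"] Basis_vec_def inner_axis)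
  have fm: "(\<lambda>x. f (ub x, Eb x)) \<in> borel_measurable borel" 
    by (rule measurable_compose[OF borel_measurable_Pair[OF ubm Ebm] borel_measurable_continuous_onI[OF fc]])
  have Gm: "G k \<in> borel_measurable borel" for k unfolding G_def[abs_def]
    by (rule measurable_compose[OF borel_measurable_add[OF fm measurable_compose[OF ubm borel_measurable_continuous_onI[OF gc]]] nthm])
  have Gb: "\<bar>G k x\<bar> \<le> C * ((\<Sum>k\<in>UNIV. \<bar>U k x\<bar>) * ((\<Sum>k\<in>UNIV. \<Sum>b\<in>Basis. \<bar>D k b x\<bar>) + (\<Sum>k\<in>UNIV. \<bar>U k x\<bar>)^2))" for k x
  proof -
    define a where "a = (\<Sum>k\<in>UNIV. \<bar>U k x\<bar>)"
    define dd where "dd = (\<Sum>k\<in>UNIV. \<Sum>b\<in>Basis. \<bar>D k b x\<bar>)"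
    have a: "norm (ub x) \<le> a" using norm_le_l1_cart[of "ub x"] by (simp add: ub_def a_def)
    have d: "norm (Eb x) \<le> dd" using norm_le_sum_nth_nth[of "Eb x"] by (simp add: Eb_def dd_def sum_Basis_axis DE)
    have a0: "0 \<le> a" by (rule order_trans[OF norm_ge_zero a])
    have "\<bar>G k x\<bar> \<le> norm (f (ub x, Eb x) + g (ub x))" unfolding G_def by (rule component_le_norm_cart)
    also have "\<dots> \<le> C * norm (ub x) * norm (Eb x) + C * norm (ub x)^3" by (rule norm_triangle_le[OF add_mono[OF assms(5,6)]])
    also have "\<dots> \<le> C * a * dd + C * a^3" using assms(4) a d a0 by (intro add_mono mult_mono power_mono mult_nonneg_nonneg) auto
    also have "\<dots> = C * (a * (dd + a^2))" by (simp add: algebra_simps power3_eq_cube power2_eq_square)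
    finally show ?thesis by (simp only: a_def dd_def)
  qed
  \<comment> \<open>\<open>U\<close> vanishes off \<open>S\<close>, and the structure bound forces
    the nonlinearity to vanish with it.\<close>
  have G0: "G k x = 0" if "x \<notin> S" for k x using Gb[of k x] U(2)[OF that] by simp
  have ub_ae: "AE x in lborel. x \<in> S \<longrightarrow> u x = ub x"
    using eventually_all_finite[where P="\<lambda>x k. x \<in> S \<longrightarrow> u x $ k = U k x", OF U(3)]
    unfolding ub_def vec_eq_iff vec_lambda_beta by (rule eventually_mono) simp
  have Eb_ae: "AE x in lborel. x \<in> S \<longrightarrow> Du x = Eb x"
    using eventually_all_finite[where P="\<lambda>x k. \<forall>i. x \<in> S \<longrightarrow> Du x $ i $ k = E k i x", OF eventually_all_finite[OF E(3)]]
    unfolding Eb_def vec_eq_iff vec_lambda_beta by (rule eventually_mono) simp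
  have G_ae: "AE x in lborel. x \<in> S \<longrightarrow> F x $ k = G k x" for k
    using ub_ae Eb_ae by eventually_elim (simp add: F_def G_def)
  have iu: "integrable (lebesgue_on (cball x r)) u" if "cball x r \<subseteq> S" for x r
    by (rule integrable_lebesgue_on_subset[OF L2_on_integrable[OF Sl(2) L2u] that Sl(1)]) simp
  have iD: "integrable (lebesgue_on (cball x r)) (\<lambda>y. Du y $ i)" if "cball x r \<subseteq> S" for x r i
    by (rule integrable_bounded_linear[OF bounded_linear_vec_nth integrable_lebesgue_on_subset[OF L2_on_integrable[OF Sl(2) L2D] that Sl(1)]]) simp
  have iF: "integrable (lebesgue_on (cball x r)) F" if "cball x r \<subseteq> S" for x r
    by (rule Fl[unfolded locally_integrable_on_def, rule_format]) (simp add: that)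
  have le: "(1::real)/2^Suc j \<le> 1/2^j" for j by (intro divide_left_mono power_increasing) auto
  have supS: "1/2^j \<le> norm z \<Longrightarrow> rhoj (Suc j) z = 0" for j and z :: "real^'m" using le[of j] by (intro rhoj_support) linarith
  have rep: "repr S (U k) (G k)" for k
    unfolding repr_def
  proof (intro allI impI)
    fix j and x :: "real^'m" assume x: "cball x (1/2^j) \<subseteq> S"
    let ?k = "\<lambda>z::real^'m. rhoj j z - rhoj (Suc j) z"
    have bk: "bump ?k" using bump_add[OF bump_rhoj bump_cmult[OF bump_rhoj[of "Suc j"], of "-1"], of j] by simp
    have "conv (rhoj j) (U k) x - conv (rhoj (Suc j)) (U k) x = conv ?k (U k) x"
      by (rule conv_diff[OF bump_rhoj bump_rhoj iU(1), symmetric])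
    also have "\<dots> = (\<integral>y. ?k (x - y) *\<^sub>R u y \<partial>lebesgue_on S) $ k"
      by (rule integral_kernel_nth[OF Sb bk _ x iu[OF x] U(1,3,2), symmetric]) (simp add: rhoj_support supS)
    \<comment> \<open>The equation is tested with the reflected kernel \<open>kapj (Suc j)\<close>,
      whose Laplacian is the difference of the two mollifiers.\<close>
    also have "\<dots> = (\<integral>y. kapj (Suc j) (x - y) *\<^sub>R F y \<partial>lebesgue_on S) $ k"
      using eq[OF test_function_kernel[OF bump_kapj kapj_Suc_support x]] by (simp add: laplacian_kapj)
    also have "\<dots> = conv (kapj (Suc j)) (G k) x"
      by (rule integral_kernel_nth[OF Sb bump_kapj kapj_Suc_support x iF[OF x] Gm G_ae G0])
    finally show "conv (rhoj j) (U k) x - conv (rhoj (Suc j)) (U k) x = conv (kapj (Suc j)) (G k) x" .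
  qed
  have grep: "grepr S (U k) (axis i 1) (E k i)" for k i
    unfolding grepr_def
  proof (intro allI impI)
    fix j and x :: "real^'m" assume x: "cball x (1/2^j) \<subseteq> S"
    \<comment> \<open>One minus sign comes from reflecting the kernel, the other from the definition
      of the weak gradient.\<close>
    have "- (\<integral>y. partial_dir (axis i 1) (rhoj j) (x - y) *\<^sub>R u y \<partial>lebesgue_on S) = - (\<integral>y. rhoj j (x - y) *\<^sub>R (Du y $ i) \<partial>lebesgue_on S)"
      using wg[unfolded weak_gradient_on_def, rule_format, OF test_function_kernel[where k="rhoj j", OF bump_rhoj rhoj_support x], of i]
      by (simp add: partial_dir_reflect[OF bump_rhoj ax])
    then have "(\<integral>y. partial_dir (axis i 1) (rhoj j) (x - y) *\<^sub>R u y \<partial>lebesgue_on S) $ k = (\<integral>y. rhoj j (x - y) *\<^sub>R (Du y $ i) \<partial>lebesgue_on S) $ k" by simp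
    then show "conv (partial_dir (axis i 1) (rhoj j)) (U k) x = conv (rhoj j) (E k i) x"
      using integral_kernel_nth[OF Sb bump_partial[OF bump_rhoj ax] rhoj_support1[OF ax] x iu[OF x] U(1,3,2)]
        integral_kernel_nth[OF Sb bump_rhoj rhoj_support x iD[OF x] E(1,3,2)] by simp
  qed
  have bas: "\<exists>i. b = axis i 1" if "b \<in> Basis" for b :: "real^'m" using that by (auto simp: Basis_vec_def)
  interpret weak_system U D G S C
  proof
    show "DIM(real^'m) \<le> 4" using assms(1) by simp
    show "integrable lborel (D k b)" "integrable lborel (\<lambda>x. (D k b x)^2)" if "b \<in> Basis" for k b
      using bas[OF that] iE by (auto simp: DE)
    show "grepr S (U k) b (D k b)" if "b \<in> Basis" for k b using bas[OF that] grep by (auto simp: DE)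
  qed (use So iU Gm assms(4) Gb rep in auto)
  define V where "V k = Lf rhoj (U k)" for k
  have V1: "HC (Suc 0) S (V k)" for k unfolding V_def by (rule regularity(1))
  have V_ae: "AE x in lborel. x \<in> S \<longrightarrow> U k x = V k x" for k unfolding V_def by (rule regularity(2))
  have VD_ae: "AE x in lborel. x \<in> S \<longrightarrow> E k i x = partial_dir (axis i 1) (V k) x" for k i
    using regularity(3)[OF ax, of k i] unfolding V_def DE .
  define v where "v x = (\<chi> k. V k x)" for x
  define Dv where "Dv x = (\<chi> i k. partial_dir (axis i 1) (V k) x)" for x
  have v_ae: "AE x in lborel. x \<in> S \<longrightarrow> ub x = v x"
    using eventually_all_finite[where P="\<lambda>x k. x \<in> S \<longrightarrow> U k x = V k x", OF V_ae]
    unfolding ub_def v_def vec_eq_iff vec_lambda_beta by (rule eventually_mono) simp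
  have Dv_ae: "AE x in lborel. x \<in> S \<longrightarrow> Eb x = Dv x"
    using eventually_all_finite[where P="\<lambda>x k. \<forall>i. x \<in> S \<longrightarrow> E k i x = partial_dir (axis i 1) (V k) x", OF eventually_all_finite[OF VD_ae]]
    unfolding Eb_def Dv_def vec_eq_iff vec_lambda_beta by (rule eventually_mono) simp
  have vc: "continuous_on S v" unfolding v_def by (intro continuous_on_vec_lambda HC_continuous[OF V1])
  have Dvc: "continuous_on S Dv" unfolding Dv_def by (intro continuous_on_vec_lambda HC_continuous[OF HC_partial[OF V1 ax]])
  have cG: "continuous_on S (\<lambda>x. (f (v x, Dv x) + g (v x)) $ k)" for k
    by (intro continuous_intros continuous_on_compose2[OF fc] continuous_on_compose2[OF gc] vc Dvc) auto
  \<comment> \<open>The bootstrap needs the nonlinearity at the regular representatives and their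
    classical derivatives. The kernel identities see functions only up to null sets, so they carry
    over.\<close>
  have rV: "repr S (V k) (\<lambda>x. (f (v x, Dv x) + g (v x)) $ k)" for k
    unfolding repr_def
  proof (intro allI impI)
    fix j and x :: "real^'m" assume x: "cball x (1/2^j) \<subseteq> S"
    then have b: "ball x (1/2^j) \<subseteq> S" using ball_subset_cball by blast
    have "AE x in lborel. x \<in> S \<longrightarrow> G k x = (f (v x, Dv x) + g (v x)) $ k"
      using v_ae Dv_ae by eventually_elim (simp add: G_def)
    note G' = conv_cong_AE[OF bump_kapj kapj_Suc_support So b Gm cG this]
    note V' = conv_cong_AE[OF bump_rhoj[of j] rhoj_support So b U(1) HC_continuous[OF V1] V_ae]
      conv_cong_AE[OF bump_rhoj[of "Suc j"] supS So b U(1) HC_continuous[OF V1] V_ae]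
    have "conv (rhoj j) (U k) x - conv (rhoj (Suc j)) (U k) x = conv (kapj (Suc j)) (G k) x" using rep[of k] x unfolding repr_def by blast
    then show "conv (rhoj j) (V k) x - conv (rhoj (Suc j)) (V k) x = conv (kapj (Suc j)) (\<lambda>x. (f (v x, Dv x) + g (v x)) $ k) x"
      by (simp only: G'[symmetric] V'[symmetric])
  qed
  have "smooth_on S v" unfolding v_def
    by (rule bootstrap[OF assms(2,3) So V1]) (use rV in \<open>simp add: v_def Dv_def\<close>)
  moreover have "AE x in lebesgue. x \<in> S \<longrightarrow> u x = v x"
    by (rule AE_completion) (use ub_ae v_ae in eventually_elim, simp)
  then have "AE x in lebesgue_on S. u x = v x" using Sl(1) by (simp add: AE_restrict_space_iff)
  ultimately show ?thesis unfolding S_def by blast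
qed

end
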